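(* Let $G$ be a profinite group, $R$ a commutative profinite ring, $K$ a profinite $R[[G]]$-module and $k$ a nonnegative integer. Let $$\cdots\to P_1\to P_0\to K\to0$$ be a resolution by projective covers. Then $\mathrm{d}_{R[[G]]}(P_k)=\lceil\tau_k(G;K)\rceil$. In particular, $\tau_k(G;K)$ is finite if and only if there exists a projective resolution (exact sequence of projective profinite $R[[G]]$-modules) $$P_k\to\cdots\to P_0\to K\to0$$ with $P_k$ finitely generated.
   Context: Modules are left profinite modules, tensor products are completed, and $R[[G]]$ is the completed group algebra; a left $R[[G]]$-module is regarded as a right module via $g\mapsto g^{-1}$ when needed, and $\mathrm{Tor}^{R[[G]]}$ is the derived functor of the completed tensor product. For an integer $n\geqslant 0$, $$\tau_n(G;K)=\sup_{M\text{ simple }R[[G]]\text{-module}}\frac{\dim_{\mathrm{End}_G(M)}\mathrm{Tor}^{R[[G]]}_n(K,M)}{\dim_{\mathrm{End}_G(M)}M}\in[0,\infty]$$ (simple modules are finite, with $\mathrm{End}_G(M)$ a finite field). $\mathrm{d}_{R[[G]]}(A)$ is the minimal number of (topological) generators of $A$ as an $R[[G]]$-module ($\infty$ if $A$ is not finitely generated), and $\lceil\infty\rceil=\infty$. A projective cover of $K$ is a surjection $f:P\to K$ from a projective profinite $R[[G]]$-module such that any (closed) submodule $H\subseteq P$ with $f(H)=K$ equals $P$; projective covers exist and are unique up to isomorphism. A resolution by projective covers is a resolution in which $P_0\to K$ is a projective cover of $K$ and, for each $j\ge0$, $P_{j+1}\to\ker(P_j\to P_{j-1})$ is a projective cover,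 where $P_{-1}=K$. *)

theory Defs
  imports "HOL-Analysis.Analysis" "HOL-Algebra.QuotRing" "HOL-Algebra.Module" "HOL-Algebra.Free_Abelian_Groups"
begin

section \<open>Profinite groups, rings and modules\<close>

record 'a top_group = "'a monoid" +
  gtop :: "'a topology"

record 'a top_ring = "'a ring" +
  rtop :: "'a topology"

record ('a, 'b) top_module = "('a, 'b) module" +
  mtop :: "'b topology"

definition profinite_space :: "'a topology \<Rightarrow> bool" where
  "profinite_space X \<longleftrightarrow>
     compact_space X \<and> Hausdorff_space X \<and> (\<forall>S. connectedin X S \<longrightarrow> (\<exists>a. S \<subseteq> {a}))"

definition profinite_group :: "('g, 'm) top_group_scheme \<Rightarrow> bool" where
  "profinite_group G \<longleftrightarrow>
     group G \<and> topspace (gtop G) = carrier G \<and> profinite_space (gtop G) \<and>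
     continuous_map (prod_topology (gtop G) (gtop G)) (gtop G) (\<lambda>(x, y). x \<otimes>\<^bsub>G\<^esub> y) \<and>
     continuous_map (gtop G) (gtop G) (\<lambda>x. inv\<^bsub>G\<^esub> x)"

definition profinite_ring :: "('r, 'm) top_ring_scheme \<Rightarrow> bool" where
  "profinite_ring R \<longleftrightarrow>
     ring R \<and> topspace (rtop R) = carrier R \<and> profinite_space (rtop R) \<and>
     continuous_map (prod_topology (rtop R) (rtop R)) (rtop R) (\<lambda>(x, y). x \<oplus>\<^bsub>R\<^esub> y) \<and>
     continuous_map (rtop R) (rtop R) (\<lambda>x. \<ominus>\<^bsub>R\<^esub> x) \<and>
     continuous_map (prod_topology (rtop R) (rtop R)) (rtop R) (\<lambda>(x, y). x \<otimes>\<^bsub>R\<^esub> y)"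

text \<open>The locale \<open>module\<close> of HOL-Algebra asks for a commutative ring of scalars; the following
  has the same axioms without commutativity.\<close>

locale left_module = R?: ring R + M?: abelian_group M for R and M (structure) +
  assumes smult_closed:
      "\<lbrakk>a \<in> carrier R; x \<in> carrier M\<rbrakk> \<Longrightarrow> a \<odot>\<^bsub>M\<^esub> x \<in> carrier M"
    and smult_l_distr:
      "\<lbrakk>a \<in> carrier R; b \<in> carrier R; x \<in> carrier M\<rbrakk> \<Longrightarrow>
       (a \<oplus>\<^bsub>R\<^esub> b) \<odot>\<^bsub>M\<^esub> x = a \<odot>\<^bsub>M\<^esub> x \<oplus>\<^bsub>M\<^esub> b \<odot>\<^bsub>M\<^esub> x"
    and smult_r_distr:
      "\<lbrakk>a \<in> carrier R; x \<in> carrier M; y \<in> carrier M\<rbrakk> \<Longrightarrow>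
       a \<odot>\<^bsub>M\<^esub> (x \<oplus>\<^bsub>M\<^esub> y) = a \<odot>\<^bsub>M\<^esub> x \<oplus>\<^bsub>M\<^esub> a \<odot>\<^bsub>M\<^esub> y"
    and smult_assoc1:
      "\<lbrakk>a \<in> carrier R; b \<in> carrier R; x \<in> carrier M\<rbrakk> \<Longrightarrow>
       (a \<otimes>\<^bsub>R\<^esub> b) \<odot>\<^bsub>M\<^esub> x = a \<odot>\<^bsub>M\<^esub> (b \<odot>\<^bsub>M\<^esub> x)"
    and smult_one: "x \<in> carrier M \<Longrightarrow> \<one>\<^bsub>R\<^esub> \<odot>\<^bsub>M\<^esub> x = x"

definition profinite_module ::
    "('l, 'x) top_ring_scheme \<Rightarrow> ('l, 'm, 'y) top_module_scheme \<Rightarrow> bool" where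
  "profinite_module L M \<longleftrightarrow>
     left_module L M \<and> topspace (mtop M) = carrier M \<and> profinite_space (mtop M) \<and>
     continuous_map (prod_topology (mtop M) (mtop M)) (mtop M) (\<lambda>(x, y). x \<oplus>\<^bsub>M\<^esub> y) \<and>
     continuous_map (mtop M) (mtop M) (\<lambda>x. \<ominus>\<^bsub>M\<^esub> x) \<and>
     continuous_map (prod_topology (rtop L) (mtop M)) (mtop M) (\<lambda>(a, x). a \<odot>\<^bsub>M\<^esub> x)"

definition closed_submodule ::
    "'m set \<Rightarrow> ('l, 'x) ring_scheme \<Rightarrow> ('l, 'm, 'y) top_module_scheme \<Rightarrow> bool" where
  "closed_submodule N L M \<longleftrightarrow> submodule N L M \<and> closedin (mtop M) N"

definition open_submodule ::
    "'m set \<Rightarrow> ('l, 'x) ring_scheme \<Rightarrow> ('l, 'm, 'y) top_module_scheme \<Rightarrow> bool" where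
  "open_submodule N L M \<longleftrightarrow> submodule N L M \<and> openin (mtop M) N"

definition cont_hom ::
    "('l, 'x) ring_scheme \<Rightarrow> ('l, 'm, 'y) top_module_scheme \<Rightarrow> ('l, 'n, 'z) top_module_scheme
      \<Rightarrow> ('m \<Rightarrow> 'n) set" where
  "cont_hom L M N =
     {f. f \<in> carrier M \<rightarrow> carrier N \<and> continuous_map (mtop M) (mtop N) f \<and>
         (\<forall>x\<in>carrier M. \<forall>y\<in>carrier M. f (x \<oplus>\<^bsub>M\<^esub> y) = f x \<oplus>\<^bsub>N\<^esub> f y) \<and>
         (\<forall>a\<in>carrier L. \<forall>x\<in>carrier M. f (a \<odot>\<^bsub>M\<^esub> x) = a \<odot>\<^bsub>N\<^esub> f x)}"

definition simple_module ::
    "('l, 'x) top_ring_scheme \<Rightarrow> ('l, 'm, 'y) top_module_scheme \<Rightarrow> bool" where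
  "simple_module L M \<longleftrightarrow>
     profinite_module L M \<and> carrier M \<noteq> {\<zero>\<^bsub>M\<^esub>} \<and>
     (\<forall>N. closed_submodule N L M \<longrightarrow> N = {\<zero>\<^bsub>M\<^esub>} \<or> N = carrier M)"

definition closed_span ::
    "('l, 'x) ring_scheme \<Rightarrow> ('l, 'm, 'y) top_module_scheme \<Rightarrow> 'm set \<Rightarrow> 'm set" where
  "closed_span L M X = \<Inter>{N. closed_submodule N L M \<and> X \<subseteq> N}"

text \<open>The infimum of the empty set in \<^typ>\<open>enat\<close> is \<open>\<infinity>\<close>.\<close>

definition min_gens ::
    "('l, 'x) ring_scheme \<Rightarrow> ('l, 'm, 'y) top_module_scheme \<Rightarrow> enat" where
  "min_gens L M =
     Inf {enat (card X) |X. finite X \<and> X \<subseteq> carrier M \<and> closed_span L M X = carrier M}"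


section \<open>The completed group algebra\<close>

text \<open>The group algebra of a finite group \<open>H\<close>, as functions with convolution.\<close>

definition group_algebra ::
    "('r, 'x) ring_scheme \<Rightarrow> ('h, 'y) monoid_scheme \<Rightarrow> ('h \<Rightarrow> 'r) ring" where
  "group_algebra A H =
     \<lparr>carrier = (carrier H \<rightarrow>\<^sub>E carrier A),
      monoid.mult = (\<lambda>f g. \<lambda>x\<in>carrier H. \<Oplus>\<^bsub>A\<^esub>y\<in>carrier H. f y \<otimes>\<^bsub>A\<^esub> g (inv\<^bsub>H\<^esub> y \<otimes>\<^bsub>H\<^esub> x)),
      one = (\<lambda>x\<in>carrier H. if x = \<one>\<^bsub>H\<^esub> then \<one>\<^bsub>A\<^esub> else \<zero>\<^bsub>A\<^esub>),
      ring.zero = (\<lambda>x\<in>carrier H. \<zero>\<^bsub>A\<^esub>),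
      ring.add = (\<lambda>f g. \<lambda>x\<in>carrier H. f x \<oplus>\<^bsub>A\<^esub> g x)\<rparr>"

type_synonym ('r, 'g) cga = "'r set \<times> 'g set \<Rightarrow> 'g set \<Rightarrow> 'r set"

definition cga_index ::
    "('r, 'x) top_ring_scheme \<Rightarrow> ('g, 'y) top_group_scheme \<Rightarrow> ('r set \<times> 'g set) set" where
  "cga_index R G =
     {I. ideal I R \<and> openin (rtop R) I} \<times> {N. N \<lhd> G \<and> openin (gtop G) N}"

definition cga_level ::
    "('r, 'x) top_ring_scheme \<Rightarrow> ('g, 'y) top_group_scheme \<Rightarrow> 'r set \<times> 'g set
      \<Rightarrow> ('g set \<Rightarrow> 'r set) ring" where
  "cga_level R G = (\<lambda>(I, N). group_algebra (R Quot I) (G Mod N))"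

text \<open>The canonical map \<open>(R/I)[G/N] \<rightarrow> (R/I')[G/N']\<close> for \<open>I \<subseteq> I'\<close> and \<open>N \<subseteq> N'\<close>.\<close>

definition cga_proj ::
    "('r, 'x) top_ring_scheme \<Rightarrow> ('g, 'y) top_group_scheme \<Rightarrow> 'r set \<times> 'g set \<Rightarrow> 'r set \<times> 'g set
      \<Rightarrow> ('g set \<Rightarrow> 'r set) \<Rightarrow> ('g set \<Rightarrow> 'r set)" where
  "cga_proj R G = (\<lambda>(I, N) (I', N') f.
     \<lambda>Y\<in>carrier (G Mod N').
       \<Oplus>\<^bsub>R Quot I'\<^esub>X\<in>{X \<in> carrier (G Mod N). X \<subseteq> Y}. I' <+>\<^bsub>R\<^esub> f X)"

definition cga_carrier ::
    "('r, 'x) top_ring_scheme \<Rightarrow> ('g, 'y) top_group_scheme \<Rightarrow> ('r, 'g) cga set" where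
  "cga_carrier R G =
     {x \<in> (\<Pi>\<^sub>E i\<in>cga_index R G. carrier (cga_level R G i)).
        \<forall>i\<in>cga_index R G. \<forall>j\<in>cga_index R G.
          fst i \<subseteq> fst j \<and> snd i \<subseteq> snd j \<longrightarrow> cga_proj R G i j (x i) = x j}"

text \<open>\<open>R[[G]]\<close>, the inverse limit of the finite rings \<open>(R/I)[G/N]\<close> over the open ideals \<open>I\<close> of \<open>R\<close>
  and the open normal subgroups \<open>N\<close> of \<open>G\<close>.\<close>

definition completed_group_algebra ::
    "('r, 'x) top_ring_scheme \<Rightarrow> ('g, 'y) top_group_scheme \<Rightarrow> ('r, 'g) cga top_ring" where
  "completed_group_algebra R G =
     \<lparr>carrier = cga_carrier R G,
      monoid.mult = (\<lambda>x y. \<lambda>i\<in>cga_index R G. x i \<otimes>\<^bsub>cga_level R G i\<^esub> y i),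
      one = (\<lambda>i\<in>cga_index R G. \<one>\<^bsub>cga_level R G i\<^esub>),
      ring.zero = (\<lambda>i\<in>cga_index R G. \<zero>\<^bsub>cga_level R G i\<^esub>),
      ring.add = (\<lambda>x y. \<lambda>i\<in>cga_index R G. x i \<oplus>\<^bsub>cga_level R G i\<^esub> y i),
      rtop = subtopology
               (product_topology (\<lambda>i. discrete_topology (carrier (cga_level R G i))) (cga_index R G))
               (cga_carrier R G)\<rparr>"

text \<open>The continuous \<open>R\<close>-linear anti-automorphism of \<open>R[[G]]\<close> extending \<open>g \<mapsto> g\<^sup>-\<^sup>1\<close>; it turns a left
  \<open>R[[G]]\<close>-module into a right one.\<close>

definition cga_antipode ::
    "('r, 'x) top_ring_scheme \<Rightarrow> ('g, 'y) top_group_scheme \<Rightarrow> ('r, 'g) cga \<Rightarrow> ('r, 'g) cga" where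
  "cga_antipode R G x =
     (\<lambda>i\<in>cga_index R G. \<lambda>X\<in>carrier (G Mod snd i). x i (inv\<^bsub>G Mod snd i\<^esub> X))"


section \<open>Projective modules, projective covers and resolutions\<close>

text \<open>The lifting property has to be stated for modules whose carriers are sets of a fixed type.
  The types chosen lose no generality: the free profinite \<open>L\<close>-module on the underlying set of \<open>P\<close>
  consists of the finitely additive \<open>L\<close>-valued measures on the subsets of \<open>P\<close>, and so is an
  instance of \<open>A\<close>.  Taking this \<open>A\<close>, \<open>B = P\<close> and \<open>f\<close> the identity exhibits \<open>P\<close> as
  a direct summand of a free profinite module, which yields the lifting property for modules with
  carriers of any types.\<close>

definition projective_module ::
    "('l, 'x) top_ring_scheme \<Rightarrow> ('l, 'p) top_module \<Rightarrow> bool" where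
  "projective_module L P \<longleftrightarrow>
     profinite_module L P \<and>
     (\<forall>(A :: ('l, 'p set \<Rightarrow> 'l) top_module) (B :: ('l, 'p) top_module) g f.
        profinite_module L A \<and> profinite_module L B \<and>
        g \<in> cont_hom L A B \<and> g ` carrier A = carrier B \<and> f \<in> cont_hom L P B \<longrightarrow>
        (\<exists>h\<in>cont_hom L P A. \<forall>x\<in>carrier P. g (h x) = f x))"

definition projective_cover ::
    "('l, 'x) top_ring_scheme \<Rightarrow> ('l, 'p) top_module \<Rightarrow> ('p \<Rightarrow> 'k) \<Rightarrow> ('l, 'k) top_module \<Rightarrow> bool"
  where
  "projective_cover L P f K \<longleftrightarrow>
     projective_module L P \<and> f \<in> cont_hom L P K \<and> f ` carrier P = carrier K \<and>
     (\<forall>H. closed_submodule H L P \<and> f ` H = carrier K \<longrightarrow> H = carrier P)"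

definition ker_set ::
    "('l, 'm, 'y) module_scheme \<Rightarrow> ('l, 'n, 'z) module_scheme \<Rightarrow> ('m \<Rightarrow> 'n) \<Rightarrow> 'm set" where
  "ker_set M N f = {x \<in> carrier M. f x = \<zero>\<^bsub>N\<^esub>}"

definition ker_module ::
    "('l, 'm) top_module \<Rightarrow> ('l, 'n) top_module \<Rightarrow> ('m \<Rightarrow> 'n) \<Rightarrow> ('l, 'm) top_module" where
  "ker_module M N f =
     M\<lparr>carrier := ker_set M N f, mtop := subtopology (mtop M) (ker_set M N f)\<rparr>"

text \<open>An exact sequence \<open>P n \<rightarrow> \<dots> \<rightarrow> P 0 \<rightarrow> K \<rightarrow> 0\<close> of projective modules, with augmentation
  \<open>e : P 0 \<rightarrow> K\<close> and differentials \<open>d j : P (j + 1) \<rightarrow> P j\<close>; nothing is required of the kernel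
  of \<open>P n \<rightarrow> P (n - 1)\<close>.\<close>

definition projective_resolution_upto ::
    "nat \<Rightarrow> ('l, 'x) top_ring_scheme \<Rightarrow> (nat \<Rightarrow> ('l, 'p) top_module) \<Rightarrow> (nat \<Rightarrow> 'p \<Rightarrow> 'p)
      \<Rightarrow> ('p \<Rightarrow> 'k) \<Rightarrow> ('l, 'k) top_module \<Rightarrow> bool" where
  "projective_resolution_upto n L P d e K \<longleftrightarrow>
     (\<forall>j\<le>n. projective_module L (P j)) \<and>
     (\<forall>j<n. d j \<in> cont_hom L (P (Suc j)) (P j)) \<and>
     e \<in> cont_hom L (P 0) K \<and> e ` carrier (P 0) = carrier K \<and>
     (0 < n \<longrightarrow> d 0 ` carrier (P 1) = ker_set (P 0) K e) \<and>
     (\<forall>j. Suc j < n \<longrightarrow>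
        d (Suc j) ` carrier (P (Suc (Suc j))) = ker_set (P (Suc j)) (P j) (d j))"

definition projective_resolution ::
    "('l, 'x) top_ring_scheme \<Rightarrow> (nat \<Rightarrow> ('l, 'p) top_module) \<Rightarrow> (nat \<Rightarrow> 'p \<Rightarrow> 'p)
      \<Rightarrow> ('p \<Rightarrow> 'k) \<Rightarrow> ('l, 'k) top_module \<Rightarrow> bool" where
  "projective_resolution L P d e K \<longleftrightarrow> (\<forall>n. projective_resolution_upto n L P d e K)"

definition resolution_by_covers ::
    "('l, 'x) top_ring_scheme \<Rightarrow> (nat \<Rightarrow> ('l, 'p) top_module) \<Rightarrow> (nat \<Rightarrow> 'p \<Rightarrow> 'p)
      \<Rightarrow> ('p \<Rightarrow> 'k) \<Rightarrow> ('l, 'k) top_module \<Rightarrow> bool" where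
  "resolution_by_covers L P d e K \<longleftrightarrow>
     projective_resolution L P d e K \<and>
     projective_cover L (P 0) e K \<and>
     projective_cover L (P 1) (d 0) (ker_module (P 0) K e) \<and>
     (\<forall>j. projective_cover L (P (Suc (Suc j))) (d (Suc j)) (ker_module (P (Suc j)) (P j) (d j)))"


section \<open>Completed tensor products\<close>

text \<open>The multiplicative fields of the record \<open>module\<close> play no role.\<close>

definition quot_module :: "('l, 'm, 'y) module_scheme \<Rightarrow> 'm set \<Rightarrow> ('l, 'm set) module" where
  "quot_module M N =
     \<lparr>carrier = a_rcosets\<^bsub>M\<^esub> N, monoid.mult = undefined, one = undefined,
      ring.zero = N, add = set_add M,
      smult = (\<lambda>a X. \<Union>x\<in>X. N +>\<^bsub>M\<^esub> (a \<odot>\<^bsub>M\<^esub> x))\<rparr>"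

text \<open>The map into \<open>M/N\<close> which \<open>f\<close> induces on cosets.\<close>

definition coset_map :: "('l, 'n, 'y) module_scheme \<Rightarrow> 'n set \<Rightarrow> ('m \<Rightarrow> 'n) \<Rightarrow> 'm set \<Rightarrow> 'n set" where
  "coset_map M N f X = (\<Union>x\<in>X. N +>\<^bsub>M\<^esub> f x)"

text \<open>The tensor product \<open>A \<otimes>\<^sub>L B\<close> of two left \<open>L\<close>-modules, where \<open>A\<close> becomes a right module by
  \<open>a \<cdot> l = \<sigma> l \<odot> a\<close> for an anti-endomorphism \<open>\<sigma>\<close> of \<open>L\<close>.\<close>

definition tensor_rel ::
    "('l, 'x) ring_scheme \<Rightarrow> ('l \<Rightarrow> 'l) \<Rightarrow> ('l, 'a, 'y) module_scheme \<Rightarrow> ('l, 'b, 'z) module_scheme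
      \<Rightarrow> ('a \<times> 'b \<Rightarrow>\<^sub>0 int) set" where
  "tensor_rel L \<sigma> A B =
     generate (free_Abelian_group (carrier A \<times> carrier B))
       ({frag_of (a \<oplus>\<^bsub>A\<^esub> a', b) - frag_of (a, b) - frag_of (a', b) |a a' b.
           a \<in> carrier A \<and> a' \<in> carrier A \<and> b \<in> carrier B} \<union>
        {frag_of (a, b \<oplus>\<^bsub>B\<^esub> b') - frag_of (a, b) - frag_of (a, b') |a b b'.
           a \<in> carrier A \<and> b \<in> carrier B \<and> b' \<in> carrier B} \<union>
        {frag_of (\<sigma> l \<odot>\<^bsub>A\<^esub> a, b) - frag_of (a, l \<odot>\<^bsub>B\<^esub> b) |l a b.
           l \<in> carrier L \<and> a \<in> carrier A \<and> b \<in> carrier B})"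

definition tensor ::
    "('l, 'x) ring_scheme \<Rightarrow> ('l \<Rightarrow> 'l) \<Rightarrow> ('l, 'a, 'y) module_scheme \<Rightarrow> ('l, 'b, 'z) module_scheme
      \<Rightarrow> ('a \<times> 'b \<Rightarrow>\<^sub>0 int) set monoid" where
  "tensor L \<sigma> A B = free_Abelian_group (carrier A \<times> carrier B) Mod tensor_rel L \<sigma> A B"

text \<open>The map \<open>f \<otimes> g\<close> into \<open>A \<otimes>\<^sub>L B\<close>.\<close>

definition tensor_map ::
    "('l, 'x) ring_scheme \<Rightarrow> ('l \<Rightarrow> 'l) \<Rightarrow> ('l, 'a, 'y) module_scheme \<Rightarrow> ('l, 'b, 'z) module_scheme
      \<Rightarrow> ('c \<Rightarrow> 'a) \<Rightarrow> ('d \<Rightarrow> 'b) \<Rightarrow> ('c \<times> 'd \<Rightarrow>\<^sub>0 int) set \<Rightarrow> ('a \<times> 'b \<Rightarrow>\<^sub>0 int) set" where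
  "tensor_map L \<sigma> A B f g T =
     (\<Union>t\<in>T. tensor_rel L \<sigma> A B #>\<^bsub>free_Abelian_group (carrier A \<times> carrier B)\<^esub>
               frag_extend (\<lambda>(c, d). frag_of (f c, g d)) t)"

text \<open>The completed tensor product of profinite modules is the inverse limit of the finite groups
  \<open>A/U \<otimes>\<^sub>L B/V\<close> over the open submodules \<open>U\<close> of \<open>A\<close> and \<open>V\<close> of \<open>B\<close>.  Its topology is not recorded,
  as the dimension of homology is purely algebraic.\<close>

definition ctensor_index ::
    "('l, 'x) ring_scheme \<Rightarrow> ('l, 'a) top_module \<Rightarrow> ('l, 'b) top_module \<Rightarrow> ('a set \<times> 'b set) set"
  where
  "ctensor_index L A B = {U. open_submodule U L A} \<times> {V. open_submodule V L B}"

definition ctensor_carrier ::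
    "('l, 'x) ring_scheme \<Rightarrow> ('l \<Rightarrow> 'l) \<Rightarrow> ('l, 'a) top_module \<Rightarrow> ('l, 'b) top_module
      \<Rightarrow> ('a set \<times> 'b set \<Rightarrow> ('a set \<times> 'b set \<Rightarrow>\<^sub>0 int) set) set" where
  "ctensor_carrier L \<sigma> A B =
     {x \<in> (\<Pi>\<^sub>E i\<in>ctensor_index L A B.
             carrier (tensor L \<sigma> (quot_module A (fst i)) (quot_module B (snd i)))).
        \<forall>i\<in>ctensor_index L A B. \<forall>j\<in>ctensor_index L A B.
          fst i \<subseteq> fst j \<and> snd i \<subseteq> snd j \<longrightarrow>
          tensor_map L \<sigma> (quot_module A (fst j)) (quot_module B (snd j))
            (coset_map A (fst j) (\<lambda>a. a)) (coset_map B (snd j) (\<lambda>b. b)) (x i) = x j}"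

text \<open>The map induced by \<open>f : A \<rightarrow> A'\<close> and \<open>g : B \<rightarrow> B'\<close>: its component at \<open>(U, V)\<close> is obtained from
  the component at the pair of preimages.\<close>

definition ctensor_map ::
    "('l, 'x) ring_scheme \<Rightarrow> ('l \<Rightarrow> 'l) \<Rightarrow> ('l, 'a) top_module \<Rightarrow> ('l, 'b) top_module
      \<Rightarrow> ('l, 'a2) top_module \<Rightarrow> ('l, 'b2) top_module \<Rightarrow> ('a \<Rightarrow> 'a2) \<Rightarrow> ('b \<Rightarrow> 'b2)
      \<Rightarrow> ('a set \<times> 'b set \<Rightarrow> ('a set \<times> 'b set \<Rightarrow>\<^sub>0 int) set)
      \<Rightarrow> ('a2 set \<times> 'b2 set \<Rightarrow> ('a2 set \<times> 'b2 set \<Rightarrow>\<^sub>0 int) set)" where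
  "ctensor_map L \<sigma> A B A' B' f g x =
     (\<lambda>i\<in>ctensor_index L A' B'.
        tensor_map L \<sigma> (quot_module A' (fst i)) (quot_module B' (snd i))
          (coset_map A' (fst i) f) (coset_map B' (snd i) g)
          (x ({a \<in> carrier A. f a \<in> fst i}, {b \<in> carrier B. g b \<in> snd i})))"


section \<open>Tor and the invariant tau\<close>

definition End_ring ::
    "('l, 'x) ring_scheme \<Rightarrow> ('l, 'm) top_module \<Rightarrow> ('m \<Rightarrow> 'm) ring" where
  "End_ring L M =
     \<lparr>carrier = cont_hom L M M \<inter> extensional (carrier M),
      monoid.mult = compose (carrier M),
      one = (\<lambda>x\<in>carrier M. x),
      ring.zero = (\<lambda>x\<in>carrier M. \<zero>\<^bsub>M\<^esub>),
      ring.add = (\<lambda>f g. \<lambda>x\<in>carrier M. f x \<oplus>\<^bsub>M\<^esub> g x)\<rparr>"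

definition End_module :: "('l, 'm) top_module \<Rightarrow> ('m \<Rightarrow> 'm, 'm) module" where
  "End_module M =
     \<lparr>carrier = carrier M, monoid.mult = undefined, one = undefined,
      ring.zero = \<zero>\<^bsub>M\<^esub>, ring.add = ring.add M, smult = (\<lambda>f x. f x)\<rparr>"

text \<open>The completed tensor product of \<open>A\<close> and \<open>B\<close>, with scalars acting through the endomorphisms
  of \<open>B\<close>.\<close>

definition ctensor ::
    "('l, 'x) ring_scheme \<Rightarrow> ('l \<Rightarrow> 'l) \<Rightarrow> ('l, 'a) top_module \<Rightarrow> ('l, 'b) top_module
      \<Rightarrow> ('b \<Rightarrow> 'b, 'a set \<times> 'b set \<Rightarrow> ('a set \<times> 'b set \<Rightarrow>\<^sub>0 int) set) module" where
  "ctensor L \<sigma> A B =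
     \<lparr>carrier = ctensor_carrier L \<sigma> A B, monoid.mult = undefined, one = undefined,
      ring.zero = (\<lambda>i\<in>ctensor_index L A B.
                \<one>\<^bsub>tensor L \<sigma> (quot_module A (fst i)) (quot_module B (snd i))\<^esub>),
      ring.add = (\<lambda>x y. \<lambda>i\<in>ctensor_index L A B.
               x i \<otimes>\<^bsub>tensor L \<sigma> (quot_module A (fst i)) (quot_module B (snd i))\<^esub> y i),
      smult = (\<lambda>h. ctensor_map L \<sigma> A B A B (\<lambda>a. a) h)\<rparr>"

text \<open>\<open>Tor\<^sub>n(K, M)\<close>, as the \<open>n\<close>-th homology of the complex \<open>Q \<otimes> M\<close> for a projective resolution
  \<open>(Q, d)\<close> of \<open>K\<close>.\<close>

definition Tor_cycles ::
    "('l, 'x) ring_scheme \<Rightarrow> ('l \<Rightarrow> 'l) \<Rightarrow> (nat \<Rightarrow> ('l, 'q) top_module) \<Rightarrow> (nat \<Rightarrow> 'q \<Rightarrow> 'q)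
      \<Rightarrow> nat \<Rightarrow> ('l, 'm) top_module
      \<Rightarrow> ('q set \<times> 'm set \<Rightarrow> ('q set \<times> 'm set \<Rightarrow>\<^sub>0 int) set) set" where
  "Tor_cycles L \<sigma> Q d n M =
     (case n of
        0 \<Rightarrow> carrier (ctensor L \<sigma> (Q 0) M)
      | Suc j \<Rightarrow> {x \<in> carrier (ctensor L \<sigma> (Q (Suc j)) M).
                   ctensor_map L \<sigma> (Q (Suc j)) M (Q j) M (d j) (\<lambda>m. m) x
                     = \<zero>\<^bsub>ctensor L \<sigma> (Q j) M\<^esub>})"

definition Tor_boundaries ::
    "('l, 'x) ring_scheme \<Rightarrow> ('l \<Rightarrow> 'l) \<Rightarrow> (nat \<Rightarrow> ('l, 'q) top_module) \<Rightarrow> (nat \<Rightarrow> 'q \<Rightarrow> 'q)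
      \<Rightarrow> nat \<Rightarrow> ('l, 'm) top_module
      \<Rightarrow> ('q set \<times> 'm set \<Rightarrow> ('q set \<times> 'm set \<Rightarrow>\<^sub>0 int) set) set" where
  "Tor_boundaries L \<sigma> Q d n M =
     ctensor_map L \<sigma> (Q (Suc n)) M (Q n) M (d n) (\<lambda>m. m) ` carrier (ctensor L \<sigma> (Q (Suc n)) M)"

definition Tor ::
    "('l, 'x) ring_scheme \<Rightarrow> ('l \<Rightarrow> 'l) \<Rightarrow> (nat \<Rightarrow> ('l, 'q) top_module) \<Rightarrow> (nat \<Rightarrow> 'q \<Rightarrow> 'q)
      \<Rightarrow> nat \<Rightarrow> ('l, 'm) top_module
      \<Rightarrow> ('m \<Rightarrow> 'm, ('q set \<times> 'm set \<Rightarrow> ('q set \<times> 'm set \<Rightarrow>\<^sub>0 int) set) set) module" where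
  "Tor L \<sigma> Q d n M =
     quot_module ((ctensor L \<sigma> (Q n) M)\<lparr>carrier := Tor_cycles L \<sigma> Q d n M\<rparr>)
       (Tor_boundaries L \<sigma> Q d n M)"

definition lin_span ::
    "('e, 'x) ring_scheme \<Rightarrow> ('e, 'v, 'y) module_scheme \<Rightarrow> 'v set \<Rightarrow> 'v set" where
  "lin_span E V B = \<Inter>{W. submodule W E V \<and> B \<subseteq> W}"

definition lin_basis ::
    "('e, 'x) ring_scheme \<Rightarrow> ('e, 'v, 'y) module_scheme \<Rightarrow> 'v set \<Rightarrow> bool" where
  "lin_basis E V B \<longleftrightarrow>
     B \<subseteq> carrier V \<and> lin_span E V B = carrier V \<and> (\<forall>b\<in>B. b \<notin> lin_span E V (B - {b}))"

definition lin_dim ::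
    "('e, 'x) ring_scheme \<Rightarrow> ('e, 'v, 'y) module_scheme \<Rightarrow> enat" where
  "lin_dim E V = Inf {enat (card B) |B. finite B \<and> lin_basis E V B}"

text \<open>\<open>\<tau>\<^sub>n(G; K)\<close>, computed from a projective resolution \<open>(Q, d)\<close> of \<open>K\<close>, of whose
  choice it is independent; \<open>K\<close> enters only through \<open>Q\<close>.  Simple profinite modules
  are finite, hence isomorphic to modules with carrier in \<^typ>\<open>nat\<close>, so that the supremum may be
  taken over these.\<close>

definition tau ::
    "('r, 'x) top_ring_scheme \<Rightarrow> ('g, 'y) top_group_scheme
      \<Rightarrow> (nat \<Rightarrow> (('r, 'g) cga, 'q) top_module) \<Rightarrow> (nat \<Rightarrow> 'q \<Rightarrow> 'q) \<Rightarrow> nat \<Rightarrow> ennreal" where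
  "tau R G Q d n =
     (SUP M \<in> {M :: (('r, 'g) cga, nat) top_module. simple_module (completed_group_algebra R G) M}.
        ennreal_of_enat
          (lin_dim (End_ring (completed_group_algebra R G) M)
             (Tor (completed_group_algebra R G) (cga_antipode R G) Q d n M)) /
        ennreal_of_enat
          (lin_dim (End_ring (completed_group_algebra R G) M) (End_module M)))"

definition ennreal_ceiling :: "ennreal \<Rightarrow> enat" where
  "ennreal_ceiling t = (if t = \<infinity> then \<infinity> else enat (nat \<lceil>enn2real t\<rceil>))"

end

theory Submission
 imports Defs "HOL-Algebra.Multiplicative_Group"
begin

text \<open>Let \<open>L = R[[G]]\<close> and, for a simple module \<open>M\<close>, let \<open>T A\<close> be the completed tensor product of \<open>A\<close> and \<open>M\<close>.
 The kernel of a projective cover is superfluous, so every homomorphism to a simple module kills it; as the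
 characters of the finite levels of \<open>T A\<close> are homomorphisms from \<open>A\<close> to the dual of \<open>M\<close>, the differentials of a
 resolution by covers vanish under \<open>T\<close>.  Comparison maps therefore identify \<open>Tor\<^sub>k(K, M)\<close> with \<open>T (P k)\<close>, and
 \<open>T (P k)\<close> embeds into \<open>T (P' k)\<close> for any other resolution \<open>P'\<close>.  Dimensions over a finite division ring being
 logarithms of cardinalities, \<open>\<tau>\<^sub>k \<le> n\<close> means that \<open>T (P k)\<close> has at most \<open>|M|\<^sup>n\<close> elements for all \<open>M\<close>.  By duality the
 homomorphisms from a finite quotient of \<open>P k\<close> to a simple \<open>S\<close> then number at most \<open>|S|\<^sup>n\<close>.  Some \<open>x\<close> divides
 these numbers by \<open>|S|\<close>, or reduces them to \<open>1\<close>, for all \<open>S\<close> at once on passing to the quotient by \<open>x\<close>, so \<open>n\<close> elements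
 generate each finite quotient, and by compactness \<open>n\<close> elements generate \<open>P k\<close>.\<close>

text \<open>Only cardinalities are compared, always through conditions of the form
  \<open>\<le> n\<close>; the equality of the theorem results from both sides satisfying the same
  conditions for every natural \<open>n\<close>, the ceiling of t being the least natural number
  above t. One-sided facts then suffice. An elementary abelian p-group is only shown to have at most
  as many characters as elements: applied to a module and to submodules of its dual, the bound
  already forces equality. The dual takes values in the integers modulo p, a simple module being
  killed by a prime p, and the antipode makes it a left module, in step with its role in the tensor
  product. One element x can serve all simple modules at once because a finite module is semisimple
  modulo its radical. Two constructions answer the restriction of carriers to fixed types:
  integration against finitely additive measures frees the lifting property of projectives from it,
  and a transport of finite modules to \<open>nat\<close> brings the duals into the range of the
  supremum that defines the invariant.\<close>

lemma profinite_space_discrete: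
 assumes "finite S" shows "profinite_space (discrete_topology S)" unfolding profinite_space_def
proof (intro conjI allI impI)
 show "compact_space (discrete_topology S)" using assms by (simp add: compact_space_discrete_topology)
 show "Hausdorff_space (discrete_topology S)" by simp
 fix T assume "connectedin (discrete_topology S) T"
 thus "\<exists>a. T \<subseteq> {a}" by (auto simp: connectedin_discrete_topology)
qed

text \<open>A connected subset of a product has connected, hence one-point, projections; closed
  subsets inherit compactness. The module of measures and the completed group algebra are both
  closed subsets of such products.\<close>

lemma profinite_space_closed_product:
 assumes "!!i. i \<in> I ==> profinite_space (X i)" and "closedin (product_topology X I) S"
 shows "profinite_space (subtopology (product_topology X I) S)"
proof -
 have c: "compact_space (product_topology X I)" "Hausdorff_space (product_topology X I)"
  using assms(1) unfolding compact_space_product_topology Hausdorff_space_product_topology profinite_space_def by blast+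
 show ?thesis unfolding profinite_space_def
 proof (intro conjI allI impI)
  show "compact_space (subtopology (product_topology X I) S)"
   using c assms(2) by (simp add: closedin_compact_space compact_space_subtopology)
  show "Hausdorff_space (subtopology (product_topology X I) S)" using c by (simp add: Hausdorff_space_subtopology)
  fix T assume "connectedin (subtopology (product_topology X I) S) T"
  hence T: "connectedin (product_topology X I) T" by (simp add: connectedin_subtopology)
  have "x = y" if "x \<in> T" "y \<in> T" for x y
  proof (rule PiE_ext)
   show "x \<in> (\<Pi>\<^sub>E i\<in>I. topspace (X i))" "y \<in> (\<Pi>\<^sub>E i\<in>I. topspace (X i))"
    using that connectedin_subset_topspace[OF T] by auto
   fix i assume i: "i \<in> I"
   have "connectedin (X i) ((%x. x i) ` T)"
    using connectedin_continuous_map_image[OF _ T] continuous_map_product_projection[OF i] by blast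
   then obtain a where "(%x. x i) ` T \<subseteq> {a}" using assms(1)[OF i] unfolding profinite_space_def by meson
   thus "x i = y i" using that by auto
  qed
  thus "\<exists>a. T \<subseteq> {a}" by blast
 qed
qed

text \<open>The connected component of \<open>x\<close> is the point itself, which is compact; in a
  locally compact Hausdorff space a compact component can be cut off inside any open neighbourhood
  by splitting the whole space into two open sets.\<close>

lemma profinite_space_clopen_nbhd:
 assumes "profinite_space X" "openin X W" "x \<in> W"
 obtains C where "openin X C" "closedin X C" "x \<in> C" "C \<subseteq> W"
proof -
 have X: "compact_space X" "Hausdorff_space X" and
  td: "!!S. connectedin X S ==> \<exists>a. S \<subseteq> {a}" using assms(1) by (auto simp: profinite_space_def)
 have x: "x \<in> topspace X" using assms openin_subset by blast
 have "connectedin X (connected_component_of_set X x)" by (simp add: connectedin_connected_component_of)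
 moreover have "x \<in> connected_component_of_set X x" using x by (simp add: connected_component_of_refl)
 ultimately have eq: "connected_component_of_set X x = {x}" using td by (metis singletonD subset_singletonD empty_iff)
 hence "{x} \<in> connected_components_of X" by (metis connected_component_in_connected_components_of x)
 moreover have "compactin X {x}" using x by simp
 ultimately obtain U V where "openin X U" "openin X V" "disjnt U V" "U \<union> V = topspace X" "{x} \<subseteq> U" "U \<subseteq> W"
  using wilder_locally_compact_component_thm[of X "{x}" W] assms X
   compact_imp_locally_compact_space by (metis empty_subsetI insert_subset)
 moreover from this have "U = topspace X - V" by (auto simp: disjnt_iff)
 hence "closedin X U" using \<open>openin X V\<close> by auto
 ultimately show ?thesis using that by blast
qed

text \<open>A form of the tube lemma: projection along the compact factor \<open>Y\<close> is a
  closed map, and the set in question is the complement of a projected closed set.\<close>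

lemma openin_all_compact:
 assumes "compact_space Y" "continuous_map (prod_topology X Y) Z f" "openin Z W" "closedin Y C"
 shows "openin X {x \<in> topspace X. \<forall>y\<in>C. f (x, y) \<in> W}"
proof -
 let ?D = "{p \<in> topspace (prod_topology X Y). f p \<in> topspace Z - W} \<inter> (topspace X \<times> C)"
 have "closedin (prod_topology X Y) ?D" using assms by (intro closedin_Int closedin_continuous_map_preimage[OF assms(2)])
   (auto simp: closedin_prod_Times_iff)
 hence cl: "closedin X (fst ` ?D)" using closed_map_fst[OF assms(1), of X] by (simp add: closed_map_def)
 have eq: "topspace X - fst ` ?D = {x \<in> topspace X. \<forall>y\<in>C. f (x, y) \<in> W}"
 proof -
  have CY: "C \<subseteq> topspace Y" using assms(4) closedin_subset by blast
  have f: "f (x, y) \<in> topspace Z" if "x \<in> topspace X" "y \<in> topspace Y" for x y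
   using continuous_map_funspace[OF assms(2)] that by (auto simp: Pi_iff)
  have "x \<in> fst ` ?D \<longleftrightarrow> x \<in> topspace X & (\<exists>y\<in>C. f (x, y) \<notin> W)" for x
  proof
   assume "x \<in> fst ` ?D" thus "x \<in> topspace X & (\<exists>y\<in>C. f (x, y) \<notin> W)" by auto
  next
   assume "x \<in> topspace X & (\<exists>y\<in>C. f (x, y) \<notin> W)"
   then obtain y where "x \<in> topspace X" "y \<in> C" "f (x, y) \<notin> W" by blast
   hence "(x, y) \<in> ?D" using CY f by auto
   thus "x \<in> fst ` ?D" by (rule image_eqI[rotated]) simp
  qed
  thus ?thesis by blast
 qed
 show ?thesis using openin_diff[OF openin_topspace cl] unfolding eq .
qed

text \<open>The finite intersection property for a downward directed family. Integrals and
  generating tuples are both found as points common to such families.\<close>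

lemma compact_space_directed:
 assumes "compact_space X" "I ~= {}" "!!i. i \<in> I ==> closedin X (C i)" "!!i. i \<in> I ==> C i ~= {}"
  and dir: "!!i j. [|i \<in> I; j \<in> I|] ==> \<exists>k\<in>I. C k \<subseteq> C i \<inter> C j"
 obtains x where "x \<in> topspace X" "!!i. i \<in> I ==> x \<in> C i"
proof -
 have *: "\<exists>k\<in>I. C k \<subseteq> \<Inter>F" if "finite F" "F \<subseteq> C ` I" for F using that
 proof (induction F rule: finite_induct)
  case empty thus ?case using assms(2) by auto
 next
  case (insert c F)
  then obtain k i where "k \<in> I" "C k \<subseteq> \<Inter>F" "i \<in> I" "c = C i" by auto
  with dir[of i k] show ?case by (metis Inter_insert Int_mono order_refl subset_trans)
 qed
 have "\<Inter>(C ` I) ~= {}"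
 proof -
  have 1: "\<forall>c\<in>C ` I. closedin X c" using assms(3) by auto
  have 2: "\<forall>F. finite F & F \<subseteq> C ` I --> \<Inter>F ~= {}" using * assms(4) by (metis subset_empty)
  show ?thesis using assms(1)[unfolded compact_space_fip] 1 2 by blast
 qed
 then obtain x where x: "!!i. i \<in> I ==> x \<in> C i" by blast
 moreover have "x \<in> topspace X" using assms(2,3) x closedin_subset by blast
 ultimately show ?thesis using that by blast
qed

section \<open>Submodules and cosets of left modules\<close>

context left_module
begin

lemma smult_zero_r [simp]: "a \<in> carrier R ==> a \<odot> \<zero> = \<zero>"
 by (metis M.r_zero M.zero_closed M.add.l_cancel_one smult_r_distr smult_closed)

lemma smult_zero_l [simp]: "x \<in> carrier M ==> \<zero>\<^bsub>R\<^esub> \<odot> x = \<zero>"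
 by (metis R.r_zero R.zero_closed M.add.l_cancel_one smult_l_distr smult_closed)

lemma smult_minus_r: "a \<in> carrier R ==> x \<in> carrier M ==> a \<odot> (\<ominus> x) = \<ominus> (a \<odot> x)"
 by (metis M.add.inv_closed M.minus_equality M.l_neg smult_closed smult_r_distr smult_zero_r)

lemma smult_minus_l: "a \<in> carrier R ==> x \<in> carrier M ==> (\<ominus>\<^bsub>R\<^esub> a) \<odot> x = \<ominus> (a \<odot> x)"
 by (metis R.add.inv_closed M.minus_equality R.l_neg smult_closed smult_l_distr smult_zero_l)

lemma minus_eq_zero_iff:
 assumes "x \<in> carrier M" "y \<in> carrier M" shows "x \<ominus> y = \<zero> \<longleftrightarrow> x = y"
proof
 assume "x \<ominus> y = \<zero>"
 hence "(x \<ominus> y) \<oplus> y = y" using assms by simp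
 thus "x = y" using assms by (simp add: M.minus_eq M.a_assoc M.l_neg)
qed (use assms in \<open>simp add: M.minus_eq M.r_neg\<close>)

lemma submod_subset: "submodule H R M ==> H \<subseteq> carrier M"
 using subgroup.subset[of H "add_monoid M"] by (simp add: submodule_def)

lemma submod_zero: "submodule H R M ==> \<zero> \<in> H"
 using subgroup.one_closed[of H "add_monoid M"] by (simp add: submodule_def)

lemma submod_add: "submodule H R M ==> x \<in> H ==> y \<in> H ==> x \<oplus> y \<in> H"
 using subgroup.m_closed[of H "add_monoid M"] by (simp add: submodule_def)

lemma submod_uminus: "submodule H R M ==> x \<in> H ==> \<ominus> x \<in> H"
 using subgroup.m_inv_closed[of H "add_monoid M"] by (simp add: submodule_def a_inv_def)

lemma submod_minus: "submodule H R M ==> x \<in> H ==> y \<in> H ==> x \<ominus> y \<in> H"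
 by (simp add: a_minus_def submod_add submod_uminus)

lemma submod_smult: "submodule H R M ==> a \<in> carrier R ==> x \<in> H ==> a \<odot> x \<in> H" by (rule submodule.smult_closed)

text \<open>Closure under negatives comes from the action of the scalar -1.\<close>

lemma submodI:
 assumes "H \<subseteq> carrier M" "\<zero> \<in> H" "!!x y. x \<in> H ==> y \<in> H ==> x \<oplus> y \<in> H"
  "!!a x. a \<in> carrier R ==> x \<in> H ==> a \<odot> x \<in> H"
 shows "submodule H R M"
proof -
 have "\<ominus> x \<in> H" if "x \<in> H" for x
 proof -
  have "(\<ominus>\<^bsub>R\<^esub> \<one>\<^bsub>R\<^esub>) \<odot> x \<in> H" using assms(4) that by simp
  thus ?thesis using smult_minus_l[of "\<one>\<^bsub>R\<^esub>" x] smult_one[of x] that assms(1) by auto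
 qed
 thus ?thesis using assms by (intro submodule.intro submodule_axioms.intro subgroup.intro) (auto simp: a_inv_def[symmetric])
qed

lemma submod_carrier: "submodule (carrier M) R M" by (rule submodI) (auto intro: smult_closed)

lemma submod_sing_zero: "submodule {\<zero>} R M" by (rule submodI) auto

lemma submod_Int: "submodule H R M ==> submodule K R M ==> submodule (H \<inter> K) R M"
 by (rule submodI) (auto simp: submod_zero submod_add submod_smult dest: submod_subset)

lemma submod_Inter:
 assumes "!!H. H \<in> S ==> submodule H R M" "S ~= {}"
 shows "submodule (\<Inter>S) R M"
proof (rule submodI)
 show "\<Inter>S \<subseteq> carrier M" using assms submod_subset by blast
qed (use assms in \<open>auto simp: submod_zero submod_add submod_smult\<close>)

lemma submod_set_add:
 assumes H: "submodule H R M" and K: "submodule K R M"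
 shows "submodule (H <+>\<^bsub>M\<^esub> K) R M"
proof (rule submodI)
 note sub = submod_subset[OF H, THEN subsetD] submod_subset[OF K, THEN subsetD]
 show "H <+>\<^bsub>M\<^esub> K \<subseteq> carrier M" using sub by (auto simp: set_add_def')
 show "\<zero> \<in> H <+>\<^bsub>M\<^esub> K" using submod_zero[OF H] submod_zero[OF K] M.r_zero[of "\<zero>"] by (force simp: set_add_def')
 fix x y assume "x \<in> H <+>\<^bsub>M\<^esub> K" "y \<in> H <+>\<^bsub>M\<^esub> K"
 then obtain h k h' k' where h: "h \<in> H" "h' \<in> H" "k \<in> K" "k' \<in> K" "x = h \<oplus> k" "y = h' \<oplus> k'"
  by (auto simp: set_add_def')
 hence "x \<oplus> y = (h \<oplus> h') \<oplus> (k \<oplus> k')" using sub by (simp add: M.add.m_ac)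
 thus "x \<oplus> y \<in> H <+>\<^bsub>M\<^esub> K" using h submod_add[OF H] submod_add[OF K] by (force simp: set_add_def')
next
 note sub = submod_subset[OF H, THEN subsetD] submod_subset[OF K, THEN subsetD]
 fix a x assume a: "a \<in> carrier R" and "x \<in> H <+>\<^bsub>M\<^esub> K"
 then obtain h k where h: "h \<in> H" "k \<in> K" "x = h \<oplus> k" by (auto simp: set_add_def')
 hence "a \<odot> x = a \<odot> h \<oplus> a \<odot> k" using sub a by (simp add: smult_r_distr)
 thus "a \<odot> x \<in> H <+>\<^bsub>M\<^esub> K" using h a submod_smult[OF H] submod_smult[OF K] by (force simp: set_add_def')
qed

lemma subset_set_add:
 assumes "submodule H R M" "submodule K R M"
 shows "H \<subseteq> H <+>\<^bsub>M\<^esub> K" "K \<subseteq> H <+>\<^bsub>M\<^esub> K"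
proof -
 have "\<exists>h\<in>H. \<exists>k\<in>K. x = h \<oplus> k" if "x \<in> H" for x
  using that submod_zero[OF assms(2)] submod_subset[OF assms(1)] by (intro bexI[of _ x] bexI[of _ "\<zero>"]) auto
 moreover have "\<exists>h\<in>H. \<exists>k\<in>K. x = h \<oplus> k" if "x \<in> K" for x
  using that submod_zero[OF assms(1)] submod_subset[OF assms(2)] by (intro bexI[of _ x] bexI[of _ "\<zero>"]) auto
 ultimately show "H \<subseteq> H <+>\<^bsub>M\<^esub> K" "K \<subseteq> H <+>\<^bsub>M\<^esub> K" by (auto simp: set_add_def')
qed

lemma set_add_least:
 assumes "submodule N R M" "H \<subseteq> N" "K \<subseteq> N" shows "H <+>\<^bsub>M\<^esub> K \<subseteq> N"
 using assms submod_add[OF assms(1)] by (auto simp: set_add_def')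

lemma submod_cyclic:
 assumes x: "x \<in> carrier M" shows "submodule ((%a. a \<odot> x) ` carrier R) R M"
proof (rule submodI)
 show "(%a. a \<odot> x) ` carrier R \<subseteq> carrier M" using x by (auto intro: smult_closed)
 show "\<zero> \<in> (%a. a \<odot> x) ` carrier R" using x by (intro image_eqI[of _ _ "\<zero>\<^bsub>R\<^esub>"]) auto
next
 fix y z assume "y \<in> (%a. a \<odot> x) ` carrier R" "z \<in> (%a. a \<odot> x) ` carrier R"
 then obtain a b where "a \<in> carrier R" "b \<in> carrier R" "y = a \<odot> x" "z = b \<odot> x" by auto
 thus "y \<oplus> z \<in> (%a. a \<odot> x) ` carrier R"
  using x by (intro image_eqI[of _ _ "a \<oplus>\<^bsub>R\<^esub> b"]) (auto simp: smult_l_distr)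
next
 fix c y assume "c \<in> carrier R" "y \<in> (%a. a \<odot> x) ` carrier R"
 then obtain a where "a \<in> carrier R" "y = a \<odot> x" by auto
 thus "c \<odot> y \<in> (%a. a \<odot> x) ` carrier R"
  using x \<open>c \<in> carrier R\<close> by (intro image_eqI[of _ _ "c \<otimes>\<^bsub>R\<^esub> a"]) (auto simp: smult_assoc1)
qed

lemma submod_abelian_subgroup: "submodule H R M ==> abelian_subgroup H M"
 by (intro abelian_subgroupI3) (auto simp: submodule_def additive_subgroup_def M.abelian_group_axioms)

lemma mem_coset_iff:
 assumes H: "submodule H R M" and x: "x \<in> carrier M" and y: "y \<in> carrier M"
 shows "x \<in> H +> y \<longleftrightarrow> x \<ominus> y \<in> H"
proof -
 interpret H: abelian_subgroup H M using H by (rule submod_abelian_subgroup)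
 show ?thesis using H.a_rcos_module[OF y x] x y by (simp add: M.minus_eq)
qed

lemma coset_eq_iff:
 assumes H: "submodule H R M" and x: "x \<in> carrier M" and y: "y \<in> carrier M"
 shows "H +> x = H +> y \<longleftrightarrow> x \<ominus> y \<in> H"
proof -
 interpret H: abelian_subgroup H M using H by (rule submod_abelian_subgroup)
 have "x \<in> H +> y \<longleftrightarrow> x \<ominus> y \<in> H" by (rule mem_coset_iff[OF assms])
 moreover have "x \<in> H +> y \<longleftrightarrow> H +> x = H +> y"
  using H.a_repr_independence'[OF _ y] H.a_repr_independenceD[OF x] by metis
 ultimately show ?thesis by blast
qed

end

section \<open>Open and closed submodules of profinite modules\<close>

locale prof_module =
 fixes L :: "('l, 'x) top_ring_scheme" and M :: "('l, 'm, 'y) top_module_scheme" (structure)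
 assumes profinite: "profinite_module L M"

sublocale prof_module \<subseteq> left_module L M using profinite by (simp add: profinite_module_def)

context prof_module
begin

lemma top [simp]: "topspace (mtop M) = carrier M" using profinite by (simp add: profinite_module_def)

lemma space: "profinite_space (mtop M)" and compact: "compact_space (mtop M)" and
 Hausdorff: "Hausdorff_space (mtop M)" using profinite by (auto simp: profinite_module_def profinite_space_def)

lemma cont_add: "continuous_map (prod_topology (mtop M) (mtop M)) (mtop M) (\<lambda>(x, y). x \<oplus> y)"
 and cont_smult: "continuous_map (prod_topology (rtop L) (mtop M)) (mtop M) (\<lambda>(a, x). a \<odot> x)"
 and cont_uminus: "continuous_map (mtop M) (mtop M) (%x. \<ominus> x)" using profinite by (auto simp: profinite_module_def)

lemma cont_add':
 assumes "continuous_map X (mtop M) f" "continuous_map X (mtop M) g"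
 shows "continuous_map X (mtop M) (%x. f x \<oplus> g x)"
 using continuous_map_compose[OF _ cont_add, of X "%x. (f x, g x)"] assms by (simp add: continuous_map_pairedI o_def)

lemma cont_smult':
 assumes "continuous_map X (rtop L) f" "continuous_map X (mtop M) g"
 shows "continuous_map X (mtop M) (%x. f x \<odot> g x)"
 using continuous_map_compose[OF _ cont_smult, of X "%x. (f x, g x)"] assms by (simp add: continuous_map_pairedI o_def)

lemma cont_uminus':
 assumes "continuous_map X (mtop M) f"
 shows "continuous_map X (mtop M) (%x. \<ominus> f x)" using continuous_map_compose[OF assms cont_uminus] by (simp add: o_def)

lemma cont_translate: "a \<in> carrier M ==> continuous_map (mtop M) (mtop M) (%x. a \<oplus> x)" by (intro cont_add') auto

lemma openin_translate:
 assumes "openin (mtop M) W" "a \<in> carrier M"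
 shows "openin (mtop M) {x \<in> carrier M. a \<oplus> x \<in> W}"
 using openin_continuous_map_preimage[OF cont_translate[OF assms(2)] assms(1)] by simp

lemma open_subgroupI:
 assumes H: "H \<subseteq> carrier M" "!!x y. x \<in> H ==> y \<in> H ==> x \<oplus> y \<in> H"
  and W: "openin (mtop M) W" "\<zero> \<in> W" "W \<subseteq> H"
 shows "openin (mtop M) H"
proof (subst openin_subopen, intro ballI)
 fix h assume h: "h \<in> H"
 hence hc: "h \<in> carrier M" using H by auto
 let ?W = "{x \<in> carrier M. \<ominus> h \<oplus> x \<in> W}"
 have "openin (mtop M) ?W" using openin_translate[OF W(1), of "\<ominus> h"] hc by simp
 moreover have "h \<in> ?W" using hc W(2) by (simp add: M.l_neg)
 moreover have "x \<in> H" if "x \<in> ?W" for x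
 proof -
  have "h \<oplus> (\<ominus> h \<oplus> x) \<in> H" using H(2)[OF h, of "\<ominus> h \<oplus> x"] that W(3) by auto
  thus ?thesis using that hc by (simp add: M.r_neg2)
 qed
 ultimately show "\<exists>T. openin (mtop M) T & h \<in> T & T \<subseteq> H" by blast
qed

lemma open_submodD:
 assumes "open_submodule U L M"
 shows "submodule U L M" "openin (mtop M) U" "U \<subseteq> carrier M" "\<zero> \<in> U"
 using assms submod_subset submod_zero by (auto simp: open_submodule_def)

lemma open_submoduleI:
 assumes "submodule H L M" "open_submodule U L M" "U \<subseteq> H"
 shows "open_submodule H L M"
 using open_subgroupI[of H U] assms submod_subset submod_add submod_zero by (auto simp: open_submodule_def)

lemma open_submodule_closed:
 assumes U: "open_submodule U L M" shows "closed_submodule U L M"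
proof -
 note UD = open_submodD[OF U]
 have "openin (mtop M) (carrier M - U)"
 proof (subst openin_subopen, intro ballI)
  fix h assume h: "h \<in> carrier M - U"
  hence hc: "h \<in> carrier M" by auto
  let ?W = "{x \<in> carrier M. \<ominus> h \<oplus> x \<in> U}"
  have "openin (mtop M) ?W" using openin_translate[OF UD(2), of "\<ominus> h"] hc by simp
  moreover have "h \<in> ?W" using hc UD(4) by (simp add: M.l_neg)
  moreover have "x \<in> carrier M - U" if "x \<in> ?W" for x
  proof -
   have "h = x \<ominus> (\<ominus> h \<oplus> x)" using that hc
    by (simp add: M.minus_add M.minus_minus M.minus_eq M.add.m_lcomm M.r_neg)
   thus ?thesis using that h submod_minus[OF UD(1)] by auto metis
  qed
  ultimately show "\<exists>T. openin (mtop M) T & h \<in> T & T \<subseteq> carrier M - U" by blast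
 qed
 thus ?thesis using UD by (auto simp: closed_submodule_def closedin_def)
qed

lemma open_submodule_carrier: "open_submodule (carrier M) L M"
 using submod_carrier openin_topspace[of "mtop M"] by (simp add: open_submodule_def)

lemma open_submodule_Int:
 "open_submodule U L M ==> open_submodule V L M ==> open_submodule (U \<inter> V) L M"
 by (simp add: open_submodule_def submod_Int openin_Int)

text \<open>The cosets are open and partition a compact space, so a finite subcover already contains
  each of them.\<close>

lemma finite_cosets:
 assumes U: "open_submodule U L M" shows "finite (a_rcosets U)"
proof -
 note UD = open_submodD[OF U]
 interpret U: abelian_subgroup U M using UD(1) by (rule submod_abelian_subgroup)
 have op: "openin (mtop M) c" if c: "c \<in> a_rcosets U" for c
 proof -
  obtain a where a: "a \<in> carrier M" "c = U +> a" using c by (auto simp: A_RCOSETS_def')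
  have "x \<in> c \<longleftrightarrow> x \<in> carrier M & \<ominus> a \<oplus> x \<in> U" for x
   using a U.a_rcos_module[OF a(1), of x] U.a_elemrcos_carrier[OF a(1), of x] by (auto simp: M.a_comm)
  hence "c = {x \<in> carrier M. \<ominus> a \<oplus> x \<in> U}" by blast
  thus ?thesis using openin_translate[OF UD(2), of "\<ominus> a"] a by simp
 qed
 have un: "\<Union>(a_rcosets U) = carrier M" by (rule U.a_rcosets_part_G)
 then obtain F where F: "finite F" "F \<subseteq> a_rcosets U" "carrier M \<subseteq> \<Union>F"
  using compact op unfolding compact_space_def compactin_def by (metis order_refl top)
 have "c \<in> F" if c: "c \<in> a_rcosets U" for c
 proof -
  obtain a where a: "a \<in> carrier M" "a \<in> c" using c U.a_rcos_self by (auto simp: A_RCOSETS_def')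
  have "a \<in> \<Union>F" using a(1) F(3) by (rule subsetD[rotated])
  then obtain d where d: "d \<in> F" "a \<in> d" by (rule UnionE)
  have dU: "d \<in> a_rcosets U" using d(1) F(2) by (rule subsetD[rotated])
  have nd: "\<not> disjnt d c" using d(2) a(2) unfolding disjnt_iff by iprover
  have "d = c"
  proof (rule ccontr)
   assume "d ~= c"
   from pairwiseD[OF U.a_rcos_disjoint dU c this] nd show False by (rule notE[rotated])
  qed
  thus ?thesis using d(1) by simp
 qed
 hence "a_rcosets U \<subseteq> F" by (rule subsetI)
 thus ?thesis using F(1) by (rule finite_subset)
qed

text \<open>Open submodules form a base of neighbourhoods of zero. Through this fact continuity,
  separation and approximation all reduce to finite quotients.\<close>

lemma open_submodule_nbhd:
 assumes L: "profinite_ring L" and W: "openin (mtop M) W" "\<zero> \<in> W"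
 obtains U where "open_submodule U L M" "U \<subseteq> W"
proof -
 have cL: "compact_space (rtop L)" and tL: "topspace (rtop L) = carrier L"
  using L by (auto simp: profinite_ring_def profinite_space_def)
 obtain C where C: "openin (mtop M) C" "closedin (mtop M) C" "\<zero> \<in> C" "C \<subseteq> W"
  using profinite_space_clopen_nbhd[OF space W] by blast
 have CM: "C \<subseteq> carrier M" using C(1) openin_subset by fastforce
 \<comment> \<open>The translations that map the clopen set \<open>C\<close> into itself. Only
   closure under addition is recorded for \<open>H\<close>; the scalars quantified in
   \<open>U\<close> below include -1, which supplies negatives.\<close>
 define H where "H = {x \<in> carrier M. \<forall>c\<in>C. x \<oplus> c \<in> C}"
 have oH: "openin (mtop M) H" using openin_all_compact[OF compact cont_add C(1,2)] by (simp add: H_def)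
 have HC: "H \<subseteq> C" using C(3) by (auto simp: H_def)
 have Hadd: "x \<oplus> y \<in> H" if "x \<in> H" "y \<in> H" for x y using that CM by (auto simp: H_def M.a_assoc subset_iff)
 have H0: "\<zero> \<in> H" using CM by (auto simp: H_def)
 define U where "U = {x \<in> carrier M. \<forall>a\<in>carrier L. a \<odot> x \<in> H}"
 have "continuous_map (prod_topology (mtop M) (rtop L)) (mtop M) (\<lambda>(x, a). a \<odot> x)"
  unfolding case_prod_beta' by (intro cont_smult' continuous_map_snd continuous_map_fst)
 from openin_all_compact[OF cL this oH closedin_topspace] have oU: "openin (mtop M) U" by (simp add: U_def tL)
 have "submodule U L M"
 proof (rule submodI)
  show "x \<oplus> y \<in> U" if "x \<in> U" "y \<in> U" for x y using that Hadd by (auto simp: U_def smult_r_distr)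
  show "a \<odot> x \<in> U" if "a \<in> carrier L" "x \<in> U" for a x
   using that by (auto simp: U_def smult_assoc1[symmetric] intro: smult_closed)
 qed (use H0 in \<open>auto simp: U_def\<close>)
 moreover have "U \<subseteq> W"
 proof
  fix x assume "x \<in> U"
  hence "\<one>\<^bsub>L\<^esub> \<odot> x \<in> H" "x \<in> carrier M" by (auto simp: U_def)
  thus "x \<in> W" using HC C(4) by (auto simp: smult_one)
 qed
 ultimately show ?thesis using that oU by (auto simp: open_submodule_def)
qed

lemma open_submodule_coset_nbhd:
 assumes L: "profinite_ring L" and W: "openin (mtop M) W" "x \<in> W"
 obtains U where "open_submodule U L M" "!!u. u \<in> U ==> x \<oplus> u \<in> W"
proof -
 have x: "x \<in> carrier M" using W openin_subset by fastforce
 have "openin (mtop M) {u \<in> carrier M. x \<oplus> u \<in> W}" "\<zero> \<in> {u \<in> carrier M. x \<oplus> u \<in> W}"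
  using openin_translate[OF W(1) x] x W by auto
 then obtain U where "open_submodule U L M" "U \<subseteq> {u \<in> carrier M. x \<oplus> u \<in> W}"
  using open_submodule_nbhd[OF L] by blast
 thus ?thesis using that by blast
qed

lemma open_submodule_separate:
 assumes L: "profinite_ring L" and x: "x \<in> carrier M" "x ~= \<zero>"
 obtains U where "open_submodule U L M" "x \<notin> U"
proof -
 have "openin (mtop M) (carrier M - {x})" using Hausdorff x(1) by (metis closedin_Hausdorff_singleton closedin_def top)
 moreover have "\<zero> \<in> carrier M - {x}" using x by auto
 ultimately obtain U where "open_submodule U L M" "U \<subseteq> carrier M - {x}" by (rule open_submodule_nbhd[OF L])
 thus ?thesis using that by blast
qed

lemma eq_if_eq_mod_open:
 assumes L: "profinite_ring L" and x: "x \<in> carrier M" "y \<in> carrier M"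
  and "!!U. open_submodule U L M ==> x \<ominus> y \<in> U"
 shows "x = y"
proof (rule ccontr)
 assume "x ~= y"
 hence "x \<ominus> y ~= \<zero>" "x \<ominus> y \<in> carrier M" using x minus_eq_zero_iff by auto
 thus False using open_submodule_separate[OF L, of "x \<ominus> y"] assms by blast
qed

text \<open>If y lies outside \<open>N\<close> and the coset of y modulo an open submodule U misses
  \<open>N\<close>, then N + U is open and still omits y.\<close>

lemma proper_closed_in_proper_open:
 assumes L: "profinite_ring L" and N: "closed_submodule N L M" "N ~= carrier M"
 obtains H where "open_submodule H L M" "N \<subseteq> H" "H ~= carrier M"
proof -
 have sN: "submodule N L M" "closedin (mtop M) N" using N by (auto simp: closed_submodule_def)
 obtain y where y: "y \<in> carrier M" "y \<notin> N" using N sN submod_subset by blast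
 have "openin (mtop M) (carrier M - N)" using sN by (simp add: closedin_def)
 then obtain U where U: "open_submodule U L M" "!!u. u \<in> U ==> y \<oplus> u \<in> carrier M - N"
  using open_submodule_coset_nbhd[OF L, of "carrier M - N" y] y by blast
 note UD = open_submodD[OF U(1)]
 have "y \<notin> N <+>\<^bsub>M\<^esub> U"
 proof
  assume "y \<in> N <+>\<^bsub>M\<^esub> U"
  then obtain n u where nu: "n \<in> N" "u \<in> U" "y = n \<oplus> u" by (auto simp: set_add_def')
  hence c: "n \<in> carrier M" "u \<in> carrier M" using submod_subset sN UD by auto
  have "y \<oplus> \<ominus> u = n" using nu c by (simp add: M.a_assoc M.r_neg)
  thus False using U(2)[of "\<ominus> u"] submod_uminus[OF UD(1) nu(2)] nu by auto
 qed
 thus ?thesis using that[of "N <+>\<^bsub>M\<^esub> U"] submod_set_add[OF sN(1) UD(1)] subset_set_add[OF sN(1) UD(1)]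
   open_submoduleI[OF _ U(1)] y by blast
qed

lemma closed_submoduleD:
 assumes "closed_submodule U L M"
 shows "submodule U L M" "closedin (mtop M) U" "U \<subseteq> carrier M" "\<zero> \<in> U"
 using assms submod_subset submod_zero by (auto simp: closed_submodule_def)

lemma closed_span_submodule:
 assumes "X \<subseteq> carrier M" shows "closed_submodule (closed_span L M X) L M" "X \<subseteq> closed_span L M X"
proof -
 have "carrier M \<in> {N. closed_submodule N L M & X \<subseteq> N}"
  using assms open_submodule_closed[OF open_submodule_carrier] by simp
 hence ne: "{N. closed_submodule N L M & X \<subseteq> N} ~= {}" by blast
 show "closed_submodule (closed_span L M X) L M" unfolding closed_span_def closed_submodule_def
  using ne by (intro conjI submod_Inter closedin_Inter) (auto simp: closed_submodule_def)
 show "X \<subseteq> closed_span L M X" by (auto simp: closed_span_def)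
qed

lemma closed_span_least: "closed_submodule N L M ==> X \<subseteq> N ==> closed_span L M X \<subseteq> N"
 by (auto simp: closed_span_def)

end

section \<open>Continuous homomorphisms\<close>

lemma cont_homD:
 assumes "f \<in> cont_hom L M N"
 shows "!!x. x \<in> carrier M ==> f x \<in> carrier N" "continuous_map (mtop M) (mtop N) f"
  "!!x y. x \<in> carrier M ==> y \<in> carrier M ==> f (x \<oplus>\<^bsub>M\<^esub> y) = f x \<oplus>\<^bsub>N\<^esub> f y"
  "!!a x. a \<in> carrier L ==> x \<in> carrier M ==> f (a \<odot>\<^bsub>M\<^esub> x) = a \<odot>\<^bsub>N\<^esub> f x"
 using assms by (auto simp: cont_hom_def)

lemma cont_hom_id: "(%x. x) \<in> cont_hom L M M" by (auto simp: cont_hom_def)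

lemma cont_hom_compose:
 "f \<in> cont_hom L M N ==> g \<in> cont_hom L N P ==> (%x. g (f x)) \<in> cont_hom L M P"
 using continuous_map_compose[of "mtop M" "mtop N" f "mtop P" g] by (auto simp: cont_hom_def Pi_iff o_def)

lemma cont_hom_add:
 assumes N: "profinite_module L N" and f: "f \<in> cont_hom L M N" and g: "g \<in> cont_hom L M N"
 shows "(%x. f x \<oplus>\<^bsub>N\<^esub> g x) \<in> cont_hom L M N"
proof -
 interpret N: prof_module L N by (rule prof_module.intro[OF N])
 note fD = cont_homD[OF f] and gD = cont_homD[OF g]
 show ?thesis unfolding cont_hom_def using fD gD by (auto simp: N.smult_r_distr N.M.add.m_ac intro!: N.cont_add')
qed

lemma cont_hom_uminus:
 assumes N: "profinite_module L N" and f: "f \<in> cont_hom L M N"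
 shows "(%x. \<ominus>\<^bsub>N\<^esub> f x) \<in> cont_hom L M N"
proof -
 interpret N: prof_module L N by (rule prof_module.intro[OF N])
 note fD = cont_homD[OF f]
 show ?thesis unfolding cont_hom_def using fD by (auto simp: N.smult_minus_r N.M.minus_add N.M.add.m_ac intro!: N.cont_uminus')
qed

lemma cont_hom_zero:
 assumes N: "profinite_module L N"
 shows "(%x. \<zero>\<^bsub>N\<^esub>) \<in> cont_hom L M N"
proof -
 interpret N: prof_module L N by (rule prof_module.intro[OF N])
 show ?thesis by (auto simp: cont_hom_def)
qed

lemma cont_hom_0:
 assumes "profinite_module L M" "profinite_module L N" "f \<in> cont_hom L M N"
 shows "f \<zero>\<^bsub>M\<^esub> = \<zero>\<^bsub>N\<^esub>"
proof -
 interpret M: prof_module L M by (rule prof_module.intro[OF assms(1)])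
 interpret N: prof_module L N by (rule prof_module.intro[OF assms(2)])
 show ?thesis
  using cont_homD(4)[OF assms(3), of "\<zero>\<^bsub>L\<^esub>" "\<zero>\<^bsub>M\<^esub>"] cont_homD(1)[OF assms(3), of "\<zero>\<^bsub>M\<^esub>"] by simp
qed

lemma cont_hom_minus:
 assumes "profinite_module L M" "profinite_module L N" "f \<in> cont_hom L M N" "x \<in> carrier M" "y \<in> carrier M"
 shows "f (\<ominus>\<^bsub>M\<^esub> x) = \<ominus>\<^bsub>N\<^esub> f x" "f (x \<ominus>\<^bsub>M\<^esub> y) = f x \<ominus>\<^bsub>N\<^esub> f y"
proof -
 interpret M: prof_module L M by (rule prof_module.intro[OF assms(1)])
 interpret N: prof_module L N by (rule prof_module.intro[OF assms(2)])
 note fD = cont_homD[OF assms(3)]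
 have *: "f (\<ominus>\<^bsub>M\<^esub> x) = \<ominus>\<^bsub>N\<^esub> f x" if "x \<in> carrier M" for x
  using fD(3)[of "\<ominus>\<^bsub>M\<^esub> x" x] fD(1) that cont_hom_0[OF assms(1-3)]
  by (metis M.M.add.inv_closed M.M.l_neg N.M.minus_equality)
 show "f (\<ominus>\<^bsub>M\<^esub> x) = \<ominus>\<^bsub>N\<^esub> f x" "f (x \<ominus>\<^bsub>M\<^esub> y) = f x \<ominus>\<^bsub>N\<^esub> f y"
  using * assms fD by (auto simp: a_minus_def)
qed

lemma submodule_preimage:
 assumes "profinite_module L M" "profinite_module L N" "f \<in> cont_hom L M N" "submodule U L N"
 shows "submodule {x \<in> carrier M. f x \<in> U} L M"
proof -
 interpret M: prof_module L M by (rule prof_module.intro[OF assms(1)])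
 interpret N: prof_module L N by (rule prof_module.intro[OF assms(2)])
 show ?thesis using cont_homD[OF assms(3)] cont_hom_0[OF assms(1-3)] assms(4)
  by (intro M.submodI) (auto simp: N.submod_zero N.submod_add N.submod_smult M.smult_closed)
qed

lemma submodule_image:
 assumes "profinite_module L M" "profinite_module L N" "f \<in> cont_hom L M N" "submodule U L M"
 shows "submodule (f ` U) L N"
proof -
 interpret M: prof_module L M by (rule prof_module.intro[OF assms(1)])
 interpret N: prof_module L N by (rule prof_module.intro[OF assms(2)])
 note fD = cont_homD[OF assms(3)] and UM = M.submod_subset[OF assms(4), THEN subsetD]
 show ?thesis
 proof (rule N.submodI)
  show "f ` U \<subseteq> carrier N" using fD UM by auto
  show "\<zero>\<^bsub>N\<^esub> \<in> f ` U" using cont_hom_0[OF assms(1-3)] M.submod_zero[OF assms(4)] by (metis image_eqI)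
 next
  fix x y assume "x \<in> f ` U" "y \<in> f ` U"
  then obtain u v where "u \<in> U" "v \<in> U" "x = f u" "y = f v" by auto
  thus "x \<oplus>\<^bsub>N\<^esub> y \<in> f ` U" using fD(3)[of u v] UM M.submod_add[OF assms(4)] by (metis image_eqI)
 next
  fix a x assume "a \<in> carrier L" "x \<in> f ` U"
  then obtain u where "u \<in> U" "x = f u" by auto
  thus "a \<odot>\<^bsub>N\<^esub> x \<in> f ` U" using \<open>a \<in> carrier L\<close> fD(4)[of a u] UM M.submod_smult[OF assms(4)]
   by (metis image_eqI)
 qed
qed

lemma open_submodule_preimage:
 assumes "profinite_module L M" "profinite_module L N" "f \<in> cont_hom L M N" "open_submodule U L N"
 shows "open_submodule {x \<in> carrier M. f x \<in> U} L M"
 using submodule_preimage[OF assms(1-3)] openin_continuous_map_preimage[OF cont_homD(2)[OF assms(3)]]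
  assms(1,4) by (simp add: open_submodule_def profinite_module_def)

lemma closed_submodule_preimage:
 assumes "profinite_module L M" "profinite_module L N" "f \<in> cont_hom L M N" "closed_submodule U L N"
 shows "closed_submodule {x \<in> carrier M. f x \<in> U} L M"
 using submodule_preimage[OF assms(1-3)] closedin_continuous_map_preimage[OF cont_homD(2)[OF assms(3)]]
  assms(1,4) by (simp add: closed_submodule_def profinite_module_def)

lemma closed_submodule_zero:
 assumes "profinite_module L M" shows "closed_submodule {\<zero>\<^bsub>M\<^esub>} L M"
proof -
 interpret M: prof_module L M by (rule prof_module.intro[OF assms(1)])
 show ?thesis using M.submod_sing_zero M.Hausdorff by (simp add: closed_submodule_def closedin_Hausdorff_singleton)
qed

lemma closed_submodule_image:
 assumes "profinite_module L M" "profinite_module L N" "f \<in> cont_hom L M N" "closed_submodule U L M"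
 shows "closed_submodule (f ` U) L N"
proof -
 interpret M: prof_module L M by (rule prof_module.intro[OF assms(1)])
 interpret N: prof_module L N by (rule prof_module.intro[OF assms(2)])
 have "compactin (mtop M) U" using assms(4) M.compact by (simp add: closed_submodule_def closedin_compact_space)
 hence "compactin (mtop N) (f ` U)" using image_compactin cont_homD(2)[OF assms(3)] by blast
 hence "closedin (mtop N) (f ` U)" using N.Hausdorff by (simp add: compactin_imp_closedin)
 thus ?thesis using submodule_image[OF assms(1-3)] assms(4) by (simp add: closed_submodule_def)
qed

lemma closed_submodule_ker:
 assumes "profinite_module L M" "profinite_module L N" "f \<in> cont_hom L M N"
 shows "closed_submodule (ker_set M N f) L M" using closed_submodule_preimage[OF assms closed_submodule_zero[OF assms(2)]]
 by (simp add: ker_set_def)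

text \<open>For an additive map continuity at zero suffices, and the open submodules are a base of
  neighbourhoods there.\<close>

lemma cont_homI:
 assumes M: "profinite_module L M" and N: "profinite_module L N" and L: "profinite_ring L"
  and f: "!!x. x \<in> carrier M ==> f x \<in> carrier N"
  and add: "!!x y. x \<in> carrier M ==> y \<in> carrier M ==> f (x \<oplus>\<^bsub>M\<^esub> y) = f x \<oplus>\<^bsub>N\<^esub> f y"
  and smult: "!!a x. a \<in> carrier L ==> x \<in> carrier M ==> f (a \<odot>\<^bsub>M\<^esub> x) = a \<odot>\<^bsub>N\<^esub> f x"
  and nbhd: "!!U. open_submodule U L N ==>
   \<exists>W. openin (mtop M) W & \<zero>\<^bsub>M\<^esub> \<in> W & (\<forall>x\<in>W. f x \<in> U)"
 shows "f \<in> cont_hom L M N"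
proof -
 interpret M: prof_module L M by (rule prof_module.intro[OF M])
 interpret N: prof_module L N by (rule prof_module.intro[OF N])
 have "continuous_map (mtop M) (mtop N) f" unfolding continuous_map_def
 proof (intro conjI allI impI)
  show "f \<in> topspace (mtop M) \<rightarrow> topspace (mtop N)" using f by auto
  fix O' assume O: "openin (mtop N) O'"
  show "openin (mtop M) {x \<in> topspace (mtop M). f x \<in> O'}"
  proof (subst openin_subopen, intro ballI)
   fix x assume "x \<in> {x \<in> topspace (mtop M). f x \<in> O'}"
   hence x: "x \<in> carrier M" "f x \<in> O'" by auto
   obtain U where U: "open_submodule U L N" "!!u. u \<in> U ==> f x \<oplus>\<^bsub>N\<^esub> u \<in> O'"
    using N.open_submodule_coset_nbhd[OF L O x(2)] by blast
   obtain W where W: "openin (mtop M) W" "\<zero>\<^bsub>M\<^esub> \<in> W" "\<forall>x\<in>W. f x \<in> U" using nbhd[OF U(1)] by blast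
   let ?W = "{y \<in> carrier M. \<ominus>\<^bsub>M\<^esub> x \<oplus>\<^bsub>M\<^esub> y \<in> W}"
   have "openin (mtop M) ?W" using M.openin_translate[OF W(1), of "\<ominus>\<^bsub>M\<^esub> x"] x by simp
   moreover have "x \<in> ?W" using x W(2) by (simp add: M.M.l_neg)
   moreover have "f y \<in> O'" if "y \<in> ?W" for y
   proof -
    have "f y = f (x \<oplus>\<^bsub>M\<^esub> (\<ominus>\<^bsub>M\<^esub> x \<oplus>\<^bsub>M\<^esub> y))" using that x by (simp add: M.M.r_neg2)
    also have "... = f x \<oplus>\<^bsub>N\<^esub> f (\<ominus>\<^bsub>M\<^esub> x \<oplus>\<^bsub>M\<^esub> y)" using add that x by simp
    finally show ?thesis using U(2) W(3) that by auto
   qed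
   ultimately show "\<exists>T. openin (mtop M) T & x \<in> T & T \<subseteq> {x \<in> topspace (mtop M). f x \<in> O'}"
    by (intro exI[of _ ?W]) auto
  qed
 qed
 thus ?thesis using f add smult by (auto simp: cont_hom_def)
qed

section \<open>Free profinite modules and the lifting property\<close>

lemma (in abelian_monoid) finsum_fibres:
 assumes "finite J" "finite K" "\<pi> ` J \<subseteq> K" "f \<in> J \<rightarrow> carrier G"
 shows "(\<Oplus>k\<in>K. \<Oplus>j\<in>{j \<in> J. \<pi> j = k}. f j) = (\<Oplus>j\<in>J. f j)"
proof -
 have "J = (\<Union>k\<in>K. {j \<in> J. \<pi> j = k})" using assms(3) by auto
 hence "(\<Oplus>j\<in>J. f j) = finsum G f (\<Union>k\<in>K. {j \<in> J. \<pi> j = k})" by simp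
 also have "... = (\<Oplus>k\<in>K. \<Oplus>j\<in>{j \<in> J. \<pi> j = k}. f j)"
  using assms by (intro add.finprod_UN_disjoint) (auto simp: pairwise_def disjnt_def Pi_iff)
 finally show ?thesis by simp
qed

lemma additive_finsum:
 assumes "abelian_monoid M" "abelian_monoid N"
  and "!!x. x \<in> carrier M ==> h x \<in> carrier N" "h \<zero>\<^bsub>M\<^esub> = \<zero>\<^bsub>N\<^esub>"
  and "!!x y. x \<in> carrier M ==> y \<in> carrier M ==> h (x \<oplus>\<^bsub>M\<^esub> y) = h x \<oplus>\<^bsub>N\<^esub> h y"
  and "finite J" "f \<in> J \<rightarrow> carrier M"
 shows "h (finsum M f J) = finsum N (%j. h (f j)) J"
proof -
 interpret M: abelian_monoid M by fact
 interpret N: abelian_monoid N by fact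
 show ?thesis using assms(6,7)
 proof (induction J rule: finite_induct)
  case (insert j J)
  have f: "f j \<in> carrier M" "f \<in> J \<rightarrow> carrier M" using insert.prems by auto
  have hf: "(%j. h (f j)) \<in> J \<rightarrow> carrier N" "h (f j) \<in> carrier N" using f assms(3) by auto
  have "h (finsum M f (insert j J)) = h (f j \<oplus>\<^bsub>M\<^esub> finsum M f J)" using insert f by simp
  also have "... = h (f j) \<oplus>\<^bsub>N\<^esub> finsum N (%j. h (f j)) J" using assms(5) f insert by simp
  also have "... = finsum N (%j. h (f j)) (insert j J)" using N.finsum_insert[OF insert(1,2) hf] by simp
  finally show ?case .
 qed (simp add: assms(4))
qed

lemma (in left_module) add_minus_cancel:
 "x \<in> carrier M ==> y \<in> carrier M ==> (x \<oplus> y) \<ominus> x = y"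
 by (simp add: M.minus_eq M.a_comm[of x y] M.a_assoc M.r_neg)

lemma (in left_module) submod_finsum:
 assumes "submodule U R M" "finite J" "f \<in> J \<rightarrow> U"
 shows "finsum M f J \<in> U" using assms(2,3)
proof (induction J rule: finite_induct)
 case (insert j J)
 have "f \<in> insert j J \<rightarrow> carrier M" using insert.prems submod_subset[OF assms(1)] by auto
 thus ?case using insert submod_add[OF assms(1)] by (simp add: Pi_iff)
qed (simp add: submod_zero[OF assms(1)])

locale prof_ring =
 fixes L :: "('l, 'x) top_ring_scheme" (structure)
 assumes profinite: "profinite_ring L"

sublocale prof_ring \<subseteq> ring L using profinite by (simp add: profinite_ring_def)

context prof_ring
begin

lemma top [simp]: "topspace (rtop L) = carrier L" using profinite by (simp add: profinite_ring_def)

lemma space: "profinite_space (rtop L)" and compact: "compact_space (rtop L)" and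
 Hausdorff: "Hausdorff_space (rtop L)" using profinite by (auto simp: profinite_ring_def profinite_space_def)

lemma cont_add:
 assumes "continuous_map X (rtop L) f" "continuous_map X (rtop L) g"
 shows "continuous_map X (rtop L) (%x. f x \<oplus> g x)"
proof -
 have "continuous_map (prod_topology (rtop L) (rtop L)) (rtop L) (\<lambda>(x, y). x \<oplus> y)"
  using profinite by (simp add: profinite_ring_def)
 from continuous_map_compose[OF _ this, of X "%x. (f x, g x)"] show ?thesis
  using assms by (simp add: continuous_map_pairedI o_def)
qed

lemma cont_mult:
 assumes "continuous_map X (rtop L) f" "continuous_map X (rtop L) g"
 shows "continuous_map X (rtop L) (%x. f x \<otimes> g x)"
proof -
 have "continuous_map (prod_topology (rtop L) (rtop L)) (rtop L) (\<lambda>(x, y). x \<otimes> y)"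
  using profinite by (simp add: profinite_ring_def)
 from continuous_map_compose[OF _ this, of X "%x. (f x, g x)"] show ?thesis
  using assms by (simp add: continuous_map_pairedI o_def)
qed

lemma cont_uminus:
 assumes "continuous_map X (rtop L) f"
 shows "continuous_map X (rtop L) (%x. \<ominus> f x)"
proof -
 have "continuous_map (rtop L) (rtop L) (%x. \<ominus> x)" using profinite by (simp add: profinite_ring_def)
 from continuous_map_compose[OF assms this] show ?thesis by (simp add: o_def)
qed

end

text \<open>These are the elements of the free profinite module on the discrete set
  \<open>X\<close>, or equally on its Stone-Cech compactification, whose clopen subsets correspond
  to the subsets of \<open>X\<close>.\<close>

definition fin_measures :: "('l, 'x) ring_scheme => 'a set => ('a set => 'l) set" where
 "fin_measures L X = {\<mu> \<in> Pow X \<rightarrow>\<^sub>E carrier L.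
   \<forall>A B. A \<subseteq> X & B \<subseteq> X & A \<inter> B = {} --> \<mu> (A \<union> B) = \<mu> A \<oplus>\<^bsub>L\<^esub> \<mu> B}"

definition free_module :: "('l, 'x) top_ring_scheme => 'a set => ('l, 'a set => 'l) top_module" where
 "free_module L X =
   \<lparr>carrier = fin_measures L X, monoid.mult = undefined, one = undefined,
   ring.zero = (\<lambda>A\<in>Pow X. \<zero>\<^bsub>L\<^esub>), ring.add = (%\<mu> \<nu>. \<lambda>A\<in>Pow X. \<mu> A \<oplus>\<^bsub>L\<^esub> \<nu> A),
   smult = (%a \<mu>. \<lambda>A\<in>Pow X. a \<otimes>\<^bsub>L\<^esub> \<mu> A),
   mtop = subtopology (product_topology (%_. rtop L) (Pow X)) (fin_measures L X)\<rparr>"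

lemma free_module_sel [simp]:
 "carrier (free_module L X) = fin_measures L X"
 "\<zero>\<^bsub>free_module L X\<^esub> = (\<lambda>A\<in>Pow X. \<zero>\<^bsub>L\<^esub>)"
 "\<mu> \<oplus>\<^bsub>free_module L X\<^esub> \<nu> = (\<lambda>A\<in>Pow X. \<mu> A \<oplus>\<^bsub>L\<^esub> \<nu> A)"
 "a \<odot>\<^bsub>free_module L X\<^esub> \<mu> = (\<lambda>A\<in>Pow X. a \<otimes>\<^bsub>L\<^esub> \<mu> A)"
 "mtop (free_module L X) = subtopology (product_topology (%_. rtop L) (Pow X)) (fin_measures L X)"
 by (simp_all add: free_module_def)

lemma (in ring) fin_measuresI:
 assumes "!!A. A \<subseteq> X ==> \<mu> A \<in> carrier R"
  "!!A B. A \<subseteq> X ==> B \<subseteq> X ==> A \<inter> B = {} ==> \<mu> (A \<union> B) = \<mu> A \<oplus> \<mu> B"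
 shows "(\<lambda>A\<in>Pow X. \<mu> A) \<in> fin_measures R X" using assms by (auto simp: fin_measures_def)

lemma fin_measuresD:
 assumes "\<mu> \<in> fin_measures R X"
 shows "A \<subseteq> X ==> \<mu> A \<in> carrier R" "\<mu> \<in> extensional (Pow X)"
  "A \<subseteq> X ==> B \<subseteq> X ==> A \<inter> B = {} ==> \<mu> (A \<union> B) = \<mu> A \<oplus>\<^bsub>R\<^esub> \<mu> B"
 using assms by (auto simp: fin_measures_def PiE_iff)

lemma (in ring) fin_measure_empty: "\<mu> \<in> fin_measures R X ==> \<mu> {} = \<zero>"
 using fin_measuresD(3)[of \<mu> R X "{}" "{}"] fin_measuresD(1)[of \<mu> R X "{}"] by simp

lemma (in ring) fin_measure_UN:
 assumes \<mu>: "\<mu> \<in> fin_measures R X" and "finite J" "!!j. j \<in> J ==> S j \<subseteq> X"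
  and "!!i j. i \<in> J ==> j \<in> J ==> i ~= j ==> S i \<inter> S j = {}"
 shows "\<mu> (\<Union>j\<in>J. S j) = (\<Oplus>j\<in>J. \<mu> (S j))" using assms(2-)
proof (induction J rule: finite_induct)
 case (insert j J)
 have "\<mu> (\<Union>i\<in>insert j J. S i) = \<mu> (S j \<union> (\<Union>i\<in>J. S i))" by simp
 also have "... = \<mu> (S j) \<oplus> \<mu> (\<Union>i\<in>J. S i)"
  using insert by (intro fin_measuresD(3)[OF \<mu>]) (auto, blast)
 also have "... = \<mu> (S j) \<oplus> (\<Oplus>j\<in>J. \<mu> (S j))" using insert by simp
 also have "... = (\<Oplus>j\<in>insert j J. \<mu> (S j))" using insert fin_measuresD(1)[OF \<mu>] by (subst finsum_insert) auto
 finally show ?case .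
qed (simp add: fin_measure_empty[OF \<mu>])

context prof_ring
begin

lemma cont_measure:
 assumes "A \<subseteq> X" shows "continuous_map (mtop (free_module L X)) (rtop L) (%\<mu>. \<mu> A)"
 using continuous_map_product_projection[of A "Pow X" "%_. rtop L"] assms by (simp add: continuous_map_from_subtopology)

text \<open>Additivity is one equation between continuous functions for each disjoint pair of sets,
  with values in a Hausdorff space.\<close>

lemma closedin_fin_measures: "closedin (product_topology (%_. rtop L) (Pow X)) (fin_measures L X)"
proof -
 let ?T = "product_topology (%_. rtop L) (Pow X)"
 let ?I = "{(A, B). A \<subseteq> X & B \<subseteq> X & A \<inter> B = {}}"
 have pr: "continuous_map ?T (rtop L) (%\<mu>. \<mu> A)" if "A \<subseteq> X" for A
  using continuous_map_product_projection[of A "Pow X" "%_. rtop L"] that by simp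
 have "closedin ?T {\<mu> \<in> topspace ?T. \<mu> (A \<union> B) = \<mu> A \<oplus> \<mu> B}" if "A \<subseteq> X" "B \<subseteq> X" for A B
  using that by (intro closedin_continuous_maps_eq[OF Hausdorff] cont_add pr) auto
 hence "closedin ?T (\<Inter>p\<in>?I. {\<mu> \<in> topspace ?T. \<mu> (fst p \<union> snd p) = \<mu> (fst p) \<oplus> \<mu> (snd p)})"
  by (intro closedin_Inter) auto
 moreover have "fin_measures L X = (\<Inter>p\<in>?I. {\<mu> \<in> topspace ?T. \<mu> (fst p \<union> snd p) = \<mu> (fst p) \<oplus> \<mu> (snd p)})"
  by (auto simp: fin_measures_def)
 ultimately show ?thesis by simp
qed

lemma continuous_map_free:
 assumes "!!x. x \<in> topspace T ==> f x \<in> fin_measures L X"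
  and "!!A. A \<subseteq> X ==> continuous_map T (rtop L) (%x. f x A)"
 shows "continuous_map T (mtop (free_module L X)) f"
 using assms fin_measuresD(2) by (fastforce simp: continuous_map_in_subtopology continuous_map_componentwise)

lemma free_module_left_module: "left_module L (free_module L X)"
proof -
 let ?F = "free_module L X"
 note mD = fin_measuresD[where R = L and X = X]
 have ext: "\<mu> = \<nu>" if "\<mu> \<in> fin_measures L X" "\<nu> \<in> fin_measures L X" "!!A. A \<subseteq> X ==> \<mu> A = \<nu> A" for \<mu> \<nu>
  using that mD(2) by (intro extensionalityI[of _ "Pow X"]) auto
 have add: "(\<lambda>A\<in>Pow X. \<mu> A \<oplus> \<nu> A) \<in> fin_measures L X" if "\<mu> \<in> fin_measures L X" "\<nu> \<in> fin_measures L X" for \<mu> \<nu>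
  using that by (intro fin_measuresI) (auto simp: mD a_ac)
 have neg: "(\<lambda>A\<in>Pow X. \<ominus> \<mu> A) \<in> fin_measures L X" if "\<mu> \<in> fin_measures L X" for \<mu>
  using that by (intro fin_measuresI) (auto simp: mD a_ac minus_add)
 have sm: "(\<lambda>A\<in>Pow X. a \<otimes> \<mu> A) \<in> fin_measures L X" if "\<mu> \<in> fin_measures L X" "a \<in> carrier L" for \<mu> a
  using that by (intro fin_measuresI) (auto simp: mD r_distr)
 have zero: "(\<lambda>A\<in>Pow X. \<zero>) \<in> fin_measures L X" by (intro fin_measuresI) auto
 have "abelian_group ?F"
 proof (rule abelian_groupI)
  show "\<zero>\<^bsub>?F\<^esub> \<oplus>\<^bsub>?F\<^esub> \<mu> = \<mu>" if "\<mu> \<in> carrier ?F" for \<mu>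
   using that add[OF zero, of \<mu>] by (intro ext) (auto simp: mD)
  show "\<exists>\<nu>\<in>carrier ?F. \<nu> \<oplus>\<^bsub>?F\<^esub> \<mu> = \<zero>\<^bsub>?F\<^esub>" if "\<mu> \<in> carrier ?F" for \<mu>
   using that neg[of \<mu>]
   by (intro bexI[of _ "\<lambda>A\<in>Pow X. \<ominus> \<mu> A"]) (auto intro!: restrict_ext simp: mD l_neg)
 qed (auto simp: add zero mD a_ac intro!: restrict_ext ext)
 thus ?thesis by (intro left_module.intro left_module_axioms.intro ring_axioms)
   (auto simp: add sm mD l_distr r_distr m_assoc intro!: restrict_ext ext)
qed

lemma free_module_profinite: "profinite_module L (free_module L X)"
proof -
 let ?F = "free_module L X"
 interpret F: left_module L ?F by (rule free_module_left_module)
 have t: "topspace (mtop ?F) = fin_measures L X" using closedin_subset[OF closedin_fin_measures[of X]] by auto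
 have neg: "\<ominus>\<^bsub>?F\<^esub> \<mu> = (\<lambda>A\<in>Pow X. \<ominus> \<mu> A)" if "\<mu> \<in> fin_measures L X" for \<mu>
 proof (rule F.M.minus_equality)
  show "(\<lambda>A\<in>Pow X. \<ominus> \<mu> A) \<oplus>\<^bsub>?F\<^esub> \<mu> = \<zero>\<^bsub>?F\<^esub>"
   using that by (auto intro!: restrict_ext simp: fin_measuresD l_neg)
  have "(\<lambda>A\<in>Pow X. \<ominus> \<mu> A) \<in> fin_measures L X"
   using that by (intro fin_measuresI) (auto simp: fin_measuresD[where R = L and X = X] a_ac minus_add)
  thus "(\<lambda>A\<in>Pow X. \<ominus> \<mu> A) \<in> carrier ?F" by simp
 qed (use that in simp)
 have cl: "\<mu> \<oplus>\<^bsub>?F\<^esub> \<nu> \<in> fin_measures L X" "\<ominus>\<^bsub>?F\<^esub> \<mu> \<in> fin_measures L X" "a \<in> carrier L ==> a \<odot>\<^bsub>?F\<^esub> \<mu> \<in> fin_measures L X"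
  if "\<mu> \<in> fin_measures L X" "\<nu> \<in> fin_measures L X" for \<mu> \<nu> a
  using F.M.add.m_closed[of \<mu> \<nu>] F.M.add.inv_closed[of \<mu>] F.smult_closed[of a \<mu>] that by auto
 have ev: "continuous_map (prod_topology (mtop ?F) (mtop ?F)) (rtop L) (%p. fst p A)"
  "continuous_map (prod_topology (mtop ?F) (mtop ?F)) (rtop L) (%p. snd p A)"
  "continuous_map (prod_topology (rtop L) (mtop ?F)) (rtop L) (%p. snd p A)" if "A \<subseteq> X" for A
  using continuous_map_compose[OF continuous_map_snd cont_measure[OF that]]
   continuous_map_compose[OF continuous_map_fst cont_measure[OF that]] by (auto simp: o_def simp del: free_module_sel(5))
 show ?thesis unfolding profinite_module_def
 proof (intro conjI)
  show "profinite_space (mtop ?F)" using profinite_space_closed_product[OF _ closedin_fin_measures] space by simp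
  show "continuous_map (prod_topology (mtop ?F) (mtop ?F)) (mtop ?F) (\<lambda>(x, y). x \<oplus>\<^bsub>?F\<^esub> y)"
   using cl t by (intro continuous_map_free) (auto simp: case_prod_beta' simp del: free_module_sel(5) intro!: cont_add ev)
  show "continuous_map (mtop ?F) (mtop ?F) (%x. \<ominus>\<^bsub>?F\<^esub> x)"
  proof (rule continuous_map_free)
   fix A assume A: "A \<subseteq> X"
   have "continuous_map (mtop ?F) (rtop L) (%\<mu>. \<ominus> \<mu> A)" by (intro cont_uminus cont_measure A)
   thus "continuous_map (mtop ?F) (rtop L) (%\<mu>. (\<ominus>\<^bsub>?F\<^esub> \<mu>) A)"
    by (rule continuous_map_eq) (use t neg A in auto)
  qed (use cl t in auto)
  show "continuous_map (prod_topology (rtop L) (mtop ?F)) (mtop ?F) (\<lambda>(a, x). a \<odot>\<^bsub>?F\<^esub> x)"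
   using cl t by (intro continuous_map_free) (auto simp: case_prod_beta' simp del: free_module_sel(5) intro!: cont_mult ev continuous_map_fst)
 qed (use t free_module_left_module in auto)
qed

end

section \<open>Integration against finitely additive measures\<close>

definition simple_int :: "('l, 'm, 'y) module_scheme => 'a set => ('a => 'm) => ('a set => 'l) => 'm" where
 "simple_int A X \<rho> \<mu> = (\<Oplus>\<^bsub>A\<^esub>c\<in>\<rho> ` X. \<mu> {x \<in> X. \<rho> x = c} \<odot>\<^bsub>A\<^esub> c)"

text \<open>\<open>\<rho>\<close> is a step function that agrees with \<open>a\<close> modulo
  \<open>U\<close>; the integrals of such step functions are the Riemann sums of
  \<open>a\<close>.\<close>

definition approximates ::
  "('l, 'm, 'y) module_scheme => 'a set => 'm set => ('a => 'm) => ('a => 'm) => bool" where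
 "approximates A X U a \<rho> \<longleftrightarrow> finite (\<rho> ` X) & (\<forall>x\<in>X. \<rho> x \<in> carrier A & \<rho> x \<ominus>\<^bsub>A\<^esub> a x \<in> U)"

text \<open>All subsets of \<open>X\<close> are measurable, so an arbitrary function
  \<open>a\<close> has an integral: the one element that every Riemann sum approximates modulo the
  open submodule used. This is how a mere function on \<open>X\<close> extends to a homomorphism on
  the free module.\<close>

definition integral_wrt ::
  "('l, 'x) ring_scheme => ('l, 'm, 'y) top_module_scheme => 'a set => ('a => 'm) => ('a set => 'l) => 'm" where
 "integral_wrt L A X a \<mu> = (THE y. y \<in> carrier A &
   (\<forall>U \<rho>. open_submodule U L A & approximates A X U a \<rho> --> simple_int A X \<rho> \<mu> \<ominus>\<^bsub>A\<^esub> y \<in> U))"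

context left_module
begin

text \<open>A step function may be summed over a partition finer than that of its own fibres. Pieces
  with equal value are merged by additivity of \<open>\<mu>\<close>, and indices outside the image
  contribute the measure of the empty set.\<close>

lemma simple_int_partition:
 assumes \<mu>: "\<mu> \<in> fin_measures R X" and J: "finite J" "\<pi> ` X \<subseteq> J" and r: "!!j. j \<in> J ==> r j \<in> carrier M"
 shows "simple_int M X (%x. r (\<pi> x)) \<mu> = (\<Oplus>j\<in>J. \<mu> {x \<in> X. \<pi> x = j} \<odot> r j)"
proof -
 let ?t = "%j. \<mu> {x \<in> X. \<pi> x = j} \<odot> r j"
 let ?J = "\<pi> ` X"
 have fJ: "finite ?J" using J finite_subset by blast
 have \<mu>c: "\<mu> {x \<in> X. Q x} \<in> carrier R" for Q by (rule fin_measuresD(1)[OF \<mu>]) auto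
 have t: "?t j \<in> carrier M" if "j \<in> J" for j using \<mu>c r[OF that] by (rule smult_closed)
 have "finsum M ?t J = finsum M ?t ?J"
 proof (rule M.add.finprod_mono_neutral_cong_right[OF J])
  fix i show "?t i = \<zero>" if "i \<in> J - ?J"
  proof -
   have i: "i \<in> J - ?J" by (rule that)
   hence e: "{x \<in> X. \<pi> x = i} = {}" by auto
   show "?t i = \<zero>" unfolding e using i r R.fin_measure_empty[OF \<mu>] by simp
  qed
 qed (use t J in auto)
 also have "... = (\<Oplus>c\<in>r ` ?J. \<Oplus>j\<in>{j \<in> ?J. r j = c}. ?t j)"
  using fJ t J by (intro M.finsum_fibres[symmetric]) auto
 also have "... = (\<Oplus>c\<in>r ` ?J. \<mu> {x \<in> X. r (\<pi> x) = c} \<odot> c)"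
 proof (rule M.finsum_cong')
  fix c assume c: "c \<in> r ` ?J"
  hence cM: "c \<in> carrier M" using r J by auto
  let ?K = "{j \<in> ?J. r j = c}"
  have "{x \<in> X. r (\<pi> x) = c} = (\<Union>j\<in>?K. {x \<in> X. \<pi> x = j})" by auto
  hence "\<mu> {x \<in> X. r (\<pi> x) = c} = (\<Oplus>\<^bsub>R\<^esub>j\<in>?K. \<mu> {x \<in> X. \<pi> x = j})"
   using fJ by (simp only:) (rule R.fin_measure_UN[OF \<mu>], auto)
  hence "\<mu> {x \<in> X. r (\<pi> x) = c} \<odot> c = (\<Oplus>\<^bsub>R\<^esub>j\<in>?K. \<mu> {x \<in> X. \<pi> x = j}) \<odot> c" by simp
  also have "... = (\<Oplus>j\<in>?K. \<mu> {x \<in> X. \<pi> x = j} \<odot> c)"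
   using fJ cM \<mu>c by (intro additive_finsum[where h = "%a. a \<odot> c"])
    (auto simp: smult_l_distr R.abelian_monoid_axioms M.abelian_monoid_axioms smult_closed)
  also have "... = (\<Oplus>j\<in>?K. ?t j)" using t J by (intro M.finsum_cong') auto
  finally show "(\<Oplus>j\<in>?K. ?t j) = \<mu> {x \<in> X. r (\<pi> x) = c} \<odot> c" by simp
 qed (use r J \<mu>c in \<open>auto intro!: smult_closed simp: image_subset_iff\<close>)
 also have "... = simple_int M X (%x. r (\<pi> x)) \<mu>" by (simp add: simple_int_def image_image)
 finally show ?thesis by simp
qed

lemma simple_int_closed:
 assumes \<mu>: "\<mu> \<in> fin_measures R X" and "!!x. x \<in> X ==> \<rho> x \<in> carrier M"
 shows "simple_int M X \<rho> \<mu> \<in> carrier M" unfolding simple_int_def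
 using assms(2) by (intro M.finsum_closed) (auto intro!: smult_closed fin_measuresD(1)[OF \<mu>])

text \<open>Both sums are rewritten over the common refinement, indexed by the pairs of values
  \<open>(\<rho> x, \<rho>' x)\<close>. The differences of the two values lie in \<open>U\<close>,
  which absorbs scalar multiples and finite sums.\<close>

lemma simple_int_diff:
 assumes \<mu>: "\<mu> \<in> fin_measures R X" and U: "submodule U R M"
  and \<rho>: "finite (\<rho> ` X)" "!!x. x \<in> X ==> \<rho> x \<in> carrier M"
  and \<rho>': "finite (\<rho>' ` X)" "!!x. x \<in> X ==> \<rho>' x \<in> carrier M"
  and d: "!!x. x \<in> X ==> \<rho> x \<ominus> \<rho>' x \<in> U"
 shows "simple_int M X \<rho> \<mu> \<ominus> simple_int M X \<rho>' \<mu> \<in> U"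
proof -
 let ?\<pi> = "%x. (\<rho> x, \<rho>' x)"
 let ?J = "?\<pi> ` X"
 let ?m = "%j. \<mu> {x \<in> X. ?\<pi> x = j}"
 have "?J \<subseteq> \<rho> ` X \<times> \<rho>' ` X" by auto
 hence fJ: "finite ?J" using \<rho>(1) \<rho>'(1) finite_subset by blast
 have m: "?m j \<in> carrier R" for j by (rule fin_measuresD(1)[OF \<mu>]) auto
 have Uc: "!!u. u \<in> U ==> u \<in> carrier M" using submod_subset[OF U] by auto
 have J: "fst j \<in> carrier M" "snd j \<in> carrier M" "fst j \<ominus> snd j \<in> U" if "j \<in> ?J" for j
  using that \<rho> \<rho>' d by auto
 let ?D = "\<Oplus>j\<in>?J. ?m j \<odot> (fst j \<ominus> snd j)"
 have 1: "simple_int M X \<rho> \<mu> = (\<Oplus>j\<in>?J. ?m j \<odot> fst j)"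
  using simple_int_partition[OF \<mu> fJ order_refl, where r = fst] J by simp
 have 2: "simple_int M X \<rho>' \<mu> = (\<Oplus>j\<in>?J. ?m j \<odot> snd j)"
  using simple_int_partition[OF \<mu> fJ order_refl, where r = snd] J by simp
 have "(\<Oplus>j\<in>?J. ?m j \<odot> fst j) = (\<Oplus>j\<in>?J. ?m j \<odot> snd j \<oplus> ?m j \<odot> (fst j \<ominus> snd j))"
 proof (rule M.finsum_cong'[OF refl])
  fix j assume "j \<in> ?J"
  note j = J[OF this] m[of j]
  have "fst j = snd j \<oplus> (fst j \<ominus> snd j)" using j by (simp add: M.minus_eq M.add.m_lcomm M.r_neg)
  hence "?m j \<odot> fst j = ?m j \<odot> (snd j \<oplus> (fst j \<ominus> snd j))" by simp
  also have "... = ?m j \<odot> snd j \<oplus> ?m j \<odot> (fst j \<ominus> snd j)" using j by (intro smult_r_distr) auto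
  finally show "?m j \<odot> fst j = ?m j \<odot> snd j \<oplus> ?m j \<odot> (fst j \<ominus> snd j)" .
 qed (use \<rho>(2) \<rho>'(2) d m Uc in \<open>auto intro!: smult_closed M.add.m_closed\<close>)
 also have "... = (\<Oplus>j\<in>?J. ?m j \<odot> snd j) \<oplus> ?D"
  using \<rho>(2) \<rho>'(2) d m Uc by (intro M.finsum_addf) (auto intro!: smult_closed)
 finally have 3: "simple_int M X \<rho> \<mu> = simple_int M X \<rho>' \<mu> \<oplus> ?D" using 1 2 by simp
 have D: "?D \<in> U" using J m by (intro submod_finsum[OF U fJ]) (auto intro!: submod_smult[OF U])
 have "simple_int M X \<rho> \<mu> \<ominus> simple_int M X \<rho>' \<mu> = ?D"
  unfolding 3 using simple_int_closed[where \<rho> = \<rho>', OF \<mu> \<rho>'(2)] Uc[OF D] by (simp add: add_minus_cancel)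
 thus ?thesis using D by simp
qed

lemma simple_int_add:
 assumes \<mu>: "\<mu> \<in> fin_measures R X" "\<nu> \<in> fin_measures R X" and \<rho>: "!!x. x \<in> X ==> \<rho> x \<in> carrier M"
 shows "simple_int M X \<rho> (\<lambda>A\<in>Pow X. \<mu> A \<oplus>\<^bsub>R\<^esub> \<nu> A) =
  simple_int M X \<rho> \<mu> \<oplus> simple_int M X \<rho> \<nu>"
proof -
 have c: "\<mu> {x \<in> X. Q x} \<in> carrier R" "\<nu> {x \<in> X. Q x} \<in> carrier R" for Q
  by (auto intro!: fin_measuresD(1)[OF \<mu>(1)] fin_measuresD(1)[OF \<mu>(2)])
 have "simple_int M X \<rho> (\<lambda>A\<in>Pow X. \<mu> A \<oplus>\<^bsub>R\<^esub> \<nu> A) =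
  (\<Oplus>c\<in>\<rho> ` X. \<mu> {x \<in> X. \<rho> x = c} \<odot> c \<oplus> \<nu> {x \<in> X. \<rho> x = c} \<odot> c)"
  unfolding simple_int_def using c \<rho> by (intro M.finsum_cong') (auto simp: smult_l_distr intro!: smult_closed M.add.m_closed)
 also have "... = simple_int M X \<rho> \<mu> \<oplus> simple_int M X \<rho> \<nu>"
  unfolding simple_int_def using c \<rho> by (intro M.finsum_addf) (auto intro!: smult_closed)
 finally show ?thesis .
qed

lemma simple_int_smult:
 assumes \<mu>: "\<mu> \<in> fin_measures R X" and a: "a \<in> carrier R" and \<rho>: "finite (\<rho> ` X)" "!!x. x \<in> X ==> \<rho> x \<in> carrier M"
 shows "simple_int M X \<rho> (\<lambda>A\<in>Pow X. a \<otimes>\<^bsub>R\<^esub> \<mu> A) = a \<odot> simple_int M X \<rho> \<mu>"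
proof -
 have c: "\<mu> {x \<in> X. Q x} \<in> carrier R" for Q by (auto intro!: fin_measuresD(1)[OF \<mu>])
 have "simple_int M X \<rho> (\<lambda>A\<in>Pow X. a \<otimes>\<^bsub>R\<^esub> \<mu> A) =
  (\<Oplus>c\<in>\<rho> ` X. a \<odot> (\<mu> {x \<in> X. \<rho> x = c} \<odot> c))" unfolding simple_int_def using c \<rho> a
  by (intro M.finsum_cong') (auto simp: smult_assoc1 intro!: smult_closed)
 also have "... = a \<odot> simple_int M X \<rho> \<mu>" unfolding simple_int_def using c \<rho> a
  by (intro additive_finsum[where h = "%x. a \<odot> x", symmetric])
   (auto simp: smult_r_distr M.abelian_monoid_axioms intro!: smult_closed)
 finally show ?thesis .
qed

end

context prof_module
begin

text \<open>One representative is chosen in each coset of \<open>U\<close>, and there are finitely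
  many cosets.\<close>

lemma ex_approximates:
 assumes U: "open_submodule U L M" and a: "!!x. x \<in> X ==> a x \<in> carrier M"
 obtains \<rho> where "approximates M X U a \<rho>"
proof -
 note UD = open_submodD[OF U]
 interpret U: abelian_subgroup U M using UD(1) by (rule submod_abelian_subgroup)
 define \<rho> where "\<rho> x = (SOME y. y \<in> U +> a x)" for x
 have r: "\<rho> x \<in> U +> a x" if "x \<in> X" for x unfolding \<rho>_def using U.a_rcos_self[OF a[OF that]] by (rule someI)
 have c: "\<rho> x \<in> carrier M" if "x \<in> X" for x using U.a_elemrcos_carrier[OF a[OF that] r[OF that]] .
 have "\<rho> ` X \<subseteq> (%c. SOME y. y \<in> c) ` (a_rcosets U)" using a by (auto simp: \<rho>_def A_RCOSETS_def')
 hence "finite (\<rho> ` X)" using finite_cosets[OF U] finite_subset by blast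
 thus ?thesis using that[of \<rho>] r c mem_coset_iff[OF UD(1) c a] by (auto simp: approximates_def)
qed

text \<open>Each approximation modulo \<open>U\<close> confines the integral to a closed set. An
  approximation modulo the intersection of \<open>U\<close> and \<open>V\<close> confines it to both
  sets at once, so the family is directed and compactness gives a common point.\<close>

lemma ex_integral:
 assumes L: "profinite_ring L" and \<mu>: "\<mu> \<in> fin_measures L X" and a: "!!x. x \<in> X ==> a x \<in> carrier M"
 obtains y where "y \<in> carrier M"
  "!!U \<rho>. open_submodule U L M ==> approximates M X U a \<rho> ==> simple_int M X \<rho> \<mu> \<ominus> y \<in> U"
proof -
 let ?I = "{(U, \<rho>). open_submodule U L M & approximates M X U a \<rho>}"
 let ?C = "%i. {y \<in> carrier M. simple_int M X (snd i) \<mu> \<ominus> y \<in> fst i}"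
 have ic: "simple_int M X \<rho> \<mu> \<in> carrier M" if "approximates M X U a \<rho>" for U \<rho>
  using that by (intro simple_int_closed[OF \<mu>]) (auto simp: approximates_def)
 obtain y where "y \<in> topspace (mtop M)" "!!i. i \<in> ?I ==> y \<in> ?C i"
 proof (rule compact_space_directed[OF compact, where I = ?I and C = ?C])
  obtain \<rho> where "approximates M X (carrier M) a \<rho>" using ex_approximates[OF open_submodule_carrier, of X a] a by blast
  hence "(carrier M, \<rho>) \<in> ?I" using open_submodule_carrier by simp
  thus "?I ~= {}" by blast
 next
  fix i assume i: "i \<in> ?I"
  then obtain U \<rho> where [simp]: "i = (U, \<rho>)" and U: "open_submodule U L M" "approximates M X U a \<rho>" by auto
  have "continuous_map (mtop M) (mtop M) (%y. simple_int M X \<rho> \<mu> \<ominus> y)"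
   unfolding a_minus_def using ic[OF U(2)] by (intro cont_add' cont_uminus) auto
  from closedin_continuous_map_preimage[OF this closed_submoduleD(2)[OF open_submodule_closed[OF U(1)]]]
  show "closedin (mtop M) (?C i)" by simp
  have "simple_int M X \<rho> \<mu> \<in> ?C i" using ic[OF U(2)] open_submodD(4)[OF U(1)] by (simp add: M.minus_eq M.r_neg)
  thus "?C i ~= {}" by blast
 next
  fix i j assume "i \<in> ?I" "j \<in> ?I"
  then obtain U \<rho> V \<sigma> where [simp]: "i = (U, \<rho>)" "j = (V, \<sigma>)"
   and U: "open_submodule U L M" "approximates M X U a \<rho>"
   and V: "open_submodule V L M" "approximates M X V a \<sigma>" by auto
  have UV: "open_submodule (U \<inter> V) L M" by (rule open_submodule_Int[OF U(1) V(1)])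
  obtain \<tau> where \<tau>: "approximates M X (U \<inter> V) a \<tau>" using ex_approximates[OF UV, of X a] a by blast
  have *: "simple_int M X \<rho> \<mu> \<ominus> y \<in> U"
   if U: "open_submodule U L M" "approximates M X U a \<rho>" and y: "y \<in> carrier M"
    and \<tau>: "approximates M X U a \<tau>" "simple_int M X \<tau> \<mu> \<ominus> y \<in> U" for U \<rho> y
  proof -
   note UD = open_submodD[OF U(1)]
   have eq: "p \<ominus> q = (p \<ominus> r) \<oplus> (r \<ominus> q)" "p \<ominus> q = (p \<ominus> r) \<ominus> (q \<ominus> r)"
    if "p \<in> carrier M" "q \<in> carrier M" "r \<in> carrier M" for p q r
    using that by (simp_all add: M.minus_eq M.minus_add M.minus_minus M.a_assoc M.r_neg1 M.r_neg2 M.a_comm)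
   have "simple_int M X \<rho> \<mu> \<ominus> simple_int M X \<tau> \<mu> \<in> U"
   proof (rule simple_int_diff[OF \<mu> UD(1)])
    fix x assume x: "x \<in> X"
    hence "\<rho> x \<ominus> \<tau> x = (\<rho> x \<ominus> a x) \<ominus> (\<tau> x \<ominus> a x)"
     using U(2) \<tau>(1) a[OF x] by (intro eq(2)) (auto simp: approximates_def)
    thus "\<rho> x \<ominus> \<tau> x \<in> U" using U(2) \<tau>(1) x submod_minus[OF UD(1)] by (auto simp: approximates_def)
   qed (use U \<tau> in \<open>auto simp: approximates_def\<close>)
   thus ?thesis using eq(1)[OF ic[OF U(2)] y ic[OF \<tau>(1)]] \<tau>(2) submod_add[OF UD(1)] by simp
  qed
  have "(U \<inter> V, \<tau>) \<in> ?I" using UV \<tau> by simp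
  moreover have "approximates M X U a \<tau>" "approximates M X V a \<tau>" using \<tau> by (auto simp: approximates_def)
  hence "?C (U \<inter> V, \<tau>) \<subseteq> ?C i \<inter> ?C j" using *[OF U] *[OF V] by auto
  ultimately show "\<exists>k\<in>?I. ?C k \<subseteq> ?C i \<inter> ?C j" by blast
 qed auto
 thus ?thesis using that by auto
qed

text \<open>Less is asked of \<open>y\<close> than of \<open>z\<close>: one approximation for each
  open submodule. Values of integrals are verified in this form below.\<close>

lemma integral_wrt_eqI:
 assumes L: "profinite_ring L" and \<mu>: "\<mu> \<in> fin_measures L X" and a: "!!x. x \<in> X ==> a x \<in> carrier M"
  and y: "y \<in> carrier M" and y': "z \<in> carrier M"
   "!!U \<rho>. open_submodule U L M ==> approximates M X U a \<rho> ==> simple_int M X \<rho> \<mu> \<ominus> z \<in> U"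
  and ap: "!!U. open_submodule U L M ==> \<exists>\<rho>. approximates M X U a \<rho> & simple_int M X \<rho> \<mu> \<ominus> y \<in> U"
 shows "y = z"
proof (rule eq_if_eq_mod_open[OF L y y'(1)])
 fix U assume U: "open_submodule U L M"
 then obtain \<rho> where \<rho>: "approximates M X U a \<rho>" "simple_int M X \<rho> \<mu> \<ominus> y \<in> U" using ap by blast
 have c: "simple_int M X \<rho> \<mu> \<in> carrier M"
  using \<rho>(1) by (intro simple_int_closed[OF \<mu>]) (auto simp: approximates_def)
 have "(s \<ominus> z) \<ominus> (s \<ominus> y) = y \<ominus> z" if "s \<in> carrier M" for s
  using that y y'(1) by (simp add: M.minus_eq M.minus_add M.minus_minus M.a_ac M.r_neg2)
 from this[OF c] show "y \<ominus> z \<in> U" using submod_minus[OF open_submodD(1)[OF U] y'(2)[OF U \<rho>(1)] \<rho>(2)] by simp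
qed

lemma integral_wrt:
 assumes L: "profinite_ring L" and \<mu>: "\<mu> \<in> fin_measures L X" and a: "!!x. x \<in> X ==> a x \<in> carrier M"
 shows "integral_wrt L M X a \<mu> \<in> carrier M" "!!U \<rho>. open_submodule U L M ==> approximates M X U a \<rho> ==>
    simple_int M X \<rho> \<mu> \<ominus> integral_wrt L M X a \<mu> \<in> U"
proof -
 let ?P = "%y. y \<in> carrier M &
   (\<forall>U \<rho>. open_submodule U L M & approximates M X U a \<rho> --> simple_int M X \<rho> \<mu> \<ominus> y \<in> U)"
 obtain y where y: "?P y"
 proof (rule ex_integral[OF L \<mu>])
  show "a x \<in> carrier M" if "x \<in> X" for x using that by (rule a)
 qed blast
 have un: "z = y" if z: "?P z" for z
 proof (rule integral_wrt_eqI[OF L \<mu>, of a])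
  fix U assume U: "open_submodule U L M"
  obtain \<rho> where "approximates M X U a \<rho>" using ex_approximates[OF U, of X a] a by blast
  thus "\<exists>\<rho>. approximates M X U a \<rho> & simple_int M X \<rho> \<mu> \<ominus> z \<in> U" using z U by blast
 qed (use a y z in auto)
 have "?P (integral_wrt L M X a \<mu>)" unfolding integral_wrt_def by (rule theI[of ?P, OF y un])
 thus "integral_wrt L M X a \<mu> \<in> carrier M" "!!U \<rho>. open_submodule U L M ==> approximates M X U a \<rho> ==>
    simple_int M X \<rho> \<mu> \<ominus> integral_wrt L M X a \<mu> \<in> U" by blast+
qed

lemma integral_wrt_unique:
 assumes L: "profinite_ring L" and \<mu>: "\<mu> \<in> fin_measures L X" and a: "!!x. x \<in> X ==> a x \<in> carrier M"
  and y: "y \<in> carrier M"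
  and ap: "!!U. open_submodule U L M ==> \<exists>\<rho>. approximates M X U a \<rho> & simple_int M X \<rho> \<mu> \<ominus> y \<in> U"
 shows "integral_wrt L M X a \<mu> = y" using integral_wrt_eqI[OF L \<mu> a y integral_wrt[where a = a, OF L \<mu> a] ap] by simp

lemma integral_wrt_cong:
 assumes L: "profinite_ring L" and \<mu>: "\<mu> \<in> fin_measures L X" and a: "!!x. x \<in> X ==> a x \<in> carrier M"
  and "!!x. x \<in> X ==> a x = b x"
 shows "integral_wrt L M X a \<mu> = integral_wrt L M X b \<mu>"
proof -
 have "approximates M X U a = approximates M X U b" for U using assms(4) by (auto simp: approximates_def fun_eq_iff)
 thus ?thesis by (simp add: integral_wrt_def)
qed

text \<open>Point masses integrate to point values, which is how the free module on the carrier of a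
  module surjects onto that module.\<close>

lemma integral_wrt_dirac:
 assumes L: "profinite_ring L" and a: "!!x. x \<in> X ==> a x \<in> carrier M" and x: "x \<in> X"
 defines "\<delta> \<equiv> \<lambda>A\<in>Pow X. if x \<in> A then \<one>\<^bsub>L\<^esub> else \<zero>\<^bsub>L\<^esub>"
 shows "\<delta> \<in> fin_measures L X" "integral_wrt L M X a \<delta> = a x"
proof -
 show \<delta>: "\<delta> \<in> fin_measures L X" unfolding \<delta>_def by (rule R.fin_measuresI) auto
 show "integral_wrt L M X a \<delta> = a x"
 proof (rule integral_wrt_unique[OF L \<delta> a])
  fix U assume U: "open_submodule U L M"
  obtain \<rho> where \<rho>: "approximates M X U a \<rho>" using ex_approximates[OF U, of X a] a by blast
  have "simple_int M X \<rho> \<delta> = (\<Oplus>c\<in>\<rho> ` X. if \<rho> x = c then c else \<zero>)"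
   unfolding simple_int_def using \<rho> x by (intro M.finsum_cong') (auto simp: \<delta>_def approximates_def smult_one)
  also have "... = \<rho> x" using \<rho> x by (intro M.finsum_singleton) (auto simp: approximates_def)
  finally have "simple_int M X \<rho> \<delta> \<ominus> a x \<in> U" using \<rho> x by (auto simp: approximates_def)
  thus "\<exists>\<rho>. approximates M X U a \<rho> & simple_int M X \<rho> \<delta> \<ominus> a x \<in> U" using \<rho> by blast
 qed (use a x in auto)
qed

lemma integral_wrt_cont_hom:
 assumes L: "profinite_ring L" and a: "!!x. x \<in> X ==> a x \<in> carrier M"
 shows "integral_wrt L M X a \<in> cont_hom L (free_module L X) M"
proof (rule cont_homI[OF prof_ring.free_module_profinite[OF prof_ring.intro[OF L]] profinite L])
 interpret L: prof_ring L by (rule prof_ring.intro[OF L])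
 interpret F: prof_module L "free_module L X" by (rule prof_module.intro[OF L.free_module_profinite])
 have I: "integral_wrt L M X a \<mu> \<in> carrier M" "open_submodule U L M ==> approximates M X U a \<rho> ==>
    simple_int M X \<rho> \<mu> \<ominus> integral_wrt L M X a \<mu> \<in> U" if "\<mu> \<in> fin_measures L X" for \<mu> U \<rho>
  using integral_wrt[where a = a, OF L that a] by blast+
 show "integral_wrt L M X a \<mu> \<in> carrier M" if "\<mu> \<in> carrier (free_module L X)" for \<mu>
  using I(1)[of \<mu>] that by simp
 show "integral_wrt L M X a (\<mu> \<oplus>\<^bsub>free_module L X\<^esub> \<nu>) = integral_wrt L M X a \<mu> \<oplus> integral_wrt L M X a \<nu>"
  if "\<mu> \<in> carrier (free_module L X)" "\<nu> \<in> carrier (free_module L X)" for \<mu> \<nu>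
 proof (rule integral_wrt_unique[OF L])
  fix U assume U: "open_submodule U L M"
  obtain \<rho> where \<rho>: "approximates M X U a \<rho>" using ex_approximates[OF U, of X a] a by blast
  have m: "\<mu> \<in> fin_measures L X" "\<nu> \<in> fin_measures L X" using that by auto
  have c: "simple_int M X \<rho> \<mu> \<in> carrier M" "simple_int M X \<rho> \<nu> \<in> carrier M"
   using \<rho> m by (auto simp: approximates_def intro!: simple_int_closed)
  have "simple_int M X \<rho> (\<mu> \<oplus>\<^bsub>free_module L X\<^esub> \<nu>) \<ominus> (integral_wrt L M X a \<mu> \<oplus> integral_wrt L M X a \<nu>)
   = (simple_int M X \<rho> \<mu> \<ominus> integral_wrt L M X a \<mu>) \<oplus> (simple_int M X \<rho> \<nu> \<ominus> integral_wrt L M X a \<nu>)"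
   using \<rho> m I(1) c by (simp add: approximates_def simple_int_add M.minus_eq M.minus_add M.a_ac)
  hence "simple_int M X \<rho> (\<mu> \<oplus>\<^bsub>free_module L X\<^esub> \<nu>) \<ominus> (integral_wrt L M X a \<mu> \<oplus> integral_wrt L M X a \<nu>) \<in> U"
   using I(2)[OF m(1) U \<rho>] I(2)[OF m(2) U \<rho>] submod_add[OF open_submodD(1)[OF U]] by simp
  thus "\<exists>\<rho>. approximates M X U a \<rho> &
   simple_int M X \<rho> (\<mu> \<oplus>\<^bsub>free_module L X\<^esub> \<nu>) \<ominus> (integral_wrt L M X a \<mu> \<oplus> integral_wrt L M X a \<nu>) \<in> U"
   using \<rho> by blast
 qed (use a I(1) that F.M.add.m_closed[OF that] in auto)
 show "integral_wrt L M X a (b \<odot>\<^bsub>free_module L X\<^esub> \<mu>) = b \<odot> integral_wrt L M X a \<mu>"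
  if "b \<in> carrier L" "\<mu> \<in> carrier (free_module L X)" for b \<mu>
 proof (rule integral_wrt_unique[OF L])
  fix U assume U: "open_submodule U L M"
  obtain \<rho> where \<rho>: "approximates M X U a \<rho>" using ex_approximates[OF U, of X a] a by blast
  have m: "\<mu> \<in> fin_measures L X" using that by auto
  have c: "simple_int M X \<rho> \<mu> \<in> carrier M" using \<rho> m by (auto simp: approximates_def intro!: simple_int_closed)
  have "simple_int M X \<rho> (b \<odot>\<^bsub>free_module L X\<^esub> \<mu>) \<ominus> b \<odot> integral_wrt L M X a \<mu>
   = b \<odot> (simple_int M X \<rho> \<mu> \<ominus> integral_wrt L M X a \<mu>)" using \<rho> m I(1) c that
   by (simp add: approximates_def simple_int_smult M.minus_eq smult_r_distr smult_minus_r)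
  hence "simple_int M X \<rho> (b \<odot>\<^bsub>free_module L X\<^esub> \<mu>) \<ominus> b \<odot> integral_wrt L M X a \<mu> \<in> U"
   using I(2)[OF m(1) U \<rho>] submod_smult[OF open_submodD(1)[OF U] that(1)] by simp
  thus "\<exists>\<rho>. approximates M X U a \<rho> &
   simple_int M X \<rho> (b \<odot>\<^bsub>free_module L X\<^esub> \<mu>) \<ominus> b \<odot> integral_wrt L M X a \<mu> \<in> U"
   using \<rho> by blast
 qed (use a I(1) that F.smult_closed[OF that] smult_closed in auto)
 fix U assume U: "open_submodule U L M"
 note UD = open_submodD[OF U]
 obtain \<rho> where \<rho>: "approximates M X U a \<rho>" using ex_approximates[OF U, of X a] a by blast
 \<comment> \<open>For continuity at zero one Riemann sum has to be controlled. It has finitely many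
   terms, each a continuous function of the measure.\<close>
 let ?W = "%c. {\<mu> \<in> carrier (free_module L X). \<mu> {x \<in> X. \<rho> x = c} \<odot> c \<in> U}"
 let ?WW = "carrier (free_module L X) \<inter> (\<Inter>c\<in>\<rho> ` X. ?W c)"
 have "openin (mtop (free_module L X)) (?W c)" if "c \<in> \<rho> ` X" for c
 proof -
  have "continuous_map (mtop (free_module L X)) (mtop M) (%\<mu>. \<mu> {x \<in> X. \<rho> x = c} \<odot> c)"
   using \<rho> that by (intro cont_smult' L.cont_measure) (auto simp: approximates_def)
  from openin_continuous_map_preimage[OF this UD(2)] show ?thesis unfolding F.top .
 qed
 hence W: "openin (mtop (free_module L X)) (?W c)" if "c \<in> \<rho> ` X" for c using that .
 have fin: "finite (\<rho> ` X)" using \<rho> by (simp add: approximates_def)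
 have tF: "openin (mtop (free_module L X)) (carrier (free_module L X))"
  using openin_topspace[of "mtop (free_module L X)"] unfolding F.top .
 have "openin (mtop (free_module L X)) ?WW"
 \<comment> \<open>An empty \<open>X\<close> gives an empty family of conditions, and
   \<open>?WW\<close> is then the whole free module.\<close>
 proof (cases "\<rho> ` X = {}")
  case True thus ?thesis using tF by simp
 next
  case False
  show ?thesis by (rule openin_Int[OF tF openin_INT2[OF fin False W]])
 qed
 moreover have z: "\<zero>\<^bsub>free_module L X\<^esub> \<in> ?WW"
  using F.M.zero_closed \<rho> UD(4) by (auto simp: approximates_def)
 moreover have "integral_wrt L M X a \<mu> \<in> U" if that: "\<mu> \<in> ?WW" for \<mu>
 proof -
  have m: "\<mu> \<in> fin_measures L X" using that by auto
  have s: "simple_int M X \<rho> \<mu> \<in> U" unfolding simple_int_def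
   using that \<rho> by (intro submod_finsum[OF UD(1)]) (auto simp: approximates_def)
  have "s \<ominus> (s \<ominus> y) = y" if "s \<in> carrier M" "y \<in> carrier M" for s y
   using that by (simp add: M.minus_eq M.minus_add M.minus_minus M.a_assoc[symmetric] M.r_neg)
  from this[of "simple_int M X \<rho> \<mu>" "integral_wrt L M X a \<mu>"] show ?thesis
   using submod_minus[OF UD(1) s I(2)[OF m U \<rho>]] s UD(3) I(1)[OF m] by auto
 qed
 ultimately show "\<exists>W. openin (mtop (free_module L X)) W & \<zero>\<^bsub>free_module L X\<^esub> \<in> W & (\<forall>x\<in>W. integral_wrt L M X a x \<in> U)"
  by (intro exI[of _ ?WW] conjI ballI)
qed

end

text \<open>A step function approximating \<open>a\<close> modulo the preimage of an open submodule
  is carried by \<open>g\<close> to one approximating the composite. Applying \<open>g\<close> may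
  merge fibres, which \<open>simple_int_partition\<close> accommodates.\<close>

lemma integral_wrt_hom:
 assumes L: "profinite_ring L" and A: "profinite_module L A" and B: "profinite_module L B"
  and g: "g \<in> cont_hom L A B" and \<mu>: "\<mu> \<in> fin_measures L X" and a: "!!x. x \<in> X ==> a x \<in> carrier A"
 shows "integral_wrt L B X (%x. g (a x)) \<mu> = g (integral_wrt L A X a \<mu>)"
proof -
 interpret A: prof_module L A by (rule prof_module.intro[OF A])
 interpret B: prof_module L B by (rule prof_module.intro[OF B])
 note gD = cont_homD[OF g]
 have I: "integral_wrt L A X a \<mu> \<in> carrier A" "open_submodule U L A ==> approximates A X U a \<rho> ==>
    simple_int A X \<rho> \<mu> \<ominus>\<^bsub>A\<^esub> integral_wrt L A X a \<mu> \<in> U" for U \<rho>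
  using A.integral_wrt[where a = a, OF L \<mu> a] by blast+
 show ?thesis
 proof (rule B.integral_wrt_unique[OF L \<mu>])
  fix V assume V: "open_submodule V L B"
  let ?U = "{x \<in> carrier A. g x \<in> V}"
  have U: "open_submodule ?U L A" by (rule open_submodule_preimage[OF A B g V])
  obtain \<rho> where \<rho>: "approximates A X ?U a \<rho>" using A.ex_approximates[OF U, of X a] a by blast
  have f: "finite (\<rho> ` X)" "!!x. x \<in> X ==> \<rho> x \<in> carrier A" using \<rho> by (auto simp: approximates_def)
  have ap: "approximates B X V (%x. g (a x)) (%x. g (\<rho> x))" using \<rho> a gD(1) finite_imageI[OF f(1), of g]
   by (auto simp: approximates_def cont_hom_minus(2)[OF A B g] image_image)
  have sc: "simple_int A X \<rho> \<mu> \<in> carrier A" using A.simple_int_closed[OF \<mu>] f by blast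
  have "simple_int B X (%x. g (\<rho> x)) \<mu> = (\<Oplus>\<^bsub>B\<^esub>c\<in>\<rho> ` X. \<mu> {x \<in> X. \<rho> x = c} \<odot>\<^bsub>B\<^esub> g c)"
   using f gD(1) by (intro B.simple_int_partition[OF \<mu>]) auto
  also have "... = (\<Oplus>\<^bsub>B\<^esub>c\<in>\<rho> ` X. g (\<mu> {x \<in> X. \<rho> x = c} \<odot>\<^bsub>A\<^esub> c))"
   using f gD fin_measuresD(1)[OF \<mu>] by (intro B.M.finsum_cong') (auto intro!: B.smult_closed)
  also have "... = g (simple_int A X \<rho> \<mu>)"
   unfolding simple_int_def using f gD cont_hom_0[OF A B g] fin_measuresD(1)[OF \<mu>] by (intro additive_finsum[symmetric])
    (auto simp: A.M.abelian_monoid_axioms B.M.abelian_monoid_axioms intro!: A.smult_closed)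
  finally have "simple_int B X (%x. g (\<rho> x)) \<mu> \<ominus>\<^bsub>B\<^esub> g (integral_wrt L A X a \<mu>)
   = g (simple_int A X \<rho> \<mu> \<ominus>\<^bsub>A\<^esub> integral_wrt L A X a \<mu>)"
   using cont_hom_minus(2)[OF A B g sc I(1)] by simp
  hence "simple_int B X (%x. g (\<rho> x)) \<mu> \<ominus>\<^bsub>B\<^esub> g (integral_wrt L A X a \<mu>) \<in> V"
   using I(2)[OF U \<rho>] by simp
  thus "\<exists>\<sigma>. approximates B X V (%x. g (a x)) \<sigma> & simple_int B X \<sigma> \<mu> \<ominus>\<^bsub>B\<^esub> g (integral_wrt L A X a \<mu>) \<in> V"
   using ap by blast
 qed (use gD a I in auto)
qed

text \<open>The identity of \<open>P\<close> lifts through the free module on the carrier of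
  \<open>P\<close>, which gives a section \<open>s\<close>; on the free module a lift is the
  integral of any pointwise choice of preimages. Asking for an inclusion of images lets maps be
  lifted into cycles without making the cycles a module of their own.\<close>

theorem projective_module_lift:
 fixes L :: "('l, 'x) top_ring_scheme" and P :: "('l, 'p) top_module"
 assumes L: "profinite_ring L" and P: "projective_module L P" and A: "profinite_module L A" and B: "profinite_module L B"
  and f: "f \<in> cont_hom L P B" and g: "g \<in> cont_hom L A B" and fg: "f ` carrier P \<subseteq> g ` carrier A"
 obtains h where "h \<in> cont_hom L P A" "!!x. x \<in> carrier P ==> g (h x) = f x"
proof -
 interpret L: prof_ring L by (rule prof_ring.intro[OF L])
 have Pp: "profinite_module L P" using P by (simp add: projective_module_def)
 interpret P: prof_module L P by (rule prof_module.intro[OF Pp])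
 interpret A: prof_module L A by (rule prof_module.intro[OF A])
 let ?X = "carrier P" and ?F = "free_module L (carrier P)"
 let ?\<epsilon> = "integral_wrt L P ?X (%x. x)"
 have \<epsilon>: "?\<epsilon> \<in> cont_hom L ?F P" by (rule P.integral_wrt_cont_hom[OF L])
 have "x \<in> ?\<epsilon> ` carrier ?F" if x: "x \<in> carrier P" for x
 proof -
  obtain \<delta> where "\<delta> \<in> fin_measures L ?X" "?\<epsilon> \<delta> = x"
   using P.integral_wrt_dirac[OF L, of ?X "%x. x" x] x by blast
  thus ?thesis by (intro image_eqI[of _ _ \<delta>]) auto
 qed
 hence "?\<epsilon> ` carrier ?F = carrier P" using cont_homD(1)[OF \<epsilon>] by auto
 hence "\<exists>h\<in>cont_hom L P ?F. \<forall>x\<in>carrier P. ?\<epsilon> (h x) = x"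
  using \<epsilon> Pp L.free_module_profinite[of ?X] cont_hom_id[of L P]
  by (intro P[unfolded projective_module_def, THEN conjunct2, rule_format, of ?F P ?\<epsilon> "%x. x"] conjI)
 then obtain s where s: "s \<in> cont_hom L P ?F" "!!x. x \<in> carrier P ==> ?\<epsilon> (s x) = x" by blast
 \<comment> \<open>The preimages \<open>a x\<close> are chosen pointwise, with no coherence among
   them; integration against the measure \<open>s x\<close> supplies linearity and
   continuity.\<close>
 have "\<forall>x\<in>carrier P. \<exists>y\<in>carrier A. g y = f x" using fg by (force simp: image_iff subset_iff)
 then obtain a where a: "!!x. x \<in> carrier P ==> a x \<in> carrier A" "!!x. x \<in> carrier P ==> g (a x) = f x" by metis
 interpret B: prof_module L B by (rule prof_module.intro[OF B])
 let ?h = "%x. integral_wrt L A ?X a (s x)"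
 have "?h \<in> cont_hom L P A" using cont_hom_compose[OF s(1) A.integral_wrt_cont_hom[OF L a(1)]] .
 moreover have "g (?h x) = f x" if x: "x \<in> carrier P" for x
 proof -
  have m: "s x \<in> fin_measures L ?X" using cont_homD(1)[OF s(1) x] by simp
  have "g (?h x) = integral_wrt L B ?X (%x. g (a x)) (s x)" using integral_wrt_hom[OF L A B g m a(1)] by simp
  also have "... = integral_wrt L B ?X (%x. f x) (s x)" using a cont_homD(1)[OF f] by (intro B.integral_wrt_cong[OF L m]) auto
  also have "... = f (?\<epsilon> (s x))" using integral_wrt_hom[OF L Pp B f m, of "%x. x"] by simp
  finally show ?thesis using s(2)[OF x] by simp
 qed
 ultimately show ?thesis using that by blast
qed

section \<open>Comparison of projective resolutions\<close>

text \<open>Exactness then reads the same in every degree, with the augmentation in the place of the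
  missing differential at 0.\<close>

definition res_cycles ::
  "(nat => ('l, 'p) top_module) => (nat => 'p => 'p) => ('p => 'k) => ('l, 'k) top_module => nat => 'p set" where
 "res_cycles P d e K j =
   (case j of 0 => ker_set (P 0) K e | Suc i => ker_set (P (Suc i)) (P i) (d i))"

lemma projective_resolution_uptoD:
 assumes "projective_resolution_upto n L P d e K"
 shows "!!j. j \<le> n ==> projective_module L (P j)" "!!j. j \<le> n ==> profinite_module L (P j)"
  "!!j. j < n ==> d j \<in> cont_hom L (P (Suc j)) (P j)" "e \<in> cont_hom L (P 0) K"
  "e ` carrier (P 0) = carrier K" "!!j. j < n ==> d j ` carrier (P (Suc j)) = res_cycles P d e K j"
proof -
 show "d j ` carrier (P (Suc j)) = res_cycles P d e K j" if "j < n" for j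
  using assms that by (cases j) (auto simp: projective_resolution_upto_def res_cycles_def)
qed (use assms in \<open>auto simp: projective_resolution_upto_def projective_module_def\<close>)

lemma projective_resolution_upto_mono:
 "projective_resolution_upto n L P d e K ==> m \<le> n ==> projective_resolution_upto m L P d e K"
 by (auto simp: projective_resolution_upto_def)

lemma res_cycles_Suc: "x \<in> res_cycles P d e K (Suc j) \<longleftrightarrow> x \<in> carrier (P (Suc j)) & d j x = \<zero>\<^bsub>P j\<^esub>"
 by (simp add: res_cycles_def ker_set_def)

lemma res_cycles_0: "x \<in> res_cycles P d e K 0 \<longleftrightarrow> x \<in> carrier (P 0) & e x = \<zero>\<^bsub>K\<^esub>"
 by (simp add: res_cycles_def ker_set_def)

definition comparison_map ::
  "nat => ('l, 'x) ring_scheme => (nat => ('l, 'c) top_module) => (nat => 'c => 'c) => ('c => 'k)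
   => (nat => ('l, 'd) top_module) => (nat => 'd => 'd) => ('d => 'k) => (nat => 'c => 'd) => bool" where
 "comparison_map n L C c eC D d eD u \<longleftrightarrow>
   (\<forall>j\<le>n. u j \<in> cont_hom L (C j) (D j)) & (\<forall>x\<in>carrier (C 0). eD (u 0 x) = eC x) &
   (\<forall>j<n. \<forall>x\<in>carrier (C (Suc j)). d j (u (Suc j) x) = u j (c j x))"

lemma comparison_mapD:
 assumes "comparison_map n L C c eC D d eD u"
 shows "j \<le> n ==> u j \<in> cont_hom L (C j) (D j)" "x \<in> carrier (C 0) ==> eD (u 0 x) = eC x"
  "j < n ==> x \<in> carrier (C (Suc j)) ==> d j (u (Suc j) x) = u j (c j x)" using assms by (auto simp: comparison_map_def)

lemma comparison_map_mono: "comparison_map n L C c eC D d eD u ==> m \<le> n ==> comparison_map m L C c eC D d eD u"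
 by (auto simp: comparison_map_def)

lemma ex_comparison_map:
 fixes L :: "('l, 'x) top_ring_scheme" and C :: "nat => ('l, 'c) top_module" and D :: "nat => ('l, 'd) top_module"
 assumes L: "profinite_ring L" and K: "profinite_module L K"
  and C: "projective_resolution_upto n L C c eC K" and D: "projective_resolution_upto n L D d eD K"
 shows "\<exists>u. comparison_map n L C c eC D d eD u"
proof -
 note CD = projective_resolution_uptoD[OF C] and DD = projective_resolution_uptoD[OF D]
 \<comment> \<open>The recursion produces an infinite sequence, so its conditions are made vacuous
   above \<open>n\<close>. That cycles go to cycles is carried along because it is the inclusion of
   images needed for the next lift.\<close>
 let ?P = "%j f. j \<le> n --> f \<in> cont_hom L (C j) (D j) &
  f ` res_cycles C c eC K j \<subseteq> res_cycles D d eD K j & (j = 0 --> (\<forall>x\<in>carrier (C 0). eD (f x) = eC x))"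
 let ?Q = "%j f g. Suc j \<le> n --> (\<forall>x\<in>carrier (C (Suc j)). d j (g x) = f (c j x))"
 have "\<exists>f. \<forall>j. ?P j (f j) & ?Q j (f j) (f (Suc j))"
 proof (rule dependent_nat_choice)
  have "eC ` carrier (C 0) \<subseteq> eD ` carrier (D 0)" using CD(5) DD(5) by simp
  from projective_module_lift[OF L CD(1)[OF le0] DD(2)[OF le0] K CD(4) DD(4) this]
  obtain h where h: "h \<in> cont_hom L (C 0) (D 0)" "!!x. x \<in> carrier (C 0) ==> eD (h x) = eC x" by blast
  hence "?P 0 h" using cont_homD(1)[OF h(1)] by (auto simp: res_cycles_0)
  thus "\<exists>f. ?P 0 f" by blast
 next
  fix f j assume f: "?P j f"
  show "\<exists>g. ?P (Suc j) g & ?Q j f g"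
  proof (cases "Suc j \<le> n")
   case True
   hence fh: "f \<in> cont_hom L (C j) (D j)" and fc: "f ` res_cycles C c eC K j \<subseteq> res_cycles D d eD K j"
    and jn: "j < n" "j \<le> n" using f by auto
   have im: "(%x. f (c j x)) ` carrier (C (Suc j)) \<subseteq> d j ` carrier (D (Suc j))"
    using fc CD(6)[OF jn(1)] DD(6)[OF jn(1)] by auto
   from projective_module_lift[OF L CD(1)[OF True] DD(2)[OF True] DD(2)[OF jn(2)]
     cont_hom_compose[OF CD(3)[OF jn(1)] fh] DD(3)[OF jn(1)] im]
   obtain g where g: "g \<in> cont_hom L (C (Suc j)) (D (Suc j))"
    "!!x. x \<in> carrier (C (Suc j)) ==> d j (g x) = f (c j x)" by blast
   have "?P (Suc j) g" using g cont_homD(1)[OF g(1)] cont_hom_0[OF CD(2)[OF jn(2)] DD(2)[OF jn(2)] fh]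
    by (auto simp: res_cycles_Suc)
   thus ?thesis using g(2) by blast
  qed simp
 qed
 then obtain u where u': "\<forall>j. ?P j (u j) & ?Q j (u j) (u (Suc j))" by (rule exE)
 have u: "?P j (u j)" "?Q j (u j) (u (Suc j))" for j by (rule conjunct1[OF u'[THEN spec, of j]], rule conjunct2[OF u'[THEN spec, of j]])
 have "comparison_map n L C c eC D d eD u" unfolding comparison_map_def
 proof (intro conjI allI impI ballI)
  show "u j \<in> cont_hom L (C j) (D j)" if "j \<le> n" for j using u(1)[of j] that by simp
  show "eD (u 0 x) = eC x" if "x \<in> carrier (C 0)" for x using u(1)[of 0] that by simp
  show "d j (u (Suc j) x) = u j (c j x)" if "j < n" "x \<in> carrier (C (Suc j))" for j x using u(2)[of j] that by simp
 qed
 thus ?thesis by (rule exI[of _ u])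
qed

text \<open>The usual homotopy w = c h + s c is built upwards, but only its top degree is kept, with
  \<open>r\<close> standing for s c. What matters afterwards is that \<open>r\<close> factors
  through the differential, so that it vanishes on cycles even after tensoring.\<close>

lemma null_homotopy:
 fixes L :: "('l, 'x) top_ring_scheme" and C :: "nat => ('l, 'c) top_module"
 assumes L: "profinite_ring L" and K: "profinite_module L K" and C: "projective_resolution_upto (Suc n) L C c e K"
  and w: "!!j. j \<le> n ==> w j \<in> cont_hom L (C j) (C j)"
  and w0: "!!x. x \<in> carrier (C 0) ==> e (w 0 x) = \<zero>\<^bsub>K\<^esub>"
  and wc: "!!j x. j < n ==> x \<in> carrier (C (Suc j)) ==> c j (w (Suc j) x) = w j (c j x)"
 shows "\<exists>h r. h \<in> cont_hom L (C n) (C (Suc n)) & r \<in> cont_hom L (C n) (C n) &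
  (\<forall>x\<in>carrier (C n). w n x = c n (h x) \<oplus>\<^bsub>C n\<^esub> r x) &
  (case n of 0 => \<forall>x\<in>carrier (C 0). r x = \<zero>\<^bsub>C 0\<^esub>
    | Suc m => \<exists>s\<in>cont_hom L (C m) (C n). \<forall>x\<in>carrier (C n). r x = s (c m x))" using C w wc
proof (induction n)
 case 0
 note CD = projective_resolution_uptoD[OF 0(1)]
 interpret C0: prof_module L "C 0" using CD(2) by (simp add: prof_module_def)
 have w0h: "w 0 \<in> cont_hom L (C 0) (C 0)" using 0 by simp
 have "w 0 ` carrier (C 0) \<subseteq> c 0 ` carrier (C (Suc 0))"
  using CD(6)[of 0] w0 cont_homD(1)[OF w0h] by (auto simp: res_cycles_0)
 from projective_module_lift[OF L CD(1) CD(2) CD(2) w0h CD(3) this]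
 obtain h where h: "h \<in> cont_hom L (C 0) (C (Suc 0))" "!!x. x \<in> carrier (C 0) ==> c 0 (h x) = w 0 x" by auto
 have "w 0 x = c 0 (h x) \<oplus>\<^bsub>C 0\<^esub> \<zero>\<^bsub>C 0\<^esub>" if "x \<in> carrier (C 0)" for x
  using h(2)[OF that] cont_homD(1)[OF w0h that] by simp
 thus ?case using h(1) cont_hom_zero[OF CD(2)[of 0], of "C 0"]
  by (intro exI[of _ h] exI[of _ "%x. \<zero>\<^bsub>C 0\<^esub>"]) auto
next
 case (Suc n)
 note CD = projective_resolution_uptoD[OF Suc.prems(1)]
 have "projective_resolution_upto (Suc n) L C c e K" by (rule projective_resolution_upto_mono[OF Suc.prems(1)]) simp
 from Suc.IH[OF this] Suc.prems obtain h r where h: "h \<in> cont_hom L (C n) (C (Suc n))"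
  and r: "r \<in> cont_hom L (C n) (C n)" "!!x. x \<in> carrier (C n) ==> w n x = c n (h x) \<oplus>\<^bsub>C n\<^esub> r x"
   "case n of 0 => \<forall>x\<in>carrier (C 0). r x = \<zero>\<^bsub>C 0\<^esub>
    | Suc m => \<exists>s\<in>cont_hom L (C m) (C n). \<forall>x\<in>carrier (C n). r x = s (c m x)"
  by (auto simp: less_Suc_eq_le)
 have M: "profinite_module L (C n)" "profinite_module L (C (Suc n))" "profinite_module L (C (Suc (Suc n)))" using CD(2) by auto
 interpret C: prof_module L "C n" using M(1) by (simp add: prof_module_def)
 interpret C': prof_module L "C (Suc n)" using M(2) by (simp add: prof_module_def)
 have cn: "c n \<in> cont_hom L (C (Suc n)) (C n)" and cn': "c (Suc n) \<in> cont_hom L (C (Suc (Suc n))) (C (Suc n))"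
  using CD(3) by auto
 have wn: "w (Suc n) \<in> cont_hom L (C (Suc n)) (C (Suc n))" using Suc.prems by simp
 \<comment> \<open>\<open>r\<close> kills boundaries, since it is zero or factors through the
   differential \<open>c m\<close>.\<close>
 have rc: "r (c n x) = \<zero>\<^bsub>C n\<^esub>" if x: "x \<in> carrier (C (Suc n))" for x
 proof (cases n)
  case 0 thus ?thesis using r(3) cont_homD(1)[OF cn x] by simp
 next
  case (Suc m)
  then obtain s where s: "s \<in> cont_hom L (C m) (C n)" "\<forall>x\<in>carrier (C n). r x = s (c m x)" using r(3) by auto
  have "c n x \<in> res_cycles C c e K n" using CD(6)[of n] x by auto
  hence "c m (c n x) = \<zero>\<^bsub>C m\<^esub>" using Suc by (simp add: res_cycles_Suc)
  thus ?thesis using s(2) cont_homD(1)[OF cn x] cont_hom_0[OF CD(2)[of m] M(1) s(1)] Suc by simp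
 qed
 let ?s = "%x. h (c n x)"
 have sh: "?s \<in> cont_hom L (C (Suc n)) (C (Suc n))" by (rule cont_hom_compose[OF cn h])
 \<comment> \<open>Subtracting the previous homotopy composed with the differential makes the map
   land in the cycles, so that it lifts through \<open>c (Suc n)\<close>. The subtracted term
   \<open>?s\<close> is the new \<open>r\<close>.\<close>
 let ?g = "%x. w (Suc n) x \<oplus>\<^bsub>C (Suc n)\<^esub> \<ominus>\<^bsub>C (Suc n)\<^esub> ?s x"
 have gh: "?g \<in> cont_hom L (C (Suc n)) (C (Suc n))" by (intro cont_hom_add cont_hom_uminus sh wn M)
 have "c n (?g x) = \<zero>\<^bsub>C n\<^esub>" if x: "x \<in> carrier (C (Suc n))" for x
 proof -
  note y = cont_homD(1)[OF cn x]
  have chy: "c n (h (c n x)) \<in> carrier (C n)" using cont_homD(1)[OF cn] cont_homD(1)[OF h y] by simp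
  have "c n (?g x) = c n (w (Suc n) x) \<oplus>\<^bsub>C n\<^esub> \<ominus>\<^bsub>C n\<^esub> c n (?s x)"
   using cont_homD(3)[OF cn] cont_homD(1)[OF wn x] cont_homD(1)[OF sh x] cont_hom_minus(1)[OF M(2,1) cn] by simp
  also have "... = w n (c n x) \<oplus>\<^bsub>C n\<^esub> \<ominus>\<^bsub>C n\<^esub> c n (?s x)" using Suc.prems(3)[of n x] x by simp
  also have "... = \<zero>\<^bsub>C n\<^esub>" using r(2)[OF y] rc[OF x] chy by (simp add: C.M.r_neg)
  finally show ?thesis .
 qed
 hence "?g ` carrier (C (Suc n)) \<subseteq> c (Suc n) ` carrier (C (Suc (Suc n)))"
  using CD(6)[of "Suc n"] cont_homD(1)[OF gh] by (auto simp: res_cycles_Suc)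
 from projective_module_lift[OF L CD(1) M(3) M(2) gh cn' this]
 obtain h' where h': "h' \<in> cont_hom L (C (Suc n)) (C (Suc (Suc n)))"
  "!!x. x \<in> carrier (C (Suc n)) ==> c (Suc n) (h' x) = ?g x" by auto
 have "w (Suc n) x = c (Suc n) (h' x) \<oplus>\<^bsub>C (Suc n)\<^esub> ?s x" if x: "x \<in> carrier (C (Suc n))" for x
  using h'(2)[OF x] cont_homD(1)[OF wn x] cont_homD(1)[OF sh x] by (simp add: C'.M.a_assoc C'.M.l_neg)
 thus ?case using h' sh h by (intro exI[of _ h'] exI[of _ ?s]) auto
qed

text \<open>This is \<open>null_homotopy\<close> for v u - 1. The homotopy lands in degree
  \<open>Suc n\<close> of \<open>C\<close>, while \<open>D\<close> is resolved up to
  \<open>n\<close> only; a truncated resolution, about whose last kernel nothing is known, can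
  therefore stand for \<open>D\<close>.\<close>

lemma comparison_map_homotopy:
 fixes L :: "('l, 'x) top_ring_scheme" and C :: "nat => ('l, 'c) top_module" and D :: "nat => ('l, 'd) top_module"
 assumes L: "profinite_ring L" and K: "profinite_module L K"
  and C: "projective_resolution_upto (Suc n) L C c eC K" and D: "projective_resolution_upto n L D d eD K"
  and u': "comparison_map n L C c eC D d eD u" and v': "comparison_map n L D d eD C c eC v"
 shows "\<exists>h r. h \<in> cont_hom L (C n) (C (Suc n)) & r \<in> cont_hom L (C n) (C n) &
  (\<forall>x\<in>carrier (C n). v n (u n x) = x \<oplus>\<^bsub>C n\<^esub> (c n (h x) \<oplus>\<^bsub>C n\<^esub> r x)) &
  (case n of 0 => \<forall>x\<in>carrier (C 0). r x = \<zero>\<^bsub>C 0\<^esub>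
    | Suc m => \<exists>s\<in>cont_hom L (C m) (C n). \<forall>x\<in>carrier (C n). r x = s (c m x))"
proof -
 note u = comparison_mapD[OF u'] and v = comparison_mapD[OF v']
 note CD = projective_resolution_uptoD[OF C] and DD = projective_resolution_uptoD[OF D]
 let ?w = "%j x. v j (u j x) \<oplus>\<^bsub>C j\<^esub> \<ominus>\<^bsub>C j\<^esub> x"
 have vu: "(%x. v j (u j x)) \<in> cont_hom L (C j) (C j)" if "j \<le> n" for j using cont_hom_compose[OF u(1) v(1)] that by simp
 have w: "?w j \<in> cont_hom L (C j) (C j)" if "j \<le> n" for j
  using that CD(2)[of j] by (intro cont_hom_add vu cont_hom_uminus cont_hom_id) auto
 have w0: "eC (?w 0 x) = \<zero>\<^bsub>K\<^esub>" if x: "x \<in> carrier (C 0)" for x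
 proof -
  interpret C: prof_module L "C 0" using CD(2) by (simp add: prof_module_def)
  interpret K: prof_module L K using K by (simp add: prof_module_def)
  have ux: "u 0 x \<in> carrier (D 0)" using cont_homD(1)[OF u(1) x] by simp
  have "eC (?w 0 x) = eC (v 0 (u 0 x)) \<oplus>\<^bsub>K\<^esub> \<ominus>\<^bsub>K\<^esub> eC x"
   using cont_homD(3)[OF CD(4)] cont_homD(1)[OF vu x] x cont_hom_minus(1)[OF CD(2) K CD(4)] by simp
  thus ?thesis using v(2)[OF ux] u(2)[OF x] cont_homD(1)[OF CD(4) x] by (simp add: K.M.r_neg)
 qed
 have wc: "c j (?w (Suc j) x) = ?w j (c j x)" if j: "j < n" and x: "x \<in> carrier (C (Suc j))" for j x
 proof -
  have M: "profinite_module L (C j)" "profinite_module L (C (Suc j))" using CD(2) j by auto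
  have cj: "c j \<in> cont_hom L (C (Suc j)) (C j)" using CD(3) j by simp
  interpret C: prof_module L "C (Suc j)" using M by (simp add: prof_module_def)
  have ux: "u (Suc j) x \<in> carrier (D (Suc j))" using cont_homD(1)[OF u(1) x] j by simp
  have "v (Suc j) (u (Suc j) x) \<in> carrier (C (Suc j))" using cont_homD(1)[OF vu x] j by simp
  hence "c j (?w (Suc j) x) = c j (v (Suc j) (u (Suc j) x)) \<oplus>\<^bsub>C j\<^esub> \<ominus>\<^bsub>C j\<^esub> c j x"
   using cont_homD(3)[OF cj] x cont_hom_minus(1)[OF M(2,1) cj] by simp
  thus ?thesis using v(3)[OF j ux] u(3)[OF j x] by simp
 qed
 have "\<exists>h r. h \<in> cont_hom L (C n) (C (Suc n)) & r \<in> cont_hom L (C n) (C n) &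
  (\<forall>x\<in>carrier (C n). ?w n x = c n (h x) \<oplus>\<^bsub>C n\<^esub> r x) &
  (case n of 0 => \<forall>x\<in>carrier (C 0). r x = \<zero>\<^bsub>C 0\<^esub>
    | Suc m => \<exists>s\<in>cont_hom L (C m) (C n). \<forall>x\<in>carrier (C n). r x = s (c m x))"
  by (rule null_homotopy[OF L K C, where w = ?w]) (fact w w0 wc)+
 then obtain h r where
  hr: "h \<in> cont_hom L (C n) (C (Suc n))" "r \<in> cont_hom L (C n) (C n)"
  "\<forall>x\<in>carrier (C n). ?w n x = c n (h x) \<oplus>\<^bsub>C n\<^esub> r x"
  "case n of 0 => \<forall>x\<in>carrier (C 0). r x = \<zero>\<^bsub>C 0\<^esub>
    | Suc m => \<exists>s\<in>cont_hom L (C m) (C n). \<forall>x\<in>carrier (C n). r x = s (c m x)" by (elim exE conjE)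
 interpret C: prof_module L "C n" using CD(2) by (simp add: prof_module_def)
 have "v n (u n x) = x \<oplus>\<^bsub>C n\<^esub> (c n (h x) \<oplus>\<^bsub>C n\<^esub> r x)" if x: "x \<in> carrier (C n)" for x
  unfolding hr(3)[rule_format, OF x, symmetric] using cont_homD(1)[OF vu x] x
  by (simp add: C.M.a_comm[of "v n (u n x)"] C.M.r_neg2)
 thus ?thesis using hr by blast
qed

section \<open>Quotient modules and tensor products\<close>

text \<open>The homomorphisms of bare modules, meant for the quotients \<open>quot_module\<close>,
  which carry no topology.\<close>

definition mod_hom ::
  "('l, 'x) ring_scheme => ('l, 'm, 'y) module_scheme => ('l, 'n, 'z) module_scheme => ('m => 'n) set" where
 "mod_hom L M N =
   {f. f \<in> carrier M \<rightarrow> carrier N &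
     (\<forall>x\<in>carrier M. \<forall>y\<in>carrier M. f (x \<oplus>\<^bsub>M\<^esub> y) = f x \<oplus>\<^bsub>N\<^esub> f y) &
     (\<forall>a\<in>carrier L. \<forall>x\<in>carrier M. f (a \<odot>\<^bsub>M\<^esub> x) = a \<odot>\<^bsub>N\<^esub> f x)}"

lemma mod_homD:
 assumes "f \<in> mod_hom L M N"
 shows "!!x. x \<in> carrier M ==> f x \<in> carrier N"
  "!!x y. x \<in> carrier M ==> y \<in> carrier M ==> f (x \<oplus>\<^bsub>M\<^esub> y) = f x \<oplus>\<^bsub>N\<^esub> f y"
  "!!a x. a \<in> carrier L ==> x \<in> carrier M ==> f (a \<odot>\<^bsub>M\<^esub> x) = a \<odot>\<^bsub>N\<^esub> f x"
 using assms by (auto simp: mod_hom_def)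

lemma cont_hom_mod_hom: "f \<in> cont_hom L M N ==> f \<in> mod_hom L M N" by (auto simp: cont_hom_def mod_hom_def)

lemma quot_module_sel [simp]:
 "carrier (quot_module M N) = a_rcosets\<^bsub>M\<^esub> N" "\<zero>\<^bsub>quot_module M N\<^esub> = N"
 "X \<oplus>\<^bsub>quot_module M N\<^esub> Y = X <+>\<^bsub>M\<^esub> Y"
 "a \<odot>\<^bsub>quot_module M N\<^esub> X = (\<Union>x\<in>X. N +>\<^bsub>M\<^esub> (a \<odot>\<^bsub>M\<^esub> x))"
 by (simp_all add: quot_module_def)

lemma quot_carrierE:
 assumes "X \<in> carrier (quot_module M N)" obtains a where "a \<in> carrier M" "X = N +>\<^bsub>M\<^esub> a"
 using assms by (auto simp: A_RCOSETS_def')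

context left_module
begin

lemma coset_in_quot: "a \<in> carrier M ==> U +> a \<in> carrier (quot_module M U)" by (auto simp: A_RCOSETS_def')

text \<open>The unions in the definitions of \<open>quot_module\<close> and \<open>coset_map\<close>
  collapse to a single coset, because \<open>f\<close> is constant on a coset of \<open>U\<close>
  modulo \<open>V\<close>.\<close>

lemma coset_map_coset:
 assumes U: "submodule U R M" and a: "a \<in> carrier M" and "left_module R N" "submodule V R N"
  and f: "!!x. x \<in> carrier M ==> f x \<in> carrier N"
   "!!x y. x \<in> carrier M ==> y \<in> carrier M ==> f (x \<oplus> y) = f x \<oplus>\<^bsub>N\<^esub> f y"
  and fU: "f ` U \<subseteq> V"
 shows "(\<Union>x\<in>U +> a. V +>\<^bsub>N\<^esub> f x) = V +>\<^bsub>N\<^esub> f a"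
proof -
 interpret N: left_module R N by fact
 have "V +>\<^bsub>N\<^esub> f x = V +>\<^bsub>N\<^esub> f a" if x: "x \<in> U +> a" for x
 proof -
  obtain u where u: "u \<in> U" "x = u \<oplus> a" using x by (auto simp: a_r_coset_def')
  have uc: "u \<in> carrier M" using u submod_subset[OF U] by auto
  have "f x \<ominus>\<^bsub>N\<^esub> f a = f u" using u uc a f by (simp add: N.M.minus_eq N.M.a_assoc N.M.r_neg)
  hence "f x \<ominus>\<^bsub>N\<^esub> f a \<in> V" using fU u by auto
  thus ?thesis using N.coset_eq_iff[OF assms(4)] f(1) uc u a by auto
 qed
 moreover have "a \<in> U +> a" using mem_coset_iff[OF U a a] submod_zero[OF U] a by (simp add: M.minus_eq M.r_neg)
 ultimately show ?thesis by blast
qed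

lemma coset_add:
 assumes U: "submodule U R M" and "a \<in> carrier M" "b \<in> carrier M"
 shows "(U +> a) <+>\<^bsub>M\<^esub> (U +> b) = U +> (a \<oplus> b)"
proof -
 interpret U: abelian_subgroup U M using U by (rule submod_abelian_subgroup)
 show ?thesis by (rule U.a_rcos_sum[OF assms(2,3)])
qed

lemma coset_smult:
 assumes U: "submodule U R M" and a: "a \<in> carrier M" and l: "l \<in> carrier R"
 shows "(\<Union>x\<in>U +> a. U +> (l \<odot> x)) = U +> (l \<odot> a)"
 using l by (intro coset_map_coset[OF U a left_module_axioms U])
  (auto simp: smult_closed smult_r_distr submod_smult[OF U])

lemma coset_zero: "submodule U R M ==> U +> \<zero> = U" using submod_subset by (intro M.a_coset_add_zero) auto

lemma coset_self: "submodule U R M ==> a \<in> carrier M ==> a \<in> U +> a"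
 using mem_coset_iff[of U a a] submod_zero by (simp add: M.minus_eq M.r_neg)

lemma coset_eq_self: "submodule U R M ==> a \<in> carrier M ==> U +> a = U \<longleftrightarrow> a \<in> U"
 using coset_eq_iff[of U a "\<zero>"] M.minus_equality[of "\<zero>" "\<zero>"] by (simp add: coset_zero M.minus_eq)

lemma quot_left_module:
 assumes U: "submodule U R M" shows "left_module R (quot_module M U)"
proof -
 let ?Q = "quot_module M U"
 note c = coset_add[OF U] coset_smult[OF U]
 have z: "U = U +> \<zero>" using coset_zero[OF U] by simp
 have "abelian_group ?Q"
 proof (rule abelian_groupI)
  fix X Y assume X: "X \<in> carrier ?Q" and Y: "Y \<in> carrier ?Q"
  then obtain a b where ab: "a \<in> carrier M" "X = U +> a" "b \<in> carrier M" "Y = U +> b" by (metis quot_carrierE)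
  show "X \<oplus>\<^bsub>?Q\<^esub> Y \<in> carrier ?Q" using ab coset_in_quot[of "a \<oplus> b" U] by (simp add: c)
  show "X \<oplus>\<^bsub>?Q\<^esub> Y = Y \<oplus>\<^bsub>?Q\<^esub> X" using ab by (simp add: c M.a_comm)
  fix Z assume "Z \<in> carrier ?Q"
  then obtain d where "d \<in> carrier M" "Z = U +> d" by (metis quot_carrierE)
  thus "X \<oplus>\<^bsub>?Q\<^esub> Y \<oplus>\<^bsub>?Q\<^esub> Z = X \<oplus>\<^bsub>?Q\<^esub> (Y \<oplus>\<^bsub>?Q\<^esub> Z)" using ab by (simp add: c M.a_assoc)
 next
  show "\<zero>\<^bsub>?Q\<^esub> \<in> carrier ?Q" using coset_in_quot[of "\<zero>" U] z by simp
  fix X assume "X \<in> carrier ?Q"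
  then obtain a where a: "a \<in> carrier M" "X = U +> a" by (metis quot_carrierE)
  have "\<zero>\<^bsub>?Q\<^esub> \<oplus>\<^bsub>?Q\<^esub> X = (U +> \<zero>) <+>\<^bsub>M\<^esub> X" using z by simp
  thus "\<zero>\<^bsub>?Q\<^esub> \<oplus>\<^bsub>?Q\<^esub> X = X" using a by (simp add: c)
  have "(U +> (\<ominus> a)) \<oplus>\<^bsub>?Q\<^esub> X = \<zero>\<^bsub>?Q\<^esub>" using a z by (simp add: c M.l_neg)
  moreover have "U +> (\<ominus> a) \<in> carrier ?Q" using a by (intro coset_in_quot) simp
  ultimately show "\<exists>Y\<in>carrier ?Q. Y \<oplus>\<^bsub>?Q\<^esub> X = \<zero>\<^bsub>?Q\<^esub>" by blast
 qed
 moreover have "left_module_axioms R ?Q"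
 proof (rule left_module_axioms.intro)
  fix l k X assume l: "l \<in> carrier R" and X: "X \<in> carrier ?Q"
  then obtain a where a: "a \<in> carrier M" "X = U +> a" by (metis quot_carrierE)
  note s = a l smult_closed
  show "l \<odot>\<^bsub>?Q\<^esub> X \<in> carrier ?Q" using s coset_in_quot[of "l \<odot> a" U] by (simp add: c)
  show "(l \<oplus>\<^bsub>R\<^esub> k) \<odot>\<^bsub>?Q\<^esub> X = l \<odot>\<^bsub>?Q\<^esub> X \<oplus>\<^bsub>?Q\<^esub> k \<odot>\<^bsub>?Q\<^esub> X" if "k \<in> carrier R"
   using s that by (simp add: c smult_l_distr)
  show "(l \<otimes>\<^bsub>R\<^esub> k) \<odot>\<^bsub>?Q\<^esub> X = l \<odot>\<^bsub>?Q\<^esub> (k \<odot>\<^bsub>?Q\<^esub> X)" if "k \<in> carrier R"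
   using s that by (simp add: c smult_assoc1)
  fix Y assume "Y \<in> carrier ?Q"
  then obtain b where b: "b \<in> carrier M" "Y = U +> b" by (metis quot_carrierE)
  show "l \<odot>\<^bsub>?Q\<^esub> (X \<oplus>\<^bsub>?Q\<^esub> Y) = l \<odot>\<^bsub>?Q\<^esub> X \<oplus>\<^bsub>?Q\<^esub> l \<odot>\<^bsub>?Q\<^esub> Y"
   using s b by (simp add: c smult_r_distr)
 next
  fix X assume "X \<in> carrier ?Q"
  then obtain a where a: "a \<in> carrier M" "X = U +> a" by (metis quot_carrierE)
  thus "\<one>\<^bsub>R\<^esub> \<odot>\<^bsub>?Q\<^esub> X = X" by (simp add: c smult_one)
 qed
 ultimately show ?thesis by (intro left_module.intro R.ring_axioms)
qed

end

definition frag_pair :: "('c => 'a) => ('d => 'b) => ('c \<times> 'd \<Rightarrow>\<^sub>0 int) => ('a \<times> 'b \<Rightarrow>\<^sub>0 int)" where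
 "frag_pair f g = frag_extend (\<lambda>(c, d). frag_of (f c, g d))"

lemma frag_pair_simps [simp]:
 "frag_pair f g 0 = 0" "frag_pair f g (frag_of (a, b)) = frag_of (f a, g b)"
 "frag_pair f g (c + c') = frag_pair f g c + frag_pair f g c'" "frag_pair f g (c - c') = frag_pair f g c - frag_pair f g c'"
 "frag_pair f g (- c) = - frag_pair f g c" by (simp_all add: frag_pair_def frag_extend_add frag_extend_diff frag_extend_minus)

lemma keys_frag_pair: "Poly_Mapping.keys (frag_pair f g c) \<subseteq> (\<lambda>(a, b). (f a, g b)) ` Poly_Mapping.keys c"
 using keys_frag_extend[of "\<lambda>(c, d). frag_of (f c, g d)" c] by (fastforce simp: frag_pair_def)

lemma keys_frag_pair_subset:
 assumes "Poly_Mapping.keys c \<subseteq> A \<times> B" "f \<in> A \<rightarrow> A'" "g \<in> B \<rightarrow> B'"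
 shows "Poly_Mapping.keys (frag_pair f g c) \<subseteq> A' \<times> B'" using keys_frag_pair[of f g c] assms by fastforce

lemma frag_pair_cong:
 assumes "Poly_Mapping.keys c \<subseteq> A \<times> B" "!!a. a \<in> A ==> f a = f' a" "!!b. b \<in> B ==> g b = g' b"
 shows "frag_pair f g c = frag_pair f' g' c" unfolding frag_pair_def using assms by (intro frag_extend_eq) auto

lemma frag_pair_compose:
 fixes c :: "'e \<times> 'f \<Rightarrow>\<^sub>0 int"
 shows "frag_pair f' g' (frag_pair f g c) = frag_pair (%a. f' (f a)) (%b. g' (g b)) c"
proof (rule frag_induction[of c UNIV])
 fix x :: "'e \<times> 'f" show "frag_pair f' g' (frag_pair f g (frag_of x)) = frag_pair (%a. f' (f a)) (%b. g' (g b)) (frag_of x)"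
  by (cases x) simp
qed auto

definition tens ::
  "('l, 'x) ring_scheme => ('l => 'l) => ('l, 'a, 'y) module_scheme => ('l, 'b, 'z) module_scheme
   => ('a \<times> 'b \<Rightarrow>\<^sub>0 int) => ('a \<times> 'b \<Rightarrow>\<^sub>0 int) set" where
 "tens L \<sigma> A B c = tensor_rel L \<sigma> A B #>\<^bsub>free_Abelian_group (carrier A \<times> carrier B)\<^esub> c"

locale tensor_prod = A: left_module L A + B: left_module L B
 for L :: "('l, 'x) ring_scheme" and A :: "('l, 'a, 'y) module_scheme" and B :: "('l, 'b, 'z) module_scheme" +
 fixes \<sigma> :: "'l => 'l"
 assumes \<sigma>: "\<sigma> \<in> carrier L \<rightarrow> carrier L"
begin

abbreviation "F \<equiv> free_Abelian_group (carrier A \<times> carrier B)"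
abbreviation "Rel \<equiv> tensor_rel L \<sigma> A B"
abbreviation "T \<equiv> tensor L \<sigma> A B"
abbreviation "cl \<equiv> tens L \<sigma> A B"
abbreviation "keysF c \<equiv> Poly_Mapping.keys c \<subseteq> carrier A \<times> carrier B"

text \<open>The relators inside \<open>tensor_rel\<close> receive a name so that their three kinds
  can be told apart by \<open>gens_cases\<close>.\<close>

definition gens :: "('a \<times> 'b \<Rightarrow>\<^sub>0 int) set" where
 "gens = {frag_of (a \<oplus>\<^bsub>A\<^esub> a', b) - frag_of (a, b) - frag_of (a', b) |a a' b.
      a \<in> carrier A & a' \<in> carrier A & b \<in> carrier B} \<union>
    {frag_of (a, b \<oplus>\<^bsub>B\<^esub> b') - frag_of (a, b) - frag_of (a, b') |a b b'.
      a \<in> carrier A & b \<in> carrier B & b' \<in> carrier B} \<union>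
    {frag_of (\<sigma> l \<odot>\<^bsub>A\<^esub> a, b) - frag_of (a, l \<odot>\<^bsub>B\<^esub> b) |l a b.
      l \<in> carrier L & a \<in> carrier A & b \<in> carrier B}"

lemma Rel_eq: "Rel = generate F gens" by (simp add: tensor_rel_def gens_def)

lemma keys_diff_subset: "Poly_Mapping.keys c \<subseteq> S ==> Poly_Mapping.keys c' \<subseteq> S ==> Poly_Mapping.keys (c - c') \<subseteq> S"
 for c c' :: "'u \<Rightarrow>\<^sub>0 int" using keys_diff[of c c'] by blast

lemma keys_add_subset: "Poly_Mapping.keys c \<subseteq> S ==> Poly_Mapping.keys c' \<subseteq> S ==> Poly_Mapping.keys (c + c') \<subseteq> S"
 for c c' :: "'u \<Rightarrow>\<^sub>0 int" using keys_add[of c c'] by blast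

lemma \<sigma>_closed: "l \<in> carrier L ==> \<sigma> l \<in> carrier L" using \<sigma> by auto

lemma gens1: "a \<in> carrier A ==> a' \<in> carrier A ==> b \<in> carrier B ==>
  frag_of (a \<oplus>\<^bsub>A\<^esub> a', b) - frag_of (a, b) - frag_of (a', b) \<in> gens" unfolding gens_def by blast

lemma gens2: "a \<in> carrier A ==> b \<in> carrier B ==> b' \<in> carrier B ==>
  frag_of (a, b \<oplus>\<^bsub>B\<^esub> b') - frag_of (a, b) - frag_of (a, b') \<in> gens" unfolding gens_def by blast

lemma gens3: "l \<in> carrier L ==> a \<in> carrier A ==> b \<in> carrier B ==>
  frag_of (\<sigma> l \<odot>\<^bsub>A\<^esub> a, b) - frag_of (a, l \<odot>\<^bsub>B\<^esub> b) \<in> gens"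
 unfolding gens_def by blast

lemma gens_cases:
 assumes "c \<in> gens"
 obtains (1) a a' b where "a \<in> carrier A" "a' \<in> carrier A" "b \<in> carrier B"
   "c = frag_of (a \<oplus>\<^bsub>A\<^esub> a', b) - frag_of (a, b) - frag_of (a', b)"
  | (2) a b b' where "a \<in> carrier A" "b \<in> carrier B" "b' \<in> carrier B"
   "c = frag_of (a, b \<oplus>\<^bsub>B\<^esub> b') - frag_of (a, b) - frag_of (a, b')"
  | (3) l a b where "l \<in> carrier L" "a \<in> carrier A" "b \<in> carrier B"
   "c = frag_of (\<sigma> l \<odot>\<^bsub>A\<^esub> a, b) - frag_of (a, l \<odot>\<^bsub>B\<^esub> b)"
 using assms unfolding gens_def by (elim UnE CollectE exE conjE) (rule 1 2 3; assumption)+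

lemma gens_subset: "gens \<subseteq> carrier F"
proof
 fix c assume "c \<in> gens"
 thus "c \<in> carrier F"
 proof (cases rule: gens_cases)
  case (3 l a b)
  have "\<sigma> l \<odot>\<^bsub>A\<^esub> a \<in> carrier A" "l \<odot>\<^bsub>B\<^esub> b \<in> carrier B"
   using 3 \<sigma>_closed A.smult_closed B.smult_closed by auto
  hence "keysF c" unfolding 3(4) using 3 by (intro keys_diff_subset) auto
  thus ?thesis by simp
 next
  case (1 a a' b)
  hence "keysF c" unfolding 1(4) by (intro keys_diff_subset) auto
  thus ?thesis by simp
 next
  case (2 a b b')
  hence "keysF c" unfolding 2(4) by (intro keys_diff_subset) auto
  thus ?thesis by simp
 qed
qed

lemma F_comm: "comm_group F" by (rule abelian_free_Abelian_group)

lemma Rel_subgroup: "subgroup Rel F"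
 unfolding Rel_eq by (rule group.generate_is_subgroup[OF group_free_Abelian_group gens_subset])

lemma Rel_normal: "Rel \<lhd> F" using Rel_subgroup F_comm by (simp add: comm_group.normal_iff_subgroup)

lemma T_comm: "comm_group T" unfolding tensor_def by (rule comm_group.abelian_FactGroup[OF F_comm Rel_subgroup])

lemma T_carrier: "carrier T = cl ` {c. keysF c}" by (auto simp: tensor_def carrier_FactGroup tens_def)

lemma cl_in_T: "keysF c ==> cl c \<in> carrier T" by (auto simp: T_carrier)

lemma cl_add: "keysF c ==> keysF c' ==> cl c \<otimes>\<^bsub>T\<^esub> cl c' = cl (c + c')"
 using normal.rcos_sum[OF Rel_normal, of c c'] by (simp add: tens_def tensor_def)

lemma T_one: "\<one>\<^bsub>T\<^esub> = cl 0"
 using group.coset_mult_one[OF group_free_Abelian_group, of Rel] subgroup.subset[OF Rel_subgroup]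
 by (simp add: tens_def tensor_def)

lemma cl_eq_iff: "keysF c ==> keysF c' ==> cl c = cl c' \<longleftrightarrow> c - c' \<in> Rel"
proof -
 assume k: "keysF c" "keysF c'"
 have inF: "c \<in> carrier F" "c' \<in> carrier F" using k by auto
 have "cl c = cl c' \<longleftrightarrow> c \<in> cl c'"
  using group.repr_independence[OF group_free_Abelian_group _ inF(2) Rel_subgroup, of c]
   group.repr_independenceD[OF group_free_Abelian_group Rel_subgroup inF(1), of c'] unfolding tens_def by metis
 also have "... \<longleftrightarrow> c - c' \<in> Rel"
  using subgroup.rcos_module[OF Rel_subgroup group_free_Abelian_group inF(2,1)] k by (simp add: tens_def)
 finally show ?thesis .
qed

lemma gens_in_Rel: "c \<in> gens ==> c \<in> Rel" unfolding Rel_eq by (rule generate.incl)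

lemma Rel_keys: "c \<in> Rel ==> keysF c" using subsetD[OF subgroup.subset[OF Rel_subgroup]] by simp

lemma Rel_closed: "0 \<in> Rel" "c \<in> Rel ==> c' \<in> Rel ==> c + c' \<in> Rel" "c \<in> Rel ==> - c \<in> Rel"
 using subgroup.one_closed[OF Rel_subgroup] subgroup.m_closed[OF Rel_subgroup, of c c']
  subgroup.m_inv_closed[OF Rel_subgroup, of c] Rel_keys[of c] by auto

lemma cl_add_left:
 assumes "a \<in> carrier A" "a' \<in> carrier A" "b \<in> carrier B"
 shows "cl (frag_of (a \<oplus>\<^bsub>A\<^esub> a', b)) = cl (frag_of (a, b) + frag_of (a', b))"
proof -
 have "frag_of (a \<oplus>\<^bsub>A\<^esub> a', b) - (frag_of (a, b) + frag_of (a', b)) \<in> Rel"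
  using gens_in_Rel[OF gens1[OF assms]] by (simp add: diff_diff_eq)
 moreover have "keysF (frag_of (a, b) + frag_of (a', b))" using assms by (intro keys_add_subset) auto
 ultimately show ?thesis using assms by (subst cl_eq_iff) auto
qed

lemma cl_add_right:
 assumes "a \<in> carrier A" "b \<in> carrier B" "b' \<in> carrier B"
 shows "cl (frag_of (a, b \<oplus>\<^bsub>B\<^esub> b')) = cl (frag_of (a, b) + frag_of (a, b'))"
proof -
 have "frag_of (a, b \<oplus>\<^bsub>B\<^esub> b') - (frag_of (a, b) + frag_of (a, b')) \<in> Rel"
  using gens_in_Rel[OF gens2[OF assms]] by (simp add: diff_diff_eq)
 moreover have "keysF (frag_of (a, b) + frag_of (a, b'))" using assms by (intro keys_add_subset) auto
 ultimately show ?thesis using assms by (subst cl_eq_iff) auto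
qed

lemma cl_smult:
 assumes "a \<in> carrier A" "b \<in> carrier B" "l \<in> carrier L"
 shows "cl (frag_of (\<sigma> l \<odot>\<^bsub>A\<^esub> a, b)) = cl (frag_of (a, l \<odot>\<^bsub>B\<^esub> b))"
proof -
 have "frag_of (\<sigma> l \<odot>\<^bsub>A\<^esub> a, b) - frag_of (a, l \<odot>\<^bsub>B\<^esub> b) \<in> Rel"
  using assms by (intro gens_in_Rel gens3)
 thus ?thesis using assms \<sigma>_closed A.smult_closed B.smult_closed by (subst cl_eq_iff) auto
qed

lemma cl_zero_left: "b \<in> carrier B ==> cl (frag_of (\<zero>\<^bsub>A\<^esub>, b)) = cl 0"
proof -
 assume b: "b \<in> carrier B"
 have "frag_of (\<zero>\<^bsub>A\<^esub> \<oplus>\<^bsub>A\<^esub> \<zero>\<^bsub>A\<^esub>, b) - frag_of (\<zero>\<^bsub>A\<^esub>, b) - frag_of (\<zero>\<^bsub>A\<^esub>, b) \<in> Rel"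
  using b by (intro gens_in_Rel gens1) auto
 hence "- frag_of (\<zero>\<^bsub>A\<^esub>, b) \<in> Rel" by simp
 from Rel_closed(3)[OF this] show ?thesis using b by (subst cl_eq_iff) auto
qed

lemma cl_zero_right: "a \<in> carrier A ==> cl (frag_of (a, \<zero>\<^bsub>B\<^esub>)) = cl 0"
proof -
 assume a: "a \<in> carrier A"
 have "frag_of (a, \<zero>\<^bsub>B\<^esub> \<oplus>\<^bsub>B\<^esub> \<zero>\<^bsub>B\<^esub>) - frag_of (a, \<zero>\<^bsub>B\<^esub>) - frag_of (a, \<zero>\<^bsub>B\<^esub>) \<in> Rel"
  using a by (intro gens_in_Rel gens2) auto
 hence "- frag_of (a, \<zero>\<^bsub>B\<^esub>) \<in> Rel" by simp
 from Rel_closed(3)[OF this] show ?thesis using a by (subst cl_eq_iff) auto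
qed

text \<open>The balanced map extends to the free abelian group on pairs and sends each of the three
  kinds of relators to the identity, hence also the subgroup that they generate.\<close>

lemma tensor_universal:
 assumes G: "comm_group G" and \<beta>: "!!a b. a \<in> carrier A ==> b \<in> carrier B ==> \<beta> a b \<in> carrier G"
  and l: "!!a a' b. a \<in> carrier A ==> a' \<in> carrier A ==> b \<in> carrier B ==> \<beta> (a \<oplus>\<^bsub>A\<^esub> a') b = \<beta> a b \<otimes>\<^bsub>G\<^esub> \<beta> a' b"
  and r: "!!a b b'. a \<in> carrier A ==> b \<in> carrier B ==> b' \<in> carrier B ==> \<beta> a (b \<oplus>\<^bsub>B\<^esub> b') = \<beta> a b \<otimes>\<^bsub>G\<^esub> \<beta> a b'"
  and s: "!!l a b. l \<in> carrier L ==> a \<in> carrier A ==> b \<in> carrier B ==> \<beta> (\<sigma> l \<odot>\<^bsub>A\<^esub> a) b = \<beta> a (l \<odot>\<^bsub>B\<^esub> b)"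
 obtains h where "h \<in> hom T G" "!!a b. a \<in> carrier A ==> b \<in> carrier B ==> h (cl (frag_of (a, b))) = \<beta> a b"
proof -
 interpret G: comm_group G by fact
 have "(\<lambda>(a, b). \<beta> a b) ` (carrier A \<times> carrier B) \<subseteq> carrier G" using \<beta> by auto
 then obtain h where h: "h \<in> hom F G"
  "!!x. x \<in> carrier A \<times> carrier B ==> h (frag_of x) = (\<lambda>(a, b). \<beta> a b) x"
  using G.free_Abelian_group_universal[of "\<lambda>(a, b). \<beta> a b" "carrier A \<times> carrier B"] by blast
 have hd: "h (c - c') = h c \<otimes>\<^bsub>G\<^esub> inv\<^bsub>G\<^esub> h c'" if "keysF c" "keysF c'" for c c'
 proof -
  have "h (c - c' + c') = h (c - c') \<otimes>\<^bsub>G\<^esub> h c'"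
   using hom_mult[OF h(1), of "c - c'" c'] that keys_diff_subset[OF that] by simp
  moreover have "h (c - c') \<in> carrier G" "h c' \<in> carrier G"
   using hom_in_carrier[OF h(1)] that keys_diff_subset[OF that] by auto
  ultimately show ?thesis by (simp add: G.m_assoc)
 qed
 have hg: "h c = \<one>\<^bsub>G\<^esub>" if "c \<in> gens" for c
 proof -
  have d: "h (frag_of x - frag_of y - frag_of z) = h (frag_of x) \<otimes>\<^bsub>G\<^esub> inv\<^bsub>G\<^esub> h (frag_of y) \<otimes>\<^bsub>G\<^esub> inv\<^bsub>G\<^esub> h (frag_of z)"
   if "x \<in> carrier A \<times> carrier B" "y \<in> carrier A \<times> carrier B" "z \<in> carrier A \<times> carrier B" for x y z
  proof -
   have "keysF (frag_of x - frag_of y)" using that by (intro keys_diff_subset) auto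
   thus ?thesis using that hd[of "frag_of x - frag_of y" "frag_of z"] hd[of "frag_of x" "frag_of y"] by simp
  qed
  have cancel: "x \<otimes>\<^bsub>G\<^esub> y \<otimes>\<^bsub>G\<^esub> inv\<^bsub>G\<^esub> x \<otimes>\<^bsub>G\<^esub> inv\<^bsub>G\<^esub> y = \<one>\<^bsub>G\<^esub>" if "x \<in> carrier G" "y \<in> carrier G" for x y
  proof -
   have "x \<otimes>\<^bsub>G\<^esub> y \<otimes>\<^bsub>G\<^esub> inv\<^bsub>G\<^esub> x \<otimes>\<^bsub>G\<^esub> inv\<^bsub>G\<^esub> y = y \<otimes>\<^bsub>G\<^esub> (x \<otimes>\<^bsub>G\<^esub> inv\<^bsub>G\<^esub> x) \<otimes>\<^bsub>G\<^esub> inv\<^bsub>G\<^esub> y"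
    using that by (simp add: G.m_comm[of x y] G.m_assoc)
   thus ?thesis using that by simp
  qed
  from that show ?thesis
  proof (cases rule: gens_cases)
   case 1 thus ?thesis using d \<beta> by (simp add: h(2) l cancel)
  next
   case 2 thus ?thesis using d \<beta> by (simp add: h(2) r cancel)
  next
   case (3 l a b)
   note cc = A.smult_closed[OF \<sigma>_closed] B.smult_closed
   have "h c = h (frag_of (\<sigma> l \<odot>\<^bsub>A\<^esub> a, b)) \<otimes>\<^bsub>G\<^esub> inv\<^bsub>G\<^esub> h (frag_of (a, l \<odot>\<^bsub>B\<^esub> b))"
    using 3 cc by (simp add: hd)
   also have "... = \<beta> a (l \<odot>\<^bsub>B\<^esub> b) \<otimes>\<^bsub>G\<^esub> inv\<^bsub>G\<^esub> \<beta> a (l \<odot>\<^bsub>B\<^esub> b)"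
    using 3 cc by (simp add: h(2) s)
   finally show ?thesis using 3 cc \<beta> by simp
  qed
 qed
 have hR: "h c = \<one>\<^bsub>G\<^esub>" if "c \<in> Rel" for c using that unfolding Rel_eq
 proof (induction c rule: generate.induct)
  case one thus ?case using hom_one[OF h(1) group_free_Abelian_group G.is_group] by simp
 next
  case (incl c) thus ?case by (rule hg)
 next
  case (inv c)
  hence "keysF c" using subsetD[OF gens_subset] by simp
  thus ?case using hd[of 0 c] hg[OF inv] hom_one[OF h(1) group_free_Abelian_group G.is_group] by simp
 next
  case (eng c c')
  hence "keysF c" "keysF c'" using Rel_keys by (auto simp: Rel_eq)
  thus ?case using hom_mult[OF h(1), of c c'] eng by simp
 qed
 obtain k where k: "k \<in> hom (F Mod Rel) G" "!!x. x \<in> carrier F ==> k (Rel #>\<^bsub>F\<^esub> x) = h x"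
 proof (rule FactGroup_universal[OF h(1) Rel_normal])
  fix x y assume "x \<in> carrier F" "y \<in> carrier F" and eq: "Rel #>\<^bsub>F\<^esub> x = Rel #>\<^bsub>F\<^esub> y"
  hence xy: "keysF x" "keysF y" by auto
  hence "x - y \<in> Rel" using cl_eq_iff[OF xy] eq by (simp add: tens_def)
  hence "h x \<otimes>\<^bsub>G\<^esub> inv\<^bsub>G\<^esub> h y = \<one>\<^bsub>G\<^esub>" using hd[OF xy] hR by simp
  thus "h x = h y"
   using hom_in_carrier[OF h(1)] xy by (metis G.inv_closed G.inv_equality G.inv_inv carrier_free_Abelian_group_iff)
 qed (rule that)
 show ?thesis
 proof (rule that)
  show "k \<in> hom T G" using k(1) by (simp add: tensor_def)
  show "k (cl (frag_of (a, b))) = \<beta> a b" if "a \<in> carrier A" "b \<in> carrier B" for a b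
   using k(2)[of "frag_of (a, b)"] h(2)[of "(a, b)"] that by (simp add: tens_def)
 qed
qed

end

text \<open>Relators go to relators, so the images of all members of a class lie in one class, and
  the union in \<open>tensor_map\<close> is that class.\<close>

lemma tensor_map_cl:
 assumes "tensor_prod L A B \<sigma>" "tensor_prod L A' B' \<sigma>"
  and f: "f \<in> mod_hom L A A'" and g: "g \<in> mod_hom L B B'"
  and c: "Poly_Mapping.keys c \<subseteq> carrier A \<times> carrier B"
 shows "tensor_map L \<sigma> A' B' f g (tens L \<sigma> A B c) = tens L \<sigma> A' B' (frag_pair f g c)"
proof -
 interpret X: tensor_prod L A B \<sigma> by fact
 interpret Y: tensor_prod L A' B' \<sigma> by fact
 note fD = mod_homD[OF f] and gD = mod_homD[OF g]
 have fg: "Y.keysF (frag_pair f g c)" if "X.keysF c" for c using that fD gD by (intro keys_frag_pair_subset[OF that]) auto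
 have gen: "frag_pair f g c \<in> Y.Rel" if "c \<in> X.gens" for c using that
 proof (cases rule: X.gens_cases)
  case 1 thus ?thesis using Y.gens_in_Rel[OF Y.gens1] by (simp add: fD gD)
 next
  case 2 thus ?thesis using Y.gens_in_Rel[OF Y.gens2] by (simp add: fD gD)
 next
  case 3 thus ?thesis using Y.gens_in_Rel[OF Y.gens3] X.\<sigma>_closed by (simp add: fD gD)
 qed
 have R: "frag_pair f g c \<in> Y.Rel" if "c \<in> X.Rel" for c using that unfolding X.Rel_eq
 proof (induction c rule: generate.induct)
  case one thus ?case using Y.Rel_closed by simp
 next
  case (incl c) thus ?case by (rule gen)
 next
  case (inv c)
  hence "X.keysF c" using subsetD[OF X.gens_subset] by simp
  thus ?case using gen[OF inv] Y.Rel_closed by simp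
 next
  case (eng c c') thus ?case using Y.Rel_closed by simp
 qed
 have "tens L \<sigma> A' B' (frag_pair f g t) = tens L \<sigma> A' B' (frag_pair f g c)" if t: "t \<in> X.cl c" for t
 proof -
  obtain r where r: "r \<in> X.Rel" "t = r + c" using t by (auto simp: tens_def r_coset_def)
  hence t: "X.keysF t" using X.keys_add_subset[OF X.Rel_keys c] by simp
  show ?thesis using r R[OF r(1)] fg[OF t] fg[OF c] by (subst Y.cl_eq_iff) auto
 qed
 moreover have "c \<in> X.cl c" using c group.rcos_self[OF group_free_Abelian_group _ X.Rel_subgroup] by (simp add: tens_def)
 ultimately show ?thesis unfolding tensor_map_def tens_def[of L \<sigma> A' B', symmetric] frag_pair_def[symmetric] by blast
qed

section \<open>The completed tensor product as a functor\<close>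

text \<open>The formal sum \<open>c\<close> consists of elements of \<open>A\<close> and
  \<open>B\<close>, not of cosets, so that the same \<open>c\<close> can represent an element of the
  completed tensor product at a level \<open>(U, V)\<close> and at all coarser levels.\<close>

definition cls ::
  "('l, 'x) ring_scheme => ('l => 'l) => ('l, 'a) top_module => ('l, 'b) top_module
   => 'a set => 'b set => ('a \<times> 'b \<Rightarrow>\<^sub>0 int) => ('a set \<times> 'b set \<Rightarrow>\<^sub>0 int) set" where
 "cls L \<sigma> A B U V c =
   tens L \<sigma> (quot_module A U) (quot_module B V)
    (frag_pair (%a. U +>\<^bsub>A\<^esub> a) (%b. V +>\<^bsub>B\<^esub> b) c)"

lemma tensor_prod_quot:
 assumes "left_module L A" "left_module L B" "\<sigma> \<in> carrier L \<rightarrow> carrier L" "submodule U L A" "submodule V L B"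
 shows "tensor_prod L (quot_module A U) (quot_module B V) \<sigma>"
 using assms by (simp add: tensor_prod_def tensor_prod_axioms_def left_module.quot_left_module)

lemma coset_map_mod_hom:
 assumes A: "left_module L A" and A': "left_module L A'" and U: "submodule U L A" and U': "submodule U' L A'"
  and f: "f \<in> mod_hom L A A'" and fU: "f ` U \<subseteq> U'"
 shows "coset_map A' U' f \<in> mod_hom L (quot_module A U) (quot_module A' U')"
  "a \<in> carrier A ==> coset_map A' U' f (U +>\<^bsub>A\<^esub> a) = U' +>\<^bsub>A'\<^esub> f a"
proof -
 interpret A: left_module L A by fact
 interpret A': left_module L A' by fact
 note fD = mod_homD[OF f]
 have c: "coset_map A' U' f (U +>\<^bsub>A\<^esub> a) = U' +>\<^bsub>A'\<^esub> f a" if "a \<in> carrier A" for a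
  unfolding coset_map_def using that fD fU by (intro A.coset_map_coset[OF U _ A' U']) auto
 thus "a \<in> carrier A ==> coset_map A' U' f (U +>\<^bsub>A\<^esub> a) = U' +>\<^bsub>A'\<^esub> f a" .
 show "coset_map A' U' f \<in> mod_hom L (quot_module A U) (quot_module A' U')" unfolding mod_hom_def
 proof (intro CollectI conjI ballI funcsetI)
  fix X assume "X \<in> carrier (quot_module A U)"
  then obtain a where a: "a \<in> carrier A" "X = U +>\<^bsub>A\<^esub> a" by (rule quot_carrierE)
  show "coset_map A' U' f X \<in> carrier (quot_module A' U')" using a fD A'.coset_in_quot c by simp
  show "coset_map A' U' f (l \<odot>\<^bsub>quot_module A U\<^esub> X) = l \<odot>\<^bsub>quot_module A' U'\<^esub> coset_map A' U' f X"
   if "l \<in> carrier L" for l using a that fD A.smult_closed by (simp add: A.coset_smult[OF U] A'.coset_smult[OF U'] c)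
  fix Y assume "Y \<in> carrier (quot_module A U)"
  then obtain b where b: "b \<in> carrier A" "Y = U +>\<^bsub>A\<^esub> b" by (rule quot_carrierE)
  show "coset_map A' U' f (X \<oplus>\<^bsub>quot_module A U\<^esub> Y) = coset_map A' U' f X \<oplus>\<^bsub>quot_module A' U'\<^esub> coset_map A' U' f Y"
   using a b fD by (simp add: A.coset_add[OF U] A'.coset_add[OF U'] c)
 qed
qed

locale ctensor_prod =
 fixes L :: "('l, 'x) top_ring_scheme" and \<sigma> :: "'l => 'l"
  and A :: "('l, 'a) top_module" and B :: "('l, 'b) top_module" (structure)
 assumes \<sigma>: "\<sigma> \<in> carrier L \<rightarrow> carrier L" and A: "profinite_module L A" and B: "profinite_module L B"
begin

sublocale A: prof_module L A by (rule prof_module.intro[OF A])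
sublocale B: prof_module L B by (rule prof_module.intro[OF B])

abbreviation "TQ U V \<equiv> tensor L \<sigma> (quot_module A U) (quot_module B V)"
abbreviation "cl \<equiv> cls L \<sigma> A B"
abbreviation "keysF c \<equiv> Poly_Mapping.keys c \<subseteq> carrier A \<times> carrier B"
abbreviation "opA U \<equiv> open_submodule U L A"
abbreviation "opB V \<equiv> open_submodule V L B"
abbreviation "C \<equiv> ctensor_carrier L \<sigma> A B"

lemma tp: "opA U ==> opB V ==> tensor_prod L (quot_module A U) (quot_module B V) \<sigma>"
 by (intro tensor_prod_quot A.left_module_axioms B.left_module_axioms \<sigma>) (auto simp: open_submodule_def)

lemma index_iff: "i \<in> ctensor_index L A B \<longleftrightarrow> opA (fst i) & opB (snd i)"
 by (cases i) (auto simp: ctensor_index_def)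

lemma keys_quot:
 "keysF c ==> Poly_Mapping.keys (frag_pair (%a. U +>\<^bsub>A\<^esub> a) (%b. V +> b) c)
  \<subseteq> carrier (quot_module A U) \<times> carrier (quot_module B V)"
 using A.coset_in_quot B.coset_in_quot by (intro keys_frag_pair_subset) auto

lemma cl_closed: "opA U ==> opB V ==> keysF c ==> cl U V c \<in> carrier (TQ U V)"
 unfolding cls_def using tensor_prod.cl_in_T[OF tp keys_quot] by blast

lemma cl_add: "opA U ==> opB V ==> keysF c ==> keysF c' ==> cl U V c \<otimes>\<^bsub>TQ U V\<^esub> cl U V c' = cl U V (c + c')"
 unfolding cls_def by (simp add: tensor_prod.cl_add[OF tp keys_quot keys_quot])

lemma T_comm: "opA U ==> opB V ==> comm_group (TQ U V)" using tensor_prod.T_comm[OF tp] .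

lemma T_one: "opA U ==> opB V ==> \<one>\<^bsub>TQ U V\<^esub> = cl U V 0"
 unfolding cls_def by (simp add: tensor_prod.T_one[OF tp])

lemma keysF_add: "keysF c ==> keysF c' ==> keysF (c + c')" using keys_add[of c c'] by blast

lemma keysF_diff: "keysF c ==> keysF c' ==> keysF (c - c')" using keys_diff[of c c'] by blast

lemma cl_diff:
 assumes "opA U" "opB V" "keysF c" "keysF c'"
 shows "cl U V (c - c') = cl U V c \<otimes>\<^bsub>TQ U V\<^esub> inv\<^bsub>TQ U V\<^esub> cl U V c'"
proof -
 interpret T: comm_group "TQ U V" by (rule T_comm[OF assms(1,2)])
 have "cl U V (c - c') \<otimes>\<^bsub>TQ U V\<^esub> cl U V c' = cl U V c"
  using cl_add[OF assms(1,2) keysF_diff[OF assms(3,4)] assms(4)] by simp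
 thus ?thesis using cl_closed[OF assms(1,2)] keysF_diff[OF assms(3,4)] assms(3,4) by (metis T.inv_solve_right)
qed

text \<open>Coset representatives lift a formal sum of pairs of cosets, by induction on formal
  sums.\<close>

lemma cl_surj:
 assumes U: "opA U" "opB V" and t: "t \<in> carrier (TQ U V)"
 obtains c where "keysF c" "t = cl U V c"
proof -
 interpret T: tensor_prod L "quot_module A U" "quot_module B V" \<sigma> by (rule tp[OF U])
 obtain c0 where c0: "T.keysF c0" "t = T.cl c0" using t by (auto simp: T.T_carrier)
 have "\<exists>c. keysF c & frag_pair (%a. U +>\<^bsub>A\<^esub> a) (%b. V +> b) c = c0"
 proof (rule free_Abelian_group_induct[OF c0(1)])
  fix x y assume "\<exists>c. keysF c & frag_pair (%a. U +>\<^bsub>A\<^esub> a) (%b. V +> b) c = x"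
   "\<exists>c. keysF c & frag_pair (%a. U +>\<^bsub>A\<^esub> a) (%b. V +> b) c = y"
  then obtain c d where "keysF c" "frag_pair (%a. U +>\<^bsub>A\<^esub> a) (%b. V +> b) c = x"
   "keysF d" "frag_pair (%a. U +>\<^bsub>A\<^esub> a) (%b. V +> b) d = y" by (elim exE conjE) (rule that)
  thus "\<exists>c. keysF c & frag_pair (%a. U +>\<^bsub>A\<^esub> a) (%b. V +> b) c = x - y"
   using keysF_diff by (intro exI[of _ "c - d"]) simp
 next
  fix p assume "p \<in> carrier (quot_module A U) \<times> carrier (quot_module B V)"
  then obtain X Y where XY: "X \<in> carrier (quot_module A U)" "Y \<in> carrier (quot_module B V)" "p = (X, Y)" by (rule SigmaE)
  obtain a where a: "a \<in> carrier A" "X = U +>\<^bsub>A\<^esub> a" by (rule quot_carrierE[OF XY(1)])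
  obtain b where b: "b \<in> carrier B" "Y = V +> b" by (rule quot_carrierE[OF XY(2)])
  from a b XY(3) show "\<exists>c. keysF c & frag_pair (%a. U +>\<^bsub>A\<^esub> a) (%b. V +> b) c = frag_of p"
   by (intro exI[of _ "frag_of (a, b)"]) simp
 qed (intro exI[of _ 0], simp)
 thus ?thesis using that c0(2) by (auto simp: cls_def)
qed

lemma cl_add_left:
 assumes U: "opA U" "opB V" and "a \<in> carrier A" "a' \<in> carrier A" "b \<in> carrier B"
 shows "cl U V (frag_of (a \<oplus>\<^bsub>A\<^esub> a', b)) = cl U V (frag_of (a, b) + frag_of (a', b))"
proof -
 interpret T: tensor_prod L "quot_module A U" "quot_module B V" \<sigma> by (rule tp[OF U])
 show ?thesis
  using T.cl_add_left[of "U +>\<^bsub>A\<^esub> a" "U +>\<^bsub>A\<^esub> a'" "V +> b"] assms A.coset_in_quot B.coset_in_quot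
  by (simp add: cls_def A.coset_add[OF A.open_submodD(1)[OF U(1)]])
qed

lemma cl_add_right:
 assumes U: "opA U" "opB V" and "a \<in> carrier A" "b \<in> carrier B" "b' \<in> carrier B"
 shows "cl U V (frag_of (a, b \<oplus> b')) = cl U V (frag_of (a, b) + frag_of (a, b'))"
proof -
 interpret T: tensor_prod L "quot_module A U" "quot_module B V" \<sigma> by (rule tp[OF U])
 show ?thesis using T.cl_add_right[of "U +>\<^bsub>A\<^esub> a" "V +> b" "V +> b'"] assms A.coset_in_quot B.coset_in_quot
  by (simp add: cls_def B.coset_add[OF B.open_submodD(1)[OF U(2)]])
qed

lemma cl_smult:
 assumes U: "opA U" "opB V" and "a \<in> carrier A" "b \<in> carrier B" "l \<in> carrier L"
 shows "cl U V (frag_of (\<sigma> l \<odot>\<^bsub>A\<^esub> a, b)) = cl U V (frag_of (a, l \<odot> b))"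
proof -
 interpret T: tensor_prod L "quot_module A U" "quot_module B V" \<sigma> by (rule tp[OF U])
 show ?thesis using T.cl_smult[of "U +>\<^bsub>A\<^esub> a" "V +> b" l] assms A.coset_in_quot B.coset_in_quot T.\<sigma>_closed
  by (simp add: cls_def A.coset_smult[OF A.open_submodD(1)[OF U(1)]] B.coset_smult[OF B.open_submodD(1)[OF U(2)]])
qed

lemma cl_mod_left:
 assumes U: "opA U" "opB V" and "a \<in> carrier A" "b \<in> carrier B" "a' \<in> carrier A" "a \<ominus>\<^bsub>A\<^esub> a' \<in> U"
 shows "cl U V (frag_of (a, b)) = cl U V (frag_of (a', b))"
 using A.coset_eq_iff[OF A.open_submodD(1)[OF U(1)] assms(3,5)] assms(6) by (simp add: cls_def)

lemma cl_zero_left: "opA U ==> opB V ==> b \<in> carrier B ==> cl U V (frag_of (\<zero>\<^bsub>A\<^esub>, b)) = cl U V 0"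
 using tensor_prod.cl_zero_left[OF tp, of U V "V +> b"] B.coset_in_quot A.coset_zero[OF A.open_submodD(1)] by (simp add: cls_def)

lemma cl_zero_right: "opA U ==> opB V ==> a \<in> carrier A ==> cl U V (frag_of (a, \<zero>)) = cl U V 0"
 using tensor_prod.cl_zero_right[OF tp, of U V "U +>\<^bsub>A\<^esub> a"] A.coset_in_quot B.coset_zero[OF B.open_submodD(1)]
 by (simp add: cls_def)

end

lemma tensor_map_cls:
 assumes X: "ctensor_prod L \<sigma> A B" and Y: "ctensor_prod L \<sigma> A' B'"
  and f: "f \<in> mod_hom L A A'" and g: "g \<in> mod_hom L B B'"
  and op: "open_submodule U L A" "open_submodule V L B" "open_submodule U' L A'" "open_submodule V' L B'"
  and fU: "f ` U \<subseteq> U'" "g ` V \<subseteq> V'" and c: "Poly_Mapping.keys c \<subseteq> carrier A \<times> carrier B"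
 shows "tensor_map L \<sigma> (quot_module A' U') (quot_module B' V') (coset_map A' U' f) (coset_map B' V' g)
   (cls L \<sigma> A B U V c) = cls L \<sigma> A' B' U' V' (frag_pair f g c)"
proof -
 interpret X: ctensor_prod L \<sigma> A B by fact
 interpret Y: ctensor_prod L \<sigma> A' B' by fact
 note F = coset_map_mod_hom[OF X.A.left_module_axioms Y.A.left_module_axioms
   X.A.open_submodD(1)[OF op(1)] Y.A.open_submodD(1)[OF op(3)] f fU(1)]
 note G = coset_map_mod_hom[OF X.B.left_module_axioms Y.B.left_module_axioms
   X.B.open_submodD(1)[OF op(2)] Y.B.open_submodD(1)[OF op(4)] g fU(2)]
 show ?thesis unfolding cls_def tensor_map_cl[OF X.tp[OF op(1,2)] Y.tp[OF op(3,4)] F(1) G(1) X.keys_quot[OF c]] frag_pair_compose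
  using frag_pair_cong[OF c, of "%a. coset_map A' U' f (U +>\<^bsub>A\<^esub> a)" "%a. U' +>\<^bsub>A'\<^esub> f a"
    "%b. coset_map B' V' g (V +>\<^bsub>B\<^esub> b)" "%b. V' +>\<^bsub>B'\<^esub> g b"] F(2) G(2) by simp
qed

context ctensor_prod
begin

lemma C_comp: "x \<in> C ==> opA U ==> opB V ==> x (U, V) \<in> carrier (TQ U V)"
 by (auto simp: ctensor_carrier_def ctensor_index_def PiE_iff)

lemma C_ext:
 assumes "x \<in> C" "y \<in> C" "!!U V. opA U ==> opB V ==> x (U, V) = y (U, V)"
 shows "x = y"
 using assms by (intro extensionalityI[of _ "ctensor_index L A B"]) (auto simp: ctensor_carrier_def PiE_iff index_iff)

lemma id_mod_hom: "(%a. a) \<in> mod_hom L A A" "(%b. b) \<in> mod_hom L B B" by (auto simp: mod_hom_def)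

lemma frag_pair_id: "keysF c ==> frag_pair (%a. a) (%b. b) c = c"
proof -
 have "(\<lambda>(a, b). frag_of (a, b)) = (frag_of :: 'a \<times> 'b => _)" by auto
 thus ?thesis by (simp add: frag_pair_def frag_expansion[symmetric])
qed

lemma C_compat:
 assumes x: "x \<in> C" and op: "opA U" "opB V" "opA U'" "opB V'" "U \<subseteq> U'" "V \<subseteq> V'" and c: "keysF c"
  and eq: "x (U, V) = cl U V c"
 shows "x (U', V') = cl U' V' c"
proof -
 have "x (U', V') = tensor_map L \<sigma> (quot_module A U') (quot_module B V')
      (coset_map A U' (%a. a)) (coset_map B V' (%b. b)) (x (U, V))"
  using x op by (auto simp: ctensor_carrier_def ctensor_index_def)
 also have "... = cl U' V' (frag_pair (%a. a) (%b. b) c)" unfolding eq using op c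
  by (intro tensor_map_cls[OF ctensor_prod_axioms ctensor_prod_axioms id_mod_hom]) auto
 finally show ?thesis by (simp add: frag_pair_id[OF c])
qed

text \<open>By compatibility a representative at a fine level remains one at every coarser level, so
  several components of \<open>x\<close> can be treated through one formal sum.\<close>

lemma C_rep:
 assumes "x \<in> C" "opA U" "opB V"
 obtains c where "keysF c" "x (U, V) = cl U V c"
  "!!U' V'. opA U' ==> opB V' ==> U \<subseteq> U' ==> V \<subseteq> V' ==> x (U', V') = cl U' V' c"
proof -
 obtain c where c: "keysF c" "x (U, V) = cl U V c" using cl_surj[OF assms(2,3) C_comp[OF assms]] by blast
 show ?thesis by (rule that[OF c]) (rule C_compat[OF assms _ _ _ _ c])
qed

text \<open>A converse of \<open>C_rep\<close>: transition maps leave the formal sum unchanged, so a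
  family that is given above each level by one formal sum is compatible. Closure of the completed
  tensor product under operations is proved in this form.\<close>

lemma CI:
 assumes c: "!!U V. opA U ==> opB V ==> \<exists>c. keysF c &
   (\<forall>U' V'. opA U' & opB V' & U \<subseteq> U' & V \<subseteq> V' --> x (U', V') = cl U' V' c)"
  and e: "x \<in> extensional (ctensor_index L A B)"
 shows "x \<in> C"
proof -
 have 1: "x i \<in> carrier (TQ (fst i) (snd i))" if i: "i \<in> ctensor_index L A B" for i
 proof -
  have op: "opA (fst i)" "opB (snd i)" using i by (auto simp: index_iff)
  obtain c where k: "keysF c" and e: "\<forall>U' V'. opA U' & opB V' & fst i \<subseteq> U' & snd i \<subseteq> V' --> x (U', V') = cl U' V' c"
   using c[OF op] by blast
  have "x i = cl (fst i) (snd i) c" using e[rule_format, of "fst i" "snd i"] op by simp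
  thus ?thesis using cl_closed[OF op k] by simp
 qed
 have 2: "tensor_map L \<sigma> (quot_module A (fst j)) (quot_module B (snd j))
      (coset_map A (fst j) (%a. a)) (coset_map B (snd j) (%b. b)) (x i) = x j"
  if i: "i \<in> ctensor_index L A B" and j: "j \<in> ctensor_index L A B" and ij: "fst i \<subseteq> fst j & snd i \<subseteq> snd j" for i j
 proof -
  obtain U V U' V' where ij': "i = (U, V)" "j = (U', V')" by (metis surj_pair)
  hence op: "opA U" "opB V" "opA U'" "opB V'" "U \<subseteq> U'" "V \<subseteq> V'" using i j ij by (auto simp: index_iff)
  obtain c where cc: "keysF c" "!!U' V'. opA U' & opB V' & U \<subseteq> U' & V \<subseteq> V' ==> x (U', V') = cl U' V' c"
   using c[OF op(1,2)] by blast
  have "tensor_map L \<sigma> (quot_module A U') (quot_module B V')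
      (coset_map A U' (%a. a)) (coset_map B V' (%b. b)) (cl U V c) = cl U' V' (frag_pair (%a. a) (%b. b) c)"
   using op cc(1) by (intro tensor_map_cls[OF ctensor_prod_axioms ctensor_prod_axioms id_mod_hom]) auto
  thus ?thesis using cc op by (simp add: ij' frag_pair_id)
 qed
 show ?thesis unfolding ctensor_carrier_def using 1 2 e by (auto simp: PiE_iff)
qed

text \<open>The image of an element of the uncompleted tensor product, or rather of a formal sum for
  it. Such elements show that the inverse limit maps onto each finite level.\<close>

definition pure_elt :: "('a \<times> 'b \<Rightarrow>\<^sub>0 int) => 'a set \<times> 'b set => ('a set \<times> 'b set \<Rightarrow>\<^sub>0 int) set" where
 "pure_elt c = (\<lambda>i\<in>ctensor_index L A B. cl (fst i) (snd i) c)"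

lemma pure_elt: "keysF c ==> pure_elt c \<in> C" by (rule CI) (auto simp: pure_elt_def index_iff)

lemma pure_elt_comp: "opA U ==> opB V ==> pure_elt c (U, V) = cl U V c" by (simp add: pure_elt_def index_iff)

abbreviation cadd where "cadd x y \<equiv> x \<oplus>\<^bsub>ctensor L \<sigma> A B\<^esub> y"

lemma cadd_comp: "opA U ==> opB V ==> cadd x y (U, V) = x (U, V) \<otimes>\<^bsub>TQ U V\<^esub> y (U, V)"
 by (simp add: ctensor_def index_iff)

lemma cadd_ext: "cadd x y \<in> extensional (ctensor_index L A B)" by (simp add: ctensor_def)

lemma cadd_closed:
 assumes x: "x \<in> C" and y: "y \<in> C" shows "cadd x y \<in> C"
proof (rule CI[OF _ cadd_ext])
 fix U V assume U: "opA U" "opB V"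
 obtain c where c: "keysF c" "x (U, V) = cl U V c"
  "!!U' V'. opA U' ==> opB V' ==> U \<subseteq> U' ==> V \<subseteq> V' ==> x (U', V') = cl U' V' c" by (rule C_rep[OF x U]) (rule that)
 obtain d where d: "keysF d" "y (U, V) = cl U V d"
  "!!U' V'. opA U' ==> opB V' ==> U \<subseteq> U' ==> V \<subseteq> V' ==> y (U', V') = cl U' V' d" by (rule C_rep[OF y U]) (rule that)
 show "\<exists>e. keysF e & (\<forall>U' V'. opA U' & opB V' & U \<subseteq> U' & V \<subseteq> V' --> cadd x y (U', V') = cl U' V' e)"
  using c d keysF_add[OF c(1) d(1)] by (intro exI[of _ "c + d"]) (auto simp: cadd_comp cl_add)
qed

abbreviation czero where "czero \<equiv> \<zero>\<^bsub>ctensor L \<sigma> A B\<^esub>"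

lemma czero_comp: "opA U ==> opB V ==> czero (U, V) = cl U V 0" by (simp add: ctensor_def index_iff T_one)

lemma czero_closed: "czero \<in> C" by (rule CI) (auto simp: czero_comp intro!: exI[of _ 0], simp add: ctensor_def)

lemma ctensor_carrier_eq: "carrier (ctensor L \<sigma> A B) = C" by (simp add: ctensor_def)

lemma ctensor_smult_eq: "h \<odot>\<^bsub>ctensor L \<sigma> A B\<^esub> x = ctensor_map L \<sigma> A B A B (%a. a) h x"
 by (simp add: ctensor_def)

end

text \<open>The definition evaluates \<open>x\<close> at the exact preimages of \<open>U'\<close>
  and \<open>V'\<close>. Any smaller level serves as well, which makes identities between several
  maps provable from one formal sum.\<close>

lemma ctensor_map_comp:
 assumes X: "ctensor_prod L \<sigma> A B" and Y: "ctensor_prod L \<sigma> A' B'"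
  and f: "f \<in> cont_hom L A A'" and g: "g \<in> cont_hom L B B'" and x: "x \<in> ctensor_carrier L \<sigma> A B"
  and op: "open_submodule U L A" "open_submodule V L B" "open_submodule U' L A'" "open_submodule V' L B'"
  and fU: "f ` U \<subseteq> U'" "g ` V \<subseteq> V'" and c: "Poly_Mapping.keys c \<subseteq> carrier A \<times> carrier B"
  and eq: "x (U, V) = cls L \<sigma> A B U V c"
 shows "ctensor_map L \<sigma> A B A' B' f g x (U', V') = cls L \<sigma> A' B' U' V' (frag_pair f g c)"
proof -
 interpret X: ctensor_prod L \<sigma> A B by fact
 interpret Y: ctensor_prod L \<sigma> A' B' by fact
 let ?U = "{a \<in> carrier A. f a \<in> U'}" and ?V = "{b \<in> carrier B. g b \<in> V'}"
 have op': "X.opA ?U" "X.opB ?V"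
  using open_submodule_preimage[OF X.A Y.A f op(3)] open_submodule_preimage[OF X.B Y.B g op(4)] by auto
 have sub: "U \<subseteq> ?U" "V \<subseteq> ?V" using fU X.A.open_submodD(3)[OF op(1)] X.B.open_submodD(3)[OF op(2)] by auto
 have "x (?U, ?V) = X.cl ?U ?V c" by (rule X.C_compat[OF x op(1,2) op' sub c eq])
 hence "ctensor_map L \<sigma> A B A' B' f g x (U', V') =
  tensor_map L \<sigma> (quot_module A' U') (quot_module B' V') (coset_map A' U' f) (coset_map B' V' g) (X.cl ?U ?V c)"
  using op by (simp add: ctensor_map_def Y.index_iff)
 also have "... = cls L \<sigma> A' B' U' V' (frag_pair f g c)"
  by (rule tensor_map_cls[OF X Y cont_hom_mod_hom[OF f] cont_hom_mod_hom[OF g] op' op(3,4) _ _ c]) auto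
 finally show ?thesis .
qed

lemma ctensor_map_rep:
 assumes X: "ctensor_prod L \<sigma> A B" and Y: "ctensor_prod L \<sigma> A' B'"
  and f: "f \<in> cont_hom L A A'" and g: "g \<in> cont_hom L B B'" and x: "x \<in> ctensor_carrier L \<sigma> A B"
  and op: "open_submodule U L A'" "open_submodule V L B'"
 obtains W W' c where "open_submodule W L A" "open_submodule W' L B" "f ` W \<subseteq> U" "g ` W' \<subseteq> V"
  "Poly_Mapping.keys c \<subseteq> carrier A \<times> carrier B" "x (W, W') = cls L \<sigma> A B W W' c"
  "!!U' V'. open_submodule U' L A' ==> open_submodule V' L B' ==> U \<subseteq> U' ==> V \<subseteq> V' ==>
   ctensor_map L \<sigma> A B A' B' f g x (U', V') = cls L \<sigma> A' B' U' V' (frag_pair f g c)"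
proof -
 interpret X: ctensor_prod L \<sigma> A B by fact
 interpret Y: ctensor_prod L \<sigma> A' B' by fact
 let ?U = "{a \<in> carrier A. f a \<in> U}" and ?V = "{b \<in> carrier B. g b \<in> V}"
 have op': "X.opA ?U" "X.opB ?V"
  using open_submodule_preimage[OF X.A Y.A f op(1)] open_submodule_preimage[OF X.B Y.B g op(2)] by auto
 obtain c where c: "X.keysF c" "x (?U, ?V) = X.cl ?U ?V c" by (rule X.C_rep[OF x op']) (rule that)
 show ?thesis
 proof (rule that[OF op' _ _ c])
  show "ctensor_map L \<sigma> A B A' B' f g x (U', V') = cls L \<sigma> A' B' U' V' (frag_pair f g c)"
   if "open_submodule U' L A'" "open_submodule V' L B'" "U \<subseteq> U'" "V \<subseteq> V'" for U' V'
   using that by (intro ctensor_map_comp[OF X Y f g x op' _ _ _ _ c]) auto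
 qed auto
qed

lemma keys_cont_hom:
 assumes "f \<in> cont_hom L A A'" "g \<in> cont_hom L B B'" "Poly_Mapping.keys c \<subseteq> carrier A \<times> carrier B"
 shows "Poly_Mapping.keys (frag_pair f g c) \<subseteq> carrier A' \<times> carrier B'"
 using cont_homD(1)[OF assms(1)] cont_homD(1)[OF assms(2)] by (intro keys_frag_pair_subset[OF assms(3)]) auto

lemma ctensor_map_ext: "ctensor_map L \<sigma> A B A' B' f g x \<in> extensional (ctensor_index L A' B')"
 by (simp add: ctensor_map_def)

lemma ctensor_map_closed:
 assumes X: "ctensor_prod L \<sigma> A B" and Y: "ctensor_prod L \<sigma> A' B'"
  and f: "f \<in> cont_hom L A A'" and g: "g \<in> cont_hom L B B'" and x: "x \<in> ctensor_carrier L \<sigma> A B"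
 shows "ctensor_map L \<sigma> A B A' B' f g x \<in> ctensor_carrier L \<sigma> A' B'"
proof -
 interpret X: ctensor_prod L \<sigma> A B by fact
 interpret Y: ctensor_prod L \<sigma> A' B' by fact
 show ?thesis
 proof (rule Y.CI[OF _ ctensor_map_ext])
  fix U V assume op: "Y.opA U" "Y.opB V"
  obtain W W' c where "X.keysF c" "!!U' V'. Y.opA U' ==> Y.opB V' ==> U \<subseteq> U' ==> V \<subseteq> V' ==>
   ctensor_map L \<sigma> A B A' B' f g x (U', V') = cls L \<sigma> A' B' U' V' (frag_pair f g c)"
   by (rule ctensor_map_rep[OF X Y f g x op]) (rule that)
  thus "\<exists>c. Y.keysF c & (\<forall>U' V'. Y.opA U' & Y.opB V' & U \<subseteq> U' & V \<subseteq> V' -->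
    ctensor_map L \<sigma> A B A' B' f g x (U', V') = cls L \<sigma> A' B' U' V' c)" using keys_cont_hom[OF f g] by blast
 qed
qed

lemma ctensor_map_id:
 assumes X: "ctensor_prod L \<sigma> A B" and x: "x \<in> ctensor_carrier L \<sigma> A B"
 shows "ctensor_map L \<sigma> A B A B (%a. a) (%b. b) x = x"
proof -
 interpret X: ctensor_prod L \<sigma> A B by fact
 show ?thesis
 proof (rule X.C_ext[OF ctensor_map_closed[OF X X cont_hom_id cont_hom_id x] x])
  fix U V assume op: "X.opA U" "X.opB V"
  obtain c where c: "X.keysF c" "x (U, V) = X.cl U V c" by (rule X.C_rep[OF x op]) (rule that)
  show "ctensor_map L \<sigma> A B A B (%a. a) (%b. b) x (U, V) = x (U, V)"
   using ctensor_map_comp[OF X X cont_hom_id cont_hom_id x op op _ _ c] c by (simp add: X.frag_pair_id)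
 qed
qed

lemma ctensor_map_compose:
 assumes X: "ctensor_prod L \<sigma> A B" and Y: "ctensor_prod L \<sigma> A' B'" and Z: "ctensor_prod L \<sigma> A'' B''"
  and f: "f \<in> cont_hom L A A'" and g: "g \<in> cont_hom L B B'"
  and f': "f' \<in> cont_hom L A' A''" and g': "g' \<in> cont_hom L B' B''" and x: "x \<in> ctensor_carrier L \<sigma> A B"
 shows "ctensor_map L \<sigma> A' B' A'' B'' f' g' (ctensor_map L \<sigma> A B A' B' f g x) =
  ctensor_map L \<sigma> A B A'' B'' (%a. f' (f a)) (%b. g' (g b)) x"
proof -
 interpret X: ctensor_prod L \<sigma> A B by fact
 interpret Y: ctensor_prod L \<sigma> A' B' by fact
 interpret Z: ctensor_prod L \<sigma> A'' B'' by fact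
 let ?y = "ctensor_map L \<sigma> A B A' B' f g x"
 have y: "?y \<in> Y.C" by (rule ctensor_map_closed[OF X Y f g x])
 note ff = cont_hom_compose[OF f f'] and gg = cont_hom_compose[OF g g']
 show ?thesis
 proof (rule Z.C_ext[OF ctensor_map_closed[OF Y Z f' g' y] ctensor_map_closed[OF X Z ff gg x]])
  fix U V assume op: "Z.opA U" "Z.opB V"
  let ?U = "{a \<in> carrier A'. f' a \<in> U}" and ?V = "{b \<in> carrier B'. g' b \<in> V}"
  have op': "Y.opA ?U" "Y.opB ?V"
   using open_submodule_preimage[OF Y.A Z.A f' op(1)] open_submodule_preimage[OF Y.B Z.B g' op(2)] by auto
  obtain W W' c where c: "X.opA W" "X.opB W'" "f ` W \<subseteq> ?U" "g ` W' \<subseteq> ?V" "X.keysF c" "x (W, W') = X.cl W W' c"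
   "!!U' V'. Y.opA U' ==> Y.opB V' ==> ?U \<subseteq> U' ==> ?V \<subseteq> V' ==> ?y (U', V') = Y.cl U' V' (frag_pair f g c)"
   by (rule ctensor_map_rep[OF X Y f g x op']) (rule that)
  have y': "?y (?U, ?V) = Y.cl ?U ?V (frag_pair f g c)" using c(7)[OF op'] by simp
  have "ctensor_map L \<sigma> A' B' A'' B'' f' g' ?y (U, V) = Z.cl U V (frag_pair f' g' (frag_pair f g c))"
   by (rule ctensor_map_comp[OF Y Z f' g' y op' op _ _ keys_cont_hom[OF f g c(5)] y']) auto
  moreover have "ctensor_map L \<sigma> A B A'' B'' (%a. f' (f a)) (%b. g' (g b)) x (U, V) =
    Z.cl U V (frag_pair (%a. f' (f a)) (%b. g' (g b)) c)"
   using c(3,4) by (intro ctensor_map_comp[OF X Z ff gg x c(1,2) op _ _ c(5,6)]) auto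
  ultimately show "ctensor_map L \<sigma> A' B' A'' B'' f' g' ?y (U, V) =
    ctensor_map L \<sigma> A B A'' B'' (%a. f' (f a)) (%b. g' (g b)) x (U, V)" by (simp add: frag_pair_compose)
 qed
qed

lemma ctensor_map_cong:
 assumes X: "ctensor_prod L \<sigma> A B" and Y: "ctensor_prod L \<sigma> A' B'"
  and f: "f \<in> cont_hom L A A'" and g: "g \<in> cont_hom L B B'"
  and f': "f' \<in> cont_hom L A A'" and g': "g' \<in> cont_hom L B B'"
  and eq: "!!a. a \<in> carrier A ==> f a = f' a" "!!b. b \<in> carrier B ==> g b = g' b"
  and x: "x \<in> ctensor_carrier L \<sigma> A B"
 shows "ctensor_map L \<sigma> A B A' B' f g x = ctensor_map L \<sigma> A B A' B' f' g' x"
proof -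
 interpret X: ctensor_prod L \<sigma> A B by fact
 interpret Y: ctensor_prod L \<sigma> A' B' by fact
 show ?thesis
 proof (rule Y.C_ext[OF ctensor_map_closed[OF X Y f g x] ctensor_map_closed[OF X Y f' g' x]])
  fix U V assume op: "Y.opA U" "Y.opB V"
  obtain W W' c where c: "X.opA W" "X.opB W'" "f ` W \<subseteq> U" "g ` W' \<subseteq> V" "X.keysF c" "x (W, W') = X.cl W W' c"
   by (rule ctensor_map_rep[OF X Y f g x op]) (rule that)
  have "f' ` W \<subseteq> U" "g' ` W' \<subseteq> V" using c(3,4) eq X.A.open_submodD(3)[OF c(1)] X.B.open_submodD(3)[OF c(2)]
   by (auto simp: image_subset_iff subset_iff)
  thus "ctensor_map L \<sigma> A B A' B' f g x (U, V) = ctensor_map L \<sigma> A B A' B' f' g' x (U, V)"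
   using ctensor_map_comp[OF X Y f g x c(1,2) op c(3,4,5,6)] ctensor_map_comp[OF X Y f' g' x c(1,2) op _ _ c(5,6)]
    frag_pair_cong[OF c(5), of f f' g g'] eq by simp
 qed
qed

lemma ctensor_map_add:
 assumes X: "ctensor_prod L \<sigma> A B" and Y: "ctensor_prod L \<sigma> A' B'"
  and f: "f \<in> cont_hom L A A'" and g: "g \<in> cont_hom L B B'"
  and x: "x \<in> ctensor_carrier L \<sigma> A B" and y: "y \<in> ctensor_carrier L \<sigma> A B"
 shows "ctensor_map L \<sigma> A B A' B' f g (x \<oplus>\<^bsub>ctensor L \<sigma> A B\<^esub> y) =
  ctensor_map L \<sigma> A B A' B' f g x \<oplus>\<^bsub>ctensor L \<sigma> A' B'\<^esub> ctensor_map L \<sigma> A B A' B' f g y"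
proof -
 interpret X: ctensor_prod L \<sigma> A B by fact
 interpret Y: ctensor_prod L \<sigma> A' B' by fact
 note cc = ctensor_map_closed[OF X Y f g]
 show ?thesis
 proof (rule Y.C_ext[OF cc[OF X.cadd_closed[OF x y]] Y.cadd_closed[OF cc[OF x] cc[OF y]]])
  fix U V assume op: "Y.opA U" "Y.opB V"
  obtain W W' c where c: "X.opA W" "X.opB W'" "f ` W \<subseteq> U" "g ` W' \<subseteq> V" "X.keysF c" "x (W, W') = X.cl W W' c"
   by (rule ctensor_map_rep[OF X Y f g x op]) (rule that)
  obtain d where d: "X.keysF d" "y (W, W') = X.cl W W' d" by (rule X.C_rep[OF y c(1,2)]) (rule that)
  have xy: "X.cadd x y (W, W') = X.cl W W' (c + d)" using c d by (simp add: X.cadd_comp X.cl_add)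
  note k = keys_cont_hom[OF f g]
  show "ctensor_map L \<sigma> A B A' B' f g (X.cadd x y) (U, V) =
    Y.cadd (ctensor_map L \<sigma> A B A' B' f g x) (ctensor_map L \<sigma> A B A' B' f g y) (U, V)"
   using ctensor_map_comp[OF X Y f g x c(1,2) op c(3,4,5,6)] ctensor_map_comp[OF X Y f g y c(1,2) op c(3,4) d]
    ctensor_map_comp[OF X Y f g X.cadd_closed[OF x y] c(1,2) op c(3,4) X.keysF_add[OF c(5) d(1)] xy]
    Y.cl_add[OF op k[OF c(5)] k[OF d(1)]] by (simp add: Y.cadd_comp[OF op])
 qed
qed

text \<open>Additivity in either factor is an instance. The equation is asked for pure tensors and
  spreads to formal sums by induction.\<close>

lemma ctensor_map_sum:
 assumes X: "ctensor_prod L \<sigma> A B" and Y: "ctensor_prod L \<sigma> A' B'"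
  and f: "f \<in> cont_hom L A A'" "g \<in> cont_hom L B B'" and f': "f' \<in> cont_hom L A A'" "g' \<in> cont_hom L B B'"
  and f'': "f'' \<in> cont_hom L A A'" "g'' \<in> cont_hom L B B'"
  and eq: "!!U V a b. open_submodule U L A' ==> open_submodule V L B' ==> a \<in> carrier A ==> b \<in> carrier B ==>
   cls L \<sigma> A' B' U V (frag_of (f'' a, g'' b)) = cls L \<sigma> A' B' U V (frag_of (f a, g b) + frag_of (f' a, g' b))"
  and x: "x \<in> ctensor_carrier L \<sigma> A B"
 shows "ctensor_map L \<sigma> A B A' B' f'' g'' x =
  ctensor_map L \<sigma> A B A' B' f g x \<oplus>\<^bsub>ctensor L \<sigma> A' B'\<^esub> ctensor_map L \<sigma> A B A' B' f' g' x"
proof -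
 interpret X: ctensor_prod L \<sigma> A B by fact
 interpret Y: ctensor_prod L \<sigma> A' B' by fact
 show ?thesis
 proof (rule Y.C_ext[OF ctensor_map_closed[OF X Y f'' x]
    Y.cadd_closed[OF ctensor_map_closed[OF X Y f x] ctensor_map_closed[OF X Y f' x]]])
  fix U V assume op: "Y.opA U" "Y.opB V"
  \<comment> \<open>The level is chosen inside the preimages under all three pairs of maps, so that
    one formal sum computes the three values.\<close>
  let ?p = "%h. {a \<in> carrier A. h a \<in> U}" and ?q = "%h. {b \<in> carrier B. h b \<in> V}"
  let ?U = "?p f \<inter> ?p f' \<inter> ?p f''" and ?V = "?q g \<inter> ?q g' \<inter> ?q g''"
  have op': "X.opA ?U" "X.opB ?V"
   by (intro X.A.open_submodule_Int X.B.open_submodule_Int open_submodule_preimage[OF X.A Y.A _ op(1)]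
     open_submodule_preimage[OF X.B Y.B _ op(2)] f f' f'')+
  obtain c where c: "X.keysF c" "x (?U, ?V) = X.cl ?U ?V c" by (rule X.C_rep[OF x op']) (rule that)
  have val: "ctensor_map L \<sigma> A B A' B' h k x (U, V) = Y.cl U V (frag_pair h k c)"
   if "h \<in> cont_hom L A A'" "k \<in> cont_hom L B B'" "h ` ?U \<subseteq> U" "k ` ?V \<subseteq> V" for h k
   by (rule ctensor_map_comp[OF X Y that(1,2) x op' op that(3,4) c])
  have v: "ctensor_map L \<sigma> A B A' B' f g x (U, V) = Y.cl U V (frag_pair f g c)"
   "ctensor_map L \<sigma> A B A' B' f' g' x (U, V) = Y.cl U V (frag_pair f' g' c)"
   "ctensor_map L \<sigma> A B A' B' f'' g'' x (U, V) = Y.cl U V (frag_pair f'' g'' c)" by (rule val; (intro f f' f'')?; auto)+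
  note k = keys_cont_hom[OF f] keys_cont_hom[OF f'] keys_cont_hom[OF f'']
  let ?P = "%c. Y.cl U V (frag_pair f'' g'' c) = Y.cl U V (frag_pair f g c + frag_pair f' g' c)"
  have "?P c"
  proof (rule free_Abelian_group_induct[OF c(1), where P = ?P])
   show "?P (frag_of p)" if "p \<in> carrier A \<times> carrier B" for p using that eq[OF op] by auto
   fix c d assume cd: "X.keysF c" "X.keysF d" "?P c" "?P d"
   have "Y.cl U V (frag_pair f'' g'' (c - d)) = Y.cl U V (frag_pair f'' g'' c - frag_pair f'' g'' d)" by simp
   also have "... = Y.cl U V ((frag_pair f g c + frag_pair f' g' c) - (frag_pair f g d + frag_pair f' g' d))"
    by (simp only: Y.cl_diff[OF op k(3)[OF cd(1)] k(3)[OF cd(2)]] cd(3,4)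
      Y.cl_diff[OF op Y.keysF_add[OF k(1)[OF cd(1)] k(2)[OF cd(1)]] Y.keysF_add[OF k(1)[OF cd(2)] k(2)[OF cd(2)]]])
   finally show "?P (c - d)" by (simp add: algebra_simps)
  qed simp
  thus "ctensor_map L \<sigma> A B A' B' f'' g'' x (U, V) =
    Y.cadd (ctensor_map L \<sigma> A B A' B' f g x) (ctensor_map L \<sigma> A B A' B' f' g' x) (U, V)"
   using v Y.cl_add[OF op k(1)[OF c(1)] k(2)[OF c(1)]] by (simp add: Y.cadd_comp[OF op])
 qed
qed

lemma ctensor_map_add_left:
 assumes X: "ctensor_prod L \<sigma> A B" and Y: "ctensor_prod L \<sigma> A' B'"
  and f: "f \<in> cont_hom L A A'" and f': "f' \<in> cont_hom L A A'" and f'': "f'' \<in> cont_hom L A A'"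
  and g: "g \<in> cont_hom L B B'" and eq: "!!a. a \<in> carrier A ==> f'' a = f a \<oplus>\<^bsub>A'\<^esub> f' a"
  and x: "x \<in> ctensor_carrier L \<sigma> A B"
 shows "ctensor_map L \<sigma> A B A' B' f'' g x =
  ctensor_map L \<sigma> A B A' B' f g x \<oplus>\<^bsub>ctensor L \<sigma> A' B'\<^esub> ctensor_map L \<sigma> A B A' B' f' g x"
proof (rule ctensor_map_sum[OF X Y f g f' g f'' g _ x])
 interpret Y: ctensor_prod L \<sigma> A' B' by fact
 show "Y.cl U V (frag_of (f'' a, g b)) = Y.cl U V (frag_of (f a, g b) + frag_of (f' a, g b))"
  if "Y.opA U" "Y.opB V" "a \<in> carrier A" "b \<in> carrier B" for U V a b
  using Y.cl_add_left[OF that(1,2) cont_homD(1)[OF f] cont_homD(1)[OF f'] cont_homD(1)[OF g]] that eq by simp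
qed

lemma ctensor_map_add_right:
 assumes X: "ctensor_prod L \<sigma> A B" and Y: "ctensor_prod L \<sigma> A' B'" and f: "f \<in> cont_hom L A A'"
  and g: "g \<in> cont_hom L B B'" and g': "g' \<in> cont_hom L B B'" and g'': "g'' \<in> cont_hom L B B'"
  and eq: "!!b. b \<in> carrier B ==> g'' b = g b \<oplus>\<^bsub>B'\<^esub> g' b" and x: "x \<in> ctensor_carrier L \<sigma> A B"
 shows "ctensor_map L \<sigma> A B A' B' f g'' x =
  ctensor_map L \<sigma> A B A' B' f g x \<oplus>\<^bsub>ctensor L \<sigma> A' B'\<^esub> ctensor_map L \<sigma> A B A' B' f g' x"
proof (rule ctensor_map_sum[OF X Y f g f g' f g'' _ x])
 interpret Y: ctensor_prod L \<sigma> A' B' by fact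
 show "Y.cl U V (frag_of (f a, g'' b)) = Y.cl U V (frag_of (f a, g b) + frag_of (f a, g' b))"
  if "Y.opA U" "Y.opB V" "a \<in> carrier A" "b \<in> carrier B" for U V a b
  using Y.cl_add_right[OF that(1,2) cont_homD(1)[OF f] cont_homD(1)[OF g] cont_homD(1)[OF g']] that eq by simp
qed

text \<open>Vanishing on pure tensors at every level passes to formal sums. The differentials of a
  resolution by covers are later shown to vanish in this form.\<close>

lemma ctensor_map_eq_zero:
 assumes X: "ctensor_prod L \<sigma> A B" and Y: "ctensor_prod L \<sigma> A' B'"
  and f: "f \<in> cont_hom L A A'" and g: "g \<in> cont_hom L B B'"
  and z: "!!U V a b. open_submodule U L A' ==> open_submodule V L B' ==> a \<in> carrier A ==> b \<in> carrier B ==>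
   cls L \<sigma> A' B' U V (frag_of (f a, g b)) = cls L \<sigma> A' B' U V 0" and x: "x \<in> ctensor_carrier L \<sigma> A B"
 shows "ctensor_map L \<sigma> A B A' B' f g x = \<zero>\<^bsub>ctensor L \<sigma> A' B'\<^esub>"
proof -
 interpret X: ctensor_prod L \<sigma> A B by fact
 interpret Y: ctensor_prod L \<sigma> A' B' by fact
 show ?thesis
 proof (rule Y.C_ext[OF ctensor_map_closed[OF X Y f g x] Y.czero_closed])
  fix U V assume op: "Y.opA U" "Y.opB V"
  obtain W W' c where c: "X.opA W" "X.opB W'" "f ` W \<subseteq> U" "g ` W' \<subseteq> V" "X.keysF c" "x (W, W') = X.cl W W' c"
   by (rule ctensor_map_rep[OF X Y f g x op]) (rule that)
  note k = keys_cont_hom[OF f g]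
  have "Y.cl U V (frag_pair f g c) = Y.cl U V 0"
  proof (rule free_Abelian_group_induct[OF c(5), where P = "%c. Y.cl U V (frag_pair f g c) = Y.cl U V 0"])
   fix p assume "p \<in> carrier A \<times> carrier B"
   thus "Y.cl U V (frag_pair f g (frag_of p)) = Y.cl U V 0" using z[OF op] by auto
  next
   fix c d assume cd: "X.keysF c" "X.keysF d" "Y.cl U V (frag_pair f g c) = Y.cl U V 0" "Y.cl U V (frag_pair f g d) = Y.cl U V 0"
   have "Y.cl U V (frag_pair f g (c - d)) = Y.cl U V (0 - 0)"
    unfolding frag_pair_simps Y.cl_diff[OF op k[OF cd(1)] k[OF cd(2)]] cd(3,4) by (subst Y.cl_diff[OF op]) auto
   thus "Y.cl U V (frag_pair f g (c - d)) = Y.cl U V 0" by simp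
  qed simp
  thus "ctensor_map L \<sigma> A B A' B' f g x (U, V) = Y.czero (U, V)"
   using ctensor_map_comp[OF X Y f g x c(1,2) op c(3,4,5,6)] by (simp add: Y.czero_comp[OF op])
 qed
qed

lemma ctensor_map_zero:
 assumes X: "ctensor_prod L \<sigma> A B" and Y: "ctensor_prod L \<sigma> A' B'"
  and f: "f \<in> cont_hom L A A'" and g: "g \<in> cont_hom L B B'"
  and fz: "!!a. a \<in> carrier A ==> f a = \<zero>\<^bsub>A'\<^esub>" and x: "x \<in> ctensor_carrier L \<sigma> A B"
 shows "ctensor_map L \<sigma> A B A' B' f g x = \<zero>\<^bsub>ctensor L \<sigma> A' B'\<^esub>"
proof -
 interpret Y: ctensor_prod L \<sigma> A' B' by fact
 show ?thesis using cont_homD(1)[OF g] by (intro ctensor_map_eq_zero[OF X Y f g _ x]) (simp add: fz Y.cl_zero_left)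
qed

lemma (in ctensor_prod) ctensor_abelian_group: "abelian_group (ctensor L \<sigma> A B)"
proof (rule abelian_groupI, unfold ctensor_carrier_eq)
 fix x y assume x: "x \<in> C" and y: "y \<in> C"
 show "cadd x y \<in> C" by (rule cadd_closed[OF x y])
 show "cadd x y = cadd y x"
 proof (rule C_ext[OF cadd_closed[OF x y] cadd_closed[OF y x]])
  fix U V assume op: "opA U" "opB V"
  interpret T: comm_group "TQ U V" by (rule T_comm[OF op])
  show "cadd x y (U, V) = cadd y x (U, V)" using C_comp[OF x op] C_comp[OF y op] by (simp add: cadd_comp[OF op] T.m_comm)
 qed
 fix z assume z: "z \<in> C"
 show "cadd (cadd x y) z = cadd x (cadd y z)"
 proof (rule C_ext)
  fix U V assume op: "opA U" "opB V"
  interpret T: comm_group "TQ U V" by (rule T_comm[OF op])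
  show "cadd (cadd x y) z (U, V) = cadd x (cadd y z) (U, V)"
   using C_comp[OF x op] C_comp[OF y op] C_comp[OF z op] by (simp add: cadd_comp[OF op] T.m_assoc)
 qed (use x y z cadd_closed in auto)
next
 show "czero \<in> C" by (rule czero_closed)
 fix x assume x: "x \<in> C"
 show "cadd czero x = x"
 proof (rule C_ext[OF cadd_closed[OF czero_closed x] x])
  fix U V assume op: "opA U" "opB V"
  interpret T: comm_group "TQ U V" by (rule T_comm[OF op])
  show "cadd czero x (U, V) = x (U, V)"
   using C_comp[OF x op] by (simp add: cadd_comp[OF op] czero_comp[OF op] T_one[OF op, symmetric])
 qed
 note m = cont_hom_uminus[OF A cont_hom_id[of L A]]
 \<comment> \<open>The negative of \<open>x\<close> is its image under negation of the first factor,
   by additivity in that factor and vanishing for the zero map.\<close>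
 let ?y = "ctensor_map L \<sigma> A B A B (%a. \<ominus>\<^bsub>A\<^esub> a) (%b. b) x"
 have "cadd ?y (ctensor_map L \<sigma> A B A B (%a. a) (%b. b) x) = ctensor_map L \<sigma> A B A B (%a. \<zero>\<^bsub>A\<^esub>) (%b. b) x"
  using A.M.l_neg by (intro ctensor_map_add_left[symmetric] ctensor_prod_axioms m cont_hom_id cont_hom_zero A x) auto
 hence "cadd ?y x = czero" using ctensor_map_id[OF ctensor_prod_axioms x]
   ctensor_map_zero[OF ctensor_prod_axioms ctensor_prod_axioms cont_hom_zero[OF A] cont_hom_id _ x] by simp
 moreover have "?y \<in> C" by (rule ctensor_map_closed[OF ctensor_prod_axioms ctensor_prod_axioms m cont_hom_id x])
 ultimately show "\<exists>y\<in>C. cadd y x = czero" by blast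
qed

section \<open>The action of the endomorphism ring\<close>

lemma End_ring_sel [simp]:
 "carrier (End_ring L M) = cont_hom L M M \<inter> extensional (carrier M)"
 "f \<otimes>\<^bsub>End_ring L M\<^esub> g = compose (carrier M) f g"
 "\<one>\<^bsub>End_ring L M\<^esub> = (\<lambda>x\<in>carrier M. x)" "\<zero>\<^bsub>End_ring L M\<^esub> = (\<lambda>x\<in>carrier M. \<zero>\<^bsub>M\<^esub>)"
 "f \<oplus>\<^bsub>End_ring L M\<^esub> g = (\<lambda>x\<in>carrier M. f x \<oplus>\<^bsub>M\<^esub> g x)"
 by (simp_all add: End_ring_def)

lemma cont_hom_cong:
 assumes "profinite_module L M" "f \<in> cont_hom L M N" "!!x. x \<in> carrier M ==> f x = g x"
 shows "g \<in> cont_hom L M N"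
proof -
 interpret M: prof_module L M by (rule prof_module.intro[OF assms(1)])
 note fD = cont_homD[OF assms(2)]
 have "continuous_map (mtop M) (mtop N) g" using fD(2) by (rule continuous_map_eq) (use assms(3) in simp)
 thus ?thesis using fD assms(3) by (auto simp: cont_hom_def M.smult_closed)
qed

lemma cont_hom_restrict:
 assumes "profinite_module L M" "f \<in> cont_hom L M N" shows "restrict f (carrier M) \<in> cont_hom L M N"
 using cont_hom_cong[OF assms, of "restrict f (carrier M)"] by simp

lemma End_ring_ring:
 assumes M: "profinite_module L M" shows "ring (End_ring L M)"
proof -
 interpret M: prof_module L M by (rule prof_module.intro[OF M])
 let ?E = "End_ring L M"
 have c: "!!f x. f \<in> carrier ?E ==> x \<in> carrier M ==> f x \<in> carrier M" using cont_homD(1) by fastforce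
 have a: "!!f x y. f \<in> carrier ?E ==> x \<in> carrier M ==> y \<in> carrier M ==> f (x \<oplus>\<^bsub>M\<^esub> y) = f x \<oplus>\<^bsub>M\<^esub> f y"
  using cont_homD(3) by fastforce
 have ext: "f = g" if "f \<in> carrier ?E" "g \<in> carrier ?E" "!!x. x \<in> carrier M ==> f x = g x" for f g
  using that by (intro extensionalityI[of _ "carrier M"]) auto
 have add: "f \<oplus>\<^bsub>?E\<^esub> g \<in> carrier ?E" if "f \<in> carrier ?E" "g \<in> carrier ?E" for f g
  using cont_hom_restrict[OF M cont_hom_add[OF M, of f M g]] that by auto
 have mult: "f \<otimes>\<^bsub>?E\<^esub> g \<in> carrier ?E" if "f \<in> carrier ?E" "g \<in> carrier ?E" for f g
  using cont_hom_restrict[OF M cont_hom_compose[of g L M M f M]] that by (auto simp: compose_def)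
 have one: "\<one>\<^bsub>?E\<^esub> \<in> carrier ?E" using cont_hom_restrict[OF M cont_hom_id] by auto
 have zero: "\<zero>\<^bsub>?E\<^esub> \<in> carrier ?E" using cont_hom_restrict[OF M cont_hom_zero[OF M]] by auto
 have uminus: "(\<lambda>x\<in>carrier M. \<ominus>\<^bsub>M\<^esub> f x) \<in> carrier ?E" if "f \<in> carrier ?E" for f
  using cont_hom_restrict[OF M cont_hom_uminus[OF M, of f M]] that by auto
 show ?thesis
 proof (rule ringI)
  show "abelian_group ?E"
  proof (rule abelian_groupI)
   show "\<exists>g\<in>carrier ?E. g \<oplus>\<^bsub>?E\<^esub> f = \<zero>\<^bsub>?E\<^esub>" if f: "f \<in> carrier ?E" for f
   proof (intro bexI[OF _ uminus[OF f]] ext[OF add[OF uminus[OF f] f] zero])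
    show "((\<lambda>x\<in>carrier M. \<ominus>\<^bsub>M\<^esub> f x) \<oplus>\<^bsub>?E\<^esub> f) x = \<zero>\<^bsub>?E\<^esub> x" if "x \<in> carrier M" for x
     using c[OF f that] that by (simp add: M.M.l_neg)
   qed
   show "f \<oplus>\<^bsub>?E\<^esub> g \<oplus>\<^bsub>?E\<^esub> h = f \<oplus>\<^bsub>?E\<^esub> (g \<oplus>\<^bsub>?E\<^esub> h)" if "f \<in> carrier ?E" "g \<in> carrier ?E" "h \<in> carrier ?E" for f g h
    using that c by (intro ext add) (auto simp: M.M.a_assoc simp del: End_ring_sel(1))
   show "f \<oplus>\<^bsub>?E\<^esub> g = g \<oplus>\<^bsub>?E\<^esub> f" if "f \<in> carrier ?E" "g \<in> carrier ?E" for f g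
    using that c by (intro ext add) (auto simp: M.M.a_comm simp del: End_ring_sel(1))
   show "\<zero>\<^bsub>?E\<^esub> \<oplus>\<^bsub>?E\<^esub> f = f" if "f \<in> carrier ?E" for f
    using that c zero by (intro ext add) (auto simp del: End_ring_sel(1))
  qed (fact add zero)+
  show "Group.monoid ?E"
  proof (rule monoidI)
   show "f \<otimes>\<^bsub>?E\<^esub> g \<otimes>\<^bsub>?E\<^esub> h = f \<otimes>\<^bsub>?E\<^esub> (g \<otimes>\<^bsub>?E\<^esub> h)" if "f \<in> carrier ?E" "g \<in> carrier ?E" "h \<in> carrier ?E" for f g h
    using that c by (intro ext mult) (auto simp: compose_def simp del: End_ring_sel(1))
   show "\<one>\<^bsub>?E\<^esub> \<otimes>\<^bsub>?E\<^esub> f = f" if "f \<in> carrier ?E" for f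
    using that c one by (intro ext mult) (auto simp: compose_def simp del: End_ring_sel(1))
   show "f \<otimes>\<^bsub>?E\<^esub> \<one>\<^bsub>?E\<^esub> = f" if "f \<in> carrier ?E" for f
    using that c one by (intro ext mult) (auto simp: compose_def simp del: End_ring_sel(1))
  qed (fact mult one)+
  show "(f \<oplus>\<^bsub>?E\<^esub> g) \<otimes>\<^bsub>?E\<^esub> h = f \<otimes>\<^bsub>?E\<^esub> h \<oplus>\<^bsub>?E\<^esub> g \<otimes>\<^bsub>?E\<^esub> h" if "f \<in> carrier ?E" "g \<in> carrier ?E" "h \<in> carrier ?E" for f g h
   using that c by (intro ext mult add) (auto simp: compose_def simp del: End_ring_sel(1))
  show "h \<otimes>\<^bsub>?E\<^esub> (f \<oplus>\<^bsub>?E\<^esub> g) = h \<otimes>\<^bsub>?E\<^esub> f \<oplus>\<^bsub>?E\<^esub> h \<otimes>\<^bsub>?E\<^esub> g" if "f \<in> carrier ?E" "g \<in> carrier ?E" "h \<in> carrier ?E" for f g h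
   using that c a by (intro ext mult add) (auto simp: compose_def simp del: End_ring_sel(1))
 qed
qed

text \<open>The module laws are functoriality and additivity of the completed tensor product in its
  second factor.\<close>

lemma (in ctensor_prod) ctensor_left_module: "left_module (End_ring L B) (ctensor L \<sigma> A B)"
proof (rule left_module.intro[OF End_ring_ring[OF B] ctensor_abelian_group], rule left_module_axioms.intro)
 let ?E = "End_ring L B"
 interpret E: ring ?E by (rule End_ring_ring[OF B])
 note X = ctensor_prod_axioms
 note id = cont_hom_id[of L A]
 fix h x assume h: "h \<in> carrier ?E" and x: "x \<in> carrier (ctensor L \<sigma> A B)"
 have hc: "h \<in> cont_hom L B B" and xc: "x \<in> C" using h x by (auto simp: ctensor_carrier_eq)
 show "h \<odot>\<^bsub>ctensor L \<sigma> A B\<^esub> x \<in> carrier (ctensor L \<sigma> A B)"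
  unfolding ctensor_smult_eq ctensor_carrier_eq by (rule ctensor_map_closed[OF X X id hc xc])
 show "h \<odot>\<^bsub>ctensor L \<sigma> A B\<^esub> (cadd x y) = cadd (h \<odot>\<^bsub>ctensor L \<sigma> A B\<^esub> x) (h \<odot>\<^bsub>ctensor L \<sigma> A B\<^esub> y)"
  if "y \<in> carrier (ctensor L \<sigma> A B)" for y
  unfolding ctensor_smult_eq using that by (intro ctensor_map_add[OF X X id hc xc]) (simp add: ctensor_carrier_eq)
 fix g assume g: "g \<in> carrier ?E"
 have gc: "g \<in> cont_hom L B B" using g by simp
 have hg: "h \<oplus>\<^bsub>?E\<^esub> g \<in> cont_hom L B B" "h \<otimes>\<^bsub>?E\<^esub> g \<in> cont_hom L B B"
  using E.a_closed[OF h g] E.m_closed[OF h g] by auto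
 show "(h \<oplus>\<^bsub>?E\<^esub> g) \<odot>\<^bsub>ctensor L \<sigma> A B\<^esub> x = cadd (h \<odot>\<^bsub>ctensor L \<sigma> A B\<^esub> x) (g \<odot>\<^bsub>ctensor L \<sigma> A B\<^esub> x)"
  unfolding ctensor_smult_eq by (rule ctensor_map_add_right[OF X X id hc gc hg(1) _ xc]) simp
 show "(h \<otimes>\<^bsub>?E\<^esub> g) \<odot>\<^bsub>ctensor L \<sigma> A B\<^esub> x = h \<odot>\<^bsub>ctensor L \<sigma> A B\<^esub> (g \<odot>\<^bsub>ctensor L \<sigma> A B\<^esub> x)"
  unfolding ctensor_smult_eq ctensor_map_compose[OF X X X id gc id hc xc]
  by (rule ctensor_map_cong[OF X X id hg(2) id cont_hom_compose[OF gc hc] _ _ xc]) (simp_all add: compose_def)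
next
 note X = ctensor_prod_axioms
 fix x assume "x \<in> carrier (ctensor L \<sigma> A B)"
 hence x: "x \<in> C" by (simp add: ctensor_carrier_eq)
 have one: "\<one>\<^bsub>End_ring L B\<^esub> \<in> cont_hom L B B" using cont_hom_restrict[OF B cont_hom_id] by simp
 have "\<one>\<^bsub>End_ring L B\<^esub> \<odot>\<^bsub>ctensor L \<sigma> A B\<^esub> x = ctensor_map L \<sigma> A B A B (%a. a) (%b. b) x"
  unfolding ctensor_smult_eq by (rule ctensor_map_cong[OF X X cont_hom_id one cont_hom_id cont_hom_id _ _ x]) simp_all
 thus "\<one>\<^bsub>End_ring L B\<^esub> \<odot>\<^bsub>ctensor L \<sigma> A B\<^esub> x = x" using ctensor_map_id[OF X x] by simp
qed

section \<open>Vector spaces over finite division rings\<close>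

text \<open>A left inverse of a scalar recovers \<open>b\<close> from \<open>a \<odot> b\<close>,
  which is all that independence arguments require; finiteness of \<open>E\<close> turns dimension
  into a logarithm of cardinality.\<close>

locale fin_div_space = left_module E V for E :: "('e, 'x) ring_scheme" and V :: "('e, 'v, 'y) module_scheme" (structure) +
 assumes E_finite: "finite (carrier E)" and E_one: "\<one>\<^bsub>E\<^esub> ~= \<zero>\<^bsub>E\<^esub>"
  and E_inv: "!!a. a \<in> carrier E ==> a ~= \<zero>\<^bsub>E\<^esub> ==> \<exists>b\<in>carrier E. b \<otimes>\<^bsub>E\<^esub> a = \<one>\<^bsub>E\<^esub>"
begin

lemma card_E: "card (carrier E) > 1"
proof -
 have "{\<zero>\<^bsub>E\<^esub>, \<one>\<^bsub>E\<^esub>} \<subseteq> carrier E" by simp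
 from card_mono[OF E_finite this] show ?thesis using E_one by simp
qed

lemma lin_span_submodule: "B \<subseteq> carrier V ==> submodule (lin_span E V B) E V"
 unfolding lin_span_def using submod_carrier by (intro submod_Inter) auto

lemma lin_span_superset: "B \<subseteq> lin_span E V B" by (auto simp: lin_span_def)

lemma lin_span_least: "submodule W E V ==> B \<subseteq> W ==> lin_span E V B \<subseteq> W" by (auto simp: lin_span_def)

lemma lin_span_mono: "B \<subseteq> B' ==> lin_span E V B \<subseteq> lin_span E V B'" by (auto simp: lin_span_def)

lemma lin_span_subset: "B \<subseteq> carrier V ==> lin_span E V B \<subseteq> carrier V"
 using lin_span_submodule submod_subset by blast

lemma lin_span_empty: "lin_span E V {} = {\<zero>}"
 using lin_span_least[OF submod_sing_zero, of "{}"] submod_zero[OF lin_span_submodule, of "{}"] by auto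

lemma lin_span_insert:
 assumes b: "b \<in> carrier V" and B: "B \<subseteq> carrier V"
 shows "lin_span E V (insert b B) = (\<lambda>(a, w). a \<odot> b \<oplus> w) ` (carrier E \<times> lin_span E V B)" (is "?l = ?r")
proof -
 let ?c = "(%a. a \<odot> b) ` carrier E" and ?S = "lin_span E V B"
 have r: "?r = ?c <+>\<^bsub>V\<^esub> ?S" by (force simp: set_add_def')
 note cy = submod_cyclic[OF b] and S = lin_span_submodule[OF B]
 have "b \<in> ?c" using smult_one[OF b] by (intro image_eqI[of _ _ "\<one>\<^bsub>E\<^esub>"]) auto
 hence "insert b B \<subseteq> ?c <+>\<^bsub>V\<^esub> ?S" using subset_set_add[OF cy S] lin_span_superset[of B] by blast
 hence 1: "?l \<subseteq> ?c <+>\<^bsub>V\<^esub> ?S" by (intro lin_span_least submod_set_add cy S)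
 have l: "submodule ?l E V" using b B by (intro lin_span_submodule) auto
 have "?c \<subseteq> ?l" using lin_span_superset[of "insert b B"] by (auto intro!: submod_smult[OF l])
 hence "?c <+>\<^bsub>V\<^esub> ?S \<subseteq> ?l" by (intro set_add_least[OF l] lin_span_mono) auto
 thus ?thesis using 1 r by blast
qed

text \<open>Each independent vector multiplies the size of the span by
  \<open>card (carrier E)\<close>: two expressions of one element with different coefficients at
  \<open>b\<close> would put \<open>b\<close> into the span of the other vectors.\<close>

lemma card_lin_span:
 assumes "finite B" "B \<subseteq> carrier V" "!!b. b \<in> B ==> b \<notin> lin_span E V (B - {b})"
 shows "finite (lin_span E V B) & card (lin_span E V B) = card (carrier E) ^ card B" using assms
proof (induction B rule: finite_induct)
 case empty thus ?case by (simp add: lin_span_empty)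
next
 case (insert b B)
 have b: "b \<in> carrier V" "B \<subseteq> carrier V" using insert.prems by auto
 let ?S = "lin_span E V B"
 have "x \<notin> lin_span E V (B - {x})" if x: "x \<in> B" for x
  using insert.prems(2)[of x] x lin_span_mono[of "B - {x}" "insert b B - {x}"] by auto
 hence IH: "finite ?S" "card ?S = card (carrier E) ^ card B" using insert.IH b by auto
 have bS: "b \<notin> ?S" using insert.prems(2)[of b] insert.hyps by simp
 note S = lin_span_submodule[OF b(2)] and Sc = subsetD[OF lin_span_subset[OF b(2)]]
 have inj: "inj_on (\<lambda>(a, w). a \<odot> b \<oplus> w) (carrier E \<times> ?S)"
 proof (rule inj_onI, clarify)
  fix a w a' w' assume a: "a \<in> carrier E" "a' \<in> carrier E" and w: "w \<in> ?S" "w' \<in> ?S"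
   and eq: "a \<odot> b \<oplus> w = a' \<odot> b \<oplus> w'"
  note c = smult_closed[OF a(1) b(1)] smult_closed[OF a(2) b(1)] Sc[OF w(1)] Sc[OF w(2)]
  have "(a \<ominus>\<^bsub>E\<^esub> a') \<odot> b = a \<odot> b \<ominus> a' \<odot> b"
   using a b by (simp add: a_minus_def smult_l_distr smult_minus_l)
  also have "... = w' \<ominus> w"
  proof -
   have "a \<odot> b = (a \<odot> b \<oplus> w) \<ominus> w" using c by (simp add: M.minus_eq M.a_assoc M.r_neg)
   hence "a \<odot> b \<ominus> a' \<odot> b = ((a' \<odot> b \<oplus> w') \<ominus> w) \<ominus> a' \<odot> b" using eq by simp
   also have "... = (a' \<odot> b \<oplus> (w' \<ominus> w)) \<oplus> \<ominus> (a' \<odot> b)" using c by (simp add: M.minus_eq M.a_assoc)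
   also have "... = (w' \<ominus> w) \<oplus> (a' \<odot> b \<oplus> \<ominus> (a' \<odot> b))"
    using c M.a_comm[of "a' \<odot> b" "w' \<ominus> w"] by (simp add: M.a_assoc)
   finally show ?thesis using c by (simp add: M.r_neg)
  qed
  finally have d: "(a \<ominus>\<^bsub>E\<^esub> a') \<odot> b \<in> ?S" using submod_minus[OF S w(2,1)] by simp
  have "a \<ominus>\<^bsub>E\<^esub> a' = \<zero>\<^bsub>E\<^esub>"
  proof (rule ccontr)
   assume ne: "a \<ominus>\<^bsub>E\<^esub> a' ~= \<zero>\<^bsub>E\<^esub>"
   have ac: "a \<ominus>\<^bsub>E\<^esub> a' \<in> carrier E" using a by simp
   obtain e where e: "e \<in> carrier E" "e \<otimes>\<^bsub>E\<^esub> (a \<ominus>\<^bsub>E\<^esub> a') = \<one>\<^bsub>E\<^esub>" using E_inv[OF ac ne] by blast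
   have "e \<odot> ((a \<ominus>\<^bsub>E\<^esub> a') \<odot> b) = b"
    using smult_assoc1[OF e(1) ac b(1)] e(2) smult_one[OF b(1)] by simp
   thus False using submod_smult[OF S e(1) d] bS by simp
  qed
  hence aa: "a = a'" using a R.minus_eq[of a a'] by (metis R.add.inv_closed R.minus_equality R.minus_minus R.add.m_comm)
  hence "w = w'" using eq c by simp
  thus "a = a' & w = w'" using aa by simp
 qed
 show ?case unfolding lin_span_insert[OF b] using IH E_finite insert.hyps by (simp add: card_image[OF inj] card_cartesian_product)
qed

lemma card_lin_basis:
 assumes "finite B" "lin_basis E V B"
 shows "finite (carrier V)" "card (carrier V) = card (carrier E) ^ card B"
 using card_lin_span[OF assms(1)] assms(2) by (auto simp: lin_basis_def)

text \<open>A spanning set of least cardinality is independent.\<close>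

lemma ex_lin_basis:
 assumes fin: "finite (carrier V)" obtains B where "finite B" "lin_basis E V B"
proof -
 let ?P = "%B. B \<subseteq> carrier V & lin_span E V B = carrier V"
 have "?P (carrier V)" using lin_span_superset[of "carrier V"] lin_span_subset[of "carrier V"] by auto
 then obtain B where B: "?P B" and min: "!!B'. ?P B' ==> card B \<le> card B'"
  using ex_has_least_nat[of ?P "carrier V" card] by blast
 have fB: "finite B" using B fin finite_subset by blast
 have "b \<notin> lin_span E V (B - {b})" if b: "b \<in> B" for b
 proof
  assume *: "b \<in> lin_span E V (B - {b})"
  have sub: "B - {b} \<subseteq> carrier V" using B by auto
  have "B \<subseteq> lin_span E V (B - {b})" using * lin_span_superset[of "B - {b}"] by auto
  hence "lin_span E V B \<subseteq> lin_span E V (B - {b})" by (intro lin_span_least lin_span_submodule sub)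
  hence "?P (B - {b})" using B sub lin_span_subset[OF sub] by auto
  from leD[OF min[OF this]] card_Diff1_less[OF fB b] show False by (rule notE)
 qed
 hence "lin_basis E V B" using B by (simp add: lin_basis_def)
 thus ?thesis using that fB by blast
qed

lemma lin_dim_finite:
 assumes fin: "finite (carrier V)"
 obtains d where "lin_dim E V = enat d" "card (carrier V) = card (carrier E) ^ d"
proof -
 obtain B where B: "finite B" "lin_basis E V B" using ex_lin_basis[OF fin] by blast
 have un: "card B' = card B" if "finite B'" "lin_basis E V B'" for B'
  using card_lin_basis(2)[OF B] card_lin_basis(2)[OF that] card_E by (metis power_inject_exp)
 have "z = enat (card B)" if z: "z \<in> {enat (card B) |B. finite B & lin_basis E V B}" for z
 proof -
  obtain B' where "z = enat (card B')" "finite B'" "lin_basis E V B'" using z by auto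
  thus ?thesis using un[of B'] by simp
 qed
 moreover have "enat (card B) \<in> {enat (card B) |B. finite B & lin_basis E V B}" using B by auto
 ultimately have "{enat (card B) |B. finite B & lin_basis E V B} = {enat (card B)}" by (intro equalityI subsetI) simp_all
 hence "lin_dim E V = enat (card B)" by (simp only: lin_dim_def cInf_singleton)
 thus ?thesis using that card_lin_basis(2)[OF B] by blast
qed

text \<open>A finite basis over a finite ring would make the space finite, so the infimum runs over
  the empty set.\<close>

lemma lin_dim_infinite:
 assumes "infinite (carrier V)" shows "lin_dim E V = \<infinity>"
proof -
 have "{enat (card B) |B. finite B & lin_basis E V B} = {}" using card_lin_basis(1) assms by auto
 hence "lin_dim E V = Inf {}" by (simp only: lin_dim_def)
 thus ?thesis by (simp add: top_enat_def)
qed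

end

text \<open>With q the size of \<open>E\<close>, |V| = q^d and |W| = q^e, the ratio d/e is at most
  \<open>n\<close> exactly if q^d is at most q^(n e). The ring \<open>E\<close> disappears from the
  right hand side, which frees the remaining argument from endomorphism rings.\<close>

lemma dim_quotient_le_iff:
 assumes V: "fin_div_space E V" and W: "fin_div_space E W" and fin: "finite (carrier W)" and nt: "card (carrier W) > 1"
 shows "ennreal_of_enat (lin_dim E V) / ennreal_of_enat (lin_dim E W) \<le> of_nat n \<longleftrightarrow>
  finite (carrier V) & card (carrier V) \<le> card (carrier W) ^ n"
proof -
 interpret V: fin_div_space E V by fact
 interpret W: fin_div_space E W by fact
 obtain e where e: "lin_dim E W = enat e" "card (carrier W) = card (carrier E) ^ e" by (rule W.lin_dim_finite[OF fin])
 have e0: "e > 0" using nt e by (cases e) auto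
 show ?thesis
 proof (cases "finite (carrier V)")
  case True
  obtain d where d: "lin_dim E V = enat d" "card (carrier V) = card (carrier E) ^ d" by (rule V.lin_dim_finite[OF True])
  have "ennreal_of_enat (lin_dim E V) / ennreal_of_enat (lin_dim E W) = ennreal (real d / real e)"
   using e0 by (simp add: d(1) e(1) ennreal_of_nat_eq_real_of_nat divide_ennreal)
  also have "... \<le> of_nat n \<longleftrightarrow> real d / real e \<le> real n" by (simp add: ennreal_of_nat_eq_real_of_nat)
  also have "... \<longleftrightarrow> d \<le> n * e" using e0 by (simp add: divide_le_eq flip: of_nat_mult)
  also have "... \<longleftrightarrow> card (carrier V) \<le> card (carrier W) ^ n"
   unfolding d(2) e(2) using V.card_E by (simp add: power_mult[symmetric] mult.commute)
  finally show ?thesis using True by simp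
 next
  case False
  hence "ennreal_of_enat (lin_dim E V) / ennreal_of_enat (lin_dim E W) = \<infinity>"
   using e0 by (simp add: V.lin_dim_infinite e(1) ennreal_top_divide)
  thus ?thesis using False by (simp add: top_unique)
 qed
qed

section \<open>Characters of finite elementary abelian groups\<close>

lemma (in group) int_pow_int_exponent_1:
 assumes "x \<in> carrier G" "x [^] (p::nat) = \<one>" shows "x [^] (int p * k) = \<one>"
 using assms by (metis int_pow_int int_pow_one int_pow_pow)

text \<open>For a subgroup W maximal among those omitting \<open>x\<close>, the whole group is W
  times the powers of \<open>x\<close>, and the exponent of \<open>x\<close> is determined modulo
  \<open>p\<close>. This exponent is the character.\<close>

lemma char_exists:
 fixes V (structure)
 assumes V: "comm_group V" and fin: "finite (carrier V)" and p: "prime (p::nat)"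
  and tor: "!!x. x \<in> carrier V ==> x [^] p = \<one>" and x: "x \<in> carrier V" "x ~= \<one>"
 obtains \<theta> where "\<theta> \<in> hom V (integer_mod_group p)" "\<theta> x = 1"
proof -
 interpret V: comm_group V by fact
 have p0: "p > 1" using p prime_gt_1_nat by blast
 let ?P = "%W. subgroup W V & x \<notin> W"
 have "?P {\<one>}" using V.triv_subgroup x by auto
 moreover have "\<forall>W. ?P W --> card W < Suc (card (carrier V))"
  using fin by (auto intro!: card_mono le_imp_less_Suc dest: subgroup.subset)
 ultimately have "\<exists>W. ?P W & (\<forall>W'. ?P W' --> card W' \<le> card W)"
  using ex_has_greatest_nat[of ?P "{\<one>}" card "Suc (card (carrier V))"] by presburger
 then obtain W where W: "subgroup W V" "x \<notin> W" and max: "!!W'. ?P W' ==> card W' \<le> card W" by (elim exE conjE) simp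
 note Wc = subgroup.mem_carrier[OF W(1)]
 have pow_p: "y [^] (int p * k) = \<one>" if "y \<in> carrier V" for y k by (rule V.int_pow_int_exponent_1[OF that tor[OF that]])
 \<comment> \<open>A Bezout coefficient inverts the power map for an exponent prime to
   \<open>p\<close>.\<close>
 have bez: "\<exists>u::int. \<forall>y\<in>carrier V. (y [^] j) [^] u = y" if j: "\<not> int p dvd j" for j :: int
 proof -
  have "coprime (int p) j" using p j by (simp add: prime_imp_coprime)
  then obtain u v where uv: "u * j + v * int p = 1" using bezout_int[of j "int p"] by (metis coprime_iff_gcd_eq_1 gcd.commute)
  have "(y [^] j) [^] u = y" if y: "y \<in> carrier V" for y
  proof -
   have "y = y [^] (j * u + int p * v)" using uv y by (simp add: mult.commute)
   also have "... = y [^] (j * u)" using y pow_p[OF y] by (simp add: V.int_pow_mult)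
   finally show ?thesis using y by (simp add: V.int_pow_pow)
  qed
  thus ?thesis by (rule exI[of _ u, OF ballI])
 qed
 have dvd: "int p dvd j" if "x [^] j \<in> W" for j :: int
 proof (rule ccontr)
  assume "\<not> int p dvd j"
  then obtain u :: int where "(x [^] j) [^] u = x" using bez x by blast
  thus False using V.subgroup_int_pow_closed[OF W(1) that, of u] W(2) by simp
 qed
 \<comment> \<open>For \<open>v\<close> outside \<open>W\<close>, maximality puts \<open>x\<close>
   into the subgroup generated by \<open>W\<close> and \<open>v\<close>, so x = w v^j. Here
   \<open>p\<close> does not divide j, as otherwise \<open>x\<close> would lie in \<open>W\<close>;
   inverting j solves for \<open>v\<close>.\<close>
 have dec: "\<exists>w\<in>W. \<exists>k::int. v = w \<otimes> x [^] k" if v: "v \<in> carrier V" for v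
 proof (cases "v \<in> W")
  case True thus ?thesis using v by (intro bexI[of _ v] exI[of _ 0]) auto
 next
  case False
  let ?G = "generate V {v}"
  have G: "subgroup ?G V" using V.generate_is_subgroup[of "{v}"] v by simp
  have sg: "subgroup (W <#>\<^bsub>V\<^esub> ?G) V" by (rule V.mult_subgroups[OF W(1) G])
  have mem: "w \<otimes> v [^] (k::int) \<in> W <#>\<^bsub>V\<^esub> ?G" if "w \<in> W" for w k
   using that unfolding set_mult_def V.generate_pow[OF v] by blast
  have "W \<subseteq> W <#>\<^bsub>V\<^esub> ?G" using mem[of _ 0] Wc by auto
  moreover have "v \<in> W <#>\<^bsub>V\<^esub> ?G" using mem[OF subgroup.one_closed[OF W(1)], of 1] v by simp
  ultimately have "W \<subset> W <#>\<^bsub>V\<^esub> ?G" using False by blast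
  moreover have "finite (W <#>\<^bsub>V\<^esub> ?G)" using fin subgroup.subset[OF sg] finite_subset by blast
  ultimately have "card W < card (W <#>\<^bsub>V\<^esub> ?G)" by (rule psubset_card_mono[rotated])
  hence "x \<in> W <#>\<^bsub>V\<^esub> ?G" using max[of "W <#>\<^bsub>V\<^esub> ?G"] sg by force
  then obtain w j where w: "w \<in> W" "x = w \<otimes> v [^] (j::int)" unfolding set_mult_def V.generate_pow[OF v] by blast
  have "\<not> int p dvd j"
  proof
   assume "int p dvd j"
   then obtain k where "j = int p * k" by (rule dvdE)
   thus False using w W(2) pow_p[OF v] Wc by simp
  qed
  then obtain u :: int where u: "(v [^] j) [^] u = v" using bez v by blast
  have "x [^] u = w [^] u \<otimes> v" using w Wc v u by (simp add: V.int_pow_distrib)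
  hence "v = inv (w [^] u) \<otimes> x [^] u" using Wc[OF w(1)] v by (simp add: V.m_assoc[symmetric])
  moreover have "inv (w [^] u) \<in> W" by (rule subgroup.m_inv_closed[OF W(1) V.subgroup_int_pow_closed[OF W(1) w(1)]])
  ultimately show ?thesis by blast
 qed
 obtain f where f: "!!v. v \<in> carrier V ==> \<exists>w\<in>W. v = w \<otimes> x [^] (f v :: int)" using dec by metis
 have uniq: "k mod int p = l mod int p" if "w \<in> W" "w' \<in> W" "w \<otimes> x [^] k = w' \<otimes> x [^] l" for w w' k l
 proof -
  have c: "w \<in> carrier V" "w' \<in> carrier V" using that Wc by auto
  have "x [^] k = inv w \<otimes> (w' \<otimes> x [^] l)"
   unfolding that(3)[symmetric] using c x by (simp add: V.m_assoc[symmetric])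
  hence "x [^] (k - l) = inv w \<otimes> w'" using c x by (simp add: V.int_pow_diff V.m_assoc)
  hence "x [^] (k - l) \<in> W" using that subgroup.m_closed[OF W(1)] subgroup.m_inv_closed[OF W(1)] by simp
  from dvd[OF this] show ?thesis by (simp add: mod_eq_dvd_iff)
 qed
 let ?\<theta> = "%v. f v mod int p"
 have "?\<theta> \<in> hom V (integer_mod_group p)"
 proof (rule homI)
  show "?\<theta> v \<in> carrier (integer_mod_group p)" for v using p0 by (simp add: carrier_integer_mod_group)
  fix v v' assume v: "v \<in> carrier V" "v' \<in> carrier V"
  obtain w w' w'' where w: "w \<in> W" "v = w \<otimes> x [^] f v" "w' \<in> W" "v' = w' \<otimes> x [^] f v'"
   "w'' \<in> W" "v \<otimes> v' = w'' \<otimes> x [^] f (v \<otimes> v')"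
   using f[OF v(1)] f[OF v(2)] f[OF V.m_closed[OF v]] by blast
  have "v \<otimes> v' = (w \<otimes> x [^] f v) \<otimes> (w' \<otimes> x [^] f v')" using w(2,4) by simp
  also have "... = (w \<otimes> w') \<otimes> x [^] (f v + f v')"
   using Wc[OF w(1)] Wc[OF w(3)] x by (simp add: V.int_pow_mult V.m_ac)
  finally have "w'' \<otimes> x [^] f (v \<otimes> v') = (w \<otimes> w') \<otimes> x [^] (f v + f v')" using w(6) by simp
  from uniq[OF w(5) subgroup.m_closed[OF W(1) w(1,3)] this]
  show "?\<theta> (v \<otimes> v') = ?\<theta> v \<otimes>\<^bsub>integer_mod_group p\<^esub> ?\<theta> v'" by (simp add: mod_add_eq)
 qed
 moreover have "?\<theta> x = 1"
 proof -
  obtain w where "w \<in> W" "x = w \<otimes> x [^] f x" using f[OF x(1)] by blast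
  hence "f x mod int p = 1 mod int p" using x by (intro uniq[of w "\<one>"]) (auto simp: subgroup.one_closed[OF W(1)])
  thus ?thesis using p0 by simp
 qed
 ultimately show ?thesis using that by blast
qed

abbreviation chars :: "nat => ('v, 'x) monoid_scheme => ('v => int) set" where
 "chars p V \<equiv> hom V (integer_mod_group p) \<inter> extensional (carrier V)"

text \<open>Induction over the kernel of a character with value 1 at some \<open>x\<close>. A
  character is determined by its restriction to that kernel and by its value at \<open>x\<close>,
  for which there are at most \<open>p\<close> choices, while the kernel has index at least
  \<open>p\<close>.\<close>

lemma card_chars:
 assumes "comm_group V" "finite (carrier V)" "prime (p::nat)"
  "!!x. x \<in> carrier V ==> x [^]\<^bsub>V\<^esub> p = \<one>\<^bsub>V\<^esub>"
 shows "finite (chars p V) & card (chars p V) \<le> card (carrier V)" using assms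
proof (induction "card (carrier V)" arbitrary: V rule: less_induct)
 case less
 interpret V: comm_group V by fact
 have p0: "p > 1" using less.prems prime_gt_1_nat by blast
 show ?case
 proof (cases "\<exists>x\<in>carrier V. x ~= \<one>\<^bsub>V\<^esub>")
  case False
  hence V1: "carrier V = {\<one>\<^bsub>V\<^esub>}" by auto
  have "chars p V \<subseteq> {\<lambda>x\<in>carrier V. 0}"
  proof
   fix \<phi> assume \<phi>: "\<phi> \<in> chars p V"
   have "\<phi> \<one>\<^bsub>V\<^esub> = 0" using hom_one[of \<phi> V "integer_mod_group p"] \<phi> V.is_group by simp
   hence "\<phi> = (\<lambda>x\<in>carrier V. 0)" using \<phi> V1 by (intro extensionalityI[of _ "carrier V"]) auto
   thus "\<phi> \<in> {\<lambda>x\<in>carrier V. 0}" by simp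
  qed
  from finite_subset[OF this] card_mono[OF _ this]
  have "finite (chars p V) & card (chars p V) \<le> 1" by simp
  thus ?thesis using V1 by simp
 next
  case True
  then obtain x where x: "x \<in> carrier V" "x ~= \<one>\<^bsub>V\<^esub>" by blast
  obtain \<theta> where \<theta>: "\<theta> \<in> hom V (integer_mod_group p)" "\<theta> x = 1"
   by (rule char_exists[OF less.prems(1-3) less.prems(4) x])
  let ?W = "{v \<in> carrier V. \<theta> v = 0}"
  let ?V = "V\<lparr>carrier := ?W\<rparr>"
  have hom: "group_hom V (integer_mod_group p) \<theta>"
   using \<theta> V.is_group by (simp add: group_hom_def group_hom_axioms_def)
  have "subgroup (kernel V (integer_mod_group p) \<theta>) V" by (rule group_hom.subgroup_kernel[OF hom])
  hence W: "subgroup ?W V" by (simp add: kernel_def)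
  have xk: "\<theta> (x [^]\<^bsub>V\<^esub> k) = k mod int p" for k :: int
   using group_hom.hom_int_pow[OF hom x(1), of k] \<theta>(2) by (simp add: int_pow_integer_mod_group)
  have \<theta>m: "\<theta> (v \<otimes>\<^bsub>V\<^esub> w) = (\<theta> v + \<theta> w) mod int p" if "v \<in> carrier V" "w \<in> carrier V" for v w
   using hom_mult[OF \<theta>(1) that] by simp
  have \<theta>r: "0 \<le> \<theta> v" "\<theta> v < int p" if "v \<in> carrier V" for v
   using hom_in_carrier[OF \<theta>(1) that] p0 by (auto simp: carrier_integer_mod_group)
  have fW: "finite ?W" using less.prems(2) by simp
  have inj: "inj_on (\<lambda>(w, k). w \<otimes>\<^bsub>V\<^esub> x [^]\<^bsub>V\<^esub> k) (?W \<times> {0..<int p})"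
  proof (rule inj_onI, clarify)
   fix w k w' k' assume w: "w \<in> carrier V" "\<theta> w = 0" "w' \<in> carrier V" "\<theta> w' = 0"
    and k: "k \<in> {0..<int p}" "k' \<in> {0..<int p}" and eq: "w \<otimes>\<^bsub>V\<^esub> x [^]\<^bsub>V\<^esub> k = w' \<otimes>\<^bsub>V\<^esub> x [^]\<^bsub>V\<^esub> k'"
   have "\<theta> (w \<otimes>\<^bsub>V\<^esub> x [^]\<^bsub>V\<^esub> k) = k" "\<theta> (w' \<otimes>\<^bsub>V\<^esub> x [^]\<^bsub>V\<^esub> k') = k'"
    using w k x by (simp_all add: \<theta>m xk)
   hence "k = k'" using eq by simp
   thus "w = w' & k = k'" using eq w x by simp
  qed
  have "(\<lambda>(w, k). w \<otimes>\<^bsub>V\<^esub> x [^]\<^bsub>V\<^esub> k) ` (?W \<times> {0..<int p}) \<subseteq> carrier V" using x by auto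
  from card_inj_on_le[OF inj this less.prems(2)]
  have cardV: "card ?W * p \<le> card (carrier V)" by (simp add: card_cartesian_product)
  have "\<one>\<^bsub>V\<^esub> \<in> ?W" using subgroup.one_closed[OF W] .
  hence "card ?W > 0" using fW card_gt_0_iff by blast
  hence "card ?W < card ?W * p" using p0 by simp
  from less_le_trans[OF this cardV] have lt: "card (carrier ?V) < card (carrier V)" by simp
  have comm: "comm_group ?V" using V.subgroup_imp_group[OF W] by (rule group.group_comm_groupI) (auto simp: V.m_comm)
  have IH: "finite (chars p ?V) & card (chars p ?V) \<le> card (carrier ?V)"
  proof (rule less.hyps[OF lt comm _ less.prems(3)])
   show "v [^]\<^bsub>?V\<^esub> p = \<one>\<^bsub>?V\<^esub>" if "v \<in> carrier ?V" for v
    using less.prems(4)[of v] that V.nat_pow_consistent[of v p ?W] by simp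
  qed (use fW in simp)
  let ?r = "%\<phi>. (restrict \<phi> ?W, \<phi> x)"
  have img: "?r ` chars p V \<subseteq> chars p ?V \<times> {0..<int p}"
  proof
   fix q assume "q \<in> ?r ` chars p V"
   then obtain \<phi> where \<phi>: "\<phi> \<in> hom V (integer_mod_group p)" "q = ?r \<phi>" by auto
   have "restrict \<phi> ?W \<in> hom ?V (integer_mod_group p)"
   proof (rule homI)
    fix v w assume "v \<in> carrier ?V" "w \<in> carrier ?V"
    thus "restrict \<phi> ?W (v \<otimes>\<^bsub>?V\<^esub> w) = restrict \<phi> ?W v \<otimes>\<^bsub>integer_mod_group p\<^esub> restrict \<phi> ?W w"
     using hom_mult[OF \<phi>(1), of v w] \<theta>m[of v w] by simp
   qed (use hom_in_carrier[OF \<phi>(1)] in auto)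
   thus "q \<in> chars p ?V \<times> {0..<int p}"
    using hom_in_carrier[OF \<phi>(1) x(1)] \<phi>(2) p0 by (auto simp: carrier_integer_mod_group)
  qed
  have "inj_on ?r (chars p V)"
  proof (rule inj_onI)
   fix \<phi> \<psi> assume \<phi>: "\<phi> \<in> chars p V" and \<psi>: "\<psi> \<in> chars p V" and eq: "?r \<phi> = ?r \<psi>"
   show "\<phi> = \<psi>"
   proof (rule extensionalityI[of _ "carrier V"])
    fix v assume v: "v \<in> carrier V"
    \<comment> \<open>The component of \<open>v\<close> in the kernel of \<open>\<theta>\<close>,
      the other component being a power of \<open>x\<close>.\<close>
    let ?w = "v \<otimes>\<^bsub>V\<^esub> x [^]\<^bsub>V\<^esub> (- \<theta> v)"
    have wW: "?w \<in> ?W" using v x by (simp add: \<theta>m xk mod_add_right_eq)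
    have vw: "v = ?w \<otimes>\<^bsub>V\<^esub> x [^]\<^bsub>V\<^esub> \<theta> v"
     using v x by (simp add: V.m_assoc V.int_pow_mult[symmetric])
    have ev: "\<rho> v = (\<rho> ?w + (\<theta> v * \<rho> x) mod int p) mod int p" if "\<rho> \<in> hom V (integer_mod_group p)" for \<rho>
    proof -
     have h: "group_hom V (integer_mod_group p) \<rho>" using that V.is_group by (simp add: group_hom_def group_hom_axioms_def)
     have "\<rho> v = \<rho> (?w \<otimes>\<^bsub>V\<^esub> x [^]\<^bsub>V\<^esub> \<theta> v)" using vw by simp
     also have "... = (\<rho> ?w + \<rho> (x [^]\<^bsub>V\<^esub> \<theta> v)) mod int p"
      using hom_mult[OF that, of ?w "x [^]\<^bsub>V\<^esub> \<theta> v"] v x by simp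
     finally show ?thesis using group_hom.hom_int_pow[OF h x(1), of "\<theta> v"] by (simp add: int_pow_integer_mod_group)
    qed
    have "restrict \<phi> ?W = restrict \<psi> ?W" using eq by simp
    from fun_cong[OF this, of ?w] have "\<phi> ?w = \<psi> ?w" unfolding restrict_apply'[OF wW] .
    moreover have "\<phi> x = \<psi> x" using eq by simp
    ultimately show "\<phi> v = \<psi> v" using ev[of \<phi>] ev[of \<psi>] \<phi> \<psi> by simp
   qed (use \<phi> \<psi> in auto)
  qed
  moreover have finp: "finite (chars p ?V \<times> {0..<int p})" using IH by simp
  ultimately have "finite (chars p V)" "card (chars p V) \<le> card (chars p ?V \<times> {0..<int p})"
   using inj_on_finite[OF _ img] card_inj_on_le[OF _ img] by blast+
  moreover have "card (chars p ?V \<times> {0..<int p}) \<le> card ?W * p" using IH by (simp add: card_cartesian_product)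
  ultimately show ?thesis using cardV by linarith
 qed
qed

lemma continuous_map_discrete:
 "f \<in> S \<rightarrow> T ==> continuous_map (discrete_topology S) (discrete_topology T) f" by (auto simp: continuous_map_def)

text \<open>For a finite discrete module, joint continuity of the action amounts to openness of the
  set of scalars that carry one given element to another.\<close>

lemma discrete_profinite_module:
 fixes L :: "('l, 'x) top_ring_scheme" and S :: "('l, 's, 'y) top_module_scheme"
 assumes L: "profinite_ring L" and S: "left_module L S" and fin: "finite (carrier S)"
  and top: "mtop S = discrete_topology (carrier S)"
  and act: "!!x y. x \<in> carrier S ==> y \<in> carrier S ==> openin (rtop L) {a \<in> carrier L. a \<odot>\<^bsub>S\<^esub> x = y}"
 shows "profinite_module L S"
proof -
 interpret S: left_module L S by fact
 have tL: "topspace (rtop L) = carrier L" using L by (simp add: profinite_ring_def)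
 have dd: "prod_topology (discrete_topology (carrier S)) (discrete_topology (carrier S)) =
   discrete_topology (carrier S \<times> carrier S)" by (simp add: prod_topology_discrete_topology)
 show ?thesis unfolding profinite_module_def
 proof (intro conjI)
  show "profinite_space (mtop S)" using fin by (simp add: top profinite_space_discrete)
  show "continuous_map (prod_topology (mtop S) (mtop S)) (mtop S) (\<lambda>(x, y). x \<oplus>\<^bsub>S\<^esub> y)"
   unfolding top dd by (rule continuous_map_discrete) auto
  show "continuous_map (mtop S) (mtop S) (%x. \<ominus>\<^bsub>S\<^esub> x)" unfolding top by (rule continuous_map_discrete) auto
  show "continuous_map (prod_topology (rtop L) (mtop S)) (mtop S) (\<lambda>(a, x). a \<odot>\<^bsub>S\<^esub> x)"
   unfolding continuous_map_def
  proof (intro conjI allI impI)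
   show "(\<lambda>(a, x). a \<odot>\<^bsub>S\<^esub> x) \<in> topspace (prod_topology (rtop L) (mtop S)) \<rightarrow> topspace (mtop S)"
    using S.smult_closed by (auto simp: top tL)
   fix W assume "openin (mtop S) W"
   show "openin (prod_topology (rtop L) (mtop S)) {q \<in> topspace (prod_topology (rtop L) (mtop S)). (\<lambda>(a, x). a \<odot>\<^bsub>S\<^esub> x) q \<in> W}"
   proof (subst openin_subopen, intro ballI)
    fix q assume "q \<in> {q \<in> topspace (prod_topology (rtop L) (mtop S)). (\<lambda>(a, x). a \<odot>\<^bsub>S\<^esub> x) q \<in> W}"
    then obtain l x where q: "q = (l, x)" "l \<in> carrier L" "x \<in> carrier S" "l \<odot>\<^bsub>S\<^esub> x \<in> W"
     by (auto simp: top tL)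
    let ?V = "{a \<in> carrier L. a \<odot>\<^bsub>S\<^esub> x = l \<odot>\<^bsub>S\<^esub> x}"
    have "openin (prod_topology (rtop L) (mtop S)) (?V \<times> {x})"
     using act[OF q(3) S.smult_closed[OF q(2,3)]] q(3) by (simp add: openin_prod_Times_iff top)
    moreover have "q \<in> ?V \<times> {x}" "?V \<times> {x} \<subseteq> {q \<in> topspace (prod_topology (rtop L) (mtop S)). (\<lambda>(a, x). a \<odot>\<^bsub>S\<^esub> x) q \<in> W}"
     using q by (auto simp: top tL)
    ultimately show "\<exists>T. openin (prod_topology (rtop L) (mtop S)) T & q \<in> T &
      T \<subseteq> {q \<in> topspace (prod_topology (rtop L) (mtop S)). (\<lambda>(a, x). a \<odot>\<^bsub>S\<^esub> x) q \<in> W}" by blast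
   qed
  qed
 qed (use S top in simp_all)
qed

section \<open>Simple modules and their duals\<close>

text \<open>These are the properties of the antipode of a completed group algebra: a continuous
  involutive anti-automorphism. The arguments about modules are carried out over any such
  ring.\<close>

locale inv_ring = prof_ring L for L :: "('l, 'x) top_ring_scheme" +
 fixes \<sigma> :: "'l => 'l"
 assumes \<sigma>_closed [simp]: "a \<in> carrier L ==> \<sigma> a \<in> carrier L"
  and \<sigma>_add: "a \<in> carrier L ==> b \<in> carrier L ==> \<sigma> (a \<oplus>\<^bsub>L\<^esub> b) = \<sigma> a \<oplus>\<^bsub>L\<^esub> \<sigma> b"
  and \<sigma>_mult: "a \<in> carrier L ==> b \<in> carrier L ==> \<sigma> (a \<otimes>\<^bsub>L\<^esub> b) = \<sigma> b \<otimes>\<^bsub>L\<^esub> \<sigma> a"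
  and \<sigma>_one: "\<sigma> \<one>\<^bsub>L\<^esub> = \<one>\<^bsub>L\<^esub>"
  and \<sigma>_inv [simp]: "a \<in> carrier L ==> \<sigma> (\<sigma> a) = a"
  and \<sigma>_cont: "continuous_map (rtop L) (rtop L) \<sigma>"
begin

lemma \<sigma>_fun: "\<sigma> \<in> carrier L \<rightarrow> carrier L" by auto

end

locale simple_mod = prof_module L M for L :: "('l, 'x) top_ring_scheme" and M :: "('l, 'm) top_module" (structure) +
 assumes ring_profinite: "profinite_ring L" and simple: "simple_module L M"
begin

lemma nontrivial: "\<exists>x\<in>carrier M. x ~= \<zero>" using simple M.zero_closed by (auto simp: simple_module_def)

text \<open>Some open submodule omits a given nonzero element; being closed and proper it is zero.
  The topology is therefore discrete, and compactness makes the module finite.\<close>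

lemma open_zero: "open_submodule {\<zero>} L M"
proof -
 obtain x where x: "x \<in> carrier M" "x ~= \<zero>" using nontrivial by blast
 obtain U where U: "open_submodule U L M" "x \<notin> U" by (rule open_submodule_separate[OF ring_profinite x])
 have "U = {\<zero>} \<or> U = carrier M" using simple open_submodule_closed[OF U(1)] by (simp add: simple_module_def)
 thus ?thesis using U x by auto
qed

lemma openin_subset: "S \<subseteq> carrier M ==> openin (mtop M) S"
proof (subst openin_subopen, intro ballI)
 fix a assume S: "S \<subseteq> carrier M" and a: "a \<in> S"
 hence ac: "a \<in> carrier M" by auto
 have "openin (mtop M) {x \<in> carrier M. \<ominus> a \<oplus> x \<in> {\<zero>}}"
  using open_submodD(2)[OF open_zero] ac by (intro openin_translate) auto
 moreover have "{x \<in> carrier M. \<ominus> a \<oplus> x \<in> {\<zero>}} = {a}"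
 proof -
  have "x = a" if "x \<in> carrier M" "\<ominus> a \<oplus> x = \<zero>" for x
   using that ac by (metis M.add.inv_closed M.minus_equality M.minus_minus M.a_comm)
  thus ?thesis using ac by (auto simp: M.l_neg)
 qed
 ultimately show "\<exists>T. openin (mtop M) T & a \<in> T & T \<subseteq> S" using a by auto
qed

lemma mtop_discrete: "mtop M = discrete_topology (carrier M)"
 using openin_subset discrete_topology_unique[of "carrier M" "mtop M"] by auto

lemma finite_carrier: "finite (carrier M)"
proof -
 have "compact_space (discrete_topology (carrier M))" using compact mtop_discrete by simp
 thus ?thesis by (simp add: compact_space_discrete_topology)
qed

lemma open_submod: "submodule N L M ==> open_submodule N L M"
 using openin_subset[of N] submod_subset[of N] by (simp add: open_submodule_def)

lemma submod_cases: "submodule N L M ==> N = {\<zero>} \<or> N = carrier M"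
 using simple open_submodule_closed[OF open_submod] by (simp add: simple_module_def)

lemma card_gt_1: "card (carrier M) > 1"
proof -
 obtain x where x: "x \<in> carrier M" "x ~= \<zero>" using nontrivial by blast
 hence "{x, \<zero>} \<subseteq> carrier M" by simp
 from card_mono[OF finite_carrier this] x show ?thesis by simp
qed

lemma hom_continuous:
 assumes N: "profinite_module L N" and f: "f \<in> mod_hom L M N"
 shows "f \<in> cont_hom L M N"
proof -
 interpret N: prof_module L N by (rule prof_module.intro[OF N])
 have "continuous_map (mtop M) (mtop N) f" unfolding continuous_map_def using mod_homD(1)[OF f] openin_subset by auto
 thus ?thesis using f by (simp add: cont_hom_def mod_hom_def)
qed

text \<open>Schur's lemma: a nonzero endomorphism has zero kernel, and an injective self-map of a
  finite set is bijective.\<close>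

lemma End_div:
 assumes V: "left_module (End_ring L M) V"
 shows "fin_div_space (End_ring L M) V"
proof -
 let ?E = "End_ring L M"
 have "carrier ?E \<subseteq> carrier M \<rightarrow>\<^sub>E carrier M"
 proof
  fix f assume "f \<in> carrier ?E"
  hence "f \<in> cont_hom L M M" "f \<in> extensional (carrier M)" by simp_all
  thus "f \<in> carrier M \<rightarrow>\<^sub>E carrier M" using cont_homD(1)[of f L M M] by (intro PiE_I) (auto dest: extensional_arb)
 qed
 moreover have "finite (carrier M \<rightarrow>\<^sub>E carrier M)" using finite_carrier by (intro finite_PiE) auto
 ultimately have fin: "finite (carrier ?E)" by (rule finite_subset)
 obtain x where x: "x \<in> carrier M" "x ~= \<zero>" using nontrivial by blast
 have one: "\<one>\<^bsub>?E\<^esub> ~= \<zero>\<^bsub>?E\<^esub>"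
 proof
  assume "\<one>\<^bsub>?E\<^esub> = \<zero>\<^bsub>?E\<^esub>"
  from fun_cong[OF this, of x] show False using x by simp
 qed
 have inv: "\<exists>b\<in>carrier ?E. b \<otimes>\<^bsub>?E\<^esub> f = \<one>\<^bsub>?E\<^esub>" if f: "f \<in> carrier ?E" "f ~= \<zero>\<^bsub>?E\<^esub>" for f
 proof -
  have fh: "f \<in> cont_hom L M M" "f \<in> extensional (carrier M)" using f by auto
  note fD = cont_homD[OF fh(1)]
  obtain y where y: "y \<in> carrier M" "f y ~= \<zero>"
  proof -
   have "\<exists>y\<in>carrier M. f y ~= \<zero>"
   proof (rule ccontr)
    assume "\<not> ?thesis"
    hence "f = (\<lambda>x\<in>carrier M. \<zero>)" using fh(2) by (intro extensionalityI[of _ "carrier M"]) auto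
    thus False using f(2) by simp
   qed
   thus ?thesis using that by blast
  qed
  have "submodule (ker_set M M f) L M"
   using closed_submodule_ker[OF profinite profinite fh(1)] by (simp add: closed_submodule_def)
  from submod_cases[OF this] have ker: "ker_set M M f = {\<zero>}" using y by (auto simp: ker_set_def)
  have inj: "inj_on f (carrier M)"
  proof (rule inj_onI)
   fix u v assume uv: "u \<in> carrier M" "v \<in> carrier M" "f u = f v"
   hence "f (u \<ominus> v) = \<zero>"
    using cont_hom_minus(2)[OF profinite profinite fh(1) uv(1,2)] fD(1) by (simp add: M.minus_eq M.r_neg)
   hence "u \<ominus> v \<in> ker_set M M f" using uv by (simp add: ker_set_def)
   thus "u = v" using ker uv minus_eq_zero_iff by simp
  qed
  have sub: "f ` carrier M \<subseteq> carrier M" using fD(1) by auto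
  have surj: "f ` carrier M = carrier M" by (rule endo_inj_surj[OF finite_carrier sub inj])
  let ?g = "the_inv_into (carrier M) f"
  have fg: "f (?g u) = u" "?g u \<in> carrier M" if "u \<in> carrier M" for u
   using that surj inj f_the_inv_into_f[OF inj, of u] the_inv_into_into[OF inj, of u "carrier M"] by auto
  have gf: "?g (f u) = u" if "u \<in> carrier M" for u using the_inv_into_f_f[OF inj that] .
  have g1: "?g \<in> mod_hom L M M" unfolding mod_hom_def
  proof (intro CollectI conjI ballI funcsetI)
   fix u assume u: "u \<in> carrier M"
   show "?g u \<in> carrier M" by (rule fg(2)[OF u])
   show "?g (u \<oplus> v) = ?g u \<oplus> ?g v" if v: "v \<in> carrier M" for v
    using gf[of "?g u \<oplus> ?g v"] fD(3)[OF fg(2)[OF u] fg(2)[OF v]] fg u v by simp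
   show "?g (a \<odot> u) = a \<odot> ?g u" if a: "a \<in> carrier L" for a
    using gf[of "a \<odot> ?g u"] fD(4)[OF a fg(2)[OF u]] fg u a smult_closed by simp
  qed
  have "restrict ?g (carrier M) \<in> cont_hom L M M" by (rule cont_hom_restrict[OF profinite hom_continuous[OF profinite g1]])
  moreover have "restrict ?g (carrier M) \<otimes>\<^bsub>?E\<^esub> f = \<one>\<^bsub>?E\<^esub>"
   using gf fD(1) by (auto simp: compose_def intro!: restrict_ext)
  ultimately show ?thesis by (intro bexI[of _ "restrict ?g (carrier M)"]) auto
 qed
 show ?thesis by (intro fin_div_space.intro fin_div_space_axioms.intro V fin one inv)
qed

lemma End_module_left_module: "left_module (End_ring L M) (End_module M)"
proof (rule left_module.intro[OF End_ring_ring[OF profinite]])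
 show "abelian_group (End_module M)"
  by (rule abelian_groupI) (auto simp: End_module_def M.a_ac intro!: bexI[of _ "\<ominus> x" for x] M.l_neg)
 show "left_module_axioms (End_ring L M) (End_module M)"
  by (rule left_module_axioms.intro) (auto simp: End_module_def compose_def dest: cont_homD)
qed

text \<open>If n = m p is the least exponent of the additive group, the multiples by m form a
  nonzero submodule, which is all of \<open>M\<close>, and p kills them.\<close>

lemma prime_torsion:
 obtains p :: nat where "prime p" "!!x. x \<in> carrier M ==> x [^]\<^bsub>add_monoid M\<^esub> p = \<zero>"
proof -
 define A where A_eq: "A = add_monoid M"
 have sel: "carrier A = carrier M" "\<one>\<^bsub>A\<^esub> = \<zero>" "!!x y. x \<otimes>\<^bsub>A\<^esub> y = x \<oplus> y" by (simp_all add: A_eq)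
 interpret A: comm_group A unfolding A_eq by (rule M.a_comm_group)
 note simps = A.pow_order_eq_1[unfolded sel] A.nat_pow_eone[unfolded sel] A.nat_pow_closed[unfolded sel]
  A.nat_pow_one[unfolded sel] A.nat_pow_distrib[unfolded sel] A.nat_pow_pow[unfolded sel]
 let ?P = "%n::nat. n > 0 & (\<forall>x\<in>carrier M. x [^]\<^bsub>A\<^esub> n = \<zero>)"
 have "order A > 0" using finite_carrier M.zero_closed by (auto simp: order_def card_gt_0_iff sel)
 hence "?P (order A)" using simps(1) by simp
 then obtain n where n: "?P n" and least: "!!m. ?P m ==> n \<le> m" using exists_least_iff[of ?P] by (metis not_less)
 obtain x where x: "x \<in> carrier M" "x ~= \<zero>" using nontrivial by blast
 have "n ~= 1" using n x simps(2)[of x] by auto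
 then obtain p where p: "prime p" "p dvd n" using prime_factor_nat by blast
 then obtain m where m: "n = m * p" by (auto simp: dvd_def mult.commute)
 have m0: "m > 0" using n m by (cases m) auto
 have mn: "m < n" using m m0 prime_gt_1_nat[OF p(1)] by simp
 have "\<not> ?P m"
 proof
  assume "?P m" from least[OF this] mn show False by simp
 qed
 then obtain y where y: "y \<in> carrier M" "y [^]\<^bsub>A\<^esub> m ~= \<zero>" using m0 by blast
 let ?N = "(%x. x [^]\<^bsub>A\<^esub> m) ` carrier M"
 have "submodule ?N L M"
 proof (rule submodI)
  show "?N \<subseteq> carrier M" using simps(3) by auto
  show "\<zero> \<in> ?N" using simps(4)[of m] by (intro image_eqI[of _ _ \<zero>]) auto
 next
  fix u v assume "u \<in> ?N" "v \<in> ?N"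
  then obtain u' v' where "u' \<in> carrier M" "v' \<in> carrier M" "u = u' [^]\<^bsub>A\<^esub> m" "v = v' [^]\<^bsub>A\<^esub> m" by auto
  thus "u \<oplus> v \<in> ?N" using simps(5)[of u' v' m] by (intro image_eqI[of _ _ "u' \<oplus> v'"]) auto
 next
  fix a u assume a: "a \<in> carrier L" and "u \<in> ?N"
  then obtain u' where u': "u' \<in> carrier M" "u = u' [^]\<^bsub>A\<^esub> m" by auto
  have h: "group_hom A A (%x. a \<odot> x)"
   using a by (intro group_hom.intro group_hom_axioms.intro A.is_group homI) (auto simp: sel smult_closed smult_r_distr)
  from group_hom.hom_nat_pow[OF h, of u' m] u' sel show "a \<odot> u \<in> ?N"
   using smult_closed[OF a] by (intro image_eqI[of _ _ "a \<odot> u'"]) auto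
 qed
 from submod_cases[OF this] have N: "?N = carrier M" using y by auto
 have "z [^]\<^bsub>A\<^esub> p = \<zero>" if z: "z \<in> carrier M" for z
 proof -
  obtain z' where "z' \<in> carrier M" "z = z' [^]\<^bsub>A\<^esub> m" using N z by blast
  thus ?thesis using n simps(6)[of z' m p] m by simp
 qed
 thus ?thesis using that p(1) unfolding A_eq by blast
qed

end

text \<open>The Pontryagin dual of a module killed by \<open>p\<close>, with characters encoded by
  the integers from 0 to \<open>p - 1\<close>. Precomposition with \<open>\<sigma>\<close> makes the
  action a left one.\<close>

definition dual_module ::
  "('l => 'l) => nat => ('l, 'm, 'y) top_module_scheme => ('l, 'm => int) top_module" where
 "dual_module \<sigma> p M =
   \<lparr>carrier = chars p (add_monoid M), monoid.mult = undefined, one = undefined,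
   ring.zero = (\<lambda>x\<in>carrier M. 0), ring.add = (%\<phi> \<psi>. \<lambda>x\<in>carrier M. (\<phi> x + \<psi> x) mod int p),
   smult = (%l \<phi>. \<lambda>x\<in>carrier M. \<phi> (\<sigma> l \<odot>\<^bsub>M\<^esub> x)),
   mtop = discrete_topology (chars p (add_monoid M))\<rparr>"

lemma dual_module_sel [simp]:
 "carrier (dual_module \<sigma> p M) = chars p (add_monoid M)"
 "\<zero>\<^bsub>dual_module \<sigma> p M\<^esub> = (\<lambda>x\<in>carrier M. 0)"
 "\<phi> \<oplus>\<^bsub>dual_module \<sigma> p M\<^esub> \<psi> = (\<lambda>x\<in>carrier M. (\<phi> x + \<psi> x) mod int p)"
 "l \<odot>\<^bsub>dual_module \<sigma> p M\<^esub> \<phi> = (\<lambda>x\<in>carrier M. \<phi> (\<sigma> l \<odot>\<^bsub>M\<^esub> x))"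
 "mtop (dual_module \<sigma> p M) = discrete_topology (chars p (add_monoid M))" by (simp_all add: dual_module_def)

locale simple_dual = simple_mod L M + inv_ring L \<sigma>
 for L :: "('l, 'x) top_ring_scheme" and M :: "('l, 'm) top_module" (structure) and \<sigma> +
 fixes p :: nat
 assumes p: "prime p" and tors: "!!x. x \<in> carrier M ==> x [^]\<^bsub>add_monoid M\<^esub> p = \<zero>"
begin

abbreviation "D \<equiv> dual_module \<sigma> p M"
abbreviation "X \<equiv> chars p (add_monoid M)"

lemma p_gt_1: "p > 1" using p prime_gt_1_nat by blast

lemma charsD:
 assumes "\<phi> \<in> X"
 shows "!!x. x \<in> carrier M ==> 0 \<le> \<phi> x" "!!x. x \<in> carrier M ==> \<phi> x < int p"
  "!!x y. x \<in> carrier M ==> y \<in> carrier M ==> \<phi> (x \<oplus> y) = (\<phi> x + \<phi> y) mod int p"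
  "\<phi> \<in> extensional (carrier M)" "\<phi> \<zero> = 0"
proof -
 have h: "\<phi> \<in> hom (add_monoid M) (integer_mod_group p)" using assms by simp
 show "0 \<le> \<phi> x" "\<phi> x < int p" if "x \<in> carrier M" for x
  using hom_in_carrier[OF h, of x] that p_gt_1 by (auto simp: carrier_integer_mod_group)
 show "\<phi> (x \<oplus> y) = (\<phi> x + \<phi> y) mod int p" if "x \<in> carrier M" "y \<in> carrier M" for x y
  using hom_mult[OF h, of x y] that by simp
 show "\<phi> \<zero> = 0" using hom_one[OF h M.a_group] by simp
qed (use assms in auto)

lemma charsI:
 assumes "!!x. x \<in> carrier M ==> 0 \<le> \<phi> x & \<phi> x < int p"
  "!!x y. x \<in> carrier M ==> y \<in> carrier M ==> \<phi> (x \<oplus> y) = (\<phi> x + \<phi> y) mod int p"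
 shows "(\<lambda>x\<in>carrier M. \<phi> x) \<in> X" using assms p_gt_1 by (auto intro!: homI simp: carrier_integer_mod_group)

lemma chars_ext: "\<phi> \<in> X ==> \<psi> \<in> X ==> (!!x. x \<in> carrier M ==> \<phi> x = \<psi> x) ==> \<phi> = \<psi>"
 using charsD(4) by (intro extensionalityI[of _ "carrier M"]) auto

lemma finite_X: "finite X" and card_X: "card X \<le> card (carrier M)"
 using card_chars[OF M.a_comm_group _ p, of] finite_carrier tors by auto

text \<open>Precomposition reverses the order of two scalars, and \<open>\<sigma>\<close> reverses
  it back.\<close>

lemma dual_left_module: "left_module L D"
proof -
 note cD = charsD
 have add: "(\<lambda>x\<in>carrier M. (\<phi> x + \<psi> x) mod int p) \<in> X" if "\<phi> \<in> X" "\<psi> \<in> X" for \<phi> \<psi>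
 proof (rule charsI)
  show "0 \<le> (\<phi> x + \<psi> x) mod int p & (\<phi> x + \<psi> x) mod int p < int p" for x using p_gt_1 by simp
  show "(\<phi> (x \<oplus> y) + \<psi> (x \<oplus> y)) mod int p = ((\<phi> x + \<psi> x) mod int p + (\<phi> y + \<psi> y) mod int p) mod int p"
   if "x \<in> carrier M" "y \<in> carrier M" for x y
   unfolding cD(3)[OF \<open>\<phi> \<in> X\<close> that] cD(3)[OF \<open>\<psi> \<in> X\<close> that] mod_simps by (simp add: ac_simps)
 qed
 have uminus: "(\<lambda>x\<in>carrier M. (- \<phi> x) mod int p) \<in> X" if "\<phi> \<in> X" for \<phi>
 proof (rule charsI)
  show "0 \<le> (- \<phi> x) mod int p & (- \<phi> x) mod int p < int p" for x using p_gt_1 by simp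
  show "(- \<phi> (x \<oplus> y)) mod int p = ((- \<phi> x) mod int p + (- \<phi> y) mod int p) mod int p"
   if "x \<in> carrier M" "y \<in> carrier M" for x y using cD(3)[OF \<open>\<phi> \<in> X\<close> that] by (simp add: mod_simps)
 qed
 have zero: "(\<lambda>x\<in>carrier M. 0) \<in> X" using p_gt_1 by (intro charsI) auto
 have sm: "(\<lambda>x\<in>carrier M. \<phi> (\<sigma> l \<odot> x)) \<in> X" if "\<phi> \<in> X" "l \<in> carrier L" for \<phi> l
  using cD[OF that(1)] that(2) by (intro charsI) (auto simp: smult_closed smult_r_distr)
 have "abelian_group D"
 proof (rule abelian_groupI, unfold dual_module_sel)
  fix \<phi> \<psi> \<rho> assume a: "\<phi> \<in> X" "\<psi> \<in> X" "\<rho> \<in> X"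
  show "(\<lambda>x\<in>carrier M. ((\<lambda>x\<in>carrier M. (\<phi> x + \<psi> x) mod int p) x + \<rho> x) mod int p) =
   (\<lambda>x\<in>carrier M. (\<phi> x + (\<lambda>x\<in>carrier M. (\<psi> x + \<rho> x) mod int p) x) mod int p)"
   by (rule restrict_ext) (simp add: mod_simps algebra_simps)
 next
  fix \<phi> \<psi> assume "\<phi> \<in> X" "\<psi> \<in> X"
  show "(\<lambda>x\<in>carrier M. (\<phi> x + \<psi> x) mod int p) = (\<lambda>x\<in>carrier M. (\<psi> x + \<phi> x) mod int p)"
   by (rule restrict_ext) (simp add: add.commute)
 next
  fix \<phi> assume a: "\<phi> \<in> X"
  show "(\<lambda>x\<in>carrier M. ((\<lambda>x\<in>carrier M. 0) x + \<phi> x) mod int p) = \<phi>"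
   using cD[OF a] by (intro extensionalityI[of _ "carrier M"]) auto
  show "\<exists>\<psi>\<in>X. (\<lambda>x\<in>carrier M. (\<psi> x + \<phi> x) mod int p) = (\<lambda>x\<in>carrier M. 0)"
   by (rule bexI[OF _ uminus[OF a]]) (auto intro!: restrict_ext simp: mod_simps)
 qed (fact add zero)+
 moreover have "left_module_axioms L D"
 proof (rule left_module_axioms.intro, unfold dual_module_sel)
  fix l k \<phi> assume l: "l \<in> carrier L" and a: "\<phi> \<in> X"
  show "(\<lambda>x\<in>carrier M. \<phi> (\<sigma> l \<odot> x)) \<in> X" by (rule sm[OF a l])
  show "(\<lambda>x\<in>carrier M. \<phi> (\<sigma> (l \<oplus>\<^bsub>L\<^esub> k) \<odot> x)) =
   (\<lambda>x\<in>carrier M. ((\<lambda>x\<in>carrier M. \<phi> (\<sigma> l \<odot> x)) x + (\<lambda>x\<in>carrier M. \<phi> (\<sigma> k \<odot> x)) x) mod int p)" if "k \<in> carrier L"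
   using l that cD(3)[OF a] by (intro restrict_ext) (simp add: \<sigma>_add smult_l_distr smult_closed)
  show "(\<lambda>x\<in>carrier M. \<phi> (\<sigma> (l \<otimes>\<^bsub>L\<^esub> k) \<odot> x)) =
   (\<lambda>x\<in>carrier M. (\<lambda>x\<in>carrier M. \<phi> (\<sigma> k \<odot> x)) (\<sigma> l \<odot> x))" if "k \<in> carrier L"
   using l that by (intro restrict_ext) (simp add: \<sigma>_mult smult_assoc1 smult_closed)
  fix \<psi> assume "\<psi> \<in> X"
  show "(\<lambda>x\<in>carrier M. (\<lambda>x\<in>carrier M. (\<phi> x + \<psi> x) mod int p) (\<sigma> l \<odot> x)) =
   (\<lambda>x\<in>carrier M. ((\<lambda>x\<in>carrier M. \<phi> (\<sigma> l \<odot> x)) x + (\<lambda>x\<in>carrier M. \<psi> (\<sigma> l \<odot> x)) x) mod int p)"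
   using l by (intro restrict_ext) (simp add: smult_closed)
 next
  fix \<phi> assume a: "\<phi> \<in> X"
  show "(\<lambda>x\<in>carrier M. \<phi> (\<sigma> \<one>\<^bsub>L\<^esub> \<odot> x)) = \<phi>"
   using cD(4)[OF a] by (intro extensionalityI[of _ "carrier M"]) (auto simp: \<sigma>_one smult_one)
 qed
 ultimately show ?thesis by (intro left_module.intro ring_axioms)
qed

text \<open>\<open>M\<close> is finite and discrete, so the scalars acting through
  \<open>\<sigma>\<close> as \<open>l0\<close> does are cut out by finitely many open
  conditions.\<close>

lemma openin_same_action:
 assumes "l0 \<in> carrier L"
 shows "openin (rtop L) {l \<in> carrier L. \<forall>x\<in>carrier M. \<sigma> l \<odot> x = \<sigma> l0 \<odot> x}"
proof -
 have "openin (rtop L) {l \<in> carrier L. \<sigma> l \<odot> x = \<sigma> l0 \<odot> x}" if x: "x \<in> carrier M" for x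
 proof -
  have "continuous_map (rtop L) (mtop M) (%l. \<sigma> l \<odot> x)" using x by (intro cont_smult' \<sigma>_cont) auto
  moreover have "openin (mtop M) {\<sigma> l0 \<odot> x}" using assms x by (intro openin_subset) (auto simp: smult_closed)
  ultimately show ?thesis using openin_continuous_map_preimage by fastforce
 qed
 hence "openin (rtop L) (\<Inter>x\<in>carrier M. {l \<in> carrier L. \<sigma> l \<odot> x = \<sigma> l0 \<odot> x})"
  using finite_carrier nontrivial by (intro openin_INT2) auto
 moreover have "(\<Inter>x\<in>carrier M. {l \<in> carrier L. \<sigma> l \<odot> x = \<sigma> l0 \<odot> x}) =
   {l \<in> carrier L. \<forall>x\<in>carrier M. \<sigma> l \<odot> x = \<sigma> l0 \<odot> x}" using nontrivial by blast
 ultimately show ?thesis by simp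
qed

lemma dual_profinite: "profinite_module L D"
proof (rule discrete_profinite_module[OF ring_profinite dual_left_module])
 fix \<phi> \<psi> assume ph: "\<phi> \<in> carrier D" "\<psi> \<in> carrier D"
 show "openin (rtop L) {a \<in> carrier L. a \<odot>\<^bsub>D\<^esub> \<phi> = \<psi>}" (is "openin _ ?S")
 proof (subst openin_subopen, intro ballI)
  fix l assume l: "l \<in> ?S"
  let ?W = "{k \<in> carrier L. \<forall>x\<in>carrier M. \<sigma> k \<odot> x = \<sigma> l \<odot> x}"
  have "k \<odot>\<^bsub>D\<^esub> \<phi> = l \<odot>\<^bsub>D\<^esub> \<phi>" if "k \<in> ?W" for k using that by (auto intro!: restrict_ext)
  hence "?W \<subseteq> ?S" using l by auto
  thus "\<exists>T. openin (rtop L) T & l \<in> T & T \<subseteq> ?S"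
   using openin_same_action[of l] l by (intro exI[of _ ?W]) auto
 qed
qed (use finite_X in auto)

lemma dual_tors: "\<phi> \<in> X ==> \<phi> [^]\<^bsub>add_monoid D\<^esub> p = \<zero>\<^bsub>D\<^esub>"
proof -
 assume a: "\<phi> \<in> X"
 have "\<phi> [^]\<^bsub>add_monoid D\<^esub> n = (\<lambda>x\<in>carrier M. (int n * \<phi> x) mod int p)" for n :: nat
  by (induction n) (auto simp: fun_eq_iff mod_simps algebra_simps)
 from this[of p] show ?thesis by simp
qed

text \<open>For a nonzero submodule N of the dual, the common kernel in \<open>M\<close> is a proper
  submodule, hence zero, so \<open>M\<close> embeds into the characters of N. Thus |M| is at most
  |N| by \<open>card_chars\<close>, while N lies in the dual, which has at most |M| elements; so N
  is the whole dual.\<close>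

lemma dual_simple: "simple_module L D"
proof -
 interpret D: prof_module L D by (rule prof_module.intro[OF dual_profinite])
 have ne: "carrier D ~= {\<zero>\<^bsub>D\<^esub>}"
 proof -
  obtain x where x: "x \<in> carrier M" "x ~= \<zero>" using nontrivial by blast
  obtain \<theta> where t: "\<theta> \<in> hom (add_monoid M) (integer_mod_group p)" "\<theta> x = 1"
   by (rule char_exists[OF M.a_comm_group _ p, of x]) (use finite_carrier tors x in auto)
  hence "restrict \<theta> (carrier M) \<in> X" by (auto intro!: homI simp: hom_mult[OF t(1), simplified] hom_in_carrier[OF t(1)])
  moreover have "restrict \<theta> (carrier M) ~= \<zero>\<^bsub>D\<^esub>"
  proof
   assume "restrict \<theta> (carrier M) = \<zero>\<^bsub>D\<^esub>"
   from fun_cong[OF this, of x] show False using x t by simp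
  qed
  ultimately show ?thesis by auto
 qed
 have "N = {\<zero>\<^bsub>D\<^esub>} \<or> N = carrier D" if "closed_submodule N L D" for N
 proof (rule disjCI)
  have N: "submodule N L D" using that by (simp add: closed_submodule_def)
  note NX = D.submod_subset[OF N, unfolded dual_module_sel(1)]
  assume "N ~= carrier D"
  show "N = {\<zero>\<^bsub>D\<^esub>}"
  proof (rule ccontr)
   assume N0: "N ~= {\<zero>\<^bsub>D\<^esub>}"
   obtain \<phi> where \<phi>: "\<phi> \<in> N" "\<phi> ~= \<zero>\<^bsub>D\<^esub>" using N0 D.submod_zero[OF N] by blast
   let ?K = "{x \<in> carrier M. \<forall>\<phi>\<in>N. \<phi> x = 0}"
   have "submodule ?K L M"
   proof (rule submodI)
    fix x y assume xy: "x \<in> ?K" "y \<in> ?K"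
    have "\<psi> (x \<oplus> y) = 0" if "\<psi> \<in> N" for \<psi>
    proof -
     have "\<psi> x = 0" "\<psi> y = 0" using xy that by blast+
     thus ?thesis using charsD(3)[OF subsetD[OF NX that], of x y] xy by simp
    qed
    thus "x \<oplus> y \<in> ?K" using xy by simp
   next
    fix l x assume l: "l \<in> carrier L" and x: "x \<in> ?K"
    have "\<psi> (l \<odot> x) = 0" if "\<psi> \<in> N" for \<psi>
    proof -
     have "\<sigma> l \<odot>\<^bsub>D\<^esub> \<psi> \<in> N" using D.submod_smult[OF N _ that, of "\<sigma> l"] l by simp
     hence "(\<sigma> l \<odot>\<^bsub>D\<^esub> \<psi>) x = 0" using x by blast
     thus ?thesis using x l by simp
    qed
    thus "l \<odot> x \<in> ?K" using l x by (simp add: smult_closed)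
   qed (use NX charsD(5) in auto)
   moreover have "?K ~= carrier M"
   proof
    assume K: "?K = carrier M"
    have "\<phi> = \<zero>\<^bsub>D\<^esub>"
    proof (rule chars_ext)
     fix x assume x: "x \<in> carrier M"
     hence "x \<in> ?K" using K by simp
     thus "\<phi> x = \<zero>\<^bsub>D\<^esub> x" using \<phi>(1) x by simp
    qed (use \<phi>(1) NX D.M.zero_closed in auto)
    thus False using \<phi>(2) by simp
   qed
   ultimately have K: "?K = {\<zero>}" using submod_cases by blast
   let ?G = "(add_monoid D)\<lparr>carrier := N\<rparr>"
   have sg: "subgroup N (add_monoid D)" using N by (simp add: submodule_def)
   have G: "comm_group ?G" using group.subgroup_imp_group[OF D.M.a_group sg] by (rule group.group_comm_groupI)
     (use NX in \<open>auto intro!: restrict_ext simp: add.commute\<close>)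
   have fN: "finite N" using finite_X NX finite_subset by blast
   have "finite (chars p ?G) & card (chars p ?G) \<le> card (carrier ?G)"
   proof (rule card_chars[OF G _ p])
    show "\<psi> [^]\<^bsub>?G\<^esub> p = \<one>\<^bsub>?G\<^esub>" if "\<psi> \<in> carrier ?G" for \<psi>
     using dual_tors[of \<psi>] that NX monoid.nat_pow_consistent[OF group.is_monoid[OF D.M.a_group], of \<psi> p N] by auto
   qed (use fN in simp)
   moreover have "inj_on (%x. \<lambda>\<psi>\<in>N. \<psi> x) (carrier M)"
   proof (rule inj_onI)
    fix x y assume xy: "x \<in> carrier M" "y \<in> carrier M" "(\<lambda>\<psi>\<in>N. \<psi> x) = (\<lambda>\<psi>\<in>N. \<psi> y)"
    have "\<psi> (x \<ominus> y) = 0" if "\<psi> \<in> N" for \<psi>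
    proof -
     have pX: "\<psi> \<in> X" using that NX by blast
     have e: "\<psi> x = \<psi> y" using fun_cong[OF xy(3), of \<psi>] that by simp
     have "\<psi> x = \<psi> ((x \<ominus> y) \<oplus> y)" using xy by (simp add: M.minus_eq M.a_assoc M.l_neg)
     also have "... = (\<psi> (x \<ominus> y) + \<psi> y) mod int p" using charsD(3)[OF pX] xy by simp
     finally have "(\<psi> (x \<ominus> y) + \<psi> x) mod int p = \<psi> x mod int p" using e charsD(1,2)[OF pX xy(1)] by simp
     hence "int p dvd \<psi> (x \<ominus> y)" by (simp add: mod_eq_dvd_iff)
     moreover have "0 \<le> \<psi> (x \<ominus> y)" "\<psi> (x \<ominus> y) < int p" using charsD(1,2)[OF pX, of "x \<ominus> y"] xy by auto
     ultimately show ?thesis by (metis zdvd_not_zless order_le_less)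
    qed
    hence "x \<ominus> y \<in> ?K" using xy by simp
    thus "x = y" using K minus_eq_zero_iff xy by simp
   qed
   moreover have "(%x. \<lambda>\<psi>\<in>N. \<psi> x) ` carrier M \<subseteq> chars p ?G"
   proof (rule image_subsetI)
    fix x assume x: "x \<in> carrier M"
    have "(\<lambda>\<psi>\<in>N. \<psi> x) \<in> hom ?G (integer_mod_group p)"
    proof (rule homI)
     show "(\<lambda>\<psi>\<in>N. \<psi> x) \<psi> \<in> carrier (integer_mod_group p)" if "\<psi> \<in> carrier ?G" for \<psi>
      using charsD(1,2)[OF subsetD[OF NX] x, of \<psi>] that p_gt_1 by (simp add: carrier_integer_mod_group)
     show "(\<lambda>\<psi>\<in>N. \<psi> x) (\<psi> \<otimes>\<^bsub>?G\<^esub> \<psi>') = (\<lambda>\<psi>\<in>N. \<psi> x) \<psi> \<otimes>\<^bsub>integer_mod_group p\<^esub> (\<lambda>\<psi>\<in>N. \<psi> x) \<psi>'"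
      if "\<psi> \<in> carrier ?G" "\<psi>' \<in> carrier ?G" for \<psi> \<psi>'
      using that x D.submod_add[OF N, of \<psi> \<psi>'] by simp
    qed
    thus "(\<lambda>\<psi>\<in>N. \<psi> x) \<in> chars p ?G" by simp
   qed
   ultimately have "card (carrier M) \<le> card (chars p ?G)" using card_inj_on_le by blast
   hence "card X \<le> card N" using card_X \<open>finite (chars p ?G) & card (chars p ?G) \<le> card (carrier ?G)\<close> by simp
   hence "N = X" using NX finite_X by (simp add: card_seteq)
   thus False using \<open>N ~= carrier D\<close> by simp
  qed
 qed
 thus ?thesis using ne dual_profinite by (simp add: simple_module_def)
qed

end

section \<open>Size of completed tensor products\<close>

context ctensor_prod
begin

lemma keysF_sum: "finite S ==> (!!s. s \<in> S ==> keysF (c s)) ==> keysF (\<Sum>s\<in>S. c s)"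
proof (induction S rule: finite_induct)
 case (insert s S)
 have "keysF (c s)" "keysF (\<Sum>s\<in>S. c s)" using insert by auto
 from keysF_add[OF this] show ?case using insert(1,2) by simp
qed simp

lemma cl_sum_cong:
 assumes op: "opA U" "opB V" and S: "finite S" "!!s. s \<in> S ==> keysF (c s)" "!!s. s \<in> S ==> keysF (d s)"
  "!!s. s \<in> S ==> cl U V (c s) = cl U V (d s)"
 shows "cl U V (\<Sum>s\<in>S. c s) = cl U V (\<Sum>s\<in>S. d s)" using S
proof (induction S rule: finite_induct)
 case (insert s S)
 have k: "keysF (\<Sum>s\<in>S. c s)" "keysF (\<Sum>s\<in>S. d s)" "keysF (c s)" "keysF (d s)"
  by (rule keysF_sum[OF insert(1)], use insert in simp)+ (use insert in auto)
 have "cl U V (\<Sum>s\<in>insert s S. c s) = cl U V (c s) \<otimes>\<^bsub>TQ U V\<^esub> cl U V (\<Sum>s\<in>S. c s)"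
  using insert(1,2) cl_add[OF op k(3,1)] by simp
 also have "... = cl U V (d s) \<otimes>\<^bsub>TQ U V\<^esub> cl U V (\<Sum>s\<in>S. d s)" using insert by simp
 also have "... = cl U V (\<Sum>s\<in>insert s S. d s)" using insert(1,2) cl_add[OF op k(4,2)] by simp
 finally show ?case .
qed simp

text \<open>As the zero submodule of \<open>B\<close> is open, the second coordinate of a separating
  level can be taken to be zero, and refining the first coordinate keeps the two elements
  apart.\<close>

lemma C_separate:
 assumes z: "opB {\<zero>}" and x: "x \<in> C" "y \<in> C" "x ~= y"
 obtains U where "opA U" "!!U'. opA U' ==> U' \<subseteq> U ==> x (U', {\<zero>}) ~= y (U', {\<zero>})"
proof -
 obtain U V where op: "opA U" "opB V" and ne: "x (U, V) ~= y (U, V)" using C_ext[OF x(1,2)] x(3) by blast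
 show ?thesis
 proof (rule that[OF op(1)])
  fix U' assume U': "opA U'" "U' \<subseteq> U"
  have zV: "{\<zero>} \<subseteq> V" using B.open_submodD(4)[OF op(2)] by simp
  obtain c where c: "keysF c" "x (U', {\<zero>}) = cl U' {\<zero>} c" by (rule C_rep[OF x(1) U'(1) z]) (rule that)
  show "x (U', {\<zero>}) ~= y (U', {\<zero>})"
  proof
   assume e: "x (U', {\<zero>}) = y (U', {\<zero>})"
   have "x (U, V) = cl U V c" by (rule C_compat[OF x(1) U'(1) z op U'(2) zV c])
   moreover have "y (U, V) = cl U V c" by (rule C_compat[OF x(2) U'(1) z op U'(2) zV c(1)]) (use c e in simp)
   ultimately show False using ne by simp
  qed
 qed
qed

text \<open>Finitely many elements are already distinct at one common level, so a bound for all
  levels bounds every finite subset of the inverse limit.\<close>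

lemma C_bound:
 assumes z: "opB {\<zero>}" and b: "!!U. opA U ==> finite (carrier (TQ U {\<zero>})) & card (carrier (TQ U {\<zero>})) \<le> k"
 shows "finite C & card C \<le> k"
proof (rule finite_if_finite_subsets_card_bdd)
 fix G assume G: "G \<subseteq> C" "finite G"
 let ?Q = "{q \<in> G \<times> G. fst q ~= snd q}"
 have "\<exists>U. opA U & (\<forall>U'. opA U' & U' \<subseteq> U --> fst q (U', {\<zero>}) ~= snd q (U', {\<zero>}))" if q: "q \<in> ?Q" for q
 proof -
  have "fst q \<in> C" "snd q \<in> C" "fst q ~= snd q" using q G by auto
  then obtain U where "opA U" "!!U'. opA U' ==> U' \<subseteq> U ==> fst q (U', {\<zero>}) ~= snd q (U', {\<zero>})"
   by (rule C_separate[OF z]) (rule that)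
  thus ?thesis by blast
 qed
 hence "\<forall>q\<in>?Q. \<exists>U. opA U & (\<forall>U'. opA U' & U' \<subseteq> U --> fst q (U', {\<zero>}) ~= snd q (U', {\<zero>}))"
  by (rule ballI)
 from bchoice[OF this] obtain W where
  W0: "\<forall>q\<in>?Q. opA (W q) & (\<forall>U'. opA U' & U' \<subseteq> W q --> fst q (U', {\<zero>}) ~= snd q (U', {\<zero>}))" ..
 have W: "!!q. q \<in> ?Q ==> opA (W q)"
  "!!q U'. q \<in> ?Q ==> opA U' ==> U' \<subseteq> W q ==> fst q (U', {\<zero>}) ~= snd q (U', {\<zero>})"
  by (use W0 in \<open>blast\<close>)+
 have fin: "finite ?Q" using G by simp
 have "\<exists>U. opA U & (\<forall>q\<in>Q'. U \<subseteq> W q)" if "finite Q'" "Q' \<subseteq> ?Q" for Q' using that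
 proof (induction Q' rule: finite_induct)
  case empty thus ?case using A.open_submodule_carrier by auto
 next
  case (insert q Q')
  then obtain U where "opA U" "\<forall>q\<in>Q'. U \<subseteq> W q" by auto
  thus ?case using A.open_submodule_Int[of U "W q"] W(1)[of q] insert.prems by (intro exI[of _ "U \<inter> W q"]) auto
 qed
 from this[OF fin order_refl] obtain U where U: "opA U" "!!q. q \<in> ?Q ==> U \<subseteq> W q" by auto
 have "inj_on (%x. x (U, {\<zero>})) G"
 proof (rule inj_onI, rule ccontr)
  fix x y assume "x \<in> G" "y \<in> G" and e: "x (U, {\<zero>}) = y (U, {\<zero>})" and "x ~= y"
  hence "(x, y) \<in> ?Q" by simp
  from W(2)[OF this U(1) U(2)[OF this]] e show False by simp
 qed
 moreover have "(%x. x (U, {\<zero>})) ` G \<subseteq> carrier (TQ U {\<zero>})" using C_comp[OF _ U(1) z] G by auto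
 ultimately have "card G \<le> card (carrier (TQ U {\<zero>}))" using b[OF U(1)] card_inj_on_le by blast
 thus "card G \<le> k" using b[OF U(1)] by simp
qed

text \<open>The elements \<open>pure_elt c\<close> show that the inverse limit projects onto each
  level.\<close>

lemma level_le:
 assumes op: "opA U" "opB V" and fin: "finite C"
 shows "finite (carrier (TQ U V)) & card (carrier (TQ U V)) \<le> card C"
proof -
 have "carrier (TQ U V) \<subseteq> (%x. x (U, V)) ` C"
 proof
  fix t assume "t \<in> carrier (TQ U V)"
  then obtain c where c: "keysF c" "t = cl U V c" by (rule cl_surj[OF op]) (rule that)
  thus "t \<in> (%x. x (U, V)) ` C" using pure_elt[OF c(1)] pure_elt_comp[OF op] by (intro image_eqI[of _ _ "pure_elt c"]) auto
 qed
 thus ?thesis using fin by (meson card_image_le card_mono finite_imageI finite_subset le_trans)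
qed

text \<open>When \<open>S\<close> generates \<open>A\<close> modulo \<open>U\<close>, every element
  of the level is a sum of tensors of the s in \<open>S\<close> with one coefficient from
  \<open>B\<close> each, so the level is an image of the functions from \<open>S\<close> to
  \<open>B\<close>.\<close>

lemma level_span:
 assumes inv: "inv_ring L \<sigma>" and finB: "finite (carrier B)"
  and S: "finite S" "S \<subseteq> carrier A" and op: "opA U" "opB V"
  and span: "!!N. submodule N L A ==> S \<subseteq> N ==> U \<subseteq> N ==> N = carrier A"
 shows "finite (carrier (TQ U V)) & card (carrier (TQ U V)) \<le> card (carrier B) ^ card S"
proof -
 interpret inv_ring L \<sigma> by fact
 interpret T: comm_group "TQ U V" by (rule T_comm[OF op])
 let ?f = "%m. \<Sum>s\<in>S. frag_of (s, m s)"
 let ?\<Phi> = "%m. cl U V (?f m)"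
 let ?I = "?\<Phi> ` (S \<rightarrow>\<^sub>E carrier B)"
 have kf: "keysF (?f m)" if "!!s. s \<in> S ==> m s \<in> carrier B" for m using S that by (intro keysF_sum) auto
 have I: "?\<Phi> m \<in> ?I" if "!!s. s \<in> S ==> m s \<in> carrier B" for m
 proof (rule image_eqI[of _ _ "restrict m S"])
  show "?\<Phi> m = ?\<Phi> (restrict m S)" by (intro arg_cong[where f = "cl U V"] sum.cong) auto
 qed (use that in auto)
 have zero: "?\<Phi> (%s. \<zero>) = cl U V 0"
 proof -
  have "?\<Phi> (%s. \<zero>) = cl U V (\<Sum>s\<in>S. 0)" using S cl_zero_right[OF op] by (intro cl_sum_cong[OF op S(1)]) auto
  thus ?thesis by simp
 qed
 have plus: "?\<Phi> m \<otimes>\<^bsub>TQ U V\<^esub> ?\<Phi> m' = ?\<Phi> (%s. m s \<oplus> m' s)"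
  if m: "!!s. s \<in> S ==> m s \<in> carrier B" "!!s. s \<in> S ==> m' s \<in> carrier B" for m m'
 proof -
  have "?\<Phi> m \<otimes>\<^bsub>TQ U V\<^esub> ?\<Phi> m' = cl U V (\<Sum>s\<in>S. frag_of (s, m s) + frag_of (s, m' s))"
   using cl_add[OF op kf kf, of m m'] m by (simp add: sum.distrib)
  also have "... = ?\<Phi> (%s. m s \<oplus> m' s)"
   using S m by (intro cl_sum_cong[OF op S(1)] cl_add_right[OF op, symmetric] keysF_add) auto
  finally show ?thesis .
 qed
 have Imult: "t \<otimes>\<^bsub>TQ U V\<^esub> t' \<in> ?I" if "t \<in> ?I" "t' \<in> ?I" for t t'
 proof -
  obtain m m' where m: "m \<in> S \<rightarrow>\<^sub>E carrier B" "m' \<in> S \<rightarrow>\<^sub>E carrier B" "t = ?\<Phi> m" "t' = ?\<Phi> m'" using \<open>t \<in> ?I\<close> \<open>t' \<in> ?I\<close> by auto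
  hence mm: "!!s. s \<in> S ==> m s \<in> carrier B" "!!s. s \<in> S ==> m' s \<in> carrier B" by auto
  have "t \<otimes>\<^bsub>TQ U V\<^esub> t' = ?\<Phi> (%s. m s \<oplus> m' s)" unfolding m(3,4) by (rule plus) (use mm in auto)
  also have "... \<in> ?I" by (rule I) (use mm in auto)
  finally show ?thesis .
 qed
 have Iinv: "inv\<^bsub>TQ U V\<^esub> t \<in> ?I" if "t \<in> ?I" for t
 proof -
  obtain m where m: "m \<in> S \<rightarrow>\<^sub>E carrier B" "t = ?\<Phi> m" using \<open>t \<in> ?I\<close> by auto
  hence mm: "!!s. s \<in> S ==> m s \<in> carrier B" by auto
  have "?\<Phi> (%s. \<ominus> m s) \<otimes>\<^bsub>TQ U V\<^esub> ?\<Phi> m = ?\<Phi> (%s. \<ominus> m s \<oplus> m s)" using mm by (intro plus) auto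
  also have "... = ?\<Phi> (%s. \<zero>)" using mm by (intro arg_cong[where f = "cl U V"] sum.cong) (auto simp: B.M.l_neg)
  also have "... = \<one>\<^bsub>TQ U V\<^esub>" using zero T_one[OF op] by simp
  finally have "inv\<^bsub>TQ U V\<^esub> t = ?\<Phi> (%s. \<ominus> m s)"
   unfolding m(2) using mm kf cl_closed[OF op] by (intro T.inv_equality) auto
  thus ?thesis using I[of "%s. \<ominus> m s"] mm by auto
 qed
 have Ione: "cl U V 0 \<in> ?I" using I[of "%s. \<zero>"] zero by auto
 \<comment> \<open>The elements all of whose pure tensors lie in \<open>?I\<close> form a submodule;
   it contains \<open>S\<close> and \<open>U\<close>, hence is everything.\<close>
 let ?N = "{a \<in> carrier A. \<forall>b\<in>carrier B. cl U V (frag_of (a, b)) \<in> ?I}"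
 have N: "submodule ?N L A"
 proof (rule A.submodI)
  show "\<zero>\<^bsub>A\<^esub> \<in> ?N" using cl_zero_left[OF op] Ione by auto
 next
  fix x y assume xy: "x \<in> ?N" "y \<in> ?N"
  have "cl U V (frag_of (x \<oplus>\<^bsub>A\<^esub> y, b)) \<in> ?I" if b: "b \<in> carrier B" for b
   using cl_add_left[OF op _ _ b, of x y] cl_add[OF op, of "frag_of (x, b)" "frag_of (y, b)"]
    Imult[of "cl U V (frag_of (x, b))" "cl U V (frag_of (y, b))"] xy b by auto
  thus "x \<oplus>\<^bsub>A\<^esub> y \<in> ?N" using xy by auto
 next
  \<comment> \<open>Since \<open>\<sigma>\<close> is an involution, the tensor of l x with b equals
    that of x with \<sigma>(l) b.\<close>
  fix l x assume l: "l \<in> carrier L" and x: "x \<in> ?N"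
  have "cl U V (frag_of (l \<odot>\<^bsub>A\<^esub> x, b)) \<in> ?I" if b: "b \<in> carrier B" for b
   using cl_smult[OF op _ b, of x "\<sigma> l"] l x B.smult_closed[of "\<sigma> l" b] b by auto
  thus "l \<odot>\<^bsub>A\<^esub> x \<in> ?N" using l x A.smult_closed by auto
 qed auto
 have "S \<subseteq> ?N"
 proof
  fix s assume s: "s \<in> S"
  have "cl U V (frag_of (s, b)) \<in> ?I" if b: "b \<in> carrier B" for b
  proof -
   let ?m = "%t. if t = s then b else \<zero>"
   have "?\<Phi> ?m = cl U V (\<Sum>t\<in>S. if t = s then frag_of (s, b) else 0)"
    using S s b cl_zero_right[OF op] by (intro cl_sum_cong[OF op S(1)]) auto
   also have "... = cl U V (frag_of (s, b))" using s S(1) by simp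
   finally show ?thesis using I[of ?m] b by auto
  qed
  thus "s \<in> ?N" using s S by auto
 qed
 moreover have "U \<subseteq> ?N"
 proof
  fix u assume u: "u \<in> U"
  hence uc: "u \<in> carrier A" using A.open_submodD(3)[OF op(1)] by auto
  have zz: "u \<ominus>\<^bsub>A\<^esub> \<zero>\<^bsub>A\<^esub> \<in> U" using u A.submod_minus[OF A.open_submodD(1)[OF op(1)] u A.open_submodD(4)[OF op(1)]] by blast
  hence "cl U V (frag_of (u, b)) = cl U V 0" if "b \<in> carrier B" for b
   using cl_mod_left[OF op uc that A.M.zero_closed zz] cl_zero_left[OF op that] by simp
  thus "u \<in> ?N" using uc Ione by auto
 qed
 ultimately have NA: "?N = carrier A" by (rule span[OF N])
 have sub: "carrier (TQ U V) \<subseteq> ?I"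
 proof
  fix t assume "t \<in> carrier (TQ U V)"
  then obtain c where c: "keysF c" "t = cl U V c" by (rule cl_surj[OF op]) (rule that)
  have "cl U V c \<in> ?I"
  proof (rule free_Abelian_group_induct[OF c(1), where P = "%c. cl U V c \<in> ?I"])
   show "cl U V 0 \<in> ?I" by (rule Ione)
   show "cl U V (x - y) \<in> ?I" if "keysF x" "keysF y" "cl U V x \<in> ?I" "cl U V y \<in> ?I" for x y
    unfolding cl_diff[OF op that(1,2)] by (rule Imult[OF that(3) Iinv[OF that(4)]])
   show "cl U V (frag_of q) \<in> ?I" if q: "q \<in> carrier A \<times> carrier B" for q
   proof -
    obtain a b where ab: "q = (a, b)" "a \<in> carrier A" "b \<in> carrier B" using q by auto
    hence "a \<in> ?N" using NA by simp
    thus ?thesis using ab by blast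
   qed
  qed
  thus "t \<in> ?I" using c by simp
 qed
 have fP: "finite (S \<rightarrow>\<^sub>E carrier B)" using S(1) finB by (intro finite_PiE) auto
 have fI: "finite ?I" by (rule finite_imageI[OF fP])
 have "card (S \<rightarrow>\<^sub>E carrier B) = card (carrier B) ^ card S" using S(1) by (simp add: card_PiE)
 thus ?thesis using card_image_le[OF fP, of ?\<Phi>] card_mono[OF fI sub] finite_subset[OF sub fI] by linarith
qed

text \<open>Representatives of the finitely many cosets of \<open>U\<close> generate
  \<open>A\<close> modulo \<open>U\<close>.\<close>

lemma level_finite:
 assumes inv: "inv_ring L \<sigma>" and finB: "finite (carrier B)" and op: "opA U" "opB V"
 shows "finite (carrier (TQ U V))"
proof -
 obtain \<rho> where r: "approximates A (carrier A) U (%a. a) \<rho>"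
  using A.ex_approximates[OF op(1), of "carrier A" "%a. a"] by blast
 have "finite (carrier (TQ U V)) & card (carrier (TQ U V)) \<le> card (carrier B) ^ card (\<rho> ` carrier A)"
 proof (rule level_span[OF inv finB _ _ op])
  fix N assume N: "submodule N L A" "\<rho> ` carrier A \<subseteq> N" "U \<subseteq> N"
  have "a \<in> N" if a: "a \<in> carrier A" for a
  proof -
   have d: "\<rho> a \<ominus>\<^bsub>A\<^esub> a \<in> U" "\<rho> a \<in> carrier A" using r a by (auto simp: approximates_def)
   have "\<rho> a \<ominus>\<^bsub>A\<^esub> (\<rho> a \<ominus>\<^bsub>A\<^esub> a) = a"
    using a d(2) by (simp add: A.M.minus_eq A.M.minus_add A.M.minus_minus A.M.a_assoc[symmetric] A.M.r_neg)
   thus ?thesis using A.submod_minus[OF N(1), of "\<rho> a" "\<rho> a \<ominus>\<^bsub>A\<^esub> a"] N d a by auto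
  qed
  thus "N = carrier A" using A.submod_subset[OF N(1)] by auto
 qed (use r in \<open>auto simp: approximates_def\<close>)
 thus ?thesis by simp
qed

text \<open>Multiples of a pure tensor can be moved to the second factor, which \<open>p\<close>
  kills.\<close>

lemma level_torsion:
 assumes op: "opA U" "opB V" and tors: "!!b. b \<in> carrier B ==> b [^]\<^bsub>add_monoid B\<^esub> p = \<zero>"
  and t: "t \<in> carrier (TQ U V)"
 shows "t [^]\<^bsub>TQ U V\<^esub> (p::nat) = \<one>\<^bsub>TQ U V\<^esub>"
proof -
 interpret T: comm_group "TQ U V" by (rule T_comm[OF op])
 have gen: "cl U V (frag_of (a, b)) [^]\<^bsub>TQ U V\<^esub> n = cl U V (frag_of (a, b [^]\<^bsub>add_monoid B\<^esub> n))"
  if a: "a \<in> carrier A" and b: "b \<in> carrier B" for a b and n :: nat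
 proof (induction n)
  case 0 thus ?case using T_one[OF op] cl_zero_right[OF op a] by simp
 next
  case (Suc n)
  have bn: "b [^]\<^bsub>add_monoid B\<^esub> n \<in> carrier B"
   using monoid.nat_pow_closed[OF group.is_monoid[OF B.M.a_group], of b n] b by simp
  show ?case using Suc cl_add_right[OF op a bn b] cl_add[OF op, of "frag_of (a, b [^]\<^bsub>add_monoid B\<^esub> n)" "frag_of (a, b)"] a b bn
   by simp
 qed
 obtain c where c: "keysF c" "t = cl U V c" by (rule cl_surj[OF op t]) (rule that)
 have "cl U V c [^]\<^bsub>TQ U V\<^esub> p = \<one>\<^bsub>TQ U V\<^esub>"
 proof (rule free_Abelian_group_induct[OF c(1), where P = "%c. cl U V c [^]\<^bsub>TQ U V\<^esub> p = \<one>\<^bsub>TQ U V\<^esub>"])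
  show "cl U V 0 [^]\<^bsub>TQ U V\<^esub> p = \<one>\<^bsub>TQ U V\<^esub>" using T_one[OF op, symmetric] by simp
  show "cl U V (x - y) [^]\<^bsub>TQ U V\<^esub> p = \<one>\<^bsub>TQ U V\<^esub>"
   if "keysF x" "keysF y" "cl U V x [^]\<^bsub>TQ U V\<^esub> p = \<one>\<^bsub>TQ U V\<^esub>" "cl U V y [^]\<^bsub>TQ U V\<^esub> p = \<one>\<^bsub>TQ U V\<^esub>" for x y
   unfolding cl_diff[OF op that(1,2)] using that cl_closed[OF op] by (simp add: T.nat_pow_distrib T.nat_pow_inv)
  show "cl U V (frag_of q) [^]\<^bsub>TQ U V\<^esub> p = \<one>\<^bsub>TQ U V\<^esub>" if q: "q \<in> carrier A \<times> carrier B" for q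
  proof -
   obtain a b where ab: "q = (a, b)" "a \<in> carrier A" "b \<in> carrier B" using q by auto
   thus ?thesis using gen[of a b p] tors cl_zero_right[OF op] T_one[OF op] by simp
  qed
 qed
 thus ?thesis using c by simp
qed

end

lemma ctensor_prod_simple:
 assumes "inv_ring L \<sigma>" "profinite_module L P" "simple_module L M"
 shows "ctensor_prod L \<sigma> P M" using assms inv_ring.\<sigma>_fun by (auto simp: ctensor_prod_def simple_module_def)

lemma simple_modI: "profinite_ring L ==> simple_module L M ==> simple_mod L M"
 by (auto simp: simple_mod_def simple_mod_axioms_def prof_module_def simple_module_def)

text \<open>Topological generators generate modulo every open submodule, so
  \<open>level_span\<close> bounds all levels uniformly.\<close>

theorem card_ctensor_le:
 assumes inv: "inv_ring L \<sigma>" and P: "profinite_module L P" and M: "simple_module L M"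
  and X: "finite X" "X \<subseteq> carrier P" "closed_span L P X = carrier P"
 shows "finite (ctensor_carrier L \<sigma> P M) & card (ctensor_carrier L \<sigma> P M) \<le> card (carrier M) ^ card X"
proof -
 interpret inv_ring L \<sigma> by fact
 interpret M: simple_mod L M by (rule simple_modI[OF profinite M])
 interpret T: ctensor_prod L \<sigma> P M by (rule ctensor_prod_simple[OF inv P M])
 show ?thesis
 proof (rule T.C_bound[OF M.open_zero])
  fix U assume U: "T.opA U"
  show "finite (carrier (T.TQ U {\<zero>\<^bsub>M\<^esub>})) & card (carrier (T.TQ U {\<zero>\<^bsub>M\<^esub>})) \<le> card (carrier M) ^ card X"
  proof (rule T.level_span[OF inv M.finite_carrier X(1,2) U M.open_zero])
   fix N assume N: "submodule N L P" "X \<subseteq> N" "U \<subseteq> N"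
   have "closed_submodule N L P" by (rule T.A.open_submodule_closed[OF T.A.open_submoduleI[OF N(1) U N(3)]])
   from T.A.closed_span_least[OF this N(2)] show "N = carrier P" using X(3) T.A.submod_subset[OF N(1)] by auto
  qed
 qed
qed

text \<open>Were the tensor nonzero, a character \<theta> of the finite level would detect it. By
  the adjunction of tensor and Hom, sending y to the function b \<mapsto> \<theta>(y \<otimes> b)
  gives a continuous homomorphism from \<open>P\<close> to the dual of \<open>M\<close>, and it does
  not kill \<open>x\<close>.\<close>

theorem pure_tensor_zero:
 assumes inv: "inv_ring L \<sigma>" and P: "profinite_module L P" and M: "simple_module L M"
  and p: "prime p" "!!b. b \<in> carrier M ==> b [^]\<^bsub>add_monoid M\<^esub> p = \<zero>\<^bsub>M\<^esub>"
  and x: "x \<in> carrier P" and kill: "!!\<phi>. \<phi> \<in> cont_hom L P (dual_module \<sigma> p M) ==> \<phi> x = \<zero>\<^bsub>dual_module \<sigma> p M\<^esub>"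
  and op: "open_submodule U L P" "open_submodule V L M" and m: "m \<in> carrier M"
 shows "cls L \<sigma> P M U V (frag_of (x, m)) = cls L \<sigma> P M U V 0"
proof (rule ccontr)
 interpret inv_ring L \<sigma> by fact
 interpret M: simple_mod L M by (rule simple_modI[OF profinite M])
 interpret D: simple_dual L M \<sigma> p by (intro simple_dual.intro simple_dual_axioms.intro M.simple_mod_axioms inv p)
 interpret T: ctensor_prod L \<sigma> P M by (rule ctensor_prod_simple[OF inv P M])
 assume ne: "T.cl U V (frag_of (x, m)) ~= T.cl U V 0"
 have k: "T.keysF (frag_of (y, b))" if "y \<in> carrier P" "b \<in> carrier M" for y b using that by simp
 obtain \<theta> where t: "\<theta> \<in> hom (T.TQ U V) (integer_mod_group p)" "\<theta> (T.cl U V (frag_of (x, m))) = 1"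
  by (rule char_exists[OF T.T_comm[OF op] T.level_finite[OF inv M.finite_carrier op] p(1)
     T.level_torsion[OF op p(2)] T.cl_closed[OF op k[OF x m]]])
   (use ne T.T_one[OF op] in auto)
 have tadd: "\<theta> (T.cl U V (c + d)) = (\<theta> (T.cl U V c) + \<theta> (T.cl U V d)) mod int p" if "T.keysF c" "T.keysF d" for c d
  using hom_mult[OF t(1) T.cl_closed[OF op that(1)] T.cl_closed[OF op that(2)]] T.cl_add[OF op that] by simp
 have tran: "0 \<le> \<theta> (T.cl U V c) & \<theta> (T.cl U V c) < int p" if "T.keysF c" for c
  using hom_in_carrier[OF t(1) T.cl_closed[OF op that]] D.p_gt_1 by (auto simp: carrier_integer_mod_group)
 have t0: "\<theta> (T.cl U V 0) = 0" using hom_one[OF t(1)] T.T_comm[OF op] T.T_one[OF op] by (simp add: comm_group_def)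
 define \<phi> where "\<phi> y = (\<lambda>b\<in>carrier M. \<theta> (T.cl U V (frag_of (y, b))))" for y
 have \<phi>X: "\<phi> y \<in> D.X" if y: "y \<in> carrier P" for y unfolding \<phi>_def
 proof (rule D.charsI)
  show "0 \<le> \<theta> (T.cl U V (frag_of (y, b))) & \<theta> (T.cl U V (frag_of (y, b))) < int p" if "b \<in> carrier M" for b
   by (rule tran[OF k[OF y that]])
  show "\<theta> (T.cl U V (frag_of (y, b \<oplus>\<^bsub>M\<^esub> b'))) =
   (\<theta> (T.cl U V (frag_of (y, b))) + \<theta> (T.cl U V (frag_of (y, b')))) mod int p" if "b \<in> carrier M" "b' \<in> carrier M" for b b'
   using T.cl_add_right[OF op y that] tadd[OF k[OF y that(1)] k[OF y that(2)]] by simp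
 qed
 have "\<phi> \<in> cont_hom L P D.D"
 proof (rule cont_homI[OF P D.dual_profinite profinite])
  show "\<phi> y \<in> carrier D.D" if "y \<in> carrier P" for y using \<phi>X[OF that] by simp
  show "\<phi> (y \<oplus>\<^bsub>P\<^esub> z) = \<phi> y \<oplus>\<^bsub>D.D\<^esub> \<phi> z" if "y \<in> carrier P" "z \<in> carrier P" for y z
   using T.cl_add_left[OF op that] tadd[OF k[OF that(1)] k[OF that(2)]] by (auto simp: \<phi>_def intro!: restrict_ext)
  show "\<phi> (l \<odot>\<^bsub>P\<^esub> y) = l \<odot>\<^bsub>D.D\<^esub> \<phi> y" if l: "l \<in> carrier L" and y: "y \<in> carrier P" for l y
   using T.cl_smult[OF op y, of _ "\<sigma> l"] l by (auto simp: \<phi>_def M.smult_closed intro!: restrict_ext)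
  fix W assume W: "open_submodule W L D.D"
  interpret DD: prof_module L D.D by (rule prof_module.intro[OF D.dual_profinite])
  have "\<phi> u \<in> W" if u: "u \<in> U" for u
  proof -
   have uc: "u \<in> carrier P" using u T.A.open_submodD(3)[OF op(1)] by auto
   have zz: "u \<ominus>\<^bsub>P\<^esub> \<zero>\<^bsub>P\<^esub> \<in> U"
    by (rule T.A.submod_minus[OF T.A.open_submodD(1)[OF op(1)] u T.A.open_submodD(4)[OF op(1)]])
   hence "T.cl U V (frag_of (u, b)) = T.cl U V 0" if "b \<in> carrier M" for b
    using T.cl_mod_left[OF op uc that T.A.M.zero_closed zz] T.cl_zero_left[OF op that] by simp
   hence "\<phi> u = \<zero>\<^bsub>D.D\<^esub>" by (auto simp: \<phi>_def t0 intro!: restrict_ext)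
   thus ?thesis using DD.open_submodD(4)[OF W] by simp
  qed
  thus "\<exists>W'. openin (mtop P) W' & \<zero>\<^bsub>P\<^esub> \<in> W' & (\<forall>x\<in>W'. \<phi> x \<in> W)"
   using T.A.open_submodD(2,4)[OF op(1)] by blast
 qed
 from fun_cong[OF kill[OF this], of m] show False using m t(2) by (simp add: \<phi>_def)
qed

text \<open>In effect the homomorphisms to \<open>S\<close> from the quotient of \<open>P\<close> by
  \<open>N\<close>, when \<open>N\<close> is a submodule. Extensionality makes the cardinality of
  this set meaningful.\<close>

definition Ann_hom ::
  "('l, 'x) ring_scheme => ('l, 'p, 'y) top_module_scheme => ('l, 's, 'z) top_module_scheme => 'p set => ('p => 's) set" where
 "Ann_hom L P S N = {\<phi> \<in> cont_hom L P S \<inter> extensional (carrier P). \<forall>x\<in>N. \<phi> x = \<zero>\<^bsub>S\<^esub>}"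

text \<open>A homomorphism \<phi> yields the character a \<otimes> \<psi> \<mapsto>
  \<psi>(\<phi>(a)) of a finite level of \<open>P\<close> tensored with the dual of
  \<open>S\<close>. Characters of \<open>S\<close> separate points, so \<phi> can be recovered. A
  level has at most as many characters as elements, and at most as many elements as the
  limit.\<close>

theorem card_Ann_hom_le:
 fixes P :: "('l, 'p) top_module" and S :: "('l, 's) top_module"
 assumes inv: "inv_ring L \<sigma>" and P: "profinite_module L P" and S: "simple_module L S"
  and p: "prime p" "!!b. b \<in> carrier S ==> b [^]\<^bsub>add_monoid S\<^esub> p = \<zero>\<^bsub>S\<^esub>"
  and U: "open_submodule U L P" and fin: "finite (ctensor_carrier L \<sigma> P (dual_module \<sigma> p S))"
 shows "finite (Ann_hom L P S U) & card (Ann_hom L P S U) \<le> card (ctensor_carrier L \<sigma> P (dual_module \<sigma> p S))"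
proof -
 interpret inv_ring L \<sigma> by fact
 interpret S: simple_mod L S by (rule simple_modI[OF profinite S])
 interpret D: simple_dual L S \<sigma> p by (intro simple_dual.intro simple_dual_axioms.intro S.simple_mod_axioms inv p)
 interpret DM: simple_mod L D.D by (rule simple_modI[OF profinite D.dual_simple])
 interpret T: ctensor_prod L \<sigma> P D.D by (rule ctensor_prod_simple[OF inv P D.dual_simple])
 let ?z = "{\<zero>\<^bsub>D.D\<^esub>}"
 note op = U DM.open_zero
 interpret TT: tensor_prod L "quot_module P U" "quot_module D.D ?z" \<sigma> by (rule T.tp[OF op])
 have lev: "finite (carrier (T.TQ U ?z)) & card (carrier (T.TQ U ?z)) \<le> card T.C" by (rule T.level_le[OF op fin])
 have ch: "finite (chars p (T.TQ U ?z)) & card (chars p (T.TQ U ?z)) \<le> card (carrier (T.TQ U ?z))"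
  using lev T.level_torsion[OF op, of p] D.dual_tors by (intro card_chars[OF T.T_comm[OF op] _ p(1)]) auto
 have ex: "\<exists>h\<in>chars p (T.TQ U ?z). \<forall>a\<in>carrier P. \<forall>\<psi>\<in>D.X. h (T.cl U ?z (frag_of (a, \<psi>))) = \<psi> (\<phi> a)"
  if \<phi>: "\<phi> \<in> Ann_hom L P S U" for \<phi>
 proof -
  have ph: "\<phi> \<in> cont_hom L P S" and pU: "!!u. u \<in> U ==> \<phi> u = \<zero>\<^bsub>S\<^esub>" using \<phi> by (auto simp: Ann_hom_def)
  note pD = cont_homD[OF ph]
  \<comment> \<open>\<open>f\<close> and \<open>g\<close> read a value off a coset through a chosen
    member: \<open>\<phi>\<close> is constant on cosets because it vanishes on \<open>U\<close>, and
    cosets of the zero submodule are singletons.\<close>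
  define f where "f X = \<phi> (SOME x. x \<in> X)" for X
  have f: "f (U +>\<^bsub>P\<^esub> a) = \<phi> a" if a: "a \<in> carrier P" for a
  proof -
   have "(SOME x. x \<in> U +>\<^bsub>P\<^esub> a) \<in> U +>\<^bsub>P\<^esub> a"
    using T.A.coset_self[OF T.A.open_submodD(1)[OF U] a] by (rule someI)
   then obtain u where u: "u \<in> U" "(SOME x. x \<in> U +>\<^bsub>P\<^esub> a) = u \<oplus>\<^bsub>P\<^esub> a" by (auto simp: a_r_coset_def')
   have uc: "u \<in> carrier P" using u T.A.open_submodD(3)[OF U] by auto
   show ?thesis unfolding f_def u(2) using pD(3)[OF uc a] pU[OF u(1)] pD(1)[OF a] by simp
  qed
  define g where "g Y = (SOME y. y \<in> Y)" for Y :: "('s => int) set"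
  have g: "g (?z +>\<^bsub>D.D\<^esub> \<psi>) = \<psi>" if ps: "\<psi> \<in> D.X" for \<psi>
  proof -
   have "?z +>\<^bsub>D.D\<^esub> \<psi> = {\<psi>}" using DM.M.l_zero[of \<psi>] ps by (simp add: a_r_coset_def')
   thus ?thesis by (simp add: g_def)
  qed
  have qP: "\<exists>a\<in>carrier P. X = U +>\<^bsub>P\<^esub> a" if "X \<in> carrier (quot_module P U)" for X
   using that by (auto simp: A_RCOSETS_def')
  have qD: "\<exists>\<psi>\<in>D.X. Y = ?z +>\<^bsub>D.D\<^esub> \<psi>" if "Y \<in> carrier (quot_module D.D ?z)" for Y
   using that by (auto simp: A_RCOSETS_def')
  note cs = T.A.coset_add[OF T.A.open_submodD(1)[OF U]] T.A.coset_smult[OF T.A.open_submodD(1)[OF U]]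
   DM.coset_add[OF DM.open_submodD(1)[OF op(2)]] DM.coset_smult[OF DM.open_submodD(1)[OF op(2)]]
  have gb: "0 \<le> \<psi> (\<phi> a) & \<psi> (\<phi> a) < int p" if "\<psi> \<in> D.X" "a \<in> carrier P" for \<psi> a
   using D.charsD(1,2)[OF that(1) pD(1)[OF that(2)]] by simp
  obtain h where h: "h \<in> hom (T.TQ U ?z) (integer_mod_group p)"
   "!!X Y. X \<in> carrier (quot_module P U) ==> Y \<in> carrier (quot_module D.D ?z) ==> h (TT.cl (frag_of (X, Y))) = (g Y) (f X)"
  proof (rule TT.tensor_universal[OF abelian_integer_mod_group[of p], where \<beta> = "%X Y. (g Y) (f X)"])
   fix X Y assume X: "X \<in> carrier (quot_module P U)" and Y: "Y \<in> carrier (quot_module D.D ?z)"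
   obtain a where a: "a \<in> carrier P" "X = U +>\<^bsub>P\<^esub> a" using qP[OF X] by blast
   obtain \<psi> where ps: "\<psi> \<in> D.X" "Y = ?z +>\<^bsub>D.D\<^esub> \<psi>" using qD[OF Y] by blast
   show "(g Y) (f X) \<in> carrier (integer_mod_group p)"
    unfolding a(2) ps(2) f[OF a(1)] g[OF ps(1)] using gb[OF ps(1) a(1)] D.p_gt_1 by (simp add: carrier_integer_mod_group)
   show "(g Y) (f (X \<oplus>\<^bsub>quot_module P U\<^esub> X')) = (g Y) (f X) \<otimes>\<^bsub>integer_mod_group p\<^esub> (g Y) (f X')"
    if X': "X' \<in> carrier (quot_module P U)" for X'
   proof -
    obtain a' where a': "a' \<in> carrier P" "X' = U +>\<^bsub>P\<^esub> a'" using qP[OF X'] by blast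
    have "X \<oplus>\<^bsub>quot_module P U\<^esub> X' = U +>\<^bsub>P\<^esub> (a \<oplus>\<^bsub>P\<^esub> a')" using a a' cs(1) by simp
    thus ?thesis using f[of "a \<oplus>\<^bsub>P\<^esub> a'"] f[OF a(1)] f[OF a'(1)] a a' g[OF ps(1)] ps(2) pD(3)[OF a(1) a'(1)]
      D.charsD(3)[OF ps(1) pD(1)[OF a(1)] pD(1)[OF a'(1)]] by simp
   qed
   show "(g (Y \<oplus>\<^bsub>quot_module D.D ?z\<^esub> Y')) (f X) = (g Y) (f X) \<otimes>\<^bsub>integer_mod_group p\<^esub> (g Y') (f X)"
    if Y': "Y' \<in> carrier (quot_module D.D ?z)" for Y'
   proof -
    obtain \<psi>' where ps': "\<psi>' \<in> D.X" "Y' = ?z +>\<^bsub>D.D\<^esub> \<psi>'" using qD[OF Y'] by blast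
    have "Y \<oplus>\<^bsub>quot_module D.D ?z\<^esub> Y' = ?z +>\<^bsub>D.D\<^esub> (\<psi> \<oplus>\<^bsub>D.D\<^esub> \<psi>')"
     using ps ps' cs(3)[of \<psi> \<psi>'] by (simp del: dual_module_sel(2,3))
    moreover have "\<psi> \<oplus>\<^bsub>D.D\<^esub> \<psi>' \<in> D.X" using DM.M.add.m_closed[of \<psi> \<psi>'] ps ps' by simp
    ultimately show ?thesis
     using g[of "\<psi> \<oplus>\<^bsub>D.D\<^esub> \<psi>'"] g[OF ps(1)] g[OF ps'(1)] ps(2) ps'(2) f[OF a(1)] a(2) pD(1)[OF a(1)]
     by simp
   qed
   show "(g Y) (f (\<sigma> l \<odot>\<^bsub>quot_module P U\<^esub> X)) = (g (l \<odot>\<^bsub>quot_module D.D ?z\<^esub> Y)) (f X)"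
    if l: "l \<in> carrier L" for l
   proof -
    have "\<sigma> l \<odot>\<^bsub>quot_module P U\<^esub> X = U +>\<^bsub>P\<^esub> (\<sigma> l \<odot>\<^bsub>P\<^esub> a)" using a l cs(2) by simp
    hence 1: "f (\<sigma> l \<odot>\<^bsub>quot_module P U\<^esub> X) = \<sigma> l \<odot>\<^bsub>S\<^esub> \<phi> a"
     using f[of "\<sigma> l \<odot>\<^bsub>P\<^esub> a"] a l T.A.smult_closed[of "\<sigma> l" a] pD(4)[of "\<sigma> l" a] by simp
    have "l \<odot>\<^bsub>quot_module D.D ?z\<^esub> Y = ?z +>\<^bsub>D.D\<^esub> (l \<odot>\<^bsub>D.D\<^esub> \<psi>)"
     using ps l cs(4)[of \<psi> l] by (simp del: dual_module_sel(2,4))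
    moreover have "l \<odot>\<^bsub>D.D\<^esub> \<psi> \<in> D.X" using DM.smult_closed[OF l, of \<psi>] ps by simp
    ultimately have 2: "g (l \<odot>\<^bsub>quot_module D.D ?z\<^esub> Y) = l \<odot>\<^bsub>D.D\<^esub> \<psi>" using g by simp
    show ?thesis using 1 2 f[OF a(1)] a(2) g[OF ps(1)] ps(2) pD(1)[OF a(1)] by simp
   qed
  qed (rule that)
  have "h (T.cl U ?z (frag_of (a, \<psi>))) = \<psi> (\<phi> a)" if "a \<in> carrier P" "\<psi> \<in> D.X" for a \<psi>
   using h(2)[of "U +>\<^bsub>P\<^esub> a" "?z +>\<^bsub>D.D\<^esub> \<psi>"] T.A.coset_in_quot[OF that(1), of U] DM.coset_in_quot[of \<psi> ?z] that
    f[OF that(1)] g[OF that(2)] by (simp add: cls_def del: quot_module_sel dual_module_sel(2))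
  moreover have "restrict h (carrier (T.TQ U ?z)) \<in> chars p (T.TQ U ?z)" using h(1) comm_groupE(1)[OF T.T_comm[OF op]]
   by (auto intro!: homI simp: hom_mult hom_in_carrier)
  moreover have "T.cl U ?z (frag_of (a, \<psi>)) \<in> carrier (T.TQ U ?z)" if "a \<in> carrier P" "\<psi> \<in> D.X" for a \<psi>
   using T.cl_closed[OF op, of "frag_of (a, \<psi>)"] that by simp
  ultimately show ?thesis by (intro bexI[of _ "restrict h (carrier (T.TQ U ?z))"]) auto
 qed
 then obtain H where H: "!!\<phi>. \<phi> \<in> Ann_hom L P S U ==> H \<phi> \<in> chars p (T.TQ U ?z)"
  "!!\<phi> a \<psi>. \<phi> \<in> Ann_hom L P S U ==> a \<in> carrier P ==> \<psi> \<in> D.X ==> H \<phi> (T.cl U ?z (frag_of (a, \<psi>))) = \<psi> (\<phi> a)"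
  by metis
 have inj: "inj_on H (Ann_hom L P S U)"
 proof (rule inj_onI)
  fix \<phi> \<phi>' assume p1: "\<phi> \<in> Ann_hom L P S U" and p2: "\<phi>' \<in> Ann_hom L P S U" and e: "H \<phi> = H \<phi>'"
  have h: "\<phi> \<in> cont_hom L P S" "\<phi>' \<in> cont_hom L P S" "\<phi> \<in> extensional (carrier P)" "\<phi>' \<in> extensional (carrier P)"
   using p1 p2 by (auto simp: Ann_hom_def)
  show "\<phi> = \<phi>'"
  proof (rule extensionalityI[OF h(3,4)], rule ccontr)
   fix a assume a: "a \<in> carrier P" and ne: "\<phi> a ~= \<phi>' a"
   note c = cont_homD(1)[OF h(1) a] cont_homD(1)[OF h(2) a]
   let ?d = "\<phi> a \<ominus>\<^bsub>S\<^esub> \<phi>' a"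
   have d: "?d \<in> carrier S" "?d ~= \<zero>\<^bsub>S\<^esub>" using c ne S.minus_eq_zero_iff by auto
   obtain \<theta> where t: "\<theta> \<in> hom (add_monoid S) (integer_mod_group p)" "\<theta> ?d = 1"
    by (rule char_exists[OF S.M.a_comm_group _ p(1), of ?d]) (use S.finite_carrier p(2) d in auto)
   let ?\<psi> = "restrict \<theta> (carrier S)"
   have ps: "?\<psi> \<in> D.X" by (auto intro!: homI simp: hom_mult[OF t(1), simplified] hom_in_carrier[OF t(1)])
   have "?\<psi> (\<phi> a) = ?\<psi> (\<phi>' a)" using H(2)[OF p1 a ps] H(2)[OF p2 a ps] e by simp
   moreover have "?\<psi> (\<phi> a) = (?\<psi> ?d + ?\<psi> (\<phi>' a)) mod int p"
    using D.charsD(3)[OF ps d(1) c(2)] c by (simp add: S.M.minus_eq S.M.a_assoc S.M.l_neg)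
   ultimately have "?\<psi> (\<phi>' a) mod int p = (1 + ?\<psi> (\<phi>' a)) mod int p"
    using t(2) d(1) D.charsD(1,2)[OF ps c(2)] by simp
   hence "int p dvd 1" by (metis add_diff_cancel_right' dvd_minus_iff minus_diff_eq mod_eq_dvd_iff)
   thus False using D.p_gt_1 by simp
  qed
 qed
 have "H ` Ann_hom L P S U \<subseteq> chars p (T.TQ U ?z)" using H(1) by auto
 hence "finite (Ann_hom L P S U)" "card (Ann_hom L P S U) \<le> card (chars p (T.TQ U ?z))"
  using ch inj inj_on_finite card_inj_on_le by blast+
 thus ?thesis using ch lev by linarith
qed

section \<open>Number of generators\<close>

lemma left_module_cong:
 assumes M: "left_module R M" and e: "carrier N = carrier M" "ring.add N = ring.add M" "ring.zero N = ring.zero M"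
  "module.smult N = module.smult M"
 shows "left_module R N"
proof -
 interpret M: left_module R M by fact
 have "abelian_group N"
 proof (rule abelian_groupI)
  fix x assume "x \<in> carrier N"
  thus "\<exists>y\<in>carrier N. y \<oplus>\<^bsub>N\<^esub> x = \<zero>\<^bsub>N\<^esub>"
   using M.M.l_neg[of x] M.M.a_inv_closed[of x] by (auto simp: e)
 qed (simp_all add: e M.M.a_ac)
 moreover have "left_module_axioms R N" using M.left_module_axioms by (simp add: left_module_def left_module_axioms_def e)
 ultimately show ?thesis by (intro left_module.intro M.R.ring_axioms)
qed

text \<open>The operations of \<open>quot_module\<close> with the discrete topology added, so that a
  finite quotient can serve as a simple profinite module.\<close>

definition quot_top :: "('l, 'm, 'y) top_module_scheme => 'm set => ('l, 'm set) top_module" where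
 "quot_top M H =
   \<lparr>carrier = a_rcosets\<^bsub>M\<^esub> H, monoid.mult = undefined, one = undefined, ring.zero = H, ring.add = set_add M,
   smult = (%a X. \<Union>x\<in>X. H +>\<^bsub>M\<^esub> (a \<odot>\<^bsub>M\<^esub> x)), mtop = discrete_topology (a_rcosets\<^bsub>M\<^esub> H)\<rparr>"

lemma quot_top_sel [simp]:
 "carrier (quot_top M H) = a_rcosets\<^bsub>M\<^esub> H" "\<zero>\<^bsub>quot_top M H\<^esub> = H"
 "X \<oplus>\<^bsub>quot_top M H\<^esub> Y = X <+>\<^bsub>M\<^esub> Y"
 "a \<odot>\<^bsub>quot_top M H\<^esub> X = (\<Union>x\<in>X. H +>\<^bsub>M\<^esub> (a \<odot>\<^bsub>M\<^esub> x))"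
 "mtop (quot_top M H) = discrete_topology (a_rcosets\<^bsub>M\<^esub> H)" by (simp_all add: quot_top_def)

definition max_open :: "('l, 'x) ring_scheme => ('l, 'm, 'y) top_module_scheme => 'm set => bool" where
 "max_open L M H \<longleftrightarrow> open_submodule H L M & H ~= carrier M &
   (\<forall>A. submodule A L M & H \<subseteq> A --> A = H \<or> A = carrier M)"

context left_module
begin

definition adjoin :: "'c => 'c set => 'c set" where
 "adjoin x A = (%a. a \<odot> x) ` carrier R <+>\<^bsub>M\<^esub> A"

lemma adjoin_submod: "x \<in> carrier M ==> submodule A R M ==> submodule (adjoin x A) R M"
 unfolding adjoin_def by (intro submod_set_add submod_cyclic)

lemma adjoin_sup: "x \<in> carrier M ==> submodule A R M ==> A \<subseteq> adjoin x A"
 unfolding adjoin_def by (intro subset_set_add submod_cyclic)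

lemma adjoin_mem: "x \<in> carrier M ==> submodule A R M ==> x \<in> adjoin x A" unfolding adjoin_def
 by (rule subset_set_add(1)[OF submod_cyclic, THEN subsetD], assumption+)
   (rule image_eqI[of _ _ "\<one>\<^bsub>R\<^esub>"], simp_all add: smult_one)

lemma adjoin_least: "submodule N R M ==> x \<in> N ==> A \<subseteq> N ==> adjoin x A \<subseteq> N"
 unfolding adjoin_def using submod_smult by (intro set_add_least) auto

lemma set_addE:
 assumes "y \<in> A <+>\<^bsub>M\<^esub> B" obtains a b where "a \<in> A" "b \<in> B" "y = a \<oplus> b"
 using assms by (auto simp: set_add_def')

lemma adjoinE:
 assumes "y \<in> adjoin x A" obtains l a where "l \<in> carrier R" "a \<in> A" "y = l \<odot> x \<oplus> a"
 using assms by (auto simp: adjoin_def set_add_def')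

end

context prof_module
begin

lemma quot_top_profinite:
 assumes L: "profinite_ring L" and H: "open_submodule H L M"
 shows "profinite_module L (quot_top M H)"
proof (rule discrete_profinite_module[OF L])
 note Hs = open_submodD(1)[OF H]
 show "left_module L (quot_top M H)"
  by (rule left_module_cong[OF quot_left_module[OF Hs]]) (simp_all add: quot_top_def quot_module_def)
 show "finite (carrier (quot_top M H))" using finite_cosets[OF H] by simp
 fix X Y assume "X \<in> carrier (quot_top M H)" "Y \<in> carrier (quot_top M H)"
 then obtain a b where ab: "a \<in> carrier M" "b \<in> carrier M" "X = H +> a" "Y = H +> b" by (auto simp: A_RCOSETS_def')
 have tL: "topspace (rtop L) = carrier L" using L by (simp add: profinite_ring_def)
 have "{l \<in> carrier L. l \<odot>\<^bsub>quot_top M H\<^esub> X = Y} = {l \<in> topspace (rtop L). l \<odot> a \<oplus> (\<ominus> b) \<in> H}"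
 proof (rule Collect_cong)
  fix l
  show "(l \<in> carrier L & l \<odot>\<^bsub>quot_top M H\<^esub> X = Y) = (l \<in> topspace (rtop L) & l \<odot> a \<oplus> (\<ominus> b) \<in> H)"
  proof (cases "l \<in> carrier L")
   case True
   thus ?thesis using coset_smult[OF Hs ab(1) True] coset_eq_iff[OF Hs smult_closed[OF True ab(1)] ab(2)]
    by (simp add: ab(3,4) tL M.minus_eq)
  qed (simp add: tL)
 qed
 moreover have "continuous_map (rtop L) (mtop M) (%l. l \<odot> a \<oplus> (\<ominus> b))"
  using ab by (intro cont_add' cont_smult') auto
 ultimately show "openin (rtop L) {l \<in> carrier L. l \<odot>\<^bsub>quot_top M H\<^esub> X = Y}"
  using openin_continuous_map_preimage[OF _ open_submodD(2)[OF H]] by simp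
qed simp

lemma quot_map_hom:
 assumes L: "profinite_ring L" and H: "open_submodule H L M"
 shows "(%x. H +> x) \<in> cont_hom L M (quot_top M H)"
proof (rule cont_homI[OF profinite quot_top_profinite[OF L H] L])
 note Hs = open_submodD(1)[OF H]
 show "H +> x \<in> carrier (quot_top M H)" if "x \<in> carrier M" for x using that by (auto simp: A_RCOSETS_def')
 show "H +> (x \<oplus> y) = (H +> x) \<oplus>\<^bsub>quot_top M H\<^esub> (H +> y)" if "x \<in> carrier M" "y \<in> carrier M" for x y
  using coset_add[OF Hs that] by simp
 show "H +> (a \<odot> x) = a \<odot>\<^bsub>quot_top M H\<^esub> (H +> x)" if "a \<in> carrier L" "x \<in> carrier M" for a x
  using coset_smult[OF Hs that(2,1)] by simp
 fix U assume U: "open_submodule U L (quot_top M H)"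
 interpret Q: prof_module L "quot_top M H" by (rule prof_module.intro[OF quot_top_profinite[OF L H]])
 have "H \<in> U" using Q.open_submodD(4)[OF U] by simp
 moreover have "H +> x = H" if "x \<in> H" for x using coset_eq_self[OF Hs] that open_submodD(3)[OF H] by auto
 ultimately show "\<exists>W. openin (mtop M) W & \<zero> \<in> W & (\<forall>x\<in>W. H +> x \<in> U)"
  using open_submodD(2,4)[OF H] by (intro exI[of _ H]) auto
qed

lemma quot_simple:
 assumes L: "profinite_ring L" and H: "max_open L M H"
 shows "simple_module L (quot_top M H)"
proof -
 have Ho: "open_submodule H L M" and ne: "H ~= carrier M"
  and mx: "!!A. submodule A L M ==> H \<subseteq> A ==> A = H \<or> A = carrier M" using H by (auto simp: max_open_def)
 note Hs = open_submodD(1)[OF Ho]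
 obtain a where a: "a \<in> carrier M" "a \<notin> H" using ne open_submodD(3)[OF Ho] by auto
 have "H +> a \<in> carrier (quot_top M H)" using a by (auto simp: A_RCOSETS_def')
 moreover have "H +> a ~= H" using coset_eq_self[OF Hs a(1)] a(2) by simp
 ultimately have 1: "carrier (quot_top M H) ~= {\<zero>\<^bsub>quot_top M H\<^esub>}" unfolding quot_top_sel(2) by blast
 interpret Q: prof_module L "quot_top M H" by (rule prof_module.intro[OF quot_top_profinite[OF L Ho]])
 have "N = {H} \<or> N = a_rcosets H" if N: "submodule N L (quot_top M H)" for N
 proof -
  let ?A = "{x \<in> carrier M. H +> x \<in> N}"
  have rc: "\<exists>x\<in>carrier M. X = H +> x" if "X \<in> a_rcosets H" for X using that by (auto simp: A_RCOSETS_def')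
  have Nc: "N \<subseteq> a_rcosets H" using Q.submod_subset[OF N] by simp
  have HN: "H \<in> N" using Q.submod_zero[OF N] by simp
  have "submodule ?A L M" by (rule submodule_preimage[OF profinite Q.profinite quot_map_hom[OF L Ho] N])
  moreover have "H \<subseteq> ?A"
  proof
   fix x assume x: "x \<in> H"
   hence xc: "x \<in> carrier M" using open_submodD(3)[OF Ho] by auto
   thus "x \<in> ?A" using HN coset_eq_self[OF Hs xc] x by simp
  qed
  ultimately consider "?A = H" | "?A = carrier M" using mx by blast
  thus ?thesis
  proof cases
   case 1
   have NH: "X = H" if XN: "X \<in> N" for X
   proof -
    obtain x where x: "x \<in> carrier M" "X = H +> x" using XN Nc rc by blast
    hence "x \<in> ?A" using XN by simp
    hence "x \<in> H" by (simp only: 1)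
    thus ?thesis using x coset_eq_self[OF Hs x(1)] by simp
   qed
   have "N \<subseteq> {H}" unfolding subset_iff singleton_iff by (intro allI impI NH)
   thus ?thesis using HN by blast
  next
   case 2
   have "X \<in> N" if XH: "X \<in> a_rcosets H" for X
   proof -
    obtain x where x: "x \<in> carrier M" "X = H +> x" using XH rc by blast
    hence "x \<in> ?A" by (simp only: 2)
    thus ?thesis using x by simp
   qed
   thus ?thesis using Nc by auto
  qed
 qed
 thus ?thesis using 1 Q.profinite by (simp add: simple_module_def closed_submodule_def)
qed

text \<open>A submodule above \<open>N\<close> is a union of cosets of \<open>N\<close>, of which
  there are finitely many.\<close>

lemma finite_above:
 assumes N: "open_submodule N L M" shows "finite {A. submodule A L M & N \<subseteq> A}"
proof (rule finite_imageD)
 let ?f = "%A. {X \<in> a_rcosets N. X \<subseteq> A}"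
 show "finite (?f ` {A. submodule A L M & N \<subseteq> A})"
  by (rule finite_subset[of _ "Pow (a_rcosets N)"]) (use finite_cosets[OF N] in auto)
 have U: "A = \<Union>(?f A)" if A: "submodule A L M" "N \<subseteq> A" for A
 proof
  show "A \<subseteq> \<Union>(?f A)"
  proof
   fix a assume a: "a \<in> A"
   have ac: "a \<in> carrier M" using a submod_subset[OF A(1)] by auto
   have "N +> a \<subseteq> A" using A a submod_add[OF A(1)] by (auto simp: a_r_coset_def')
   thus "a \<in> \<Union>(?f A)"
    using coset_self[OF open_submodD(1)[OF N] ac] ac by (auto simp: A_RCOSETS_def' intro!: exI[of _ "N +> a"])
  qed
 qed auto
 show "inj_on ?f {A. submodule A L M & N \<subseteq> A}" by (rule inj_onI) (metis (no_types, lifting) U mem_Collect_eq)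
qed

lemma ex_max_open:
 assumes N: "open_submodule N L M" "N ~= carrier M"
 obtains H where "max_open L M H" "N \<subseteq> H"
proof -
 let ?S = "{A. submodule A L M & N \<subseteq> A & A ~= carrier M}"
 have "finite ?S" by (rule finite_subset[OF _ finite_above[OF N(1)]]) auto
 moreover have "?S ~= {}" using N open_submodD(1)[OF N(1)] by auto
 ultimately have "\<exists>H\<in>?S. \<forall>A\<in>?S. H \<le> A --> H = A" by (rule finite_has_maximal)
 then obtain H where H: "H \<in> ?S" "\<forall>A\<in>?S. H \<le> A --> H = A" ..
 have "open_submodule H L M" using open_submoduleI[OF _ N(1)] H(1) by blast
 hence "max_open L M H" unfolding max_open_def using H by blast
 thus ?thesis using that H(1) by blast
qed

text \<open>The preimage of the Jacobson radical of the quotient by \<open>N\<close>, for an open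
  submodule \<open>N\<close>. Inserting the carrier gives the value \<open>carrier M\<close> when no
  maximal open submodule lies above \<open>N\<close>.\<close>

definition rad :: "'m set => 'm set" where
 "rad N = \<Inter>(insert (carrier M) {H. max_open L M H & N \<subseteq> H})"

lemma rad_submod: "submodule (rad N) L M"
 unfolding rad_def by (rule submod_Inter) (auto simp: max_open_def submod_carrier open_submodule_def)

lemma rad_sup: "N \<subseteq> carrier M ==> N \<subseteq> rad N" by (auto simp: rad_def)

text \<open>Semisimplicity of the quotient by the radical. Among the finitely many submodules that
  together with \<open>X\<close> span everything, a minimal one meets \<open>X\<close> in the
  radical only.\<close>

lemma rad_complement:
 assumes N: "open_submodule N L M" and X: "submodule X L M" "rad N \<subseteq> X"
 obtains C where "submodule C L M" "rad N \<subseteq> C" "X <+>\<^bsub>M\<^esub> C = carrier M" "X \<inter> C = rad N"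
proof -
 let ?S = "{C. submodule C L M & rad N \<subseteq> C & X <+>\<^bsub>M\<^esub> C = carrier M}"
 have Nr: "N \<subseteq> rad N" by (rule rad_sup[OF open_submodD(3)[OF N]])
 have finS: "finite ?S" by (rule finite_subset[OF _ finite_above[OF N]]) (use Nr in auto)
 have "carrier M \<in> ?S"
  using submod_carrier subset_set_add(2)[OF X(1) submod_carrier] set_add_least[OF submod_carrier submod_subset[OF X(1)] order_refl]
   submod_subset[OF rad_submod] by auto
 hence "?S ~= {}" by blast
 with finS have "\<exists>C\<in>?S. \<forall>A\<in>?S. A \<le> C --> C = A" by (rule finite_has_minimal)
 then obtain C where C: "C \<in> ?S" "\<forall>A\<in>?S. A \<le> C --> C = A" ..
 have Cs: "submodule C L M" "rad N \<subseteq> C" "X <+>\<^bsub>M\<^esub> C = carrier M" using C(1) by auto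
 have "X \<inter> C \<subseteq> rad N"
 proof
  fix y assume y: "y \<in> X \<inter> C"
  have yc: "y \<in> carrier M" using y submod_subset[OF X(1)] by auto
  show "y \<in> rad N"
  proof (rule ccontr)
   assume "y \<notin> rad N"
   then obtain H where H: "max_open L M H" "N \<subseteq> H" "y \<notin> H" using yc by (auto simp: rad_def)
   have Hs: "submodule H L M" using H(1) by (simp add: max_open_def open_submodule_def)
   have rH: "rad N \<subseteq> H" using H by (auto simp: rad_def)
   have full: "adjoin y H = carrier M"
    using H(1,3) adjoin_submod[OF yc Hs] adjoin_sup[OF yc Hs] adjoin_mem[OF yc Hs] by (auto simp: max_open_def)
   \<comment> \<open>Since \<open>y\<close> and the maximal \<open>H\<close> span everything, each c
     in \<open>C\<close> is l y + h, where l y lies in \<open>X\<close> and h in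
     \<open>C \<inter> H\<close>. So \<open>C \<inter> H\<close> also spans together with
     \<open>X\<close>, contrary to minimality of \<open>C\<close>.\<close>
   let ?C = "C \<inter> H"
   have Cs': "submodule ?C L M" by (rule submod_Int[OF Cs(1) Hs])
   let ?T = "X <+>\<^bsub>M\<^esub> ?C"
   have Ts: "submodule ?T L M" by (rule submod_set_add[OF X(1) Cs'])
   have XT: "X \<subseteq> ?T" "?C \<subseteq> ?T" by (rule subset_set_add[OF X(1) Cs'])+
   have "C \<subseteq> ?T"
   proof
    fix c assume c: "c \<in> C"
    have "c \<in> adjoin y H" using c full submod_subset[OF Cs(1)] by auto
    then obtain l h where l: "l \<in> carrier L" "h \<in> H" "c = l \<odot> y \<oplus> h" by (rule adjoinE)
    have hc: "h \<in> carrier M" and ly: "l \<odot> y \<in> carrier M" using l submod_subset[OF Hs] smult_closed yc by auto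
    have "h = c \<ominus> l \<odot> y" unfolding l(3) using hc ly by (simp add: M.minus_eq M.a_ac M.r_neg M.r_neg1)
    hence "h \<in> C" using submod_minus[OF Cs(1) c submod_smult[OF Cs(1) l(1)]] y by auto
    hence "h \<in> ?T" using XT l by auto
    moreover have "l \<odot> y \<in> ?T" using submod_smult[OF X(1) l(1)] y XT by auto
    ultimately show "c \<in> ?T" unfolding l(3) by (intro submod_add[OF Ts])
   qed
   hence "X <+>\<^bsub>M\<^esub> C \<subseteq> ?T" using XT by (intro set_add_least[OF Ts]) auto
   hence "?T = carrier M" using Cs(3) submod_subset[OF Ts] by auto
   hence "?C \<in> ?S" using Cs' Cs(2) rH by auto
   from C(2)[rule_format, OF this] have "C = ?C" by simp
   thus False using y H(3) by auto
  qed
 qed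
 thus ?thesis using that[OF Cs] X(2) Cs(2) by blast
qed

text \<open>The image of a submodule under \<open>\<phi>\<close> is zero or all of the simple module
  \<open>S\<close>; a submodule strictly above the kernel therefore maps onto \<open>S\<close> and
  is all of \<open>M\<close>.\<close>

lemma Ann_hom_ker_max:
 fixes S :: "('l, 's) top_module"
 assumes L: "profinite_ring L" and S: "simple_module L S" and N: "open_submodule N L M"
  and \<phi>: "\<phi> \<in> Ann_hom L M S N" and ne: "y \<in> carrier M" "\<phi> y ~= \<zero>\<^bsub>S\<^esub>"
 shows "max_open L M {x \<in> carrier M. \<phi> x = \<zero>\<^bsub>S\<^esub>}" (is "max_open L M ?K") and "\<phi> ` carrier M = carrier S"
proof -
 interpret S: simple_mod L S by (rule simple_modI[OF L S])
 have h: "\<phi> \<in> cont_hom L M S" and kN: "!!x. x \<in> N ==> \<phi> x = \<zero>\<^bsub>S\<^esub>" using \<phi> by (auto simp: Ann_hom_def)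
 note hD = cont_homD[OF h]
 have im: "\<phi> ` A = carrier S" if A: "submodule A L M" "a \<in> A" "\<phi> a ~= \<zero>\<^bsub>S\<^esub>" for A a
  using S.submod_cases[OF submodule_image[OF profinite S.profinite h A(1)]] A(2,3) by auto
 show "\<phi> ` carrier M = carrier S" by (rule im[OF submod_carrier ne])
 have Ks: "submodule ?K L M" using submodule_preimage[OF profinite S.profinite h S.submod_sing_zero] by simp
 have "open_submodule ?K L M" by (rule open_submoduleI[OF Ks N]) (use kN open_submodD(3)[OF N] in auto)
 moreover have "A = ?K \<or> A = carrier M" if A: "submodule A L M" "?K \<subseteq> A" for A
 proof (cases "A \<subseteq> ?K")
  case False
  then obtain a where a: "a \<in> A" "\<phi> a ~= \<zero>\<^bsub>S\<^esub>" using submod_subset[OF A(1)] by auto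
  have "x \<in> A" if x: "x \<in> carrier M" for x
  proof -
   obtain b where b: "b \<in> A" "\<phi> b = \<phi> x" using im[OF A(1) a] hD(1)[OF x] by (metis imageE)
   have bc: "b \<in> carrier M" using b submod_subset[OF A(1)] by auto
   have "\<phi> (x \<ominus> b) = \<zero>\<^bsub>S\<^esub>"
    using cont_hom_minus(2)[OF profinite S.profinite h x bc] b hD(1)[OF x] by (simp add: S.M.minus_eq S.M.r_neg)
   hence "x \<ominus> b \<in> A" using A(2) x bc by auto
   hence "(x \<ominus> b) \<oplus> b \<in> A" using b submod_add[OF A(1)] by auto
   thus ?thesis using x bc by (simp add: M.minus_eq M.a_assoc M.l_neg)
  qed
  thus ?thesis using submod_subset[OF A(1)] by auto
 qed (use A in auto)
 ultimately show "max_open L M ?K" using ne by (auto simp: max_open_def)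
qed

text \<open>The idea is to choose \<open>x\<close> whose cyclic submodule modulo the radical is as large as possible. If
 \<open>\<phi> x = 0\<close> with \<open>\<phi> ~= 0\<close>, and \<open>s\<close> is not a value at \<open>x\<close>, then some \<open>t\<close> in a complement of the kernel of \<open>\<phi>\<close>
 has \<open>\<phi> t = s\<close>; now \<open>x + t\<close> generates more than \<open>x\<close>, as \<open>x \<mapsto> t\<close> does not extend to a homomorphism.\<close>

lemma ex_separating_element:
 assumes L: "profinite_ring L" and N: "open_submodule N L M"
 obtains x where "x \<in> carrier M" "!!S :: ('l, 's) top_module. simple_module L S ==>
   (\<forall>\<phi>\<in>Ann_hom L M S N. \<phi> x = \<zero>\<^bsub>S\<^esub> --> (\<forall>y\<in>carrier M. \<phi> y = \<zero>\<^bsub>S\<^esub>)) \<or>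
   (\<forall>s\<in>carrier S. \<exists>\<phi>\<in>Ann_hom L M S N. \<phi> x = s)"
proof -
 let ?J = "rad N"
 have NJ: "N \<subseteq> ?J" by (rule rad_sup[OF open_submodD(3)[OF N]])
 have Jc: "?J \<subseteq> carrier M" by (rule submod_subset[OF rad_submod])
 let ?F = "(%x. adjoin x ?J) ` carrier M"
 have "finite ?F" by (rule finite_subset[OF _ finite_above[OF N]])
   (use NJ adjoin_submod[OF _ rad_submod] adjoin_sup[OF _ rad_submod] in fast)
 moreover have "?F ~= {}" using M.zero_closed by blast
 ultimately have "\<exists>X\<in>?F. \<forall>Y\<in>?F. X \<le> Y --> X = Y" by (rule finite_has_maximal)
 then obtain X where X: "X \<in> ?F" "\<forall>Y\<in>?F. X \<le> Y --> X = Y" ..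
 obtain x where x: "x \<in> carrier M" "X = adjoin x ?J" using X(1) by auto
 have Xs: "submodule X L M" and JX: "?J \<subseteq> X" and xX: "x \<in> X"
  unfolding x(2) by (rule adjoin_submod[OF x(1) rad_submod] adjoin_sup[OF x(1) rad_submod] adjoin_mem[OF x(1) rad_submod])+
 show ?thesis
 proof (rule that[OF x(1)], rule ccontr)
  fix S :: "('l, 's) top_module"
  assume S: "simple_module L S" and "\<not> ((\<forall>\<phi>\<in>Ann_hom L M S N. \<phi> x = \<zero>\<^bsub>S\<^esub> --> (\<forall>y\<in>carrier M. \<phi> y = \<zero>\<^bsub>S\<^esub>)) \<or>
   (\<forall>s\<in>carrier S. \<exists>\<phi>\<in>Ann_hom L M S N. \<phi> x = s))"
  then obtain \<phi> y s where \<phi>: "\<phi> \<in> Ann_hom L M S N" "\<phi> x = \<zero>\<^bsub>S\<^esub>" "y \<in> carrier M" "\<phi> y ~= \<zero>\<^bsub>S\<^esub>"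
   and s: "s \<in> carrier S" "!!\<psi>. \<psi> \<in> Ann_hom L M S N ==> \<psi> x ~= s" by blast
  interpret S: simple_mod L S by (rule simple_modI[OF L S])
  have h: "\<phi> \<in> cont_hom L M S" and kN: "!!x. x \<in> N ==> \<phi> x = \<zero>\<^bsub>S\<^esub>" using \<phi> by (auto simp: Ann_hom_def)
  note hD = cont_homD[OF h]
  let ?K = "{x \<in> carrier M. \<phi> x = \<zero>\<^bsub>S\<^esub>}"
  have mK: "max_open L M ?K" by (rule Ann_hom_ker_max(1)[OF L S N \<phi>(1,3,4)])
  have surj: "\<phi> ` carrier M = carrier S" by (rule Ann_hom_ker_max(2)[OF L S N \<phi>(1,3,4)])
  have Ks: "submodule ?K L M" using mK by (simp add: max_open_def open_submodule_def)
  have JK: "?J \<subseteq> ?K" unfolding rad_def using mK kN open_submodD(3)[OF N] by (intro Inter_lower) auto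
  obtain T where T: "submodule T L M" "?J \<subseteq> T" "?K <+>\<^bsub>M\<^esub> T = carrier M" "?K \<inter> T = ?J"
   by (rule rad_complement[OF N Ks JK]) (rule that)
  obtain C where C: "submodule C L M" "?J \<subseteq> C" "X <+>\<^bsub>M\<^esub> C = carrier M" "X \<inter> C = ?J"
   by (rule rad_complement[OF N Xs JX]) (rule that)
  note Tc = submod_subset[OF T(1), THEN subsetD] and Cc = submod_subset[OF C(1), THEN subsetD]
  obtain z where z: "z \<in> carrier M" "\<phi> z = s" using surj s(1) by (metis imageE)
  have "z \<in> ?K <+>\<^bsub>M\<^esub> T" unfolding T(3) by (rule z(1))
  then obtain u t where ut: "u \<in> ?K" "t \<in> T" "z = u \<oplus> t" by (rule set_addE)
  have tc: "t \<in> carrier M" by (rule Tc[OF ut(2)])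
  have ft: "\<phi> t = s" using z(2) hD(3)[of u t] ut tc hD(1)[OF tc] by simp
  have Tzero: "w \<in> ?J" if "w \<in> T" "\<phi> w = \<zero>\<^bsub>S\<^esub>" for w using that T(4) Tc by blast
  \<comment> \<open>If every scalar that kills \<open>x\<close> modulo the radical also killed
    \<open>t\<close>, then l x + c \<mapsto> l s, with c in the complement \<open>C\<close> of
    \<open>X\<close>, would be a well defined homomorphism taking the excluded value
    \<open>s\<close> at \<open>x\<close>.\<close>
  have "\<exists>l\<in>carrier L. l \<odot> x \<in> ?J & l \<odot> t \<notin> ?J"
  proof (rule ccontr)
   assume "\<not> ?thesis"
   hence imp: "\<phi> (l \<odot> t) = \<zero>\<^bsub>S\<^esub>" if "l \<in> carrier L" "l \<odot> x \<in> ?J" for l using that JK by blast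
   have rep: "\<exists>l\<in>carrier L. \<exists>c\<in>C. w = l \<odot> x \<oplus> c" if w: "w \<in> carrier M" for w
   proof -
    have "w \<in> X <+>\<^bsub>M\<^esub> C" unfolding C(3) by (rule w)
    then obtain v c where v: "v \<in> X" "c \<in> C" "w = v \<oplus> c" by (rule set_addE)
    from v(1) obtain l j where l: "l \<in> carrier L" "j \<in> ?J" "v = l \<odot> x \<oplus> j" unfolding x(2) by (rule adjoinE)
    have "w = l \<odot> x \<oplus> (j \<oplus> c)" using v l x(1) Jc Cc by (simp add: M.a_assoc smult_closed subset_iff)
    moreover have "j \<oplus> c \<in> C" using l v C(2) submod_add[OF C(1)] by auto
    ultimately show ?thesis using l(1) by blast
   qed
   have uniq: "l \<odot>\<^bsub>S\<^esub> s = l' \<odot>\<^bsub>S\<^esub> s"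
    if l: "l \<in> carrier L" "l' \<in> carrier L" and c: "c \<in> C" "c' \<in> C" and e: "l \<odot> x \<oplus> c = l' \<odot> x \<oplus> c'" for l l' c c'
   proof -
    have cc: "c \<in> carrier M" "c' \<in> carrier M" using c Cc by auto
    have lx: "l \<odot> x \<in> carrier M" "l' \<odot> x \<in> carrier M" using l x(1) smult_closed by auto
    have d: "(l \<ominus>\<^bsub>L\<^esub> l') \<odot> v = l \<odot> v \<oplus> \<ominus> (l' \<odot> v)" if "v \<in> carrier M" for v
     using l that by (simp add: R.minus_eq smult_l_distr smult_minus_l)
    have "l \<odot> x \<oplus> \<ominus> (l' \<odot> x) = (l \<odot> x \<oplus> c) \<oplus> (\<ominus> (l' \<odot> x) \<oplus> \<ominus> c)"
     using lx cc by (simp add: M.a_ac M.r_neg M.r_neg1 M.r_neg2)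
    also have "... = c' \<oplus> \<ominus> c" unfolding e using lx cc by (simp add: M.a_ac M.r_neg M.r_neg1 M.r_neg2)
    finally have "(l \<ominus>\<^bsub>L\<^esub> l') \<odot> x = c' \<ominus> c" using d[OF x(1)] by (simp add: M.minus_eq)
    hence "(l \<ominus>\<^bsub>L\<^esub> l') \<odot> x \<in> X \<inter> C"
     using submod_minus[OF C(1) c(2,1)] submod_smult[OF Xs _ xX, of "l \<ominus>\<^bsub>L\<^esub> l'"] l by auto
    hence "\<phi> ((l \<ominus>\<^bsub>L\<^esub> l') \<odot> t) = \<zero>\<^bsub>S\<^esub>" using imp[of "l \<ominus>\<^bsub>L\<^esub> l'"] C(4) l by auto
    hence "(l \<ominus>\<^bsub>L\<^esub> l') \<odot>\<^bsub>S\<^esub> s = \<zero>\<^bsub>S\<^esub>" using hD(4)[of "l \<ominus>\<^bsub>L\<^esub> l'" t] tc ft l by simp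
    hence "l \<odot>\<^bsub>S\<^esub> s \<ominus>\<^bsub>S\<^esub> l' \<odot>\<^bsub>S\<^esub> s = \<zero>\<^bsub>S\<^esub>"
     using l s(1) by (simp add: R.minus_eq S.M.minus_eq S.smult_l_distr S.smult_minus_l)
    thus ?thesis using S.minus_eq_zero_iff l s(1) S.smult_closed by simp
   qed
   define g where "g w = (SOME l. l \<in> carrier L & (\<exists>c\<in>C. w = l \<odot> x \<oplus> c))" for w
   define \<psi> where "\<psi> = (\<lambda>w\<in>carrier M. g w \<odot>\<^bsub>S\<^esub> s)"
   have g: "g w \<in> carrier L & (\<exists>c\<in>C. w = g w \<odot> x \<oplus> c)" if w: "w \<in> carrier M" for w
    unfolding g_def by (rule someI_ex) (use rep[OF w] in blast)
   have ps: "\<psi> (l \<odot> x \<oplus> c) = l \<odot>\<^bsub>S\<^esub> s" if l: "l \<in> carrier L" and c: "c \<in> C" for l c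
   proof -
    have w: "l \<odot> x \<oplus> c \<in> carrier M" using l c x(1) Cc smult_closed by simp
    obtain c' where "c' \<in> C" "l \<odot> x \<oplus> c = g (l \<odot> x \<oplus> c) \<odot> x \<oplus> c'" using g[OF w] by blast
    thus ?thesis using uniq[OF _ l _ c, of "g (l \<odot> x \<oplus> c)" c'] g[OF w] w by (simp add: \<psi>_def)
   qed
   have "\<psi> \<in> cont_hom L M S"
   proof (rule cont_homI[OF profinite S.profinite L])
    show "\<psi> w \<in> carrier S" if "w \<in> carrier M" for w using g[OF that] that s(1) S.smult_closed by (simp add: \<psi>_def)
    show "\<psi> (w \<oplus> w') = \<psi> w \<oplus>\<^bsub>S\<^esub> \<psi> w'" if w: "w \<in> carrier M" "w' \<in> carrier M" for w w'
    proof -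
     obtain l c l' c' where r: "l \<in> carrier L" "c \<in> C" "w = l \<odot> x \<oplus> c" "l' \<in> carrier L" "c' \<in> C" "w' = l' \<odot> x \<oplus> c'"
      using rep[OF w(1)] rep[OF w(2)] by blast
     have "w \<oplus> w' = (l \<oplus>\<^bsub>L\<^esub> l') \<odot> x \<oplus> (c \<oplus> c')"
      unfolding r(3,6) using r x(1) Cc by (simp add: smult_l_distr smult_closed M.a_ac)
     thus ?thesis
      using ps[of "l \<oplus>\<^bsub>L\<^esub> l'" "c \<oplus> c'"] ps[OF r(1,2)] ps[OF r(4,5)] r submod_add[OF C(1)] s(1) by (simp add: S.smult_l_distr)
    qed
    show "\<psi> (a \<odot> w) = a \<odot>\<^bsub>S\<^esub> \<psi> w" if a: "a \<in> carrier L" and w: "w \<in> carrier M" for a w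
    proof -
     obtain l c where r: "l \<in> carrier L" "c \<in> C" "w = l \<odot> x \<oplus> c" using rep[OF w] by blast
     have "a \<odot> w = (a \<otimes>\<^bsub>L\<^esub> l) \<odot> x \<oplus> a \<odot> c"
      unfolding r(3) using r a x(1) Cc by (simp add: smult_r_distr smult_closed smult_assoc1)
     thus ?thesis
      using ps[of "a \<otimes>\<^bsub>L\<^esub> l" "a \<odot> c"] ps[OF r(1,2)] r a submod_smult[OF C(1)] s(1) by (simp add: S.smult_assoc1)
    qed
    fix U assume U: "open_submodule U L S"
    have "\<psi> w = \<zero>\<^bsub>S\<^esub>" if "w \<in> N" for w
    proof -
     have wC: "w \<in> C" using that NJ C(2) by auto
     hence "w = \<zero>\<^bsub>L\<^esub> \<odot> x \<oplus> w" using x(1) Cc by simp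
     thus ?thesis using ps[of "\<zero>\<^bsub>L\<^esub>" w] wC s(1) by simp
    qed
    thus "\<exists>W. openin (mtop M) W & \<zero> \<in> W & (\<forall>x\<in>W. \<psi> x \<in> U)"
     using open_submodD(2,4)[OF N] S.open_submodD(4)[OF U] by (intro exI[of _ N]) auto
   qed
   moreover have "\<psi> w = \<zero>\<^bsub>S\<^esub>" if "w \<in> N" for w
   proof -
    have wC: "w \<in> C" using that NJ C(2) by auto
    hence "w = \<zero>\<^bsub>L\<^esub> \<odot> x \<oplus> w" using x(1) Cc by simp
    thus ?thesis using ps[of "\<zero>\<^bsub>L\<^esub>" w] wC s(1) by simp
   qed
   ultimately have "\<psi> \<in> Ann_hom L M S N" by (auto simp: Ann_hom_def \<psi>_def)
   moreover have "\<psi> x = s"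
    using ps[of "\<one>\<^bsub>L\<^esub>" "\<zero>"] submod_zero[OF C(1)] x(1) s(1) by (simp add: smult_one S.smult_one)
   ultimately show False using s(2) by blast
  qed
  then obtain l where l: "l \<in> carrier L" "l \<odot> x \<in> ?J" "l \<odot> t \<notin> ?J" by blast
  let ?x = "x \<oplus> t"
  let ?Y = "adjoin ?x ?J"
  have xt: "?x \<in> carrier M" using x(1) tc by simp
  have Ys: "submodule ?Y L M" and JY: "?J \<subseteq> ?Y" and xY: "?x \<in> ?Y"
   by (rule adjoin_submod[OF xt rad_submod] adjoin_sup[OF xt rad_submod] adjoin_mem[OF xt rad_submod])+
  have lt: "l \<odot> t \<in> T" by (rule submod_smult[OF T(1) l(1) ut(2)])
  have ltc: "l \<odot> t \<in> carrier M" "l \<odot> x \<in> carrier M" using l x(1) tc smult_closed by auto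
  have "l \<odot> t = l \<odot> ?x \<ominus> l \<odot> x" using l x(1) tc ltc by (simp add: smult_r_distr M.minus_eq M.a_ac M.r_neg M.r_neg1 M.r_neg2)
  hence ltY: "l \<odot> t \<in> ?Y" using submod_minus[OF Ys submod_smult[OF Ys l(1) xY]] l(2) JY by auto
  have ne: "\<phi> (l \<odot> t) ~= \<zero>\<^bsub>S\<^esub>" using Tzero[OF lt] l(3) by blast
  have fl: "\<phi> (l \<odot> t) \<in> carrier S" by (rule hD(1)[OF ltc(1)])
  \<comment> \<open>The nonzero value at \<open>l \<odot> t\<close> generates the simple module
    \<open>S\<close>, so some multiple of \<open>l \<odot> t\<close> has the same value as
    \<open>t\<close>. As \<open>\<phi>\<close> is injective on \<open>T\<close> modulo the radical,
    \<open>t\<close> lies in \<open>?Y\<close>.\<close>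
  have "(%a. a \<odot>\<^bsub>S\<^esub> \<phi> (l \<odot> t)) ` carrier L = carrier S"
  proof -
   have "\<phi> (l \<odot> t) \<in> (%a. a \<odot>\<^bsub>S\<^esub> \<phi> (l \<odot> t)) ` carrier L"
    using fl S.smult_one[OF fl] by (intro image_eqI[of _ _ "\<one>\<^bsub>L\<^esub>"]) auto
   thus ?thesis using S.submod_cases[OF S.submod_cyclic[OF fl]] ne by auto
  qed
  then obtain b where b: "b \<in> carrier L" "s = b \<odot>\<^bsub>S\<^esub> \<phi> (l \<odot> t)" using s(1) by blast
  have blt: "b \<odot> (l \<odot> t) \<in> carrier M" using b(1) ltc smult_closed by auto
  have "t \<ominus> b \<odot> (l \<odot> t) \<in> ?J"
  proof (rule Tzero)
   show "t \<ominus> b \<odot> (l \<odot> t) \<in> T" by (rule submod_minus[OF T(1) ut(2) submod_smult[OF T(1) b(1) lt]])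
   show "\<phi> (t \<ominus> b \<odot> (l \<odot> t)) = \<zero>\<^bsub>S\<^esub>"
    using cont_hom_minus(2)[OF profinite S.profinite h tc blt] hD(4)[OF b(1) ltc(1)] b(2) ft s(1)
    by (simp add: S.M.minus_eq S.M.r_neg)
  qed
  hence "(t \<ominus> b \<odot> (l \<odot> t)) \<oplus> b \<odot> (l \<odot> t) \<in> ?Y"
   using JY submod_add[OF Ys] submod_smult[OF Ys b(1) ltY] by blast
  hence tY: "t \<in> ?Y" using tc blt by (simp add: M.minus_eq M.a_assoc M.l_neg)
  have "x = ?x \<ominus> t" using x(1) tc by (simp add: M.minus_eq M.a_assoc M.r_neg)
  hence "x \<in> ?Y" using submod_minus[OF Ys xY tY] by simp
  hence "X \<subseteq> ?Y" unfolding x(2) using JY by (intro adjoin_least[OF Ys])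
  hence "X = ?Y" using X(2)[rule_format, of ?Y] xt by blast
  hence tX: "t \<in> X" using tY by simp
  \<comment> \<open>Maximality has put \<open>t\<close> into \<open>X\<close>. But \<open>X\<close>
    lies in the kernel of \<open>\<phi>\<close>, so \<open>s\<close> is zero, a value that the zero
    homomorphism does take at \<open>x\<close>.\<close>
  have "X \<subseteq> ?K" unfolding x(2) using JK x(1) \<phi>(2) by (intro adjoin_least[OF Ks]) auto
  hence "s = \<zero>\<^bsub>S\<^esub>" using tX ft by auto
  moreover have "(\<lambda>w\<in>carrier M. \<zero>\<^bsub>S\<^esub>) \<in> Ann_hom L M S N"
   using cont_hom_restrict[OF profinite cont_hom_zero[OF S.profinite]] open_submodD(3)[OF N] by (auto simp: Ann_hom_def)
  ultimately show False using s(2)[of "\<lambda>w\<in>carrier M. \<zero>\<^bsub>S\<^esub>"] x(1) by simp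
 qed
qed

end

definition spans_mod :: "('l, 'x) ring_scheme => ('l, 'm, 'y) top_module_scheme => 'm set => 'm set => bool" where
 "spans_mod L M N X \<longleftrightarrow> (\<forall>A. submodule A L M & X \<subseteq> A & N \<subseteq> A --> A = carrier M)"

lemma spans_mod_mono: "spans_mod L M N X ==> X \<subseteq> Y ==> spans_mod L M N Y" unfolding spans_mod_def by blast

context prof_module
begin

lemma Ann_hom_adjoin:
 fixes S :: "('l, 's) top_module"
 assumes L: "profinite_ring L" and S: "simple_module L S" and N: "open_submodule N L M" and x: "x \<in> carrier M"
 shows "Ann_hom L M S (adjoin x N) = {\<phi> \<in> Ann_hom L M S N. \<phi> x = \<zero>\<^bsub>S\<^esub>}"
proof -
 interpret S: simple_mod L S by (rule simple_modI[OF L S])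
 note Ns = open_submodD(1)[OF N]
 have "\<phi> y = \<zero>\<^bsub>S\<^esub>" if ph: "\<phi> \<in> Ann_hom L M S N" "\<phi> x = \<zero>\<^bsub>S\<^esub>" and y: "y \<in> adjoin x N" for \<phi> y
 proof -
  have h: "\<phi> \<in> cont_hom L M S" using ph(1) by (simp add: Ann_hom_def)
  have "submodule {x \<in> carrier M. \<phi> x \<in> {\<zero>\<^bsub>S\<^esub>}} L M"
   by (rule submodule_preimage[OF profinite S.profinite h S.submod_sing_zero])
  hence "adjoin x N \<subseteq> {x \<in> carrier M. \<phi> x \<in> {\<zero>\<^bsub>S\<^esub>}}"
   by (rule adjoin_least) (use ph x open_submodD(3)[OF N] in \<open>auto simp: Ann_hom_def\<close>)
  thus ?thesis using y by auto
 qed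
 thus ?thesis using adjoin_sup[OF x Ns] adjoin_mem[OF x Ns] by (auto simp: Ann_hom_def)
qed

text \<open>In the second alternative evaluation at \<open>x\<close> is onto \<open>S\<close>:
  adding to the maps that vanish at \<open>x\<close> one chosen map for each value s gives distinct
  maps, so passing to the kernel of evaluation divides the count by at least
  \<open>card (carrier S)\<close>. In the first alternative only the zero map survives.\<close>

lemma card_Ann_hom_adjoin:
 fixes S :: "('l, 's) top_module"
 assumes L: "profinite_ring L" and S: "simple_module L S" and N: "open_submodule N L M" and x: "x \<in> carrier M"
  and alt: "(\<forall>\<phi>\<in>Ann_hom L M S N. \<phi> x = \<zero>\<^bsub>S\<^esub> --> (\<forall>y\<in>carrier M. \<phi> y = \<zero>\<^bsub>S\<^esub>)) \<or>
   (\<forall>s\<in>carrier S. \<exists>\<phi>\<in>Ann_hom L M S N. \<phi> x = s)"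
  and fin: "finite (Ann_hom L M S N)" and le: "card (Ann_hom L M S N) \<le> card (carrier S) ^ Suc n"
 shows "finite (Ann_hom L M S (adjoin x N)) & card (Ann_hom L M S (adjoin x N)) \<le> card (carrier S) ^ n"
proof -
 interpret S: simple_mod L S by (rule simple_modI[OF L S])
 let ?B = "Ann_hom L M S (adjoin x N)"
 note B = Ann_hom_adjoin[OF L S N x]
 have fB: "finite ?B" unfolding B using fin by simp
 have pos: "0 < card (carrier S)" using S.card_gt_1 by simp
 from alt have "card ?B \<le> card (carrier S) ^ n"
 proof
  assume a: "\<forall>\<phi>\<in>Ann_hom L M S N. \<phi> x = \<zero>\<^bsub>S\<^esub> --> (\<forall>y\<in>carrier M. \<phi> y = \<zero>\<^bsub>S\<^esub>)"
  have "\<phi> = (\<lambda>y\<in>carrier M. \<zero>\<^bsub>S\<^esub>)" if p: "\<phi> \<in> ?B" for \<phi>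
  proof (rule extensionalityI[of _ "carrier M"])
   have "\<phi> \<in> Ann_hom L M S N" "\<phi> x = \<zero>\<^bsub>S\<^esub>" using p by (auto simp: B)
   thus "\<phi> y = (\<lambda>y\<in>carrier M. \<zero>\<^bsub>S\<^esub>) y" if "y \<in> carrier M" for y using a that by simp
  qed (use p in \<open>auto simp: Ann_hom_def\<close>)
  hence "?B \<subseteq> {\<lambda>y\<in>carrier M. \<zero>\<^bsub>S\<^esub>}" by blast
  hence "card ?B \<le> 1" using card_mono[of "{\<lambda>y\<in>carrier M. \<zero>\<^bsub>S\<^esub>}" ?B] by simp
  also have "1 \<le> card (carrier S) ^ n" using pos by simp
  finally show ?thesis .
 next
  assume a: "\<forall>s\<in>carrier S. \<exists>\<phi>\<in>Ann_hom L M S N. \<phi> x = s"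
  from bchoice[OF a[unfolded Bex_def]] obtain \<phi> where
   \<phi>: "\<forall>s\<in>carrier S. \<phi> s \<in> Ann_hom L M S N & \<phi> s x = s" ..
  have hom: "\<psi> \<in> cont_hom L M S" "!!y. y \<in> N ==> \<psi> y = \<zero>\<^bsub>S\<^esub>" "\<psi> \<in> extensional (carrier M)"
   if "\<psi> \<in> Ann_hom L M S N" for \<psi> using that by (auto simp: Ann_hom_def)
  let ?f = "\<lambda>(\<psi>, s). \<lambda>y\<in>carrier M. \<psi> y \<oplus>\<^bsub>S\<^esub> \<phi> s y"
  have "?f ` (?B \<times> carrier S) \<subseteq> Ann_hom L M S N"
  proof
   fix \<xi> assume "\<xi> \<in> ?f ` (?B \<times> carrier S)"
   then obtain \<psi> s where p: "\<psi> \<in> Ann_hom L M S N" "s \<in> carrier S" "\<xi> = (\<lambda>y\<in>carrier M. \<psi> y \<oplus>\<^bsub>S\<^esub> \<phi> s y)" by (auto simp: B)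
   have q: "\<phi> s \<in> Ann_hom L M S N" using \<phi> p(2) by blast
   have "\<xi> \<in> cont_hom L M S"
    unfolding p(3) by (rule cont_hom_restrict[OF profinite cont_hom_add[OF S.profinite hom(1)[OF p(1)] hom(1)[OF q]]])
   moreover have "\<xi> y = \<zero>\<^bsub>S\<^esub>" if "y \<in> N" for y
    using that hom(2)[OF p(1) that] hom(2)[OF q that] open_submodD(3)[OF N] unfolding p(3) by auto
   ultimately show "\<xi> \<in> Ann_hom L M S N" using p(3) by (simp add: Ann_hom_def)
  qed
  moreover have "inj_on ?f (?B \<times> carrier S)"
  proof (rule inj_onI, clarify)
   fix \<psi> s \<psi>' s' assume p: "\<psi> \<in> ?B" "s \<in> carrier S" "\<psi>' \<in> ?B" "s' \<in> carrier S"
    and e: "(\<lambda>y\<in>carrier M. \<psi> y \<oplus>\<^bsub>S\<^esub> \<phi> s y) = (\<lambda>y\<in>carrier M. \<psi>' y \<oplus>\<^bsub>S\<^esub> \<phi> s' y)"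
   have 1: "\<psi> \<in> Ann_hom L M S N" "\<psi> x = \<zero>\<^bsub>S\<^esub>" "\<psi>' \<in> Ann_hom L M S N" "\<psi>' x = \<zero>\<^bsub>S\<^esub>" using p by (auto simp: B)
   have 2: "\<phi> s \<in> Ann_hom L M S N" "\<phi> s x = s" "\<phi> s' x = s'" using \<phi> p by auto
   have ss: "s = s'" using fun_cong[OF e, of x] x 1 2 p by simp
   have "\<psi> y = \<psi>' y" if y: "y \<in> carrier M" for y
    using fun_cong[OF e, of y] y ss cont_homD(1)[OF hom(1)[OF 1(1)] y] cont_homD(1)[OF hom(1)[OF 1(3)] y]
     cont_homD(1)[OF hom(1)[OF 2(1)] y] by simp
   hence "\<psi> = \<psi>'" by (intro extensionalityI[OF hom(3)[OF 1(1)] hom(3)[OF 1(3)]])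
   thus "\<psi> = \<psi>' & s = s'" using ss by simp
  qed
  ultimately have "card (?B \<times> carrier S) \<le> card (Ann_hom L M S N)" by (intro card_inj_on_le[OF _ _ fin])
  hence "card ?B * card (carrier S) \<le> card (carrier S) ^ n * card (carrier S)"
   using le_trans[OF _ le] by (simp only: card_cartesian_product power_Suc2)
  thus ?thesis using pos by simp
 qed
 thus ?thesis using fB by simp
qed

text \<open>Adjoining a separating element to \<open>N\<close> lowers the exponent by one for all
  simple modules simultaneously. The carriers of type \<open>'m set\<close> are those of the simple
  quotients \<open>quot_top M H\<close>.\<close>

lemma spans_mod_ex:
 assumes L: "profinite_ring L"
 shows "open_submodule N L M ==>
  (!!S :: ('l, 'm set) top_module. simple_module L S ==>
   finite (Ann_hom L M S N) & card (Ann_hom L M S N) \<le> card (carrier S) ^ n) ==>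
  \<exists>X. finite X & X \<subseteq> carrier M & card X \<le> n & spans_mod L M N X"
proof (induction n arbitrary: N)
 case 0
 have "N = carrier M"
 proof (rule ccontr)
  assume "N ~= carrier M"
  then obtain H where H: "max_open L M H" "N \<subseteq> H" by (rule ex_max_open[OF 0(1)])
  have Ho: "open_submodule H L M" using H(1) by (simp add: max_open_def)
  let ?S = "quot_top M H"
  have S: "simple_module L ?S" by (rule quot_simple[OF L H(1)])
  interpret S: simple_mod L ?S by (rule simple_modI[OF L S])
  \<comment> \<open>With exponent 0 there is room for one homomorphism only, whereas a proper
    \<open>N\<close> admits both the zero map and the projection onto a simple quotient.\<close>
  let ?p = "\<lambda>x\<in>carrier M. H +> x" and ?z = "\<lambda>x\<in>carrier M. \<zero>\<^bsub>?S\<^esub>"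
  have Hx: "H +> x = H \<longleftrightarrow> x \<in> H" if "x \<in> carrier M" for x by (rule coset_eq_self[OF open_submodD(1)[OF Ho] that])
  have Nc: "!!x. x \<in> N ==> x \<in> carrier M" using open_submodD(3)[OF 0(1)] by auto
  have "?p \<in> Ann_hom L M ?S N"
   using cont_hom_restrict[OF profinite quot_map_hom[OF L Ho]] Hx H(2) Nc by (auto simp: Ann_hom_def)
  moreover have "?z \<in> Ann_hom L M ?S N"
   using cont_hom_restrict[OF profinite cont_hom_zero[OF S.profinite]] Nc by (auto simp: Ann_hom_def)
  ultimately have sub: "{?p, ?z} \<subseteq> Ann_hom L M ?S N" by blast
  have pz: "?p ~= ?z"
  proof
   assume e: "?p = ?z"
   obtain x where x: "x \<in> carrier M" "x \<notin> H" using H(1) open_submodD(3)[OF Ho] by (auto simp: max_open_def)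
   show False using fun_cong[OF e, of x] x Hx[OF x(1)] by simp
  qed
  have "card {a, b} = 2" if "a ~= b" for a b :: "'m => 'm set" using that by simp
  from this[OF pz] show False using card_mono[OF conjunct1[OF 0(2)[OF S]] sub] 0(2)[OF S] by simp
 qed
 thus ?case using submod_subset by (intro exI[of _ "{}"]) (auto simp: spans_mod_def)
next
 case (Suc n)
 obtain x where x: "x \<in> carrier M" "!!S :: ('l, 'm set) top_module. simple_module L S ==>
   (\<forall>\<phi>\<in>Ann_hom L M S N. \<phi> x = \<zero>\<^bsub>S\<^esub> --> (\<forall>y\<in>carrier M. \<phi> y = \<zero>\<^bsub>S\<^esub>)) \<or>
   (\<forall>s\<in>carrier S. \<exists>\<phi>\<in>Ann_hom L M S N. \<phi> x = s)"
  by (rule ex_separating_element[OF L Suc.prems(1)]) (rule that)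
 note Ns = open_submodD(1)[OF Suc.prems(1)]
 have "\<exists>X. finite X & X \<subseteq> carrier M & card X \<le> n & spans_mod L M (adjoin x N) X"
 proof (rule Suc.IH)
  show "open_submodule (adjoin x N) L M"
   by (rule open_submoduleI[OF adjoin_submod[OF x(1) Ns] Suc.prems(1) adjoin_sup[OF x(1) Ns]])
  fix S :: "('l, 'm set) top_module" assume S: "simple_module L S"
  show "finite (Ann_hom L M S (adjoin x N)) & card (Ann_hom L M S (adjoin x N)) \<le> card (carrier S) ^ n"
   using Suc.prems(2)[OF S] by (intro card_Ann_hom_adjoin[OF L S Suc.prems(1) x(1) x(2)[OF S]]) auto
 qed
 then obtain X where X: "finite X" "X \<subseteq> carrier M" "card X \<le> n" "spans_mod L M (adjoin x N) X" by blast
 have "spans_mod L M N (insert x X)" using X(4) adjoin_least unfolding spans_mod_def by (metis insert_subset)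
 moreover have "card (insert x X) \<le> Suc n" using X(1,3) card_insert_le_m1[of "Suc n" X x] by simp
 ultimately show ?case using X x(1) by (intro exI[of _ "insert x X"]) auto
qed

text \<open>The tuples generating modulo N form a nonempty closed subset of the compact space of
  \<open>n\<close>-tuples, shrinking with N. A tuple common to all these sets generates
  topologically, since a proper closed submodule lies in a proper open one.\<close>

lemma closed_span_ex:
 assumes L: "profinite_ring L"
  and sp: "!!N. open_submodule N L M ==> \<exists>X. finite X & X \<subseteq> carrier M & card X \<le> n & spans_mod L M N X"
 shows "\<exists>X. finite X & X \<subseteq> carrier M & card X \<le> n & closed_span L M X = carrier M"
proof -
 let ?T = "product_topology (%i. mtop M) {..<n}"
 let ?E = "{..<n} \<rightarrow>\<^sub>E carrier M"
 let ?K = "%N. {f \<in> ?E. spans_mod L M N (f ` {..<n})}"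
 have tT: "topspace ?T = ?E" by simp
 have cl: "closedin ?T (?K N)" if N: "open_submodule N L M" for N
 proof -
  let ?Q = "{A. submodule A L M & N \<subseteq> A & A ~= carrier M}"
  have "openin ?T (\<Union>A\<in>?Q. {..<n} \<rightarrow>\<^sub>E A)"
   using open_submoduleI[OF _ N] by (intro openin_Union) (auto simp: openin_PiE_gen open_submodule_def)
  \<comment> \<open>A tuple fails exactly if its entries lie in some proper submodule above
    \<open>N\<close>. Such a submodule is open, so the failing tuples form a union of open
    boxes.\<close>
  moreover have "?E - ?K N = (\<Union>A\<in>?Q. {..<n} \<rightarrow>\<^sub>E A)"
  proof (intro equalityI subsetI)
   fix f assume f: "f \<in> ?E - ?K N"
   then obtain A where A: "submodule A L M" "f ` {..<n} \<subseteq> A" "N \<subseteq> A" "A ~= carrier M" by (auto simp: spans_mod_def)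
   have "f \<in> {..<n} \<rightarrow>\<^sub>E A" using f A(2) by (auto simp: PiE_iff)
   thus "f \<in> (\<Union>A\<in>?Q. {..<n} \<rightarrow>\<^sub>E A)" using A by blast
  next
   fix f assume "f \<in> (\<Union>A\<in>?Q. {..<n} \<rightarrow>\<^sub>E A)"
   then obtain A where A: "submodule A L M" "N \<subseteq> A" "A ~= carrier M" "f \<in> {..<n} \<rightarrow>\<^sub>E A" by blast
   have "f \<in> ?E" using A(4) submod_subset[OF A(1)] by (auto simp: PiE_iff)
   moreover have "f ` {..<n} \<subseteq> A" using A(4) by (auto simp: PiE_iff)
   ultimately show "f \<in> ?E - ?K N" using A(1-3) by (auto simp: spans_mod_def)
  qed
  ultimately show ?thesis unfolding closedin_def tT by auto
 qed
 have ne: "?K N ~= {}" if N: "open_submodule N L M" for N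
 proof -
  obtain X where X: "finite X" "X \<subseteq> carrier M" "card X \<le> n" "spans_mod L M N X" using sp[OF N] by blast
  obtain g where g: "bij_betw g {0..<card X} X" using ex_bij_betw_nat_finite[OF X(1)] by blast
  \<comment> \<open>Fewer than \<open>n\<close> generators are padded with zeros to a tuple of
    length \<open>n\<close>.\<close>
  let ?f = "\<lambda>i\<in>{..<n}. if i < card X then g i else \<zero>"
  have gX: "g i \<in> X" if "i < card X" for i using bij_betwE[OF g] that by auto
  have "g i \<in> carrier M" if "i < card X" for i using gX[OF that] X(2) by auto
  hence "?f \<in> ?E" by (simp add: restrict_PiE_iff)
  moreover have "X \<subseteq> ?f ` {..<n}"
  proof
   fix x assume "x \<in> X"
   hence "x \<in> g ` {0..<card X}" unfolding bij_betw_imp_surj_on[OF g] .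
   then obtain i where "i < card X" "x = g i" by auto
   thus "x \<in> ?f ` {..<n}" using X(3) by (intro image_eqI[of _ _ i]) auto
  qed
  ultimately have "?f \<in> ?K N" using spans_mod_mono[OF X(4)] by simp
  thus ?thesis by blast
 qed
 obtain f where f: "f \<in> ?E" "!!N. open_submodule N L M ==> f \<in> ?K N"
 proof (rule compact_space_directed[of ?T "{N. open_submodule N L M}" ?K])
  show "compact_space ?T" using compact by (simp add: compact_space_product_topology)
  show "{N. open_submodule N L M} ~= {}" using open_submodule_carrier by blast
  show "\<exists>k\<in>{N. open_submodule N L M}. ?K k \<subseteq> ?K i \<inter> ?K j"
   if "i \<in> {N. open_submodule N L M}" "j \<in> {N. open_submodule N L M}" for i j
   using that open_submodule_Int[of i j] by (intro bexI[of _ "i \<inter> j"]) (auto simp: spans_mod_def)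
 qed (use cl ne that tT in auto)
 let ?X = "f ` {..<n}"
 have Xc: "?X \<subseteq> carrier M" using f(1) by auto
 have "closed_span L M ?X = carrier M"
 proof (rule ccontr)
  assume "closed_span L M ?X ~= carrier M"
  then obtain H where H: "open_submodule H L M" "closed_span L M ?X \<subseteq> H" "H ~= carrier M"
   by (rule proper_closed_in_proper_open[OF L closed_span_submodule(1)[OF Xc]])
  have "?X \<subseteq> H" using H(2) closed_span_submodule(2)[OF Xc] by blast
  thus False using f(2)[OF H(1)] H(3) open_submodD(1)[OF H(1)] by (auto simp: spans_mod_def)
 qed
 moreover have "card ?X \<le> n" using card_image_le[of "{..<n}" f] by simp
 ultimately show ?thesis using Xc by (intro exI[of _ ?X]) auto
qed

end

text \<open>A copy of a finite discrete module along an injection of its carrier. The duals consist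
  of functions, while the invariant ranges over simple modules with carriers in
  \<open>nat\<close>.\<close>

definition transport :: "('s => 't) => ('l, 's) top_module => ('l, 't) top_module" where
 "transport h S =
   \<lparr>carrier = h ` carrier S, monoid.mult = undefined, one = undefined, ring.zero = h \<zero>\<^bsub>S\<^esub>,
   ring.add = (%x y. h (inv_into (carrier S) h x \<oplus>\<^bsub>S\<^esub> inv_into (carrier S) h y)),
   smult = (%a x. h (a \<odot>\<^bsub>S\<^esub> inv_into (carrier S) h x)), mtop = discrete_topology (h ` carrier S)\<rparr>"

lemma transport_simple:
 fixes S :: "('l, 's) top_module"
 assumes L: "profinite_ring L" and S: "simple_module L S" and h: "inj_on h (carrier S)"
 shows "simple_module L (transport h S)" "h \<in> cont_hom L S (transport h S)"
  "inv_into (carrier S) h \<in> cont_hom L (transport h S) S"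
proof -
 interpret S: simple_mod L S by (rule simple_modI[OF L S])
 let ?T = "transport h S" and ?k = "inv_into (carrier S) h"
 have sel: "carrier ?T = h ` carrier S" "\<zero>\<^bsub>?T\<^esub> = h \<zero>\<^bsub>S\<^esub>" "mtop ?T = discrete_topology (h ` carrier S)"
  "!!x y. x \<oplus>\<^bsub>?T\<^esub> y = h (?k x \<oplus>\<^bsub>S\<^esub> ?k y)" "!!a x. a \<odot>\<^bsub>?T\<^esub> x = h (a \<odot>\<^bsub>S\<^esub> ?k x)"
  by (simp_all add: transport_def)
 have k [simp]: "?k (h x) = x" if "x \<in> carrier S" for x by (rule inv_into_f_f[OF h that])
 have hi [simp]: "h x = h y \<longleftrightarrow> x = y" if "x \<in> carrier S" "y \<in> carrier S" for x y using h that by (auto simp: inj_on_def)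
 have "abelian_group ?T"
 proof (rule abelian_groupI)
  fix x assume "x \<in> carrier ?T"
  then obtain u where u: "u \<in> carrier S" "x = h u" by (auto simp: sel)
  show "\<exists>y\<in>carrier ?T. y \<oplus>\<^bsub>?T\<^esub> x = \<zero>\<^bsub>?T\<^esub>"
   using u by (intro bexI[of _ "h (\<ominus>\<^bsub>S\<^esub> u)"]) (auto simp: sel S.M.l_neg)
 qed (auto simp: sel S.M.a_ac)
 moreover have "left_module_axioms L ?T" by (rule left_module_axioms.intro)
   (auto simp: sel S.smult_closed S.smult_l_distr S.smult_r_distr S.smult_assoc1 S.smult_one)
 ultimately have lm: "left_module L ?T" by (intro left_module.intro S.R.ring_axioms)
 have T: "profinite_module L ?T"
 proof (rule discrete_profinite_module[OF L lm])
  fix x y assume "x \<in> carrier ?T" "y \<in> carrier ?T"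
  then obtain u v where u: "u \<in> carrier S" "x = h u" "v \<in> carrier S" "y = h v" by (auto simp: sel)
  have tL: "topspace (rtop L) = carrier L" using L by (simp add: profinite_ring_def)
  have "{a \<in> carrier L. a \<odot>\<^bsub>?T\<^esub> x = y} = {a \<in> topspace (rtop L). a \<odot>\<^bsub>S\<^esub> u \<in> {v}}"
   using u S.smult_closed by (auto simp: sel tL)
  moreover have "continuous_map (rtop L) (mtop S) (%a. a \<odot>\<^bsub>S\<^esub> u)" using u by (intro S.cont_smult') auto
  ultimately show "openin (rtop L) {a \<in> carrier L. a \<odot>\<^bsub>?T\<^esub> x = y}"
   using openin_continuous_map_preimage[OF _ S.openin_subset[of "{v}"]] u by simp
 qed (use S.finite_carrier in \<open>auto simp: sel\<close>)
 interpret T: prof_module L ?T by (rule prof_module.intro[OF T])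
 show hh: "h \<in> cont_hom L S ?T"
  unfolding cont_hom_def S.mtop_discrete sel(3) by (auto simp: sel intro!: continuous_map_discrete)
 show kh: "?k \<in> cont_hom L ?T S"
  unfolding cont_hom_def S.mtop_discrete sel(3) by (auto simp: sel S.smult_closed intro!: continuous_map_discrete)
 have "carrier ?T ~= {\<zero>\<^bsub>?T\<^esub>}"
 proof -
  obtain x where "x \<in> carrier S" "x ~= \<zero>\<^bsub>S\<^esub>" using S.nontrivial by blast
  hence "h x \<in> carrier ?T" "h x ~= \<zero>\<^bsub>?T\<^esub>" by (auto simp: sel)
  thus ?thesis by blast
 qed
 moreover have "A = {\<zero>\<^bsub>?T\<^esub>} \<or> A = carrier ?T" if A: "submodule A L ?T" for A
 proof -
  have Ac: "A \<subseteq> h ` carrier S" using T.submod_subset[OF A] by (simp add: sel)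
  hence im: "A = h ` {x \<in> carrier S. h x \<in> A}" by auto
  have "submodule {x \<in> carrier S. h x \<in> A} L S" by (rule submodule_preimage[OF S.profinite T hh A])
  from S.submod_cases[OF this] show ?thesis
  proof
   assume e: "{x \<in> carrier S. h x \<in> A} = {\<zero>\<^bsub>S\<^esub>}"
   have "A = h ` {x \<in> carrier S. h x \<in> A}" by (rule im)
   also have "... = {\<zero>\<^bsub>?T\<^esub>}" unfolding e sel by simp
   finally show ?thesis ..
  next
   assume e: "{x \<in> carrier S. h x \<in> A} = carrier S"
   have "A = h ` {x \<in> carrier S. h x \<in> A}" by (rule im)
   also have "... = carrier ?T" unfolding e sel ..
   finally show ?thesis ..
  qed
 qed
 ultimately show "simple_module L ?T" using T by (simp add: simple_module_def closed_submodule_def)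
qed

text \<open>The transport map and its inverse induce mutually inverse maps by functoriality; of this
  the injectivity in one direction is recorded.\<close>

lemma card_ctensor_transport:
 assumes inv: "inv_ring L \<sigma>" and P: "profinite_module L P" and S: "simple_module L S" and h: "inj_on h (carrier S)"
  and fin: "finite (ctensor_carrier L \<sigma> P (transport h S))"
 shows "finite (ctensor_carrier L \<sigma> P S) & card (ctensor_carrier L \<sigma> P S) \<le> card (ctensor_carrier L \<sigma> P (transport h S))"
proof -
 interpret inv_ring L \<sigma> by fact
 note t = transport_simple[OF profinite S h]
 have X: "ctensor_prod L \<sigma> P S" and Y: "ctensor_prod L \<sigma> P (transport h S)"
  by (rule ctensor_prod_simple[OF inv P] S t)+
 let ?f = "ctensor_map L \<sigma> P S P (transport h S) (%a. a) h"
  and ?g = "ctensor_map L \<sigma> P (transport h S) P S (%a. a) (inv_into (carrier S) h)"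
 have "?g (?f x) = x" if x: "x \<in> ctensor_carrier L \<sigma> P S" for x
 proof -
  have "?g (?f x) = ctensor_map L \<sigma> P S P S (%a. a) (%b. inv_into (carrier S) h (h b)) x"
   by (rule ctensor_map_compose[OF X Y X cont_hom_id t(2) cont_hom_id t(3) x])
  also have "... = ctensor_map L \<sigma> P S P S (%a. a) (%b. b) x"
   by (rule ctensor_map_cong[OF X X cont_hom_id cont_hom_compose[OF t(2,3)] cont_hom_id cont_hom_id refl _ x])
    (simp add: inv_into_f_f[OF h])
  also have "... = x" by (rule ctensor_map_id[OF X x])
  finally show ?thesis .
 qed
 hence inj: "inj_on ?f (ctensor_carrier L \<sigma> P S)" by (intro inj_on_inverseI[where g = ?g])
 have sub: "?f ` ctensor_carrier L \<sigma> P S \<subseteq> ctensor_carrier L \<sigma> P (transport h S)"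
  using ctensor_map_closed[OF X Y cont_hom_id t(2)] by blast
 show ?thesis using inj_on_finite[OF inj sub fin] card_inj_on_le[OF inj sub fin] by simp
qed

text \<open>For the passage back to generators, the homomorphisms from a finite quotient of
  \<open>P\<close> to a simple S are bounded by the tensor product of \<open>P\<close> with the dual
  of S, copied to \<open>nat\<close>. The dual is no larger than S, so the bound by the n-th power
  carries over to S.\<close>

theorem generators_iff_card_ctensor:
 fixes P :: "('l, 'p) top_module"
 assumes inv: "inv_ring L \<sigma>" and P: "profinite_module L P"
 shows "(\<exists>X. finite X & X \<subseteq> carrier P & card X \<le> n & closed_span L P X = carrier P) \<longleftrightarrow>
  (\<forall>M :: ('l, nat) top_module. simple_module L M -->
   finite (ctensor_carrier L \<sigma> P M) & card (ctensor_carrier L \<sigma> P M) \<le> card (carrier M) ^ n)" (is "?l = ?r")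
proof
 interpret inv_ring L \<sigma> by fact
 interpret P: prof_module L P by (rule prof_module.intro[OF P])
 {
  assume ?l
  then obtain X where X: "finite X" "X \<subseteq> carrier P" "card X \<le> n" "closed_span L P X = carrier P" by blast
  show ?r
  proof (intro allI impI)
   fix M :: "('l, nat) top_module" assume M: "simple_module L M"
   interpret M: simple_mod L M by (rule simple_modI[OF profinite M])
   have "card (carrier M) ^ card X \<le> card (carrier M) ^ n" using M.card_gt_1 X(3) by (intro power_increasing) auto
   thus "finite (ctensor_carrier L \<sigma> P M) & card (ctensor_carrier L \<sigma> P M) \<le> card (carrier M) ^ n"
    using card_ctensor_le[OF inv P M X(1,2,4)] by linarith
  qed
 next
  assume r: ?r
  show ?l
  proof (rule P.closed_span_ex[OF profinite], rule P.spans_mod_ex[OF profinite])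
   fix N and S :: "('l, 'p set) top_module"
   assume N: "open_submodule N L P" and S: "simple_module L S"
   interpret S: simple_mod L S by (rule simple_modI[OF profinite S])
   obtain p :: nat where p: "prime p" "!!x. x \<in> carrier S ==> x [^]\<^bsub>add_monoid S\<^esub> p = \<zero>\<^bsub>S\<^esub>"
    by (rule S.prime_torsion) (rule that)
   interpret D: simple_dual L S \<sigma> p by (intro simple_dual.intro simple_dual_axioms.intro S.simple_mod_axioms inv p)
   obtain h :: "('p set => int) => nat" where h: "inj_on h (carrier D.D)"
    using finite_imp_inj_to_nat_seg[of "carrier D.D"] D.finite_X by auto
   let ?M = "transport h D.D"
   have cM: "card (carrier ?M) = card (carrier D.D)" using card_image[OF h] by (simp add: transport_def)
   have "card (carrier ?M) ^ n \<le> card (carrier S) ^ n" using cM D.card_X by (intro power_mono) auto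
   moreover have "finite (ctensor_carrier L \<sigma> P ?M) & card (ctensor_carrier L \<sigma> P ?M) \<le> card (carrier ?M) ^ n"
    using r transport_simple(1)[OF profinite D.dual_simple h] by blast
   moreover from card_ctensor_transport[OF inv P D.dual_simple h] this
   have "finite (ctensor_carrier L \<sigma> P D.D)" "card (ctensor_carrier L \<sigma> P D.D) \<le> card (ctensor_carrier L \<sigma> P ?M)" by auto
   moreover note card_Ann_hom_le[OF inv P S p N, simplified]
   ultimately show "finite (Ann_hom L P S N) & card (Ann_hom L P S N) \<le> card (carrier S) ^ n" by linarith
  qed
 }
qed

section \<open>The completed group algebra\<close>

lemma (in abelian_monoid) finsum_swap:
 assumes "finite J" "finite K" "!!j k. j \<in> J ==> k \<in> K ==> f j k \<in> carrier G"
 shows "(\<Oplus>j\<in>J. \<Oplus>k\<in>K. f j k) = (\<Oplus>k\<in>K. \<Oplus>j\<in>J. f j k)" using assms(1,3)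
proof (induction J rule: finite_induct)
 case (insert a J)
 have c: "(%j. \<Oplus>k\<in>K. f j k) \<in> J \<rightarrow> carrier G" "(\<Oplus>k\<in>K. f a k) \<in> carrier G"
  using insert.prems by (auto intro!: finsum_closed)
 have d: "(%k. f a k) \<in> K \<rightarrow> carrier G" "(%k. \<Oplus>j\<in>J. f j k) \<in> K \<rightarrow> carrier G"
  using insert.prems by (auto intro!: finsum_closed)
 have "(\<Oplus>j\<in>insert a J. \<Oplus>k\<in>K. f j k) = (\<Oplus>k\<in>K. f a k) \<oplus> (\<Oplus>k\<in>K. \<Oplus>j\<in>J. f j k)"
  using finsum_insert[OF insert(1,2) c] insert by simp
 also have "... = (\<Oplus>k\<in>K. f a k \<oplus> (\<Oplus>j\<in>J. f j k))" by (rule finsum_addf[OF d, symmetric])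
 also have "... = (\<Oplus>k\<in>K. \<Oplus>j\<in>insert a J. f j k)"
 proof (rule finsum_cong'[OF refl])
  fix k assume k: "k \<in> K"
  have e: "(%j. f j k) \<in> J \<rightarrow> carrier G" "f a k \<in> carrier G" using insert.prems k by auto
  show "f a k \<oplus> (\<Oplus>j\<in>J. f j k) = (\<Oplus>j\<in>insert a J. f j k)" using finsum_insert[OF insert(1,2) e] by simp
 qed (use insert.prems in \<open>auto intro!: finsum_closed\<close>)
 finally show ?case .
qed simp

lemma (in abelian_monoid) finsum_bij:
 assumes "bij_betw h J K" "f \<in> K \<rightarrow> carrier G"
 shows "(\<Oplus>k\<in>K. f k) = (\<Oplus>j\<in>J. f (h j))" using finsum_reindex[of f h J] assms by (auto simp: bij_betw_def)

locale group_alg = A: ring A + H: group H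
 for A :: "('r, 'x) ring_scheme" (structure) and H :: "('h, 'y) monoid_scheme" +
 assumes fin: "finite (carrier H)"
begin

abbreviation "GA \<equiv> group_algebra A H"
abbreviation conv (infixl "\<star>" 70) where "f \<star> g \<equiv> f \<otimes>\<^bsub>GA\<^esub> g"
abbreviation ldiv (infixr "\<setminus>" 75) where "y \<setminus> x \<equiv> inv\<^bsub>H\<^esub> y \<otimes>\<^bsub>H\<^esub> x"

lemma sel:
 "carrier GA = (carrier H \<rightarrow>\<^sub>E carrier A)"
 "f \<otimes>\<^bsub>GA\<^esub> g = (\<lambda>x\<in>carrier H. \<Oplus>y\<in>carrier H. f y \<otimes> g (inv\<^bsub>H\<^esub> y \<otimes>\<^bsub>H\<^esub> x))"
 "\<one>\<^bsub>GA\<^esub> = (\<lambda>x\<in>carrier H. if x = \<one>\<^bsub>H\<^esub> then \<one> else \<zero>)"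
 "\<zero>\<^bsub>GA\<^esub> = (\<lambda>x\<in>carrier H. \<zero>)"
 "f \<oplus>\<^bsub>GA\<^esub> g = (\<lambda>x\<in>carrier H. f x \<oplus> g x)" by (simp_all add: group_algebra_def)

lemma val: "f \<in> carrier GA ==> x \<in> carrier H ==> f x \<in> carrier A" by (auto simp: sel)

lemma eqI:
 assumes "f \<in> carrier GA" "g \<in> carrier GA" "!!x. x \<in> carrier H ==> f x = g x" shows "f = g"
 using assms(1,2) by (intro PiE_ext[OF _ _ assms(3)]) (auto simp: sel)

lemma shift: "y \<in> carrier H ==> bij_betw (%z. y \<setminus> z) (carrier H) (carrier H)"
 by (rule bij_betw_byWitness[where f' = "%z. y \<otimes>\<^bsub>H\<^esub> z"]) (auto simp: H.m_assoc[symmetric])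

lemma mult_closed: "f \<in> carrier GA ==> g \<in> carrier GA ==> f \<star> g \<in> carrier GA"
 unfolding sel(2) by (auto simp: sel(1) intro!: A.finsum_closed)

lemma finite_GA: "finite (carrier A) ==> finite (carrier GA)" unfolding sel(1) using fin by (intro finite_PiE) auto

lemma add_group: "abelian_group GA"
proof (rule abelian_groupI)
 fix f assume f: "f \<in> carrier GA"
 show "\<exists>g\<in>carrier GA. g \<oplus>\<^bsub>GA\<^esub> f = \<zero>\<^bsub>GA\<^esub>"
  using val[OF f] by (intro bexI[of _ "\<lambda>x\<in>carrier H. \<ominus> f x"]) (auto simp: sel A.l_neg intro!: restrict_ext)
 show "\<zero>\<^bsub>GA\<^esub> \<oplus>\<^bsub>GA\<^esub> f = f" using val[OF f] f by (intro eqI) (auto simp: sel)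
 fix g assume g: "g \<in> carrier GA"
 show "f \<oplus>\<^bsub>GA\<^esub> g \<in> carrier GA" using val[OF f] val[OF g] by (auto simp: sel)
 show "f \<oplus>\<^bsub>GA\<^esub> g = g \<oplus>\<^bsub>GA\<^esub> f" using val[OF f] val[OF g] by (auto simp: sel A.a_comm intro!: restrict_ext)
 fix h assume h: "h \<in> carrier GA"
 show "f \<oplus>\<^bsub>GA\<^esub> g \<oplus>\<^bsub>GA\<^esub> h = f \<oplus>\<^bsub>GA\<^esub> (g \<oplus>\<^bsub>GA\<^esub> h)"
  using val[OF f] val[OF g] val[OF h] by (auto simp: sel A.a_assoc intro!: restrict_ext)
qed (auto simp: sel)

text \<open>Shifting the variable of the inner convolution on the right by \<open>y\<close> turns
  both sides into the same double sum over y and z.\<close>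

lemma mult_assoc:
 assumes f: "f \<in> carrier GA" and g: "g \<in> carrier GA" and h: "h \<in> carrier GA"
 shows "f \<star> g \<star> h = f \<star> (g \<star> h)"
proof (rule eqI)
 fix x assume x: "x \<in> carrier H"
 note v = val[OF f] val[OF g] val[OF h]
 let ?t = "%y z. f y \<otimes> g (y \<setminus> z) \<otimes> h (z \<setminus> x)"
 have "(f \<star> g \<star> h) x =
   (\<Oplus>z\<in>carrier H. (\<Oplus>y\<in>carrier H. f y \<otimes> g (y \<setminus> z)) \<otimes> h (z \<setminus> x))"
  unfolding sel using x v by (auto intro!: A.finsum_cong' A.finsum_closed)
 also have "... = (\<Oplus>z\<in>carrier H. \<Oplus>y\<in>carrier H. ?t y z)"
  using x v fin by (intro A.finsum_cong'[OF refl] A.finsum_ldistr) (auto intro!: A.finsum_closed)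
 also have "... = (\<Oplus>y\<in>carrier H. \<Oplus>z\<in>carrier H. ?t y z)" using x v by (intro A.finsum_swap[OF fin fin]) auto
 also have "... = (\<Oplus>y\<in>carrier H. f y \<otimes> (g \<star> h) (y \<setminus> x))"
 proof (rule A.finsum_cong'[OF refl])
  fix y assume y: "y \<in> carrier H"
  have "(g \<star> h) (y \<setminus> x) =
    (\<Oplus>w\<in>carrier H. g w \<otimes> h (inv\<^bsub>H\<^esub> w \<otimes>\<^bsub>H\<^esub> (y \<setminus> x)))" using x y by (simp add: sel)
  also have "... = (\<Oplus>z\<in>carrier H. g (y \<setminus> z) \<otimes>
    h (inv\<^bsub>H\<^esub> (y \<setminus> z) \<otimes>\<^bsub>H\<^esub> (y \<setminus> x)))"
   using x y v by (intro A.finsum_bij[OF shift[OF y]]) auto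
  also have "... = (\<Oplus>z\<in>carrier H. g (y \<setminus> z) \<otimes> h (z \<setminus> x))"
  proof (rule A.finsum_cong'[OF refl])
   fix z assume z: "z \<in> carrier H"
   have "y \<otimes>\<^bsub>H\<^esub> (y \<setminus> x) = x" using x y by (simp add: H.m_assoc[symmetric])
   hence "inv\<^bsub>H\<^esub> (y \<setminus> z) \<otimes>\<^bsub>H\<^esub> (y \<setminus> x) = z \<setminus> x"
    using x y z by (simp add: H.inv_mult_group H.m_assoc)
   thus "g (y \<setminus> z) \<otimes> h (inv\<^bsub>H\<^esub> (y \<setminus> z) \<otimes>\<^bsub>H\<^esub> (y \<setminus> x)) =
     g (y \<setminus> z) \<otimes> h (z \<setminus> x)" using y z by simp
  qed (use x y v in auto)
  finally have e: "(g \<star> h) (y \<setminus> x) = ..." .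
  show "(\<Oplus>z\<in>carrier H. ?t y z) = f y \<otimes> (g \<star> h) (y \<setminus> x)" unfolding e using x y v
   by (subst A.finsum_rdistr[OF fin]) (auto intro!: A.finsum_cong' simp: A.m_assoc)
 qed (use x v val[OF mult_closed[OF g h]] in auto)
 also have "... = (f \<star> (g \<star> h)) x" using x by (simp add: sel(2)[of f])
 finally show "(f \<star> g \<star> h) x = (f \<star> (g \<star> h)) x" .
qed (intro mult_closed f g h)+

lemma finsum_delta:
 assumes "a \<in> carrier H" "t \<in> carrier H \<rightarrow> carrier A" "!!y. y \<in> carrier H ==> y ~= a ==> t y = \<zero>"
 shows "(\<Oplus>y\<in>carrier H. t y) = t a"
proof -
 have "(\<Oplus>y\<in>carrier H. t y) = (\<Oplus>y\<in>carrier H. if a = y then t y else \<zero>)"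
  using assms by (intro A.finsum_cong'[OF refl]) auto
 also have "... = t a" by (rule A.finsum_singleton[OF assms(1) fin assms(2)])
 finally show ?thesis .
qed

lemma ring_GA: "ring GA"
proof (rule ringI[OF add_group])
 have one: "\<one>\<^bsub>GA\<^esub> \<in> carrier GA" by (auto simp: sel)
 show "monoid GA"
 proof (rule monoidI)
  fix f assume f: "f \<in> carrier GA"
  note v = val[OF f]
  show "\<one>\<^bsub>GA\<^esub> \<star> f = f"
  proof (rule eqI[OF mult_closed[OF one f] f])
   fix x assume x: "x \<in> carrier H"
   have "(\<one>\<^bsub>GA\<^esub> \<star> f) x = (\<Oplus>y\<in>carrier H. \<one>\<^bsub>GA\<^esub> y \<otimes> f (y \<setminus> x))"
    using x by (simp add: sel(2))
   also have "... = \<one>\<^bsub>GA\<^esub> \<one>\<^bsub>H\<^esub> \<otimes> f (inv\<^bsub>H\<^esub> \<one>\<^bsub>H\<^esub> \<otimes>\<^bsub>H\<^esub> x)"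
    by (rule finsum_delta) (use x v in \<open>auto simp: sel(3)\<close>)
   also have "... = f x" using x v by (simp add: sel)
   finally show "(\<one>\<^bsub>GA\<^esub> \<star> f) x = f x" .
  qed
  show "f \<star> \<one>\<^bsub>GA\<^esub> = f"
  proof (rule eqI[OF mult_closed[OF f one] f])
   fix x assume x: "x \<in> carrier H"
   have ne: "y \<setminus> x ~= \<one>\<^bsub>H\<^esub>" if "y \<in> carrier H" "y ~= x" for y
    using that x by (metis H.inv_closed H.inv_equality H.inv_inv)
   have "(f \<star> \<one>\<^bsub>GA\<^esub>) x = (\<Oplus>y\<in>carrier H. f y \<otimes> \<one>\<^bsub>GA\<^esub> (y \<setminus> x))"
    using x by (simp add: sel(2))
   also have "... = f x \<otimes> \<one>\<^bsub>GA\<^esub> (x \<setminus> x)"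
    by (rule finsum_delta) (use x v ne in \<open>auto simp: sel(3)\<close>)
   also have "... = f x" using x v by (simp add: sel)
   finally show "(f \<star> \<one>\<^bsub>GA\<^esub>) x = f x" .
  qed
 qed (use one mult_closed mult_assoc in auto)
next
 fix f g h assume f: "f \<in> carrier GA" and g: "g \<in> carrier GA" and h: "h \<in> carrier GA"
 note v = val[OF f] val[OF g] val[OF h]
 note ac = abelian_groupE(1)[OF add_group]
 show "(f \<oplus>\<^bsub>GA\<^esub> g) \<star> h = f \<star> h \<oplus>\<^bsub>GA\<^esub> g \<star> h"
 proof (rule eqI[OF mult_closed[OF ac[OF f g] h] ac[OF mult_closed[OF f h] mult_closed[OF g h]]])
  fix x assume x: "x \<in> carrier H"
  have "((f \<oplus>\<^bsub>GA\<^esub> g) \<star> h) x = (\<Oplus>y\<in>carrier H. (f \<oplus>\<^bsub>GA\<^esub> g) y \<otimes> h (y \<setminus> x))"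
   using x by (simp only: sel(2) restrict_apply' if_True)
  also have "... = (\<Oplus>y\<in>carrier H. f y \<otimes> h (y \<setminus> x) \<oplus> g y \<otimes> h (y \<setminus> x))"
   by (rule A.finsum_cong'[OF refl]) (use x v in \<open>auto simp: sel(5) A.l_distr\<close>)
  also have "... = (f \<star> h \<oplus>\<^bsub>GA\<^esub> g \<star> h) x"
   using x v by (subst A.finsum_addf) (auto simp: sel(2,5))
  finally show "((f \<oplus>\<^bsub>GA\<^esub> g) \<star> h) x = (f \<star> h \<oplus>\<^bsub>GA\<^esub> g \<star> h) x" .
 qed
 show "h \<star> (f \<oplus>\<^bsub>GA\<^esub> g) = h \<star> f \<oplus>\<^bsub>GA\<^esub> h \<star> g"
 proof (rule eqI[OF mult_closed[OF h ac[OF f g]] ac[OF mult_closed[OF h f] mult_closed[OF h g]]])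
  fix x assume x: "x \<in> carrier H"
  have "(h \<star> (f \<oplus>\<^bsub>GA\<^esub> g)) x = (\<Oplus>y\<in>carrier H. h y \<otimes> (f \<oplus>\<^bsub>GA\<^esub> g) (y \<setminus> x))"
   using x by (simp only: sel(2) restrict_apply' if_True)
  also have "... = (\<Oplus>y\<in>carrier H. h y \<otimes> f (y \<setminus> x) \<oplus> h y \<otimes> g (y \<setminus> x))"
   by (rule A.finsum_cong'[OF refl]) (use x v in \<open>auto simp: sel(5) A.r_distr\<close>)
  also have "... = (h \<star> f \<oplus>\<^bsub>GA\<^esub> h \<star> g) x"
   using x v by (subst A.finsum_addf) (auto simp: sel(2,5))
  finally show "(h \<star> (f \<oplus>\<^bsub>GA\<^esub> g)) x = (h \<star> f \<oplus>\<^bsub>GA\<^esub> h \<star> g) x" .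
 qed
qed

text \<open>The antipode of one finite level, the component from which \<open>cga_antipode\<close>
  is assembled.\<close>

definition anti :: "('h => 'r) => 'h => 'r" where
 "anti f = (\<lambda>x\<in>carrier H. f (inv\<^bsub>H\<^esub> x))"

lemma anti_closed: "f \<in> carrier GA ==> anti f \<in> carrier GA" by (auto simp: anti_def sel)

lemma anti_add: "anti (f \<oplus>\<^bsub>GA\<^esub> g) = anti f \<oplus>\<^bsub>GA\<^esub> anti g"
 by (auto simp: anti_def sel intro!: restrict_ext)

lemma anti_one: "anti \<one>\<^bsub>GA\<^esub> = \<one>\<^bsub>GA\<^esub>"
 using H.inv_eq_1_iff by (auto simp: anti_def sel intro!: restrict_ext)

lemma anti_anti: "f \<in> carrier GA ==> anti (anti f) = f" by (rule eqI) (auto simp: anti_def sel)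

text \<open>The sum is reindexed by w = x y, after which the two coefficients stand in opposite
  order; commutativity of \<open>A\<close> exchanges them.\<close>

lemma anti_mult:
 assumes "cring A" and f: "f \<in> carrier GA" and g: "g \<in> carrier GA"
 shows "anti (f \<star> g) = anti g \<star> anti f"
proof (rule eqI[OF anti_closed[OF mult_closed[OF f g]] mult_closed[OF anti_closed[OF g] anti_closed[OF f]]])
 interpret AC: cring A by fact
 fix x assume x: "x \<in> carrier H"
 note v = val[OF f] val[OF g]
 have ix: "inv\<^bsub>H\<^esub> x \<in> carrier H" using x by simp
 have "anti (f \<star> g) x = (\<Oplus>y\<in>carrier H. f y \<otimes> g (inv\<^bsub>H\<^esub> y \<otimes>\<^bsub>H\<^esub> inv\<^bsub>H\<^esub> x))"
  using x by (simp add: anti_def sel)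
 also have "... = (\<Oplus>w\<in>carrier H. f (x \<setminus> w) \<otimes> g (inv\<^bsub>H\<^esub> (x \<setminus> w) \<otimes>\<^bsub>H\<^esub> inv\<^bsub>H\<^esub> x))"
  using x v by (intro A.finsum_bij[OF shift[OF x]]) auto
 also have "... = (\<Oplus>w\<in>carrier H. anti g w \<otimes> anti f (w \<setminus> x))"
 proof (rule A.finsum_cong'[OF refl])
  fix w assume w: "w \<in> carrier H"
  have "inv\<^bsub>H\<^esub> (x \<setminus> w) \<otimes>\<^bsub>H\<^esub> inv\<^bsub>H\<^esub> x = inv\<^bsub>H\<^esub> w \<otimes>\<^bsub>H\<^esub> (x \<otimes>\<^bsub>H\<^esub> inv\<^bsub>H\<^esub> x)"
   using x w by (simp add: H.inv_mult_group H.m_assoc del: H.r_inv)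
  moreover have "inv\<^bsub>H\<^esub> (w \<setminus> x) = x \<setminus> w" using x w by (simp add: H.inv_mult_group)
  ultimately show "f (x \<setminus> w) \<otimes> g (inv\<^bsub>H\<^esub> (x \<setminus> w) \<otimes>\<^bsub>H\<^esub> inv\<^bsub>H\<^esub> x) =
    anti g w \<otimes> anti f (w \<setminus> x)" using x w v by (simp add: anti_def AC.m_comm)
 qed (use x val[OF anti_closed[OF f]] val[OF anti_closed[OF g]] in auto)
 also have "... = (anti g \<star> anti f) x" using x by (simp add: sel(2))
 finally show "anti (f \<star> g) x = (anti g \<star> anti f) x" .
qed

end

locale group_alg_hom = S: group_alg A H + T: group_alg A' H'
 for A :: "('r, 'x) ring_scheme" and H :: "('h, 'y) monoid_scheme"
  and A' :: "('r2, 'x2) ring_scheme" (structure) and H' :: "('h2, 'y2) monoid_scheme" +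
 fixes \<rho> :: "'r => 'r2" and \<pi> :: "'h => 'h2"
 assumes \<rho>: "\<rho> \<in> ring_hom A A'" and \<pi>: "\<pi> \<in> hom H H'"
begin

text \<open>The ring homomorphism A[H] \<rightarrow> A'[H'] induced by \<open>\<rho>\<close> and
  \<open>\<pi>\<close>, summing over the fibres of \<open>\<pi>\<close>. The transition maps
  \<open>cga_proj\<close> are of this kind.\<close>

definition push :: "('h => 'r) => 'h2 => 'r2" where
 "push f = (\<lambda>Y\<in>carrier H'. \<Oplus>X\<in>{X \<in> carrier H. \<pi> X = Y}. \<rho> (f X))"

lemma \<pi>c [simp]: "x \<in> carrier H ==> \<pi> x \<in> carrier H'" using \<pi> by (auto simp: hom_def)

lemma \<rho>c [simp]: "a \<in> carrier A ==> \<rho> a \<in> carrier A'" by (rule ring_hom_closed[OF \<rho>])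

lemma \<rho>0 [simp]: "\<rho> \<zero>\<^bsub>A\<^esub> = \<zero>"
 by (rule ring_hom_zero[OF \<rho> S.A.ring_axioms T.A.ring_axioms])

lemma \<pi>inv: "x \<in> carrier H ==> \<pi> (inv\<^bsub>H\<^esub> x) = inv\<^bsub>H'\<^esub> \<pi> x"
 using \<pi> S.H.group_axioms T.H.group_axioms group_hom.hom_inv[of H H' \<pi> x] by (simp add: group_hom_def group_hom_axioms_def)

lemma \<pi>one: "\<pi> \<one>\<^bsub>H\<^esub> = \<one>\<^bsub>H'\<^esub>"
 by (rule hom_one[OF \<pi> S.H.group_axioms T.H.group_axioms])

lemma push_closed: "f \<in> carrier S.GA ==> push f \<in> carrier T.GA"
 using S.val[of f] by (auto simp: push_def T.sel(1) intro!: T.A.finsum_closed)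

lemma push_add:
 assumes f: "f \<in> carrier S.GA" and g: "g \<in> carrier S.GA"
 shows "push (f \<oplus>\<^bsub>S.GA\<^esub> g) = push f \<oplus>\<^bsub>T.GA\<^esub> push g"
proof -
 note v = S.val[OF f] S.val[OF g]
 have "(\<Oplus>X\<in>{X \<in> carrier H. \<pi> X = Y}. \<rho> ((f \<oplus>\<^bsub>S.GA\<^esub> g) X)) =
  (\<Oplus>X\<in>{X \<in> carrier H. \<pi> X = Y}. \<rho> (f X)) \<oplus> (\<Oplus>X\<in>{X \<in> carrier H. \<pi> X = Y}. \<rho> (g X))" for Y
 proof -
  have "(\<Oplus>X\<in>{X \<in> carrier H. \<pi> X = Y}. \<rho> ((f \<oplus>\<^bsub>S.GA\<^esub> g) X)) =
   (\<Oplus>X\<in>{X \<in> carrier H. \<pi> X = Y}. \<rho> (f X) \<oplus> \<rho> (g X))"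
   by (rule T.A.finsum_cong'[OF refl]) (use v in \<open>auto simp: S.sel(5) ring_hom_add[OF \<rho>]\<close>)
  also have "... = (\<Oplus>X\<in>{X \<in> carrier H. \<pi> X = Y}. \<rho> (f X)) \<oplus> (\<Oplus>X\<in>{X \<in> carrier H. \<pi> X = Y}. \<rho> (g X))"
   by (rule T.A.finsum_addf) (use v in auto)
  finally show ?thesis .
 qed
 thus ?thesis by (auto simp: push_def T.sel(5) intro!: restrict_ext)
qed

lemma push_zero: "push \<zero>\<^bsub>S.GA\<^esub> = \<zero>\<^bsub>T.GA\<^esub>"
proof -
 have "(\<Oplus>X\<in>{X \<in> carrier H. \<pi> X = Y}. \<rho> (\<zero>\<^bsub>S.GA\<^esub> X)) = \<zero>" for Y
  by (rule T.A.add.finprod_one_eqI) (simp add: S.sel(4))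
 thus ?thesis by (auto simp: push_def T.sel(4) intro!: restrict_ext)
qed

lemma push_one: "push \<one>\<^bsub>S.GA\<^esub> = \<one>\<^bsub>T.GA\<^esub>"
proof -
 have "(\<Oplus>X\<in>{X \<in> carrier H. \<pi> X = Y}. \<rho> (\<one>\<^bsub>S.GA\<^esub> X)) = (if Y = \<one>\<^bsub>H'\<^esub> then \<one> else \<zero>)" for Y
 proof (cases "Y = \<one>\<^bsub>H'\<^esub>")
  case True
  have "(\<Oplus>X\<in>{X \<in> carrier H. \<pi> X = Y}. \<rho> (\<one>\<^bsub>S.GA\<^esub> X)) =
    (\<Oplus>X\<in>{X \<in> carrier H. \<pi> X = Y}. if \<one>\<^bsub>H\<^esub> = X then \<one> else \<zero>)"
   by (rule T.A.finsum_cong'[OF refl]) (auto simp: S.sel(3) ring_hom_one[OF \<rho>])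
  also have "... = \<one>" by (rule T.A.finsum_singleton[where f = "%_. \<one>"]) (use True S.fin \<pi>one in auto)
  finally show ?thesis using True by simp
 next
  case False
  thus ?thesis using \<pi>one by (auto simp: S.sel(3) intro!: T.A.add.finprod_one_eqI)
 qed
 thus ?thesis by (auto simp: push_def T.sel(3) intro!: restrict_ext)
qed

text \<open>Translation by Z matches the fibre over Y with the fibre over the translate of Y by the
  inverse of \<pi>(Z). Grouping the elements Z by their image under \<pi> then produces the
  convolution in A'[H'].\<close>

lemma push_mult:
 assumes f: "f \<in> carrier S.GA" and g: "g \<in> carrier S.GA"
 shows "push (f \<otimes>\<^bsub>S.GA\<^esub> g) = push f \<otimes>\<^bsub>T.GA\<^esub> push g"
proof (rule T.eqI[OF push_closed[OF S.mult_closed[OF f g]] T.mult_closed[OF push_closed[OF f] push_closed[OF g]]])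
 fix Y assume Y: "Y \<in> carrier H'"
 note v = S.val[OF f] S.val[OF g]
 note pv = T.val[OF push_closed[OF g]] T.val[OF push_closed[OF f]]
 let ?F = "%Y. {X \<in> carrier H. \<pi> X = Y}"
 let ?t = "%Z X. \<rho> (f Z) \<otimes> \<rho> (g (inv\<^bsub>H\<^esub> Z \<otimes>\<^bsub>H\<^esub> X))"
 let ?s = "%Z. \<rho> (f Z) \<otimes> push g (inv\<^bsub>H'\<^esub> \<pi> Z \<otimes>\<^bsub>H'\<^esub> Y)"
 have finF: "finite (?F Y)" for Y using S.fin by simp
 have "push (f \<otimes>\<^bsub>S.GA\<^esub> g) Y = (\<Oplus>X\<in>?F Y. \<rho> ((f \<otimes>\<^bsub>S.GA\<^esub> g) X))" using Y by (simp add: push_def)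
 also have "... = (\<Oplus>X\<in>?F Y. \<Oplus>Z\<in>carrier H. ?t Z X)"
 proof (rule T.A.finsum_cong'[OF refl])
  fix X assume X: "X \<in> ?F Y"
  have "\<rho> ((f \<otimes>\<^bsub>S.GA\<^esub> g) X) = \<rho> (\<Oplus>\<^bsub>A\<^esub>Z\<in>carrier H. f Z \<otimes>\<^bsub>A\<^esub> g (inv\<^bsub>H\<^esub> Z \<otimes>\<^bsub>H\<^esub> X))"
   using X by (simp add: S.sel(2))
  also have "... = (\<Oplus>Z\<in>carrier H. \<rho> (f Z \<otimes>\<^bsub>A\<^esub> g (inv\<^bsub>H\<^esub> Z \<otimes>\<^bsub>H\<^esub> X)))"
   by (rule additive_finsum[OF S.A.abelian_monoid_axioms T.A.abelian_monoid_axioms _ _ _ S.fin])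
    (use X v in \<open>auto simp: ring_hom_add[OF \<rho>]\<close>)
  also have "... = (\<Oplus>Z\<in>carrier H. ?t Z X)"
   using X v by (intro T.A.finsum_cong'[OF refl]) (auto simp: ring_hom_mult[OF \<rho>])
  finally show "\<rho> ((f \<otimes>\<^bsub>S.GA\<^esub> g) X) = (\<Oplus>Z\<in>carrier H. ?t Z X)" .
 qed (use v in \<open>auto intro!: T.A.finsum_closed\<close>)
 also have "... = (\<Oplus>Z\<in>carrier H. \<Oplus>X\<in>?F Y. ?t Z X)" using v by (intro T.A.finsum_swap[OF finF S.fin]) auto
 also have "... = (\<Oplus>Z\<in>carrier H. ?s Z)"
 proof (rule T.A.finsum_cong'[OF refl])
  fix Z assume Z: "Z \<in> carrier H"
  let ?Y = "inv\<^bsub>H'\<^esub> \<pi> Z \<otimes>\<^bsub>H'\<^esub> Y"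
  have Yc: "?Y \<in> carrier H'" using Y Z by simp
  have e: "\<pi> Z \<otimes>\<^bsub>H'\<^esub> ?Y = Y" using Y Z by (simp add: T.H.m_assoc[symmetric])
  have bij: "bij_betw (%X. inv\<^bsub>H\<^esub> Z \<otimes>\<^bsub>H\<^esub> X) (?F Y) (?F ?Y)"
   by (rule bij_betw_byWitness[where f' = "%X. Z \<otimes>\<^bsub>H\<^esub> X"])
    (use Z Y e in \<open>auto simp: S.H.m_assoc[symmetric] hom_mult[OF \<pi>] \<pi>inv\<close>)
  have "(\<Oplus>X\<in>?F Y. ?t Z X) = \<rho> (f Z) \<otimes> (\<Oplus>X\<in>?F Y. \<rho> (g (inv\<^bsub>H\<^esub> Z \<otimes>\<^bsub>H\<^esub> X)))"
   using Z v by (intro T.A.finsum_rdistr[OF finF, symmetric]) auto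
  also have "(\<Oplus>X\<in>?F Y. \<rho> (g (inv\<^bsub>H\<^esub> Z \<otimes>\<^bsub>H\<^esub> X))) = (\<Oplus>X\<in>?F ?Y. \<rho> (g X))"
   using v by (intro T.A.finsum_bij[OF bij, symmetric]) auto
  also have "... = push g ?Y" using Yc by (simp add: push_def)
  finally show "(\<Oplus>X\<in>?F Y. ?t Z X) = ?s Z" .
 qed (use v pv Y in auto)
 also have "... = (\<Oplus>V\<in>carrier H'. \<Oplus>Z\<in>{Z \<in> carrier H. \<pi> Z = V}. ?s Z)"
  using v pv Y by (intro T.A.finsum_fibres[OF S.fin T.fin, symmetric]) auto
 also have "... = (\<Oplus>V\<in>carrier H'. push f V \<otimes> push g (inv\<^bsub>H'\<^esub> V \<otimes>\<^bsub>H'\<^esub> Y))"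
 proof (rule T.A.finsum_cong'[OF refl])
  fix V assume V: "V \<in> carrier H'"
  have "(\<Oplus>Z\<in>?F V. ?s Z) = (\<Oplus>Z\<in>?F V. \<rho> (f Z) \<otimes> push g (inv\<^bsub>H'\<^esub> V \<otimes>\<^bsub>H'\<^esub> Y))"
   using v pv V Y by (intro T.A.finsum_cong'[OF refl]) auto
  also have "... = (\<Oplus>Z\<in>?F V. \<rho> (f Z)) \<otimes> push g (inv\<^bsub>H'\<^esub> V \<otimes>\<^bsub>H'\<^esub> Y)"
   using v pv V Y by (intro T.A.finsum_ldistr[OF finF, symmetric]) auto
  also have "(\<Oplus>Z\<in>?F V. \<rho> (f Z)) = push f V" using V by (simp add: push_def)
  finally show "(\<Oplus>Z\<in>?F V. ?s Z) = push f V \<otimes> push g (inv\<^bsub>H'\<^esub> V \<otimes>\<^bsub>H'\<^esub> Y)" .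
 qed (use pv Y in auto)
 also have "... = (push f \<otimes>\<^bsub>T.GA\<^esub> push g) Y" using Y by (simp add: T.sel(2))
 finally show "push (f \<otimes>\<^bsub>S.GA\<^esub> g) Y = (push f \<otimes>\<^bsub>T.GA\<^esub> push g) Y" .
qed

lemma push_uminus:
 assumes f: "f \<in> carrier S.GA" shows "push (\<ominus>\<^bsub>S.GA\<^esub> f) = \<ominus>\<^bsub>T.GA\<^esub> push f"
proof -
 interpret SG: ring S.GA by (rule S.ring_GA)
 interpret TG: ring T.GA by (rule T.ring_GA)
 have "push (\<ominus>\<^bsub>S.GA\<^esub> f) \<oplus>\<^bsub>T.GA\<^esub> push f = push (\<ominus>\<^bsub>S.GA\<^esub> f \<oplus>\<^bsub>S.GA\<^esub> f)"
  using f by (intro push_add[symmetric] SG.a_inv_closed)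
 also have "... = \<zero>\<^bsub>T.GA\<^esub>" using SG.l_neg[OF f] push_zero by simp
 finally show ?thesis using TG.minus_equality push_closed f SG.a_inv_closed by metis
qed

lemma push_anti:
 assumes f: "f \<in> carrier S.GA" shows "push (S.anti f) = T.anti (push f)"
proof (rule T.eqI[OF push_closed[OF S.anti_closed[OF f]] T.anti_closed[OF push_closed[OF f]]])
 fix Y assume Y: "Y \<in> carrier H'"
 have bij: "bij_betw (%X. inv\<^bsub>H\<^esub> X) {X \<in> carrier H. \<pi> X = Y} {X \<in> carrier H. \<pi> X = inv\<^bsub>H'\<^esub> Y}"
  by (rule bij_betw_byWitness[where f' = "%X. inv\<^bsub>H\<^esub> X"]) (use Y in \<open>auto simp: \<pi>inv\<close>)
 have "push (S.anti f) Y = (\<Oplus>X\<in>{X \<in> carrier H. \<pi> X = Y}. \<rho> (f (inv\<^bsub>H\<^esub> X)))"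
  using Y S.val[OF f] by (auto simp: push_def S.anti_def intro!: T.A.finsum_cong')
 also have "... = (\<Oplus>X\<in>{X \<in> carrier H. \<pi> X = inv\<^bsub>H'\<^esub> Y}. \<rho> (f X))"
  using S.val[OF f] by (intro T.A.finsum_bij[OF bij, symmetric]) auto
 also have "... = T.anti (push f) Y" using Y by (simp add: push_def T.anti_def)
 finally show "push (S.anti f) Y = T.anti (push f) Y" .
qed

end

section \<open>Inverse limits of finite rings\<close>

lemma continuous_map_discrete2:
 assumes f: "continuous_map Z (discrete_topology S) f" and g: "continuous_map Z (discrete_topology T) g"
  and h: "!!a b. a \<in> S ==> b \<in> T ==> h a b \<in> U"
 shows "continuous_map Z (discrete_topology U) (%z. h (f z) (g z))"
proof -
 have a: "continuous_map Z (discrete_topology (S \<times> T)) (%z. (f z, g z))"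
  using continuous_map_pairedI[OF f g] by (simp add: prod_topology_discrete_topology)
 have b: "continuous_map (discrete_topology (S \<times> T)) (discrete_topology U) (\<lambda>(a, b). h a b)"
  using h by (intro continuous_map_discrete) auto
 show ?thesis using continuous_map_compose[OF a b] by (simp add: o_def)
qed

text \<open>\<open>C\<close> is to be the set of compatible families. Leaving it abstract separates
  the topological argument, which asks for a closed set stable under the operations, from the
  particular transition maps.\<close>

definition lim_ring :: "'i set => ('i => ('b, 'x) ring_scheme) => ('i => 'b) set => ('i => 'b) top_ring" where
 "lim_ring I B C =
   \<lparr>carrier = C, monoid.mult = (%x y. \<lambda>i\<in>I. x i \<otimes>\<^bsub>B i\<^esub> y i), one = (\<lambda>i\<in>I. \<one>\<^bsub>B i\<^esub>),
   ring.zero = (\<lambda>i\<in>I. \<zero>\<^bsub>B i\<^esub>), ring.add = (%x y. \<lambda>i\<in>I. x i \<oplus>\<^bsub>B i\<^esub> y i),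
   rtop = subtopology (product_topology (%i. discrete_topology (carrier (B i))) I) C\<rparr>"

lemma lim_ring_profinite:
 assumes B: "!!i. i \<in> I ==> ring (B i)" "!!i. i \<in> I ==> finite (carrier (B i))"
  and C: "C \<subseteq> (\<Pi>\<^sub>E i\<in>I. carrier (B i))"
  and cl: "closedin (product_topology (%i. discrete_topology (carrier (B i))) I) C"
  and one: "(\<lambda>i\<in>I. \<one>\<^bsub>B i\<^esub>) \<in> C" and zero: "(\<lambda>i\<in>I. \<zero>\<^bsub>B i\<^esub>) \<in> C"
  and mult: "!!x y. x \<in> C ==> y \<in> C ==> (\<lambda>i\<in>I. x i \<otimes>\<^bsub>B i\<^esub> y i) \<in> C"
  and add: "!!x y. x \<in> C ==> y \<in> C ==> (\<lambda>i\<in>I. x i \<oplus>\<^bsub>B i\<^esub> y i) \<in> C"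
  and neg: "!!x. x \<in> C ==> (\<lambda>i\<in>I. \<ominus>\<^bsub>B i\<^esub> x i) \<in> C"
 shows "profinite_ring (lim_ring I B C)"
proof -
 let ?L = "lim_ring I B C"
 let ?P = "product_topology (%i. discrete_topology (carrier (B i))) I"
 have sel: "carrier ?L = C" "!!x y. x \<otimes>\<^bsub>?L\<^esub> y = (\<lambda>i\<in>I. x i \<otimes>\<^bsub>B i\<^esub> y i)" "\<one>\<^bsub>?L\<^esub> = (\<lambda>i\<in>I. \<one>\<^bsub>B i\<^esub>)"
  "\<zero>\<^bsub>?L\<^esub> = (\<lambda>i\<in>I. \<zero>\<^bsub>B i\<^esub>)" "!!x y. x \<oplus>\<^bsub>?L\<^esub> y = (\<lambda>i\<in>I. x i \<oplus>\<^bsub>B i\<^esub> y i)" "rtop ?L = subtopology ?P C"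
  by (simp_all add: lim_ring_def)
 have v: "x i \<in> carrier (B i)" if "x \<in> C" "i \<in> I" for x i using that C by auto
 have eq: "(\<lambda>i\<in>I. f i) = x" if "x \<in> C" "!!i. i \<in> I ==> f i = x i" for x f
  using that C by (intro extensionalityI[of _ I]) (auto simp: PiE_def)
 note rs = ring.is_abelian_group[OF B(1)] ring.is_monoid[OF B(1)]
 have ag: "abelian_group ?L"
 proof (rule abelian_groupI)
  fix x assume "x \<in> carrier ?L"
  hence x: "x \<in> C" by (simp add: sel)
  show "\<zero>\<^bsub>?L\<^esub> \<oplus>\<^bsub>?L\<^esub> x = x"
   unfolding sel by (rule eq[OF x]) (use v[OF x] abelian_groupE(5)[OF rs(1)] in simp)
  show "\<exists>y\<in>carrier ?L. y \<oplus>\<^bsub>?L\<^esub> x = \<zero>\<^bsub>?L\<^esub>"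
   using neg[OF x] abelian_group.l_neg[OF rs(1)] v[OF x]
   by (intro bexI[of _ "\<lambda>i\<in>I. \<ominus>\<^bsub>B i\<^esub> x i"]) (auto simp: sel intro!: restrict_ext)
  fix y assume "y \<in> carrier ?L"
  hence y: "y \<in> C" by (simp add: sel)
  show "x \<oplus>\<^bsub>?L\<^esub> y = y \<oplus>\<^bsub>?L\<^esub> x"
   unfolding sel using abelian_groupE(4)[OF rs(1)] v[OF x] v[OF y] by (intro restrict_ext) auto
  fix z assume "z \<in> carrier ?L"
  hence z: "z \<in> C" by (simp add: sel)
  show "x \<oplus>\<^bsub>?L\<^esub> y \<oplus>\<^bsub>?L\<^esub> z = x \<oplus>\<^bsub>?L\<^esub> (y \<oplus>\<^bsub>?L\<^esub> z)"
   unfolding sel using abelian_groupE(3)[OF rs(1)] v[OF x] v[OF y] v[OF z] by (intro restrict_ext) auto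
 qed (use add zero in \<open>auto simp: sel\<close>)
 have rL: "ring ?L"
 proof (rule ringI[OF ag])
  show "monoid ?L"
  proof (rule monoidI)
   fix x assume "x \<in> carrier ?L"
   hence x: "x \<in> C" by (simp add: sel)
   show "\<one>\<^bsub>?L\<^esub> \<otimes>\<^bsub>?L\<^esub> x = x" "x \<otimes>\<^bsub>?L\<^esub> \<one>\<^bsub>?L\<^esub> = x"
    unfolding sel by (rule eq[OF x], use v[OF x] monoid.l_one[OF rs(2)] monoid.r_one[OF rs(2)] in simp)+
   fix y z assume "y \<in> carrier ?L" "z \<in> carrier ?L"
   hence y: "y \<in> C" and z: "z \<in> C" by (auto simp: sel)
   show "x \<otimes>\<^bsub>?L\<^esub> y \<otimes>\<^bsub>?L\<^esub> z = x \<otimes>\<^bsub>?L\<^esub> (y \<otimes>\<^bsub>?L\<^esub> z)"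
    unfolding sel using monoid.m_assoc[OF rs(2)] v[OF x] v[OF y] v[OF z] by (intro restrict_ext) auto
  qed (use mult one in \<open>auto simp: sel\<close>)
  fix x y z assume "x \<in> carrier ?L" "y \<in> carrier ?L" "z \<in> carrier ?L"
  hence x: "x \<in> C" and y: "y \<in> C" and z: "z \<in> C" by (auto simp: sel)
  show "(x \<oplus>\<^bsub>?L\<^esub> y) \<otimes>\<^bsub>?L\<^esub> z = x \<otimes>\<^bsub>?L\<^esub> z \<oplus>\<^bsub>?L\<^esub> y \<otimes>\<^bsub>?L\<^esub> z"
   unfolding sel using ringE(3)[OF B(1)] v[OF x] v[OF y] v[OF z] by (intro restrict_ext) auto
  show "z \<otimes>\<^bsub>?L\<^esub> (x \<oplus>\<^bsub>?L\<^esub> y) = z \<otimes>\<^bsub>?L\<^esub> x \<oplus>\<^bsub>?L\<^esub> z \<otimes>\<^bsub>?L\<^esub> y"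
   unfolding sel using ringE(4)[OF B(1)] v[OF x] v[OF y] v[OF z] by (intro restrict_ext) auto
 qed
 interpret R: ring ?L by (rule rL)
 have tP: "topspace (subtopology ?P C) = C" using C by auto
 have pr: "continuous_map (subtopology ?P C) (discrete_topology (carrier (B i))) (%x. x i)" if "i \<in> I" for i
  by (rule continuous_map_from_subtopology[OF continuous_map_product_projection[OF that]])
 have into: "continuous_map Z (subtopology ?P C) f"
  if "!!i. i \<in> I ==> continuous_map Z (discrete_topology (carrier (B i))) (%z. f z i)"
   "!!z. z \<in> topspace Z ==> f z \<in> C" for Z and f
  using that C by (auto simp: continuous_map_in_subtopology continuous_map_componentwise PiE_def)
 have bin: "continuous_map (prod_topology (rtop ?L) (rtop ?L)) (rtop ?L) (\<lambda>(x, y). \<lambda>i\<in>I. h i (x i) (y i))"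
  if hc: "!!x y. x \<in> C ==> y \<in> C ==> (\<lambda>i\<in>I. h i (x i) (y i)) \<in> C"
   "!!i a b. i \<in> I ==> a \<in> carrier (B i) ==> b \<in> carrier (B i) ==> h i a b \<in> carrier (B i)" for h unfolding sel(6)
 proof (rule into)
  fix i assume i: "i \<in> I"
  have "continuous_map (prod_topology (subtopology ?P C) (subtopology ?P C)) (discrete_topology (carrier (B i)))
    (%q. h i (fst q i) (snd q i))"
  proof (rule continuous_map_discrete2[where h = "h i", OF _ _ hc(2)[OF i]])
   show "continuous_map (prod_topology (subtopology ?P C) (subtopology ?P C)) (discrete_topology (carrier (B i))) (%q. fst q i)"
    using continuous_map_compose[OF continuous_map_fst pr[OF i]] by (simp add: o_def)
   show "continuous_map (prod_topology (subtopology ?P C) (subtopology ?P C)) (discrete_topology (carrier (B i))) (%q. snd q i)"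
    using continuous_map_compose[OF continuous_map_snd pr[OF i]] by (simp add: o_def)
  qed
  thus "continuous_map (prod_topology (subtopology ?P C) (subtopology ?P C)) (discrete_topology (carrier (B i)))
    (%z. (case z of (x, y) => \<lambda>i\<in>I. h i (x i) (y i)) i)" using i by (simp add: case_prod_beta)
 qed (use hc(1) tP in auto)
 have um: "\<ominus>\<^bsub>?L\<^esub> x = (\<lambda>i\<in>I. \<ominus>\<^bsub>B i\<^esub> x i)" if x: "x \<in> C" for x
 proof (rule R.minus_equality)
  show "(\<lambda>i\<in>I. \<ominus>\<^bsub>B i\<^esub> x i) \<oplus>\<^bsub>?L\<^esub> x = \<zero>\<^bsub>?L\<^esub>"
   unfolding sel using abelian_group.l_neg[OF rs(1)] v[OF x] by (intro restrict_ext) auto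
 qed (use x neg in \<open>auto simp: sel\<close>)
 have "continuous_map (subtopology ?P C) (subtopology ?P C) (%x. \<lambda>i\<in>I. \<ominus>\<^bsub>B i\<^esub> x i)"
 proof (rule into)
  fix i assume i: "i \<in> I"
  have "continuous_map (discrete_topology (carrier (B i))) (discrete_topology (carrier (B i))) (a_inv (B i))"
   using abelian_group.a_inv_closed[OF rs(1)[OF i]] by (intro continuous_map_discrete) auto
  thus "continuous_map (subtopology ?P C) (discrete_topology (carrier (B i))) (%z. (\<lambda>i\<in>I. \<ominus>\<^bsub>B i\<^esub> z i) i)"
   using continuous_map_compose[OF pr[OF i], of "discrete_topology (carrier (B i))" "a_inv (B i)"] i by (simp add: o_def)
 qed (use neg tP in auto)
 hence un: "continuous_map (rtop ?L) (rtop ?L) (%x. \<ominus>\<^bsub>?L\<^esub> x)"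
  unfolding sel(6) by (rule continuous_map_eq) (use tP um in auto)
 show ?thesis unfolding profinite_ring_def
 proof (intro conjI rL un)
  show "topspace (rtop ?L) = carrier ?L" using tP by (simp add: sel)
  show "profinite_space (rtop ?L)" unfolding sel(6)
   by (rule profinite_space_closed_product[OF _ cl]) (use B(2) profinite_space_discrete in auto)
  show "continuous_map (prod_topology (rtop ?L) (rtop ?L)) (rtop ?L) (\<lambda>(x, y). x \<oplus>\<^bsub>?L\<^esub> y)"
   unfolding sel(5) by (rule bin[OF add abelian_groupE(1)[OF rs(1)]])
  show "continuous_map (prod_topology (rtop ?L) (rtop ?L)) (rtop ?L) (\<lambda>(x, y). x \<otimes>\<^bsub>?L\<^esub> y)"
   unfolding sel(2) by (rule bin[OF mult monoid.m_closed[OF rs(2)]])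
 qed
qed

text \<open>A finite subcover of a partition into nonempty sets is the whole partition.\<close>

lemma finite_open_partition:
 assumes "compact_space X" and op: "!!C. C \<in> \<C> ==> openin X C" and ne: "!!C. C \<in> \<C> ==> C ~= {}"
  and cov: "topspace X \<subseteq> \<Union>\<C>" and dis: "pairwise disjnt \<C>"
 shows "finite \<C>"
proof -
 obtain F where F: "finite F" "F \<subseteq> \<C>" "topspace X \<subseteq> \<Union>F"
  using assms(1) op cov unfolding compact_space_def compactin_def by meson
 have "C \<in> F" if C: "C \<in> \<C>" for C
 proof -
  obtain x where x: "x \<in> C" using ne[OF C] by blast
  then obtain D where D: "D \<in> F" "x \<in> D" using F(3) openin_subset[OF op[OF C]] by blast
  hence "C = D" using dis C F(2) x unfolding pairwise_def disjnt_def by blast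
  thus ?thesis using D by simp
 qed
 thus ?thesis using F(1) finite_subset[of \<C> F] by blast
qed

section \<open>The completed group algebra as a profinite ring with involution\<close>

locale cga =
 fixes R :: "('r, 'x) top_ring_scheme" (structure) and G :: "('g, 'y) top_group_scheme"
 assumes R: "profinite_ring R" and Rc: "cring R" and G: "profinite_group G"

sublocale cga \<subseteq> R: cring R by (rule Rc)

sublocale cga \<subseteq> G: group G using G by (simp add: profinite_group_def)

context cga
begin

lemma quot_finite:
 assumes I: "ideal I R" "openin (rtop R) I" shows "finite (carrier (R Quot I))"
proof -
 interpret I: ideal I R by fact
 have tR: "topspace (rtop R) = carrier R" "compact_space (rtop R)" using R by (auto simp: profinite_ring_def profinite_space_def)
 have "finite (a_rcosets I)"
 proof (rule finite_open_partition[OF tR(2)])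
  fix C assume C: "C \<in> a_rcosets I"
  then obtain a where a: "a \<in> carrier R" "C = I +> a" by (auto simp: A_RCOSETS_def')
  have "C = {x \<in> topspace (rtop R). x \<oplus> \<ominus> a \<in> I}"
   using a I.a_rcos_module[OF a(1)] I.a_elemrcos_carrier[OF a(1)] R.minus_eq by (auto simp: tR)
  moreover have "continuous_map (rtop R) (rtop R) (%x. x \<oplus> \<ominus> a)"
  proof -
   have "continuous_map (rtop R) (prod_topology (rtop R) (rtop R)) (%x. (x, \<ominus> a))"
    using a tR by (intro continuous_map_pairedI) auto
   moreover have "continuous_map (prod_topology (rtop R) (rtop R)) (rtop R) (\<lambda>(x, y). x \<oplus> y)"
    using R by (simp add: profinite_ring_def)
   ultimately show ?thesis using continuous_map_compose[of _ _ "%x. (x, \<ominus> a)" _ "\<lambda>(x, y). x \<oplus> y"] by (simp add: o_def)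
  qed
  ultimately show "openin (rtop R) C" using openin_continuous_map_preimage[OF _ I(2)] by simp
  show "C ~= {}" unfolding a(2) using I.a_rcos_self[OF a(1)] by blast
 qed (use I.a_rcosets_part_G I.a_rcos_disjoint tR in auto)
 thus ?thesis by (simp add: FactRing_def)
qed

lemma mod_finite:
 assumes N: "N \<lhd> G" "openin (gtop G) N" shows "finite (carrier (G Mod N))"
proof -
 interpret N: normal N G by fact
 have tG: "topspace (gtop G) = carrier G" "compact_space (gtop G)" using G by (auto simp: profinite_group_def profinite_space_def)
 have "finite (rcosets\<^bsub>G\<^esub> N)"
 proof (rule finite_open_partition[OF tG(2)])
  fix C assume C: "C \<in> rcosets\<^bsub>G\<^esub> N"
  then obtain a where a: "a \<in> carrier G" "C = N #>\<^bsub>G\<^esub> a" by (auto simp: RCOSETS_def)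
  have "C = {x \<in> topspace (gtop G). x \<otimes>\<^bsub>G\<^esub> inv\<^bsub>G\<^esub> a \<in> N}"
   using a N.rcos_module[OF G.is_group a(1)] N.elemrcos_carrier[OF G.is_group a(1)] by (auto simp: tG)
  moreover have "continuous_map (gtop G) (gtop G) (%x. x \<otimes>\<^bsub>G\<^esub> inv\<^bsub>G\<^esub> a)"
  proof -
   have "continuous_map (gtop G) (prod_topology (gtop G) (gtop G)) (%x. (x, inv\<^bsub>G\<^esub> a))"
    using a tG by (intro continuous_map_pairedI) auto
   moreover have "continuous_map (prod_topology (gtop G) (gtop G)) (gtop G) (\<lambda>(x, y). x \<otimes>\<^bsub>G\<^esub> y)"
    using G by (simp add: profinite_group_def)
   ultimately show ?thesis using continuous_map_compose[of _ _ "%x. (x, inv\<^bsub>G\<^esub> a)" _ "\<lambda>(x, y). x \<otimes>\<^bsub>G\<^esub> y"] by (simp add: o_def)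
  qed
  ultimately show "openin (gtop G) C" using openin_continuous_map_preimage[OF _ N(2)] by simp
  show "C ~= {}" unfolding a(2) using G.rcos_self[OF a(1) N.is_subgroup] by blast
 qed (use G.rcosets_part_G[OF N.is_subgroup] G.rcos_disjoint[OF N.is_subgroup] tG in auto)
 thus ?thesis by (simp add: FactGroup_def)
qed

abbreviation "idx \<equiv> cga_index R G"
abbreviation "lev \<equiv> cga_level R G"

lemma lev_eq: "lev i = group_algebra (R Quot fst i) (G Mod snd i)" by (cases i) (simp add: cga_level_def)

lemma level:
 assumes "i \<in> idx"
 shows "group_alg (R Quot fst i) (G Mod snd i)" "cring (R Quot fst i)" "finite (carrier (R Quot fst i))"
proof -
 have I: "ideal (fst i) R" "openin (rtop R) (fst i)" and N: "snd i \<lhd> G" "openin (gtop G) (snd i)"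
  using assms by (auto simp: cga_index_def)
 show "cring (R Quot fst i)" by (rule ideal.quotient_is_cring[OF I(1) Rc])
 thus "group_alg (R Quot fst i) (G Mod snd i)" using normal.factorgroup_is_group[OF N(1)] mod_finite[OF N]
  by (simp add: group_alg_def group_alg_axioms_def cring_def)
 show "finite (carrier (R Quot fst i))" by (rule quot_finite[OF I])
qed

lemma quot_map:
 assumes I: "ideal I R" and J: "ideal J R" and IJ: "I \<subseteq> J"
 shows "(%X. J <+>\<^bsub>R\<^esub> X) \<in> ring_hom (R Quot I) (R Quot J)"
proof -
 interpret I: ideal I R by fact
 interpret J: ideal J R by fact
 have c: "J <+>\<^bsub>R\<^esub> (I +> a) = J +> a" if a: "a \<in> carrier R" for a
 proof
  show "J <+>\<^bsub>R\<^esub> (I +> a) \<subseteq> J +> a"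
  proof
   fix x assume "x \<in> J <+>\<^bsub>R\<^esub> (I +> a)"
   then obtain j i where ji: "j \<in> J" "i \<in> I" "x = j \<oplus> (i \<oplus> a)" by (auto simp: set_add_def' a_r_coset_def')
   hence "x = (j \<oplus> i) \<oplus> a" "j \<oplus> i \<in> J" using a IJ J.a_closed J.a_Hcarr by (auto simp: R.a_assoc)
   thus "x \<in> J +> a" by (auto simp: a_r_coset_def')
  qed
  show "J +> a \<subseteq> J <+>\<^bsub>R\<^esub> (I +> a)"
  proof
   fix x assume "x \<in> J +> a"
   then obtain j where "j \<in> J" "x = j \<oplus> a" by (auto simp: a_r_coset_def')
   thus "x \<in> J <+>\<^bsub>R\<^esub> (I +> a)" using I.a_rcos_self[OF a] unfolding set_add_def' by blast
  qed
 qed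
 have cI: "carrier (R Quot I) = (+>) I ` carrier R" and cJ: "carrier (R Quot J) = (+>) J ` carrier R"
  by (auto simp: FactRing_def A_RCOSETS_def')
 have m: "(I +> a) \<otimes>\<^bsub>R Quot I\<^esub> (I +> b) = I +> (a \<otimes> b)"
   "(J +> a) \<otimes>\<^bsub>R Quot J\<^esub> (J +> b) = J +> (a \<otimes> b)"
   "(I +> a) \<oplus>\<^bsub>R Quot I\<^esub> (I +> b) = I +> (a \<oplus> b)"
   "(J +> a) \<oplus>\<^bsub>R Quot J\<^esub> (J +> b) = J +> (a \<oplus> b)"
  if "a \<in> carrier R" "b \<in> carrier R" for a b
  using that by (simp_all add: FactRing_def I.rcoset_mult_add J.rcoset_mult_add I.a_rcos_sum J.a_rcos_sum)
 have o: "\<one>\<^bsub>R Quot I\<^esub> = I +> \<one>" "\<one>\<^bsub>R Quot J\<^esub> = J +> \<one>" by (simp_all add: FactRing_def)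
 show ?thesis by (rule ring_hom_memI) (auto simp: cI cJ c m o)
qed

lemma mod_map_coset:
 assumes N: "N \<lhd> G" and N': "N' \<lhd> G" and sub: "N \<subseteq> N'" and a: "a \<in> carrier G"
 shows "N' <#>\<^bsub>G\<^esub> (N #>\<^bsub>G\<^esub> a) = N' #>\<^bsub>G\<^esub> a"
proof
 interpret N: normal N G by fact
 interpret N': normal N' G by fact
 show "N' <#>\<^bsub>G\<^esub> (N #>\<^bsub>G\<^esub> a) \<subseteq> N' #>\<^bsub>G\<^esub> a"
 proof
  fix x assume "x \<in> N' <#>\<^bsub>G\<^esub> (N #>\<^bsub>G\<^esub> a)"
  then obtain j i where ji: "j \<in> N'" "i \<in> N" "x = j \<otimes>\<^bsub>G\<^esub> (i \<otimes>\<^bsub>G\<^esub> a)" by (auto simp: set_mult_def r_coset_def)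
  hence "x = (j \<otimes>\<^bsub>G\<^esub> i) \<otimes>\<^bsub>G\<^esub> a" "j \<otimes>\<^bsub>G\<^esub> i \<in> N'"
   using a sub N'.m_closed N'.mem_carrier by (auto simp: G.m_assoc)
  thus "x \<in> N' #>\<^bsub>G\<^esub> a" by (auto simp: r_coset_def)
 qed
 show "N' #>\<^bsub>G\<^esub> a \<subseteq> N' <#>\<^bsub>G\<^esub> (N #>\<^bsub>G\<^esub> a)"
 proof
  fix x assume "x \<in> N' #>\<^bsub>G\<^esub> a"
  then obtain j where "j \<in> N'" "x = j \<otimes>\<^bsub>G\<^esub> a" by (auto simp: r_coset_def)
  thus "x \<in> N' <#>\<^bsub>G\<^esub> (N #>\<^bsub>G\<^esub> a)"
   using G.rcos_self[OF a N.is_subgroup] unfolding set_mult_def by blast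
 qed
qed

lemma mod_map:
 assumes N: "N \<lhd> G" and N': "N' \<lhd> G" and sub: "N \<subseteq> N'"
 shows "(%X. N' <#>\<^bsub>G\<^esub> X) \<in> hom (G Mod N) (G Mod N')"
proof -
 interpret N: normal N G by fact
 interpret N': normal N' G by fact
 have cN: "carrier (G Mod N) = (#>\<^bsub>G\<^esub>) N ` carrier G" and cN': "carrier (G Mod N') = (#>\<^bsub>G\<^esub>) N' ` carrier G"
  by (auto simp: FactGroup_def RCOSETS_def)
 show ?thesis by (rule homI) (auto simp: cN cN' mod_map_coset[OF N N' sub] N.rcos_sum N'.rcos_sum)
qed

text \<open>This identifies the index set of the sum in \<open>cga_proj\<close>, the cosets inside
  \<open>Y\<close>, with a fibre of the projection between quotient groups.\<close>

lemma subset_coset_iff: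
 assumes N: "N \<lhd> G" and N': "N' \<lhd> G" and sub: "N \<subseteq> N'"
  and X: "X \<in> carrier (G Mod N)" and Y: "Y \<in> carrier (G Mod N')"
 shows "X \<subseteq> Y \<longleftrightarrow> N' <#>\<^bsub>G\<^esub> X = Y"
proof -
 interpret N: normal N G by fact
 interpret N': normal N' G by fact
 obtain a b where ab: "a \<in> carrier G" "X = N #>\<^bsub>G\<^esub> a" "b \<in> carrier G" "Y = N' #>\<^bsub>G\<^esub> b"
  using X Y by (auto simp: FactGroup_def RCOSETS_def)
 note c = mod_map_coset[OF N N' sub ab(1)]
 show ?thesis
 proof
  assume "X \<subseteq> Y"
  hence "a \<in> N' #>\<^bsub>G\<^esub> b" using G.rcos_self[OF ab(1) N.is_subgroup] ab by auto
  thus "N' <#>\<^bsub>G\<^esub> X = Y" unfolding ab(2,4) c by (rule G.repr_independence[OF _ ab(3) N'.is_subgroup, symmetric])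
 next
  assume "N' <#>\<^bsub>G\<^esub> X = Y"
  thus "X \<subseteq> Y" using c sub unfolding ab(2) by (auto simp: r_coset_def)
 qed
qed

text \<open>The map \<open>cga_proj\<close> is \<open>push\<close> for the two quotient maps, so all
  seven facts are those about \<open>push\<close>.\<close>

lemma proj:
 assumes i: "i \<in> idx" and j: "j \<in> idx" and le: "fst i \<subseteq> fst j" "snd i \<subseteq> snd j"
 shows "!!f. f \<in> carrier (lev i) ==> cga_proj R G i j f \<in> carrier (lev j)"
  "!!f g. f \<in> carrier (lev i) ==> g \<in> carrier (lev i) ==>
   cga_proj R G i j (f \<oplus>\<^bsub>lev i\<^esub> g) = cga_proj R G i j f \<oplus>\<^bsub>lev j\<^esub> cga_proj R G i j g"
  "!!f g. f \<in> carrier (lev i) ==> g \<in> carrier (lev i) ==>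
   cga_proj R G i j (f \<otimes>\<^bsub>lev i\<^esub> g) = cga_proj R G i j f \<otimes>\<^bsub>lev j\<^esub> cga_proj R G i j g"
  "cga_proj R G i j \<one>\<^bsub>lev i\<^esub> = \<one>\<^bsub>lev j\<^esub>" "cga_proj R G i j \<zero>\<^bsub>lev i\<^esub> = \<zero>\<^bsub>lev j\<^esub>"
  "!!f. f \<in> carrier (lev i) ==> cga_proj R G i j (\<ominus>\<^bsub>lev i\<^esub> f) = \<ominus>\<^bsub>lev j\<^esub> cga_proj R G i j f"
  "!!f. f \<in> carrier (lev i) ==> cga_proj R G i j (\<lambda>X\<in>carrier (G Mod snd i). f (inv\<^bsub>G Mod snd i\<^esub> X)) =
   (\<lambda>X\<in>carrier (G Mod snd j). cga_proj R G i j f (inv\<^bsub>G Mod snd j\<^esub> X))"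
proof -
 have I: "ideal (fst i) R" "ideal (fst j) R" and N: "snd i \<lhd> G" "snd j \<lhd> G" using i j by (auto simp: cga_index_def)
 interpret h: group_alg_hom "R Quot fst i" "G Mod snd i" "R Quot fst j" "G Mod snd j"
   "%X. fst j <+>\<^bsub>R\<^esub> X" "%X. snd j <#>\<^bsub>G\<^esub> X"
  by (intro group_alg_hom.intro group_alg_hom_axioms.intro level(1) i j quot_map mod_map I N le)
 have p: "cga_proj R G i j f = h.push f" for f
 proof -
  have "{X \<in> carrier (G Mod snd i). X \<subseteq> Y} = {X \<in> carrier (G Mod snd i). snd j <#>\<^bsub>G\<^esub> X = Y}"
   if "Y \<in> carrier (G Mod snd j)" for Y using subset_coset_iff[OF N le(2) _ that] by blast
  note e = this
  have "cga_proj R G i j f = (\<lambda>Y\<in>carrier (G Mod snd j).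
    \<Oplus>\<^bsub>R Quot fst j\<^esub>X\<in>{X \<in> carrier (G Mod snd i). X \<subseteq> Y}. fst j <+>\<^bsub>R\<^esub> f X)"
   by (cases i, cases j) (simp add: cga_proj_def)
  also have "... = h.push f" unfolding h.push_def by (rule restrict_ext) (simp only: e)
  finally show ?thesis .
 qed
 note anti = h.S.anti_def h.T.anti_def
 show "!!f. f \<in> carrier (lev i) ==> cga_proj R G i j f \<in> carrier (lev j)"
  "!!f g. f \<in> carrier (lev i) ==> g \<in> carrier (lev i) ==>
   cga_proj R G i j (f \<oplus>\<^bsub>lev i\<^esub> g) = cga_proj R G i j f \<oplus>\<^bsub>lev j\<^esub> cga_proj R G i j g"
  "!!f g. f \<in> carrier (lev i) ==> g \<in> carrier (lev i) ==>
   cga_proj R G i j (f \<otimes>\<^bsub>lev i\<^esub> g) = cga_proj R G i j f \<otimes>\<^bsub>lev j\<^esub> cga_proj R G i j g"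
  "cga_proj R G i j \<one>\<^bsub>lev i\<^esub> = \<one>\<^bsub>lev j\<^esub>" "cga_proj R G i j \<zero>\<^bsub>lev i\<^esub> = \<zero>\<^bsub>lev j\<^esub>"
  "!!f. f \<in> carrier (lev i) ==> cga_proj R G i j (\<ominus>\<^bsub>lev i\<^esub> f) = \<ominus>\<^bsub>lev j\<^esub> cga_proj R G i j f"
  "!!f. f \<in> carrier (lev i) ==> cga_proj R G i j (\<lambda>X\<in>carrier (G Mod snd i). f (inv\<^bsub>G Mod snd i\<^esub> X)) =
   (\<lambda>X\<in>carrier (G Mod snd j). cga_proj R G i j f (inv\<^bsub>G Mod snd j\<^esub> X))"
  unfolding p lev_eq anti[symmetric]
  by (rule h.push_closed h.push_add h.push_mult h.push_one h.push_zero h.push_uminus h.push_anti, (assumption+)?)+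
qed

lemma cga_eq: "completed_group_algebra R G = lim_ring idx lev (cga_carrier R G)"
 by (simp add: completed_group_algebra_def lim_ring_def)

lemma level_ring: "i \<in> idx ==> ring (lev i)" and level_finite: "i \<in> idx ==> finite (carrier (lev i))"
 unfolding lev_eq using group_alg.ring_GA[OF level(1)] group_alg.finite_GA[OF level(1) level(3)] by auto

lemma carrierI:
 assumes "!!i. i \<in> idx ==> f i \<in> carrier (lev i)"
  "!!i j. i \<in> idx ==> j \<in> idx ==> fst i \<subseteq> fst j ==> snd i \<subseteq> snd j ==> cga_proj R G i j (f i) = f j"
 shows "(\<lambda>i\<in>idx. f i) \<in> cga_carrier R G" using assms by (auto simp: cga_carrier_def)

lemma carrierD:
 assumes "x \<in> cga_carrier R G"
 shows "x \<in> extensional idx" "!!i. i \<in> idx ==> x i \<in> carrier (lev i)"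
  "!!i j. i \<in> idx ==> j \<in> idx ==> fst i \<subseteq> fst j ==> snd i \<subseteq> snd j ==> cga_proj R G i j (x i) = x j"
 using assms by (auto simp: cga_carrier_def PiE_def)

abbreviation "PT \<equiv> product_topology (%i. discrete_topology (carrier (lev i))) idx"

text \<open>Each compatibility condition compares two coordinates in discrete spaces, and so is
  closed; the carrier is the intersection of these conditions within the product.\<close>

lemma closedin_carrier: "closedin PT (cga_carrier R G)"
proof -
 let ?Q = "{(i, j). i \<in> idx & j \<in> idx & fst i \<subseteq> fst j & snd i \<subseteq> snd j}"
 let ?S = "%q. {x \<in> topspace PT. (cga_proj R G (fst q) (snd q) (x (fst q)) = x (snd q)) \<in> {True}}"
 have "closedin PT (?S q)" if q: "q \<in> ?Q" for q
 proof (rule closedin_continuous_map_preimage)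
  have "fst q \<in> idx" "snd q \<in> idx" using q by auto
  thus "continuous_map PT (discrete_topology UNIV) (%x. cga_proj R G (fst q) (snd q) (x (fst q)) = x (snd q))"
   by (intro continuous_map_discrete2[where h = "%a b. cga_proj R G (fst q) (snd q) a = b"
      and S = "carrier (lev (fst q))" and T = "carrier (lev (snd q))"]
     continuous_map_product_projection) auto
 qed simp
 hence "\<forall>D\<in>insert (topspace PT) (?S ` ?Q). closedin PT D" by blast
 hence "closedin PT (\<Inter>(insert (topspace PT) (?S ` ?Q)))" by (intro closedin_Inter) blast+
 moreover have "cga_carrier R G = \<Inter>(insert (topspace PT) (?S ` ?Q))" by (auto simp: cga_carrier_def)
 ultimately show ?thesis by simp
qed

lemma profinite_cga: "profinite_ring (completed_group_algebra R G)" unfolding cga_eq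
proof (rule lim_ring_profinite[OF level_ring level_finite _ closedin_carrier])
 show "cga_carrier R G \<subseteq> (\<Pi>\<^sub>E i\<in>idx. carrier (lev i))" by (auto simp: cga_carrier_def)
 note r = ring.is_abelian_group[OF level_ring] ring.is_monoid[OF level_ring]
 show "(\<lambda>i\<in>idx. \<one>\<^bsub>lev i\<^esub>) \<in> cga_carrier R G"
  by (rule carrierI) (simp_all add: proj(4) monoid.one_closed[OF r(2)])
 show "(\<lambda>i\<in>idx. \<zero>\<^bsub>lev i\<^esub>) \<in> cga_carrier R G"
  by (rule carrierI) (simp_all add: proj(5) abelian_groupE(2)[OF r(1)])
 fix x assume x: "x \<in> cga_carrier R G"
 note xD = carrierD[OF x]
 show "(\<lambda>i\<in>idx. \<ominus>\<^bsub>lev i\<^esub> x i) \<in> cga_carrier R G"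
  by (rule carrierI) (use xD in \<open>simp_all add: proj(6) abelian_group.a_inv_closed[OF r(1)]\<close>)
 fix y assume y: "y \<in> cga_carrier R G"
 note yD = carrierD[OF y]
 show "(\<lambda>i\<in>idx. x i \<otimes>\<^bsub>lev i\<^esub> y i) \<in> cga_carrier R G"
  by (rule carrierI) (use xD yD in \<open>simp_all add: proj(3) monoid.m_closed[OF r(2)]\<close>)
 show "(\<lambda>i\<in>idx. x i \<oplus>\<^bsub>lev i\<^esub> y i) \<in> cga_carrier R G"
  by (rule carrierI) (use xD yD in \<open>simp_all add: proj(2) abelian_groupE(1)[OF r(1)]\<close>)
qed

lemma cga_sel:
 "carrier (completed_group_algebra R G) = cga_carrier R G"
 "x \<otimes>\<^bsub>completed_group_algebra R G\<^esub> y = (\<lambda>i\<in>idx. x i \<otimes>\<^bsub>lev i\<^esub> y i)"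
 "\<one>\<^bsub>completed_group_algebra R G\<^esub> = (\<lambda>i\<in>idx. \<one>\<^bsub>lev i\<^esub>)"
 "x \<oplus>\<^bsub>completed_group_algebra R G\<^esub> y = (\<lambda>i\<in>idx. x i \<oplus>\<^bsub>lev i\<^esub> y i)"
 "rtop (completed_group_algebra R G) = subtopology PT (cga_carrier R G)" by (simp_all add: completed_group_algebra_def)

text \<open>The laws hold levelwise by those of \<open>anti\<close>, where commutativity of
  \<open>R\<close> enters through the reversal of products. That the antipode respects compatible
  families is the last fact of \<open>proj\<close>.\<close>

theorem inv_ring_cga: "inv_ring (completed_group_algebra R G) (cga_antipode R G)"
proof (intro inv_ring.intro inv_ring_axioms.intro prof_ring.intro profinite_cga)
 let ?L = "completed_group_algebra R G" and ?\<sigma> = "cga_antipode R G"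
 define anti where "anti i f = (\<lambda>X\<in>carrier (G Mod snd i). f (inv\<^bsub>G Mod snd i\<^esub> X))" for i :: "'r set \<times> 'g set" and f :: "'g set => 'r set"
 have ap: "?\<sigma> x = (\<lambda>i\<in>idx. anti i (x i))" for x by (simp add: cga_antipode_def anti_def)
 have an: "anti i f = group_alg.anti (G Mod snd i) f" if "i \<in> idx" for i f
  using group_alg.anti_def[OF level(1)[OF that]] by (simp add: anti_def)
 have ac: "anti i f \<in> carrier (lev i)" if "i \<in> idx" "f \<in> carrier (lev i)" for i f
  using group_alg.anti_closed[OF level(1)[OF that(1)]] that by (simp add: an lev_eq)
 show cl: "?\<sigma> x \<in> carrier ?L" if "x \<in> carrier ?L" for x
 proof -
  note D = carrierD[OF that[unfolded cga_sel]]
  show ?thesis unfolding cga_sel ap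
  proof (rule carrierI)
   fix i j assume ij: "i \<in> idx" "j \<in> idx" "fst i \<subseteq> fst j" "snd i \<subseteq> snd j"
   show "cga_proj R G i j (anti i (x i)) = anti j (x j)" using proj(7)[OF ij D(2)[OF ij(1)]] D(3)[OF ij] by (simp add: anti_def)
  qed (use ac D(2) in auto)
 qed
 show "?\<sigma> (x \<oplus>\<^bsub>?L\<^esub> y) = ?\<sigma> x \<oplus>\<^bsub>?L\<^esub> ?\<sigma> y" if "x \<in> carrier ?L" "y \<in> carrier ?L" for x y
  unfolding cga_sel ap using group_alg.anti_add[OF level(1)] by (auto simp: an lev_eq intro!: restrict_ext)
 show "?\<sigma> (x \<otimes>\<^bsub>?L\<^esub> y) = ?\<sigma> y \<otimes>\<^bsub>?L\<^esub> ?\<sigma> x" if "x \<in> carrier ?L" "y \<in> carrier ?L" for x y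
  unfolding cga_sel ap using group_alg.anti_mult[OF level(1) level(2)] carrierD(2)[OF that(1)[unfolded cga_sel]]
   carrierD(2)[OF that(2)[unfolded cga_sel]] by (auto simp: an lev_eq intro!: restrict_ext)
 show "?\<sigma> \<one>\<^bsub>?L\<^esub> = \<one>\<^bsub>?L\<^esub>"
  unfolding cga_sel ap using group_alg.anti_one[OF level(1)] by (auto simp: an lev_eq intro!: restrict_ext)
 show "?\<sigma> (?\<sigma> x) = x" if "x \<in> carrier ?L" for x
 proof (rule extensionalityI[of _ idx])
  note D = carrierD[OF that[unfolded cga_sel]]
  show "?\<sigma> (?\<sigma> x) i = x i" if "i \<in> idx" for i
   using that group_alg.anti_anti[OF level(1)[OF that]] D(2)[OF that] by (simp add: ap an lev_eq)
  show "x \<in> extensional idx" by (rule D(1))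
 qed (simp add: ap)
 show "continuous_map (rtop ?L) (rtop ?L) ?\<sigma>"
  unfolding cga_sel(5) continuous_map_in_subtopology continuous_map_componentwise
 proof (intro conjI ballI)
  fix i assume i: "i \<in> idx"
  have "continuous_map (subtopology PT (cga_carrier R G)) (discrete_topology (carrier (lev i))) (%x. x i)"
   by (rule continuous_map_from_subtopology[OF continuous_map_product_projection[OF i]])
  moreover have "continuous_map (discrete_topology (carrier (lev i))) (discrete_topology (carrier (lev i))) (anti i)"
   using ac[OF i] by (intro continuous_map_discrete) auto
  ultimately have "continuous_map (subtopology PT (cga_carrier R G)) (discrete_topology (carrier (lev i))) (anti i \<circ> (%x. x i))"
   by (rule continuous_map_compose)
  thus "continuous_map (subtopology PT (cga_carrier R G)) (discrete_topology (carrier (lev i))) (%x. ?\<sigma> x i)"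
   using i by (simp add: ap o_def)
 qed (use cl in \<open>auto simp: ap cga_sel\<close>)
qed

end

section \<open>Tor of a resolution by projective covers\<close>

lemma (in left_module) submodule_left_module:
 assumes H: "submodule H R M" shows "left_module R (M\<lparr>carrier := H\<rparr>)"
proof -
 note Hc = submod_subset[OF H, THEN subsetD]
 have "abelian_group (M\<lparr>carrier := H\<rparr>)"
 proof (rule abelian_groupI)
  fix x assume "x \<in> carrier (M\<lparr>carrier := H\<rparr>)"
  hence x: "x \<in> H" by simp
  show "\<exists>y\<in>carrier (M\<lparr>carrier := H\<rparr>). y \<oplus>\<^bsub>M\<lparr>carrier := H\<rparr>\<^esub> x = \<zero>\<^bsub>M\<lparr>carrier := H\<rparr>\<^esub>"
   using submod_uminus[OF H x] M.l_neg[OF Hc[OF x]] by auto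
 qed (use submod_add[OF H] submod_zero[OF H] in \<open>auto simp: Hc M.a_ac\<close>)
 moreover have "left_module_axioms R (M\<lparr>carrier := H\<rparr>)" by (rule left_module_axioms.intro)
   (use submod_smult[OF H] in \<open>auto simp: Hc smult_l_distr smult_r_distr smult_assoc1 smult_one\<close>)
 ultimately show ?thesis by (intro left_module.intro R.ring_axioms)
qed

text \<open>Only the size of \<open>Tor\<close> matters, so a bijection onto cosets takes the place
  of an isomorphism theorem: \<open>inj\<close> and \<open>surj\<close> are injectivity and
  surjectivity modulo \<open>B\<close>.\<close>

lemma (in left_module) bij_betw_cosets:
 assumes B: "submodule B R M" and f: "!!x. x \<in> S ==> f x \<in> carrier M"
  and inj: "!!x y b. x \<in> S ==> y \<in> S ==> b \<in> B ==> f x = b \<oplus> f y ==> x = y"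
  and surj: "!!z. z \<in> carrier M ==> \<exists>x\<in>S. \<exists>b\<in>B. f x = z \<oplus> b"
 shows "bij_betw (%x. B +> f x) S (a_rcosets B)" unfolding bij_betw_def
proof
 show "inj_on (%x. B +> f x) S"
 proof (rule inj_onI)
  fix x y assume x: "x \<in> S" and y: "y \<in> S" and e: "B +> f x = B +> f y"
  have "f x \<ominus> f y \<in> B" using coset_eq_iff[OF B f[OF x] f[OF y]] e by simp
  moreover have "f x = (f x \<ominus> f y) \<oplus> f y" using f[OF x] f[OF y] by (simp add: M.minus_eq M.a_assoc M.l_neg)
  ultimately show "x = y" by (rule inj[OF x y])
 qed
 show "(%x. B +> f x) ` S = a_rcosets B"
 proof
  show "(%x. B +> f x) ` S \<subseteq> a_rcosets B" using f by (auto simp: A_RCOSETS_def')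
  show "a_rcosets B \<subseteq> (%x. B +> f x) ` S"
  proof
   fix Z assume "Z \<in> a_rcosets B"
   then obtain z where z: "z \<in> carrier M" "Z = B +> z" by (auto simp: A_RCOSETS_def')
   obtain x b where x: "x \<in> S" "b \<in> B" "f x = z \<oplus> b" using surj[OF z(1)] by blast
   have bc: "b \<in> carrier M" using x(2) submod_subset[OF B] by auto
   have "f x \<ominus> z = b" unfolding x(3) by (rule add_minus_cancel[OF z(1) bc])
   hence "Z = B +> f x" using coset_eq_iff[OF B f[OF x(1)] z(1)] x(2) z(2) by simp
   thus "Z \<in> (%x. B +> f x) ` S" using x(1) by blast
  qed
 qed
qed

text \<open>If \<phi>(x) were nonzero, the closed submodule generated by \<open>x\<close> would map
  onto the simple module \<open>D\<close> while lying in the kernel of \<open>f\<close>. Every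
  element of \<open>P\<close> could then be moved by it into the kernel of \<phi> without changing
  the image under \<open>f\<close>, so that kernel would be all of \<open>P\<close>.\<close>

lemma superfluous_ker_killed:
 assumes L: "profinite_ring L" and P: "profinite_module L P" and N: "profinite_module L N" and f: "f \<in> cont_hom L P N"
  and sup: "!!H. closed_submodule H L P ==> f ` H = f ` carrier P ==> H = carrier P"
  and D: "simple_module L D" and \<phi>: "\<phi> \<in> cont_hom L P D" and x: "x \<in> carrier P" "f x = \<zero>\<^bsub>N\<^esub>"
 shows "\<phi> x = \<zero>\<^bsub>D\<^esub>"
proof (rule ccontr)
 assume ne: "\<phi> x ~= \<zero>\<^bsub>D\<^esub>"
 interpret P: prof_module L P by (rule prof_module.intro[OF P])
 interpret N: prof_module L N by (rule prof_module.intro[OF N])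
 have Dp: "profinite_module L D" using D by (simp add: simple_module_def)
 interpret D: prof_module L D by (rule prof_module.intro[OF Dp])
 note fD = cont_homD[OF f] and pD = cont_homD[OF \<phi>]
 have px: "\<phi> x \<in> carrier D" by (rule pD(1)[OF x(1)])
 let ?H = "{y \<in> carrier P. \<phi> y \<in> {\<zero>\<^bsub>D\<^esub>}}"
 let ?C = "\<phi> ` closed_span L P {x}"
 have cs: "closed_submodule (closed_span L P {x}) L P" "x \<in> closed_span L P {x}"
  using P.closed_span_submodule[of "{x}"] x by auto
 have "closed_submodule ?C L D" by (rule closed_submodule_image[OF P Dp \<phi> cs(1)])
 moreover have "?C ~= {\<zero>\<^bsub>D\<^esub>}" using cs(2) ne by blast
 ultimately have full: "?C = carrier D" using D by (auto simp: simple_module_def)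
 have kz: "closed_span L P {x} \<subseteq> ker_set P N f"
  by (rule P.closed_span_least[OF closed_submodule_ker[OF P N f]]) (use x in \<open>simp add: ker_set_def\<close>)
 have "closed_submodule ?H L P" by (rule closed_submodule_preimage[OF P Dp \<phi> closed_submodule_zero[OF Dp]])
 moreover have "f ` ?H = f ` carrier P"
 proof
  show "f ` carrier P \<subseteq> f ` ?H"
  proof
   fix w assume "w \<in> f ` carrier P"
   then obtain y where y: "y \<in> carrier P" "w = f y" by blast
   have "\<phi> y \<in> ?C" unfolding full by (rule pD(1)[OF y(1)])
   then obtain k where k: "k \<in> closed_span L P {x}" "\<phi> y = \<phi> k" by blast
   have kc: "k \<in> carrier P" "f k = \<zero>\<^bsub>N\<^esub>" using k(1) kz by (auto simp: ker_set_def)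
   have "\<phi> (y \<ominus>\<^bsub>P\<^esub> k) = \<zero>\<^bsub>D\<^esub>"
    using cont_hom_minus(2)[OF P Dp \<phi> y(1) kc(1)] k(2) pD(1)[OF kc(1)] by (simp add: D.M.minus_eq D.M.r_neg)
   moreover have "f (y \<ominus>\<^bsub>P\<^esub> k) = w"
    using cont_hom_minus(2)[OF P N f y(1) kc(1)] kc(2) y(2) fD(1)[OF y(1)] by (simp add: N.M.minus_eq)
   ultimately show "w \<in> f ` ?H" using y(1) kc(1) by (intro image_eqI[of _ _ "y \<ominus>\<^bsub>P\<^esub> k"]) auto
  qed
 qed auto
 ultimately have "?H = carrier P" by (rule sup)
 thus False using x(1) ne by auto
qed

text \<open>Exactness places \<open>d n x\<close> in the kernel of the covering map out of
  \<open>P n\<close>, which is the augmentation or the preceding differential.\<close>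

lemma covers_killed:
 assumes L: "profinite_ring L" and K: "profinite_module L K" and R: "resolution_by_covers L P d e K"
  and D: "simple_module L D" and \<phi>: "\<phi> \<in> cont_hom L (P n) D" and x: "x \<in> carrier (P (Suc n))"
 shows "\<phi> (d n x) = \<zero>\<^bsub>D\<^esub>"
proof -
 have res: "projective_resolution_upto m L P d e K" for m
  using R by (simp add: resolution_by_covers_def projective_resolution_def)
 note r = projective_resolution_uptoD[OF res]
 have pf: "profinite_module L (P j)" for j using r(2)[of j j] by simp
 have dh: "d j \<in> cont_hom L (P (Suc j)) (P j)" for j using r(3)[of j "Suc j"] by simp
 have dc: "d n x \<in> carrier (P n)" by (rule cont_homD(1)[OF dh x])
 have "d n x \<in> res_cycles P d e K n" using r(6)[of n "Suc n"] x by blast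
 hence z: "case n of 0 => e (d n x) = \<zero>\<^bsub>K\<^esub> | Suc m => d m (d n x) = \<zero>\<^bsub>P m\<^esub>"
  by (cases n) (auto simp: res_cycles_0 res_cycles_Suc)
 show ?thesis
 proof (cases n)
  case 0
  have "projective_cover L (P 0) e K" using R by (simp add: resolution_by_covers_def)
  thus ?thesis
   using 0 z dc \<phi> by (intro superfluous_ker_killed[OF L pf K r(4) _ D, where \<phi> = \<phi> and x = "d n x"]) (auto simp: projective_cover_def)
 next
  case (Suc m)
  have im: "d m ` carrier (P (Suc m)) = res_cycles P d e K m" using r(6)[of m "Suc m"] by simp
  have "H = carrier (P (Suc m))" if H: "closed_submodule H L (P (Suc m))" "d m ` H = d m ` carrier (P (Suc m))" for H
   using R that im by (cases m) (auto simp: resolution_by_covers_def projective_cover_def ker_module_def res_cycles_def)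
  thus ?thesis
   using Suc z dc \<phi> by (intro superfluous_ker_killed[OF L pf pf dh _ D, where \<phi> = \<phi> and x = "d n x"]) auto
 qed
qed

locale tens_simple =
 fixes L :: "('l, 'x) top_ring_scheme" and \<sigma> :: "'l => 'l" and M :: "('l, 'm) top_module"
 assumes inv: "inv_ring L \<sigma>" and M: "simple_module L M"

sublocale tens_simple \<subseteq> inv_ring L \<sigma> by (rule inv)

sublocale tens_simple \<subseteq> S: simple_mod L M by (rule simple_modI[OF profinite M])

context tens_simple
begin

abbreviation "T A \<equiv> ctensor L \<sigma> A M"
abbreviation "tcar A \<equiv> ctensor_carrier L \<sigma> A M"
abbreviation "tm A A' f \<equiv> ctensor_map L \<sigma> A M A' M f (%m. m)"
abbreviation "pf A \<equiv> profinite_module L A"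

lemma X: "pf A ==> ctensor_prod L \<sigma> A M" by (rule ctensor_prod_simple[OF inv _ M])

lemma tag: "pf A ==> abelian_group (T A)" by (rule ctensor_prod.ctensor_abelian_group[OF X])

lemma tcarrier [simp]: "carrier (T A) = tcar A" by (simp add: ctensor_def)

lemma tm_closed: "pf A ==> pf A' ==> f \<in> cont_hom L A A' ==> x \<in> tcar A ==> tm A A' f x \<in> tcar A'"
 by (rule ctensor_map_closed[OF X X _ cont_hom_id])

lemma tm_compose:
 "pf A ==> pf A' ==> pf A'' ==> f \<in> cont_hom L A A' ==> g \<in> cont_hom L A' A'' ==> x \<in> tcar A ==>
  tm A' A'' g (tm A A' f x) = tm A A'' (%a. g (f a)) x" by (rule ctensor_map_compose[OF X X X _ cont_hom_id _ cont_hom_id])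

lemma tm_cong:
 "pf A ==> pf A' ==> f \<in> cont_hom L A A' ==> f' \<in> cont_hom L A A' ==> (!!a. a \<in> carrier A ==> f a = f' a) ==>
  x \<in> tcar A ==> tm A A' f x = tm A A' f' x" by (rule ctensor_map_cong[OF X X _ cont_hom_id _ cont_hom_id _ refl])

lemma tm_add:
 "pf A ==> pf A' ==> f \<in> cont_hom L A A' ==> x \<in> tcar A ==> y \<in> tcar A ==>
  tm A A' f (x \<oplus>\<^bsub>T A\<^esub> y) = tm A A' f x \<oplus>\<^bsub>T A'\<^esub> tm A A' f y"
 by (rule ctensor_map_add[OF X X _ cont_hom_id])

lemma tm_zero:
 assumes A: "pf A" and A': "pf A'" and f: "f \<in> cont_hom L A A'"
 shows "tm A A' f \<zero>\<^bsub>T A\<^esub> = \<zero>\<^bsub>T A'\<^esub>"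
proof -
 interpret A: abelian_group "T A" by (rule tag[OF A])
 interpret A': abelian_group "T A'" by (rule tag[OF A'])
 let ?e = "tm A A' f \<zero>\<^bsub>T A\<^esub>"
 have z: "\<zero>\<^bsub>T A\<^esub> \<in> tcar A" using A.zero_closed by simp
 have e: "?e \<in> carrier (T A')" using tm_closed[OF A A' f z] by simp
 have "?e \<oplus>\<^bsub>T A'\<^esub> ?e = ?e" using tm_add[OF A A' f z z] A.r_zero[OF A.zero_closed] by simp
 thus ?thesis using e by (metis A'.a_assoc A'.a_inv_closed A'.l_neg A'.l_zero)
qed

lemma tm_smult:
 assumes A: "pf A" and A': "pf A'" and f: "f \<in> cont_hom L A A'" and h: "h \<in> carrier (End_ring L M)" and x: "x \<in> tcar A"
 shows "tm A A' f (h \<odot>\<^bsub>T A\<^esub> x) = h \<odot>\<^bsub>T A'\<^esub> tm A A' f x"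
proof -
 have hh: "h \<in> cont_hom L M M" using h by simp
 have "tm A A' f (h \<odot>\<^bsub>T A\<^esub> x) = ctensor_map L \<sigma> A M A' M (%a. f a) (%b. h b) x"
  using ctensor_map_compose[OF X[OF A] X[OF A] X[OF A'] cont_hom_id hh f cont_hom_id x] by (simp add: ctensor_def)
 also have "... = h \<odot>\<^bsub>T A'\<^esub> tm A A' f x"
  using ctensor_map_compose[OF X[OF A] X[OF A'] X[OF A'] f cont_hom_id cont_hom_id hh x] by (simp add: ctensor_def)
 finally show ?thesis .
qed

text \<open>The term \<open>r\<close> factors through the differential and therefore vanishes on the
  cycle \<open>z\<close>; in degree 0 it is zero outright.\<close>

lemma tm_homotopy:
 assumes C: "projective_resolution_upto (Suc n) L C c e K"
  and h: "h \<in> cont_hom L (C n) (C (Suc n))" and r: "r \<in> cont_hom L (C n) (C n)" and w: "w \<in> cont_hom L (C n) (C n)"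
  and eq: "\<forall>x\<in>carrier (C n). w x = x \<oplus>\<^bsub>C n\<^esub> (c n (h x) \<oplus>\<^bsub>C n\<^esub> r x)"
  and rz: "case n of 0 => \<forall>x\<in>carrier (C 0). r x = \<zero>\<^bsub>C 0\<^esub>
    | Suc m => \<exists>s\<in>cont_hom L (C m) (C n). \<forall>x\<in>carrier (C n). r x = s (c m x)"
  and z: "z \<in> tcar (C n)" and cz: "!!m. n = Suc m ==> tm (C n) (C m) (c m) z = \<zero>\<^bsub>T (C m)\<^esub>"
 shows "tm (C n) (C n) w z = z \<oplus>\<^bsub>T (C n)\<^esub> tm (C (Suc n)) (C n) (c n) (tm (C n) (C (Suc n)) h z)"
proof -
 note CD = projective_resolution_uptoD[OF C]
 have p: "pf (C n)" "pf (C (Suc n))" using CD(2) by auto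
 have cn: "c n \<in> cont_hom L (C (Suc n)) (C n)" using CD(3) by simp
 interpret TT: abelian_group "T (C n)" by (rule tag[OF p(1)])
 have ch: "(%x. c n (h x)) \<in> cont_hom L (C n) (C n)" by (rule cont_hom_compose[OF h cn])
 have rr: "tm (C n) (C n) r z = \<zero>\<^bsub>T (C n)\<^esub>"
 proof (cases n)
  case 0
  thus ?thesis using rz z r p by (intro ctensor_map_zero[OF X X _ cont_hom_id]) auto
 next
  case (Suc m)
  then obtain s where s: "s \<in> cont_hom L (C m) (C n)" "!!x. x \<in> carrier (C n) ==> r x = s (c m x)" using rz by auto
  have pm: "pf (C m)" using CD(2) Suc by simp
  have cm: "c m \<in> cont_hom L (C n) (C m)" using CD(3)[of m] Suc by simp
  have "tm (C n) (C n) r z = tm (C n) (C n) (%x. s (c m x)) z"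
   by (rule tm_cong[OF p(1) p(1) r cont_hom_compose[OF cm s(1)] s(2) z])
  also have "... = tm (C m) (C n) s (tm (C n) (C m) (c m) z)" by (rule tm_compose[OF p(1) pm p(1) cm s(1) z, symmetric])
  also have "... = \<zero>\<^bsub>T (C n)\<^esub>" using cz[OF Suc] tm_zero[OF pm p(1) s(1)] by simp
  finally show ?thesis .
 qed
 have chc: "tm (C n) (C n) (%x. c n (h x)) z \<in> carrier (T (C n))" using tm_closed[OF p(1) p(1) ch z] by simp
 have sum: "(%x. c n (h x) \<oplus>\<^bsub>C n\<^esub> r x) \<in> cont_hom L (C n) (C n)" by (rule cont_hom_add[OF p(1) ch r])
 have "tm (C n) (C n) w z = tm (C n) (C n) (%x. x) z \<oplus>\<^bsub>T (C n)\<^esub> tm (C n) (C n) (%x. c n (h x) \<oplus>\<^bsub>C n\<^esub> r x) z"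
  by (rule ctensor_map_add_left[OF X[OF p(1)] X[OF p(1)] cont_hom_id sum w cont_hom_id eq[rule_format] z])
 also have "tm (C n) (C n) (%x. c n (h x) \<oplus>\<^bsub>C n\<^esub> r x) z =
   tm (C n) (C n) (%x. c n (h x)) z \<oplus>\<^bsub>T (C n)\<^esub> tm (C n) (C n) r z"
  by (rule ctensor_map_add_left[OF X[OF p(1)] X[OF p(1)] ch r sum cont_hom_id refl z])
 also have "... = tm (C n) (C n) (%x. c n (h x)) z" unfolding rr by (rule TT.r_zero[OF chc])
 also have "... = tm (C (Suc n)) (C n) (c n) (tm (C n) (C (Suc n)) h z)" by (rule tm_compose[OF p(1) p(2) p(1) h cn z, symmetric])
 also have "tm (C n) (C n) (%x. x) z = z" by (rule ctensor_map_id[OF X[OF p(1)] z])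
 finally show ?thesis .
qed

context
 fixes K :: "('l, 'k) top_module" and P :: "nat => ('l, 'p) top_module" and dP :: "nat => 'p => 'p" and eP :: "'p => 'k"
 assumes K: "profinite_module L K" and covers: "resolution_by_covers L P dP eP K"
begin

lemma P_res: "projective_resolution_upto n L P dP eP K"
 using covers by (simp add: resolution_by_covers_def projective_resolution_def)

lemma P_pf: "pf (P n)" and dP_hom: "dP n \<in> cont_hom L (P (Suc n)) (P n)"
 using projective_resolution_uptoD(2,3)[OF P_res[of "Suc n"]] by auto

text \<open>The dual of \<open>M\<close> is again simple, so homomorphisms to it kill the image of
  the differential, and \<open>pure_tensor_zero\<close> applies.\<close>

lemma tm_dP: assumes x: "x \<in> tcar (P (Suc n))" shows "tm (P (Suc n)) (P n) (dP n) x = \<zero>\<^bsub>T (P n)\<^esub>"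
proof (rule ctensor_map_eq_zero[OF X[OF P_pf] X[OF P_pf] dP_hom cont_hom_id _ x])
 fix U V a b assume op: "open_submodule U L (P n)" "open_submodule V L M" and a: "a \<in> carrier (P (Suc n))" and b: "b \<in> carrier M"
 obtain p :: nat where p: "prime p" "!!x. x \<in> carrier M ==> x [^]\<^bsub>add_monoid M\<^esub> p = \<zero>\<^bsub>M\<^esub>"
  by (rule S.prime_torsion) (rule that)
 interpret D: simple_dual L M \<sigma> p by (intro simple_dual.intro simple_dual_axioms.intro S.simple_mod_axioms inv p)
 show "cls L \<sigma> (P n) M U V (frag_of (dP n a, b)) = cls L \<sigma> (P n) M U V 0"
 proof (rule pure_tensor_zero[OF inv P_pf M p(1)])
  show "x [^]\<^bsub>add_monoid M\<^esub> p = \<zero>\<^bsub>M\<^esub>" if "x \<in> carrier M" for x by (rule p(2)[OF that])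
  show "dP n a \<in> carrier (P n)" by (rule cont_homD(1)[OF dP_hom a])
  show "\<phi> (dP n a) = \<zero>\<^bsub>D.D\<^esub>" if "\<phi> \<in> cont_hom L (P n) D.D" for \<phi>
   by (rule covers_killed[OF profinite K covers D.dual_simple that a])
 qed (rule op b)+
qed

text \<open>The composite of the comparison maps differs from the identity by terms that contain
  differentials of \<open>P\<close>, and these act as zero after tensoring. It is thus the identity
  on the tensor product itself, before any passage to homology.\<close>

lemma tm_retract:
 fixes D :: "nat => ('l, 'd) top_module"
 assumes D: "projective_resolution_upto n L D dD eD K"
  and u: "comparison_map n L P dP eP D dD eD u" and v: "comparison_map n L D dD eD P dP eP v" and x: "x \<in> tcar (P n)"
 shows "tm (D n) (P n) (v n) (tm (P n) (D n) (u n) x) = x"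
proof -
 from comparison_map_homotopy[OF profinite K P_res D u v]
 obtain h r where hr: "h \<in> cont_hom L (P n) (P (Suc n))" "r \<in> cont_hom L (P n) (P n)"
  "\<forall>x\<in>carrier (P n). v n (u n x) = x \<oplus>\<^bsub>P n\<^esub> (dP n (h x) \<oplus>\<^bsub>P n\<^esub> r x)"
  "case n of 0 => \<forall>x\<in>carrier (P 0). r x = \<zero>\<^bsub>P 0\<^esub>
    | Suc m => \<exists>s\<in>cont_hom L (P m) (P n). \<forall>x\<in>carrier (P n). r x = s (dP m x)" by (elim exE conjE)
 have Dn: "pf (D n)" using projective_resolution_uptoD(2)[OF D] by simp
 have un: "u n \<in> cont_hom L (P n) (D n)" "v n \<in> cont_hom L (D n) (P n)"
  using comparison_mapD(1)[OF u] comparison_mapD(1)[OF v] by auto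
 interpret TT: abelian_group "T (P n)" by (rule tag[OF P_pf])
 have "tm (D n) (P n) (v n) (tm (P n) (D n) (u n) x) = tm (P n) (P n) (%x. v n (u n x)) x"
  by (rule tm_compose[OF P_pf Dn P_pf un x])
 also have "... = x \<oplus>\<^bsub>T (P n)\<^esub> tm (P (Suc n)) (P n) (dP n) (tm (P n) (P (Suc n)) h x)"
  by (rule tm_homotopy[OF P_res hr(1,2) cont_hom_compose[OF un] hr(3,4) x]) (use x tm_dP in auto)
 also have "... = x" using tm_dP[OF tm_closed[OF P_pf P_pf hr(1) x]] TT.r_zero[of x] x by simp
 finally show ?thesis .
qed

text \<open>Homology of the truncated \<open>D\<close> in degree \<open>n\<close> would say nothing
  here; it is the retraction that embeds one tensor product into the other.\<close>

lemma card_le_resolution: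
 fixes D :: "nat => ('l, 'd) top_module"
 assumes D: "projective_resolution_upto n L D dD eD K" and fin: "finite (tcar (D n))"
 shows "finite (tcar (P n)) & card (tcar (P n)) \<le> card (tcar (D n))"
proof -
 obtain u where u: "comparison_map n L P dP eP D dD eD u" using ex_comparison_map[OF profinite K P_res D] by blast
 obtain v where v: "comparison_map n L D dD eD P dP eP v" using ex_comparison_map[OF profinite K D P_res] by blast
 have Dn: "pf (D n)" using projective_resolution_uptoD(2)[OF D] by simp
 have inj: "inj_on (tm (P n) (D n) (u n)) (tcar (P n))"
  by (rule inj_on_inverseI[where g = "tm (D n) (P n) (v n)"]) (rule tm_retract[OF D u v])
 have sub: "tm (P n) (D n) (u n) ` tcar (P n) \<subseteq> tcar (D n)"
  using tm_closed[OF P_pf Dn comparison_mapD(1)[OF u order_refl]] by blast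
 show ?thesis using inj_on_finite[OF inj sub fin] card_inj_on_le[OF inj sub fin] by simp
qed

text \<open>The map \<open>v\<close> carries all of \<open>tcar (P n)\<close> into cycles, since the
  differentials of \<open>P\<close> vanish after tensoring. Composing back with \<open>u\<close>
  shows injectivity modulo boundaries, and the homotopy on the side of \<open>Q\<close> shows
  surjectivity modulo boundaries. The module structure gives access to dimensions.\<close>

lemma Tor_structure:
 fixes Q :: "nat => ('l, 'q) top_module"
 assumes Q: "projective_resolution L Q dQ eQ K"
 shows "left_module (End_ring L M) (Tor L \<sigma> Q dQ n M) &
  (\<exists>f. bij_betw f (tcar (P n)) (carrier (Tor L \<sigma> Q dQ n M)))"
proof -
 have Qr: "projective_resolution_upto m L Q dQ eQ K" for m using Q by (simp add: projective_resolution_def)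
 have Qp: "pf (Q j)" and dh: "dQ j \<in> cont_hom L (Q (Suc j)) (Q j)" for j
  using projective_resolution_uptoD(2,3)[OF Qr[of "Suc j"]] by auto
 have dd: "dQ m (dQ (Suc m) x) = \<zero>\<^bsub>Q m\<^esub>" if "x \<in> carrier (Q (Suc (Suc m)))" for m x
 proof -
  have "dQ (Suc m) x \<in> res_cycles Q dQ eQ K (Suc m)"
   using projective_resolution_uptoD(6)[OF Qr[of "Suc (Suc m)"], of "Suc m"] that by auto
  thus ?thesis by (simp add: res_cycles_Suc)
 qed
 let ?E = "End_ring L M" and ?T = "%j. T (Q j)"
 let ?Z = "Tor_cycles L \<sigma> Q dQ n M" and ?B = "Tor_boundaries L \<sigma> Q dQ n M"
 have lm: "left_module ?E (?T j)" for j by (rule ctensor_prod.ctensor_left_module[OF X[OF Qp]])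
 interpret TT: left_module ?E "?T n" by (rule lm)
 have Zc: "?Z \<subseteq> tcar (Q n)" by (cases n) (auto simp: Tor_cycles_def)
 have Zsub: "submodule ?Z ?E (?T n)"
 proof (cases n)
  case 0 thus ?thesis using TT.submod_carrier by (simp add: Tor_cycles_def)
 next
  case (Suc m)
  interpret T': left_module ?E "?T m" by (rule lm)
  have Zm: "x \<in> ?Z \<longleftrightarrow> x \<in> tcar (Q n) & tm (Q n) (Q m) (dQ m) x = \<zero>\<^bsub>?T m\<^esub>" for x by (simp add: Suc Tor_cycles_def)
  have dm: "dQ m \<in> cont_hom L (Q n) (Q m)" using dh[of m] Suc by simp
  show ?thesis
  proof (rule TT.submodI)
   show "?Z \<subseteq> carrier (?T n)" using Zc by simp
   show "\<zero>\<^bsub>?T n\<^esub> \<in> ?Z" using TT.M.zero_closed tm_zero[OF Qp Qp dm] by (simp add: Zm)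
   show "x \<oplus>\<^bsub>?T n\<^esub> y \<in> ?Z" if "x \<in> ?Z" "y \<in> ?Z" for x y
    using that tm_add[OF Qp Qp dm, of x y] TT.M.a_closed[of x y] T'.M.zero_closed by (simp add: Zm)
   show "a \<odot>\<^bsub>?T n\<^esub> x \<in> ?Z" if "a \<in> carrier ?E" "x \<in> ?Z" for a x
    using that(2) tm_smult[OF Qp Qp dm that(1), of x] TT.smult_closed[OF that(1), of x] T'.smult_zero_r[OF that(1)] by (simp add: Zm)
  qed
 qed
 let ?M = "(?T n)\<lparr>carrier := ?Z\<rparr>"
 interpret Z: left_module ?E ?M by (rule TT.submodule_left_module[OF Zsub])
 have bz: "tm (Q (Suc n)) (Q n) (dQ n) w \<in> ?Z" if w: "w \<in> tcar (Q (Suc n))" for w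
 proof (cases n)
  case 0 thus ?thesis using tm_closed[OF Qp Qp dh w] by (simp add: Tor_cycles_def)
 next
  case (Suc m)
  have dm: "dQ m \<in> cont_hom L (Q n) (Q m)" using dh[of m] Suc by simp
  have "tm (Q n) (Q m) (dQ m) (tm (Q (Suc n)) (Q n) (dQ n) w) = tm (Q (Suc n)) (Q m) (%a. dQ m (dQ n a)) w"
   by (rule tm_compose[OF Qp Qp Qp dh dm w])
  also have "... = \<zero>\<^bsub>?T m\<^esub>"
   by (rule ctensor_map_zero[OF X[OF Qp] X[OF Qp] cont_hom_compose[OF dh dm] cont_hom_id _ w]) (use dd Suc in simp)
  finally show ?thesis using tm_closed[OF Qp Qp dh w] by (simp add: Suc Tor_cycles_def)
 qed
 interpret T1: left_module ?E "?T (Suc n)" by (rule lm)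
 have Bsub: "submodule ?B ?E ?M"
 proof (rule Z.submodI)
  show "?B \<subseteq> carrier ?M" using bz by (auto simp: Tor_boundaries_def)
  show "\<zero>\<^bsub>?M\<^esub> \<in> ?B"
   using T1.M.zero_closed tm_zero[OF Qp Qp dh, of n] by (auto simp: Tor_boundaries_def intro!: image_eqI[of _ _ "\<zero>\<^bsub>?T (Suc n)\<^esub>"])
 next
  fix x y assume "x \<in> ?B" "y \<in> ?B"
  then obtain a b where ab: "a \<in> tcar (Q (Suc n))" "b \<in> tcar (Q (Suc n))"
   "x = tm (Q (Suc n)) (Q n) (dQ n) a" "y = tm (Q (Suc n)) (Q n) (dQ n) b" by (auto simp: Tor_boundaries_def)
  show "x \<oplus>\<^bsub>?M\<^esub> y \<in> ?B" using tm_add[OF Qp Qp dh ab(1,2)] T1.M.a_closed[of a b] ab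
   by (auto simp: Tor_boundaries_def intro!: image_eqI[of _ _ "a \<oplus>\<^bsub>?T (Suc n)\<^esub> b"])
 next
  fix h x assume h: "h \<in> carrier ?E" and "x \<in> ?B"
  then obtain a where a: "a \<in> tcar (Q (Suc n))" "x = tm (Q (Suc n)) (Q n) (dQ n) a" by (auto simp: Tor_boundaries_def)
  show "h \<odot>\<^bsub>?M\<^esub> x \<in> ?B" using tm_smult[OF Qp Qp dh h a(1)] T1.smult_closed[OF h, of a] a
   by (auto simp: Tor_boundaries_def intro!: image_eqI[of _ _ "h \<odot>\<^bsub>?T (Suc n)\<^esub> a"])
 qed
 obtain v where v: "comparison_map (Suc n) L P dP eP Q dQ eQ v" using ex_comparison_map[OF profinite K P_res Qr] by blast
 obtain u where u: "comparison_map (Suc n) L Q dQ eQ P dP eP u" using ex_comparison_map[OF profinite K Qr P_res] by blast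
 note vD = comparison_mapD[OF v] and uD = comparison_mapD[OF u]
 have vn: "v n \<in> cont_hom L (P n) (Q n)" and un: "u n \<in> cont_hom L (Q n) (P n)"
  and un': "u (Suc n) \<in> cont_hom L (Q (Suc n)) (P (Suc n))" using uD(1) vD(1) by auto
 have v': "comparison_map n L P dP eP Q dQ eQ v" and u': "comparison_map n L Q dQ eQ P dP eP u"
  by (rule comparison_map_mono[OF v] comparison_map_mono[OF u], simp)+
 have uv: "tm (Q n) (P n) (u n) (tm (P n) (Q n) (v n) x) = x" if x: "x \<in> tcar (P n)" for x by (rule tm_retract[OF Qr v' u' x])
 from comparison_map_homotopy[OF profinite K Qr P_res u' v']
 obtain h r where hr: "h \<in> cont_hom L (Q n) (Q (Suc n))" "r \<in> cont_hom L (Q n) (Q n)"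
  "\<forall>x\<in>carrier (Q n). v n (u n x) = x \<oplus>\<^bsub>Q n\<^esub> (dQ n (h x) \<oplus>\<^bsub>Q n\<^esub> r x)"
  "case n of 0 => \<forall>x\<in>carrier (Q 0). r x = \<zero>\<^bsub>Q 0\<^esub>
    | Suc m => \<exists>s\<in>cont_hom L (Q m) (Q n). \<forall>x\<in>carrier (Q n). r x = s (dQ m x)" by (elim exE conjE)
 have bij: "bij_betw (%x. ?B +>\<^bsub>?M\<^esub> tm (P n) (Q n) (v n) x) (tcar (P n)) (a_rcosets\<^bsub>?M\<^esub> ?B)"
 proof (rule Z.bij_betw_cosets[OF Bsub])
  fix x assume x: "x \<in> tcar (P n)"
  note vx = tm_closed[OF P_pf Qp vn x]
  show "tm (P n) (Q n) (v n) x \<in> carrier ?M"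
  proof (cases n)
   case 0 thus ?thesis using vx by (simp add: Tor_cycles_def)
  next
   case (Suc m)
   have dm: "dQ m \<in> cont_hom L (Q n) (Q m)" "dP m \<in> cont_hom L (P n) (P m)" using dh[of m] dP_hom[of m] Suc by auto
   have vm: "v m \<in> cont_hom L (P m) (Q m)" using vD(1) Suc by simp
   have "tm (Q n) (Q m) (dQ m) (tm (P n) (Q n) (v n) x) = tm (P n) (Q m) (%a. dQ m (v n a)) x"
    by (rule tm_compose[OF P_pf Qp Qp vn dm(1) x])
   also have "... = tm (P n) (Q m) (%a. v m (dP m a)) x"
    by (rule tm_cong[OF P_pf Qp cont_hom_compose[OF vn dm(1)] cont_hom_compose[OF dm(2) vm] _ x])
     (use vD(3)[of m] Suc in simp)
   also have "... = tm (P m) (Q m) (v m) (tm (P n) (P m) (dP m) x)" by (rule tm_compose[OF P_pf P_pf Qp dm(2) vm x, symmetric])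
   also have "... = \<zero>\<^bsub>?T m\<^esub>" using tm_dP[of x m] x tm_zero[OF P_pf Qp vm] Suc by simp
   finally show ?thesis using vx by (simp add: Suc Tor_cycles_def)
  qed
 next
  fix x y b assume x: "x \<in> tcar (P n)" and y: "y \<in> tcar (P n)" and b: "b \<in> ?B"
   and e: "tm (P n) (Q n) (v n) x = b \<oplus>\<^bsub>?M\<^esub> tm (P n) (Q n) (v n) y"
  obtain w where w: "w \<in> tcar (Q (Suc n))" "b = tm (Q (Suc n)) (Q n) (dQ n) w" using b by (auto simp: Tor_boundaries_def)
  interpret TP: abelian_group "T (P n)" by (rule tag[OF P_pf])
  have bc: "b \<in> tcar (Q n)" unfolding w(2) by (rule tm_closed[OF Qp Qp dh w(1)])
  \<comment> \<open>\<open>u\<close> sends boundaries of the tensored \<open>Q\<close> to boundaries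
    of the tensored \<open>P\<close>, which are zero.\<close>
  have "tm (Q n) (P n) (u n) b = tm (Q (Suc n)) (P n) (%a. u n (dQ n a)) w"
   unfolding w(2) by (rule tm_compose[OF Qp Qp P_pf dh un w(1)])
  also have "... = tm (Q (Suc n)) (P n) (%a. dP n (u (Suc n) a)) w"
   by (rule tm_cong[OF Qp P_pf cont_hom_compose[OF dh un] cont_hom_compose[OF un' dP_hom] _ w(1)]) (simp add: uD(3))
  also have "... = tm (P (Suc n)) (P n) (dP n) (tm (Q (Suc n)) (P (Suc n)) (u (Suc n)) w)"
   by (rule tm_compose[OF Qp P_pf P_pf un' dP_hom w(1), symmetric])
  also have "... = \<zero>\<^bsub>T (P n)\<^esub>" by (rule tm_dP[OF tm_closed[OF Qp P_pf un' w(1)]])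
  finally have ub: "tm (Q n) (P n) (u n) b = \<zero>\<^bsub>T (P n)\<^esub>" .
  have "x = tm (Q n) (P n) (u n) (b \<oplus>\<^bsub>?T n\<^esub> tm (P n) (Q n) (v n) y)" using uv[OF x] e by simp
  also have "... = \<zero>\<^bsub>T (P n)\<^esub> \<oplus>\<^bsub>T (P n)\<^esub> y"
   using tm_add[OF Qp P_pf un bc tm_closed[OF P_pf Qp vn y]] ub uv[OF y] by simp
  also have "... = y" using TP.l_zero[of y] y by simp
  finally show "x = y" .
 next
  fix z assume "z \<in> carrier ?M"
  hence zZ: "z \<in> ?Z" by simp
  hence z: "z \<in> tcar (Q n)" using Zc by blast
  \<comment> \<open>Every cycle \<open>z\<close> differs by a boundary from an element that comes
    from \<open>P n\<close>.\<close>
  have "tm (P n) (Q n) (v n) (tm (Q n) (P n) (u n) z) = tm (Q n) (Q n) (%x. v n (u n x)) z"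
   by (rule tm_compose[OF Qp P_pf Qp un vn z])
  also have "... = z \<oplus>\<^bsub>?T n\<^esub> tm (Q (Suc n)) (Q n) (dQ n) (tm (Q n) (Q (Suc n)) h z)"
  proof (rule tm_homotopy[OF Qr hr(1,2) cont_hom_compose[OF un vn] hr(3,4) z])
   show "tm (Q n) (Q m) (dQ m) z = \<zero>\<^bsub>?T m\<^esub>" if "n = Suc m" for m using zZ that by (simp add: Tor_cycles_def)
  qed
  finally have "tm (P n) (Q n) (v n) (tm (Q n) (P n) (u n) z) =
   z \<oplus>\<^bsub>?M\<^esub> tm (Q (Suc n)) (Q n) (dQ n) (tm (Q n) (Q (Suc n)) h z)" by simp
  moreover have "tm (Q (Suc n)) (Q n) (dQ n) (tm (Q n) (Q (Suc n)) h z) \<in> ?B"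
   using tm_closed[OF Qp Qp hr(1) z] by (auto simp: Tor_boundaries_def)
  ultimately show "\<exists>x\<in>tcar (P n). \<exists>b\<in>?B. tm (P n) (Q n) (v n) x = z \<oplus>\<^bsub>?M\<^esub> b"
   using tm_closed[OF Qp P_pf un z] by blast
 qed
 show ?thesis using Z.quot_left_module[OF Bsub] bij unfolding Tor_def quot_module_sel by blast
qed

text \<open>The right hand side no longer mentions \<open>Q\<close>, which also explains why the
  invariant does not depend on the resolution from which it is computed.\<close>

lemma dim_Tor_le_iff:
 fixes Q :: "nat => ('l, 'q) top_module"
 assumes Q: "projective_resolution L Q dQ eQ K"
 shows "ennreal_of_enat (lin_dim (End_ring L M) (Tor L \<sigma> Q dQ n M)) /
   ennreal_of_enat (lin_dim (End_ring L M) (End_module M)) \<le> of_nat k \<longleftrightarrow>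
  finite (tcar (P n)) & card (tcar (P n)) \<le> card (carrier M) ^ k"
proof -
 have lm: "left_module (End_ring L M) (Tor L \<sigma> Q dQ n M)" using Tor_structure[OF Q] by blast
 obtain f where f: "bij_betw f (tcar (P n)) (carrier (Tor L \<sigma> Q dQ n M))" using Tor_structure[OF Q] by blast
 have cM: "carrier (End_module M) = carrier M" by (simp add: End_module_def)
 show ?thesis using dim_quotient_le_iff[OF S.End_div[OF lm] S.End_div[OF S.End_module_left_module], of k]
   S.finite_carrier S.card_gt_1 bij_betw_finite[OF f] bij_betw_same_card[OF f] by (simp add: cM)
qed

end

end

section \<open>The invariant and the number of generators\<close>

text \<open>An infimum in \<open>enat\<close> is attained when the set is nonempty and is infinite
  otherwise.\<close>

lemma min_gens_le_iff:
 "min_gens L P \<le> enat n \<longleftrightarrow>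
  (\<exists>X. finite X & X \<subseteq> carrier P & card X \<le> n & closed_span L P X = carrier P)"
proof
 let ?A = "{enat (card X) |X. finite X & X \<subseteq> carrier P & closed_span L P X = carrier P}"
 assume le: "min_gens L P \<le> enat n"
 have "?A ~= {}"
 proof
  assume "?A = {}"
  hence "min_gens L P = \<infinity>" unfolding min_gens_def Inf_enat_def by (rule if_P)
  thus False using le by simp
 qed
 hence "Inf ?A \<in> ?A" unfolding Inf_enat_def by (auto intro: LeastI)
 thus "\<exists>X. finite X & X \<subseteq> carrier P & card X \<le> n & closed_span L P X = carrier P"
  using le unfolding min_gens_def by auto
next
 assume "\<exists>X. finite X & X \<subseteq> carrier P & card X \<le> n & closed_span L P X = carrier P"
 then obtain X where X: "finite X" "X \<subseteq> carrier P" "card X \<le> n" "closed_span L P X = carrier P" by blast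
 hence "min_gens L P \<le> enat (card X)" unfolding min_gens_def by (intro Inf_lower) blast
 also have "... \<le> enat n" using X by simp
 finally show "min_gens L P \<le> enat n" .
qed

lemma ennreal_ceiling_le_iff: "ennreal_ceiling t \<le> enat n \<longleftrightarrow> t \<le> of_nat n"
proof (cases t)
 case (real r)
 have "nat \<lceil>r\<rceil> \<le> n \<longleftrightarrow> r \<le> real n" by linarith
 thus ?thesis using real by (simp add: ennreal_ceiling_def ennreal_of_nat_eq_real_of_nat)
next
 case top
 thus ?thesis by (simp add: ennreal_ceiling_def top_unique)
qed

lemma enat_eqI:
 fixes a b :: enat assumes "!!n. a \<le> enat n \<longleftrightarrow> b \<le> enat n" shows "a = b"
proof (cases a)
 case (enat i)
 then obtain j where "b = enat j" using assms[of i] by (cases b) auto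
 thus ?thesis using assms[of i] assms[of j] enat by auto
next
 case infinity
 thus ?thesis using assms by (cases b) auto
qed

text \<open>\<open>Q\<close> is the resolution from which the invariant is computed, and it may be
  any. A formula cannot quantify over types: finiteness is witnessed by \<open>P\<close> itself, in
  the type \<open>'p\<close>, while the converse is stated for resolutions with carriers in an
  arbitrary type \<open>'s\<close>.\<close>

theorem theorem2p14:
  fixes G :: "'g top_group" and R :: "'r top_ring"
    and K :: "(('r, 'g) cga, 'k) top_module"
    and P :: "nat \<Rightarrow> (('r, 'g) cga, 'p) top_module"
    and dP :: "nat \<Rightarrow> 'p \<Rightarrow> 'p" and eP :: "'p \<Rightarrow> 'k"
    and Q :: "nat \<Rightarrow> (('r, 'g) cga, 'q) top_module"
    and dQ :: "nat \<Rightarrow> 'q \<Rightarrow> 'q" and eQ :: "'q \<Rightarrow> 'k"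
    and k :: nat
  assumes "profinite_group G"
    and "profinite_ring R" and "cring R"
    and "profinite_module (completed_group_algebra R G) K"
    and "resolution_by_covers (completed_group_algebra R G) P dP eP K"
    and "projective_resolution (completed_group_algebra R G) Q dQ eQ K"
  shows "min_gens (completed_group_algebra R G) (P k) = ennreal_ceiling (tau R G Q dQ k) \<and>
    (tau R G Q dQ k < \<infinity> \<longleftrightarrow>
      (\<exists>(P' :: nat \<Rightarrow> (('r, 'g) cga, 'p) top_module) d' e'.
         projective_resolution_upto k (completed_group_algebra R G) P' d' e' K \<and>
         min_gens (completed_group_algebra R G) (P' k) < \<infinity>)) \<and>
    ((\<exists>(P' :: nat \<Rightarrow> (('r, 'g) cga, 's) top_module) d' e'.
         projective_resolution_upto k (completed_group_algebra R G) P' d' e' K \<and>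
         min_gens (completed_group_algebra R G) (P' k) < \<infinity>) \<longrightarrow>
      tau R G Q dQ k < \<infinity>)"
proof -
 let ?L = "completed_group_algebra R G" and ?\<sigma> = "cga_antipode R G" and ?t = "tau R G Q dQ k"
 interpret cga R G by (intro cga.intro assms(1-3))
 have inv: "inv_ring ?L ?\<sigma>" by (rule inv_ring_cga)
 have ts: "tens_simple ?L ?\<sigma> M" if "simple_module ?L M" for M :: "(('r, 'g) cga, nat) top_module"
  using inv that by (rule tens_simple.intro)
 have res: "projective_resolution_upto k ?L P dP eP K"
  using assms(5) by (simp add: resolution_by_covers_def projective_resolution_def)
 have Pk: "profinite_module ?L (P k)" using projective_resolution_uptoD(2)[OF res] by simp
 \<comment> \<open>A supremum is bounded by \<open>n\<close> exactly if each of its terms is, which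
   turns the ratios of dimensions into cardinalities for all simple modules on
   \<open>nat\<close>.\<close>
 have tau_le: "?t \<le> of_nat n \<longleftrightarrow> (\<forall>M :: (('r, 'g) cga, nat) top_module. simple_module ?L M -->
   finite (ctensor_carrier ?L ?\<sigma> (P k) M) & card (ctensor_carrier ?L ?\<sigma> (P k) M) \<le> card (carrier M) ^ n)" for n
  using tens_simple.dim_Tor_le_iff[OF ts assms(4-6), of _ k n] unfolding tau_def SUP_le_iff by auto
 have gens: "min_gens ?L (P k) \<le> enat n \<longleftrightarrow> ?t \<le> of_nat n" for n
  unfolding tau_le min_gens_le_iff by (rule generators_iff_card_ctensor[OF inv Pk])
 have ceil: "min_gens ?L (P k) = ennreal_ceiling ?t" by (rule enat_eqI) (simp add: gens ennreal_ceiling_le_iff)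
 \<comment> \<open>The type \<open>'b\<close> is local to this fact, which is therefore available
   for both \<open>'p\<close> and \<open>'s\<close> below.\<close>
 have bounded: "?t < \<infinity>" if P': "projective_resolution_upto k ?L P' d' e' K" and fg: "min_gens ?L (P' k) < \<infinity>"
  for P' :: "nat => (('r, 'g) cga, 'b) top_module" and d' e'
 proof -
  obtain n where n: "min_gens ?L (P' k) \<le> enat n" using fg by (cases "min_gens ?L (P' k)") auto
  have P'k: "profinite_module ?L (P' k)" using projective_resolution_uptoD(2)[OF P'] by simp
  have "?t \<le> of_nat n" unfolding tau_le
  proof (intro allI impI)
   fix M :: "(('r, 'g) cga, nat) top_module" assume M: "simple_module ?L M"
   have "finite (ctensor_carrier ?L ?\<sigma> (P' k) M) & card (ctensor_carrier ?L ?\<sigma> (P' k) M) \<le> card (carrier M) ^ n"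
    using n M unfolding min_gens_le_iff generators_iff_card_ctensor[OF inv P'k] by blast
   thus "finite (ctensor_carrier ?L ?\<sigma> (P k) M) & card (ctensor_carrier ?L ?\<sigma> (P k) M) \<le> card (carrier M) ^ n"
    using tens_simple.card_le_resolution[OF ts[OF M] assms(4,5) P'] by linarith
  qed
  also have "of_nat n < (\<infinity> :: ennreal)" by (simp add: of_nat_less_top)
  finally show ?thesis .
 qed
 have finite_gens: "min_gens ?L (P k) < \<infinity>" if "?t < \<infinity>" using that by (simp add: ceil ennreal_ceiling_def)
 show ?thesis
 proof (intro conjI)
  show "?t < \<infinity> \<longleftrightarrow> (\<exists>(P' :: nat => (('r, 'g) cga, 'p) top_module) d' e'.
     projective_resolution_upto k ?L P' d' e' K & min_gens ?L (P' k) < \<infinity>)" using res finite_gens bounded by blast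
  show "(\<exists>(P' :: nat => (('r, 'g) cga, 's) top_module) d' e'.
     projective_resolution_upto k ?L P' d' e' K & min_gens ?L (P' k) < \<infinity>) --> ?t < \<infinity>" using bounded by blast
 qed (rule ceil)
qed

end
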